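(* Let $k\ge1$, $m\in\{k-1,k\}$ and $\alpha\in\{-1,1\}$. There is a constant $C>0$, independent of the mesh size, such that (discrete inf-sup condition) $$\sup_{\bm 0\ne\bm\tau_h\in\bm\Sigma_h^{\bm 0}}\frac{B_h(\bm\sigma_h,\bm\tau_h)}{\|\bm\tau_h\|_{\bm\Sigma_h}}\ge C\|\bm\sigma_h\|_{\bm\Sigma_h}\quad\text{for all }\bm\sigma_h\in\bm\Sigma_h^{\bm 0},$$ $$\sup_{\bm 0\ne\bm\sigma_h\in\bm\Sigma_h^{\bm 0}}\frac{B_h(\bm\sigma_h,\bm\tau_h)}{\|\bm\sigma_h\|_{\bm\Sigma_h}}\ge C\|\bm\tau_h\|_{\bm\Sigma_h}\quad\text{for all }\bm\tau_h\in\bm\Sigma_h^{\bm 0}.$$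
   Context: $\Omega\subset\mathbb R^3$ is a bounded simply-connected Lipschitz polyhedron with connected boundary $\Gamma$. $\mathcal T_h$ is a conforming triangulation of $\Omega$ by shape-regular simplices; $h_T$ is the infimum of the diameters of spheres containing $T$, $h=\max_T h_T$; $\mathcal F_h$ is the set of all faces, $\mathcal F_h^I$ the interior faces; $h_F$ is the diameter of the circle containing the face $F$. $\bm n$ is the unit outward normal on $\partial T$ (a fixed unit normal $\bm n_F$ on a face $F$). $\nabla_h,\nabla_h\cdot,\nabla_h\times$ are elementwise operators. $(\cdot,\cdot)$ and $\|\cdot\|_0$ are the $L^2(\Omega)$ inner product and norm; $\langle u,v\rangle_{\partial\mathcal T_h}=\sum_T\int_{\partial T}uv$, $\|v\|_{0,\partial\mathcal T_h}^2=\sum_T\|v\|^2_{0,\partial T}$; $\|\cdot\|_{0,\mathcal F_h^I}$ is the $L^2$ norm on the interior faces. On $F=\partial T\cap\partial T'$ the jump is $[\![\phi]\!]=\phi|_T-\phi|_{T'}$ ($\bm n_F$ pointing from $T$ to $T'$), and $[\![\phi]\!]=\phi$ on boundary faces. $\mathbb P_j(\mathcal T_h)$, $\mathbb P_j(\mathcal F_h)$ are the piecewise polynomials of degree $\le j$ on elements, resp. faces. Spaces: $\bm R_h=[\mathbb P_m(\mathcal T_h)]^3$, $\bm U_h=[\mathbb P_k(\mathcal T_h)]^3$, $\widehat{\bm U}_h=\{\widehat{\bm v}_h\in[\mathbb P_k(\mathcal F_h)]^3:\widehat{\bm v}_h\cdot\bm n|_{\mathcal F_h}=0\}$, $\widehat{\bm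 U}_h^{\bm 0}=\{\widehat{\bm v}_h\in\widehat{\bm U}_h:\bm n\times\widehat{\bm v}_h|_\Gamma=\bm 0\}$, $P_h=\mathbb P_k(\mathcal T_h)$, $\widehat P_h^0=\{\widehat q_h\in\mathbb P_k(\mathcal F_h):\widehat q_h|_\Gamma=0\}$, and $\bm\Sigma_h^{\bm 0}=\bm R_h\times\bm U_h\times\widehat{\bm U}_h^{\bm 0}\times P_h\times\widehat P_h^0$. For $\bm\sigma_h=(\bm r_h,\bm u_h,\widehat{\bm u}_h,p_h,\widehat p_h)$ and $\bm\tau_h=(\bm s_h,\bm v_h,\widehat{\bm v}_h,q_h,\widehat q_h)$, $$B_h(\bm\sigma_h,\bm\tau_h)=(\bm r_h,\bm s_h)+b_h(\bm u_h,\widehat{\bm u}_h;\bm s_h)+b_h(\bm v_h,\widehat{\bm v}_h;\bm r_h)+c_h(p_h,\widehat p_h;\bm v_h)-s_h^u(\bm u_h,\widehat{\bm u}_h;\bm v_h,\widehat{\bm v}_h)+c_h(q_h,\widehat q_h;\bm u_h)+s_h^p(p_h,\widehat p_h;q_h,\widehat q_h),$$ where $b_h(\bm u_h,\widehat{\bm u}_h;\bm s_h)=-(\bm u_h,\nabla_h\times\bm s_h)-\langle\bm n\times\widehat{\bm u}_h,\bm s_h\rangle_{\partial\mathcal T_h}$, $c_h(q_h,\widehat q_h;\bm u_h)=(\nabla_h\cdot\bm u_h,q_h)-\langle\bm n\cdot\bm u_h,\widehat q_h\rangle_{\partial\mathcal T_h}$, $s_h^u(\bm u_h,\widehat{\bm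 u}_h;\bm v_h,\widehat{\bm v}_h)=\langle h_F^{-1}\bm n\times(\bm u_h-\widehat{\bm u}_h),\bm n\times(\bm v_h-\widehat{\bm v}_h)\rangle_{\partial\mathcal T_h}$, $s_h^p(p_h,\widehat p_h;q_h,\widehat q_h)=\langle h_F^\alpha(p_h-\widehat p_h),q_h-\widehat q_h\rangle_{\partial\mathcal T_h}$. Norm: $\|(\bm r,\bm u,\widehat{\bm u},p,\widehat p)\|_{\bm\Sigma_h}^2=\|\bm r\|_0^2+\|(\bm u,\widehat{\bm u})\|_U^2+\|(p,\widehat p)\|_P^2$, with $\|(\bm v,\widehat{\bm v})\|_U^2=\|\nabla_h\times\bm v\|_0^2+\|h_F^{-1/2}\bm n\times(\bm v-\widehat{\bm v})\|_{0,\partial\mathcal T_h}^2+\|h_T^{\frac{1-\alpha}2}\nabla_h\cdot\bm v\|_0^2+\|h_F^{-\frac\alpha2}[\![\bm n\cdot\bm v]\!]\|_{0,\mathcal F_h^I}^2$ and $\|(q,\widehat q)\|_P^2=\|h_T^{\frac{\alpha+1}2}\nabla_hq\|_0^2+\|h_F^{\frac\alpha2}(q-\widehat q)\|_{0,\partial\mathcal T_h}^2$. *)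

theory Defs
  imports "HOL-Analysis.Analysis"
begin

section \<open>The domain\<close>

definition lipschitz_boundary :: "(real^3) set \<Rightarrow> bool" where
  "lipschitz_boundary \<Omega> \<longleftrightarrow>
     (\<forall>x\<in>frontier \<Omega>. \<exists>(f :: real^3 \<Rightarrow> real^3) r (\<phi> :: real^2 \<Rightarrow> real) L.
        orthogonal_transformation f \<and> r > 0 \<and> L-lipschitz_on UNIV \<phi> \<and>
        (\<forall>y\<in>ball x r. y \<in> \<Omega> \<longleftrightarrow> \<phi> (vector [f (y - x) $ 1, f (y - x) $ 2]) < f (y - x) $ 3))"

definition lipschitz_polyhedron :: "(real^3) set \<Rightarrow> bool" where
  "lipschitz_polyhedron \<Omega> \<longleftrightarrow>
     \<Omega> \<noteq> {} \<and> open \<Omega> \<and> connected \<Omega> \<and> bounded \<Omega> \<and> lipschitz_boundary \<Omega> \<and>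
     (\<exists>\<P>. finite \<P> \<and> (\<forall>P\<in>\<P>. polytope P) \<and> \<Union>\<P> = closure \<Omega>)"

section \<open>Meshes\<close>

type_synonym mesh = "(real^3) set set"

definition conforming_triangulation :: "(real^3) set \<Rightarrow> mesh \<Rightarrow> bool" where
  "conforming_triangulation \<Omega> \<T> \<longleftrightarrow>
     triangulation \<T> \<and> (\<forall>T\<in>\<T>. 3 simplex T) \<and> \<Union>\<T> = closure \<Omega>"

text \<open>The infimum of the diameters of the balls containing a set, the balls being taken in its
  affine hull. For a tetrahedron \<open>T\<close> this is \<open>h\<^sub>T\<close> (spheres in space); for a
  triangular face \<open>F\<close> it is \<open>h\<^sub>F\<close> (circles in the plane of \<open>F\<close>).\<close>

definition encl_diam :: "(real^3) set \<Rightarrow> real" where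
  "encl_diam S = Inf {2 * r | r a. a \<in> affine hull S \<and> S \<subseteq> cball a r}"

definition inscr_diam :: "(real^3) set \<Rightarrow> real" where
  "inscr_diam S = Sup {2 * r | r a. 0 \<le> r \<and> cball a r \<subseteq> S}"

definition shape_regular :: "real \<Rightarrow> mesh \<Rightarrow> bool" where
  "shape_regular \<kappa> \<T> \<longleftrightarrow> (\<forall>T\<in>\<T>. encl_diam T \<le> \<kappa> * inscr_diam T)"

definition mesh_faces :: "mesh \<Rightarrow> (real^3) set set" where
  "mesh_faces \<T> = {F. \<exists>T\<in>\<T>. F facet_of T}"

definition boundary_faces :: "(real^3) set \<Rightarrow> mesh \<Rightarrow> (real^3) set set" where
  "boundary_faces \<Omega> \<T> = {F \<in> mesh_faces \<T>. F \<subseteq> frontier \<Omega>}"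

definition interior_faces :: "(real^3) set \<Rightarrow> mesh \<Rightarrow> (real^3) set set" where
  "interior_faces \<Omega> \<T> = mesh_faces \<T> - boundary_faces \<Omega> \<T>"

definition outward_normal :: "(real^3) set \<Rightarrow> (real^3) set \<Rightarrow> real^3" where
  "outward_normal T F =
     (THE n. norm n = 1 \<and> (\<exists>c. F \<subseteq> {x. n \<bullet> x = c} \<and> T \<subseteq> {x. n \<bullet> x \<le> c}))"

text \<open>Every face is oriented once and for all: its fixed normal points from \<open>elem1\<close> to
  \<open>elem2\<close>, where \<open>elem2\<close> is meaningful on interior faces only.\<close>

definition elem1 :: "mesh \<Rightarrow> (real^3) set \<Rightarrow> (real^3) set" where
  "elem1 \<T> F = (SOME T. T \<in> \<T> \<and> F facet_of T)"

definition elem2 :: "mesh \<Rightarrow> (real^3) set \<Rightarrow> (real^3) set" where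
  "elem2 \<T> F = (SOME T. T \<in> \<T> \<and> F facet_of T \<and> T \<noteq> elem1 \<T> F)"

definition face_normal :: "mesh \<Rightarrow> (real^3) set \<Rightarrow> real^3" where
  "face_normal \<T> F = outward_normal (elem1 \<T> F) F"

section \<open>Differential operators and integrals\<close>

definition pderivative :: "3 \<Rightarrow> (real^3 \<Rightarrow> real) \<Rightarrow> real^3 \<Rightarrow> real" where
  "pderivative i f x = frechet_derivative f (at x) (axis i 1)"

definition grad :: "(real^3 \<Rightarrow> real) \<Rightarrow> real^3 \<Rightarrow> real^3" where
  "grad f x = (\<chi> i. pderivative i f x)"

definition divergence :: "(real^3 \<Rightarrow> real^3) \<Rightarrow> real^3 \<Rightarrow> real" where
  "divergence v x = (\<Sum>i\<in>UNIV. pderivative i (\<lambda>y. v y $ i) x)"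

definition curl :: "(real^3 \<Rightarrow> real^3) \<Rightarrow> real^3 \<Rightarrow> real^3" where
  "curl v x = vector
     [pderivative 2 (\<lambda>y. v y $ 3) x - pderivative 3 (\<lambda>y. v y $ 2) x,
      pderivative 3 (\<lambda>y. v y $ 1) x - pderivative 1 (\<lambda>y. v y $ 3) x,
      pderivative 1 (\<lambda>y. v y $ 2) x - pderivative 2 (\<lambda>y. v y $ 1) x]"

text \<open>The surface integral over a triangle \<open>F\<close>, by the affine parametrisation over the
  reference triangle; the area element is the length of the cross product of two edges. The value
  does not depend on the order in which the vertices \<open>a\<close>, \<open>b\<close>, \<open>c\<close> are listed.\<close>

definition face_integral :: "(real^3) set \<Rightarrow> (real^3 \<Rightarrow> real) \<Rightarrow> real" where
  "face_integral F f =
     (let (a, b, c) = (SOME (a, b, c). F = convex hull {a, b, c}) in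
      norm (cross3 (b - a) (c - a)) *
      integral {z :: real^2. 0 \<le> z $ 1 \<and> 0 \<le> z $ 2 \<and> z $ 1 + z $ 2 \<le> 1}
        (\<lambda>z. f (a + (z $ 1) *\<^sub>R (b - a) + (z $ 2) *\<^sub>R (c - a))))"

section \<open>Piecewise polynomial spaces\<close>

text \<open>An elementwise function \<open>v\<close> is indexed by the elements: \<open>v T\<close> is the restriction to
  \<open>T\<close>, so that both traces on an interior face are available. Since a polynomial on a
  tetrahedron extends uniquely to the whole space, \<open>v T\<close> is taken to be a polynomial on all of
  space. A function on the skeleton is indexed by the faces, and its value on \<open>F\<close> is extended by
  zero outside \<open>F\<close>. The values at indices outside the mesh are zero, so each piecewise
  polynomial has exactly one representation.\<close>

type_synonym 'b field = "(real^3) set \<Rightarrow> real^3 \<Rightarrow> 'b"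

definition poly_fun :: "nat \<Rightarrow> (real^3 \<Rightarrow> real) \<Rightarrow> bool" where
  "poly_fun j f \<longleftrightarrow>
     (\<exists>c. \<forall>x. f x = (\<Sum>(p, q, r)\<in>{(p, q, r). p + q + r \<le> j}.
        c p q r * (x $ 1) ^ p * (x $ 2) ^ q * (x $ 3) ^ r))"

definition poly_elem :: "nat \<Rightarrow> mesh \<Rightarrow> real field set" where
  "poly_elem j \<T> = {q. (\<forall>T\<in>\<T>. poly_fun j (q T)) \<and> (\<forall>T. T \<notin> \<T> \<longrightarrow> q T = (\<lambda>_. 0))}"

definition poly_face :: "nat \<Rightarrow> mesh \<Rightarrow> real field set" where
  "poly_face j \<T> =
     {q. (\<forall>F\<in>mesh_faces \<T>. \<exists>p. poly_fun j p \<and> q F = (\<lambda>x. if x \<in> F then p x else 0)) \<and>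
         (\<forall>F. F \<notin> mesh_faces \<T> \<longrightarrow> q F = (\<lambda>_. 0))}"

definition vpoly_elem :: "nat \<Rightarrow> mesh \<Rightarrow> (real^3) field set" where
  "vpoly_elem j \<T> = {v. \<forall>i. (\<lambda>T x. v T x $ i) \<in> poly_elem j \<T>}"

definition vpoly_face :: "nat \<Rightarrow> mesh \<Rightarrow> (real^3) field set" where
  "vpoly_face j \<T> = {v. \<forall>i. (\<lambda>F x. v F x $ i) \<in> poly_face j \<T>}"

definition Uhat :: "nat \<Rightarrow> mesh \<Rightarrow> (real^3) field set" where
  "Uhat k \<T> = {v \<in> vpoly_face k \<T>. \<forall>F\<in>mesh_faces \<T>. \<forall>x\<in>F. v F x \<bullet> face_normal \<T> F = 0}"

definition Uhat0 :: "nat \<Rightarrow> (real^3) set \<Rightarrow> mesh \<Rightarrow> (real^3) field set" where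
  "Uhat0 k \<Omega> \<T> =
     {v \<in> Uhat k \<T>. \<forall>F\<in>boundary_faces \<Omega> \<T>. \<forall>x\<in>F. cross3 (face_normal \<T> F) (v F x) = 0}"

definition Phat0 :: "nat \<Rightarrow> (real^3) set \<Rightarrow> mesh \<Rightarrow> real field set" where
  "Phat0 k \<Omega> \<T> = {q \<in> poly_face k \<T>. \<forall>F\<in>boundary_faces \<Omega> \<T>. \<forall>x\<in>F. q F x = 0}"

type_synonym state =
  "(real^3) field \<times> (real^3) field \<times> (real^3) field \<times> real field \<times> real field"

definition Sigma0 :: "nat \<Rightarrow> nat \<Rightarrow> (real^3) set \<Rightarrow> mesh \<Rightarrow> state set" where
  "Sigma0 m k \<Omega> \<T> =
     vpoly_elem m \<T> \<times> vpoly_elem k \<T> \<times> Uhat0 k \<Omega> \<T> \<times> poly_elem k \<T> \<times> Phat0 k \<Omega> \<T>"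

definition zero_state :: state where
  "zero_state = (\<lambda>_ _. 0, \<lambda>_ _. 0, \<lambda>_ _. 0, \<lambda>_ _. 0, \<lambda>_ _. 0)"

section \<open>Inner products and jumps\<close>

text \<open>The inner product of \<open>L\<^sup>2(\<Omega>)\<close>, the elements covering \<open>\<Omega>\<close> up to a null set.\<close>

definition ip_elem :: "mesh \<Rightarrow> 'b::real_inner field \<Rightarrow> 'b field \<Rightarrow> real" where
  "ip_elem \<T> u v = (\<Sum>T\<in>\<T>. integral T (\<lambda>x. u T x \<bullet> v T x))"

text \<open>The product over all element boundaries; an interior face is counted from both sides, and
  the functions may depend on the element, on the face and on the point.\<close>

definition ip_bdry ::
  "mesh \<Rightarrow> ((real^3) set \<Rightarrow> 'b::real_inner field) \<Rightarrow> ((real^3) set \<Rightarrow> 'b field) \<Rightarrow> real" where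
  "ip_bdry \<T> u v = (\<Sum>T\<in>\<T>. \<Sum>F | F facet_of T. face_integral F (\<lambda>x. u T F x \<bullet> v T F x))"

definition jump :: "(real^3) set \<Rightarrow> mesh \<Rightarrow> real field \<Rightarrow> real field" where
  "jump \<Omega> \<T> \<phi> F x =
     (if F \<in> boundary_faces \<Omega> \<T> then \<phi> (elem1 \<T> F) x
      else \<phi> (elem1 \<T> F) x - \<phi> (elem2 \<T> F) x)"

section \<open>The bilinear form\<close>

definition b_h :: "mesh \<Rightarrow> (real^3) field \<Rightarrow> (real^3) field \<Rightarrow> (real^3) field \<Rightarrow> real" where
  "b_h \<T> u uh s =
     - ip_elem \<T> u (\<lambda>T. curl (s T))
     - ip_bdry \<T> (\<lambda>T F x. cross3 (outward_normal T F) (uh F x)) (\<lambda>T F x. s T x)"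

definition c_h :: "mesh \<Rightarrow> real field \<Rightarrow> real field \<Rightarrow> (real^3) field \<Rightarrow> real" where
  "c_h \<T> q qh u =
     ip_elem \<T> (\<lambda>T. divergence (u T)) q
     - ip_bdry \<T> (\<lambda>T F x. outward_normal T F \<bullet> u T x) (\<lambda>T F x. qh F x)"

definition su_h ::
  "mesh \<Rightarrow> (real^3) field \<Rightarrow> (real^3) field \<Rightarrow> (real^3) field \<Rightarrow> (real^3) field \<Rightarrow> real" where
  "su_h \<T> u uh v vh =
     ip_bdry \<T>
       (\<lambda>T F x. inverse (encl_diam F) *\<^sub>R cross3 (outward_normal T F) (u T x - uh F x))
       (\<lambda>T F x. cross3 (outward_normal T F) (v T x - vh F x))"

definition sp_h ::
  "real \<Rightarrow> mesh \<Rightarrow> real field \<Rightarrow> real field \<Rightarrow> real field \<Rightarrow> real field \<Rightarrow> real" where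
  "sp_h \<alpha> \<T> p ph q qh =
     ip_bdry \<T>
       (\<lambda>T F x. encl_diam F powr \<alpha> * (p T x - ph F x))
       (\<lambda>T F x. q T x - qh F x)"

fun B_h :: "real \<Rightarrow> mesh \<Rightarrow> state \<Rightarrow> state \<Rightarrow> real" where
  "B_h \<alpha> \<T> (r, u, uh, p, ph) (s, v, vh, q, qh) =
     ip_elem \<T> r s + b_h \<T> u uh s + b_h \<T> v vh r + c_h \<T> p ph v
     - su_h \<T> u uh v vh + c_h \<T> q qh u + sp_h \<alpha> \<T> p ph q qh"

section \<open>The norm\<close>

definition normsq_elem :: "mesh \<Rightarrow> 'b::real_inner field \<Rightarrow> real" where
  "normsq_elem \<T> u = ip_elem \<T> u u"

definition normsq_bdry :: "mesh \<Rightarrow> ((real^3) set \<Rightarrow> 'b::real_inner field) \<Rightarrow> real" where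
  "normsq_bdry \<T> u = ip_bdry \<T> u u"

definition normsq_int_faces :: "(real^3) set \<Rightarrow> mesh \<Rightarrow> real field \<Rightarrow> real" where
  "normsq_int_faces \<Omega> \<T> g = (\<Sum>F\<in>interior_faces \<Omega> \<T>. face_integral F (\<lambda>x. (g F x)\<^sup>2))"

definition normsq_U ::
  "real \<Rightarrow> (real^3) set \<Rightarrow> mesh \<Rightarrow> (real^3) field \<Rightarrow> (real^3) field \<Rightarrow> real" where
  "normsq_U \<alpha> \<Omega> \<T> v vh =
     normsq_elem \<T> (\<lambda>T. curl (v T))
     + normsq_bdry \<T>
         (\<lambda>T F x. (encl_diam F powr (- 1 / 2)) *\<^sub>R cross3 (outward_normal T F) (v T x - vh F x))
     + normsq_elem \<T> (\<lambda>T x. encl_diam T powr ((1 - \<alpha>) / 2) * divergence (v T) x)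
     + normsq_int_faces \<Omega> \<T>
         (\<lambda>F x. encl_diam F powr (- \<alpha> / 2) * jump \<Omega> \<T> (\<lambda>T y. face_normal \<T> F \<bullet> v T y) F x)"

definition normsq_P :: "real \<Rightarrow> mesh \<Rightarrow> real field \<Rightarrow> real field \<Rightarrow> real" where
  "normsq_P \<alpha> \<T> q qh =
     normsq_elem \<T> (\<lambda>T x. (encl_diam T powr ((\<alpha> + 1) / 2)) *\<^sub>R grad (q T) x)
     + normsq_bdry \<T> (\<lambda>T F x. encl_diam F powr (\<alpha> / 2) * (q T x - qh F x))"

fun norm_Sigma :: "real \<Rightarrow> (real^3) set \<Rightarrow> mesh \<Rightarrow> state \<Rightarrow> real" where
  "norm_Sigma \<alpha> \<Omega> \<T> (r, u, uh, p, ph) =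
     sqrt (normsq_elem \<T> r + normsq_U \<alpha> \<Omega> \<T> u uh + normsq_P \<alpha> \<T> p ph)"

end

theory Submission
  imports Defs "HOL-Analysis.Analysis"
begin

text \<open>The form \<open>B_h\<close> is symmetric, so both conditions follow from one: if \<open>B_h \<sigma> \<tau> \<le> M * norm \<tau>\<close> for all test
functions \<open>\<tau>\<close>, then \<open>norm \<sigma>\<close> is at most a constant times \<open>M\<close> (lemma \<open>stability\<close>). The parts of the norm of
\<open>\<sigma> = (r, u, uh, p, ph)\<close> are recovered one after the other, each by a test function of its own.

The test function \<open>(r, - u, - uh, p, ph)\<close> produces the squares of \<open>r\<close>, of the tangential jump \<open>u - uh\<close> and of
\<open>p - ph\<close>. After integration by parts, \<open>b_h\<close> is \<open>- (curl u, s)\<close> plus a term in the tangential jump, so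
\<open>s = - curl u\<close>, which has degree \<open>k - 1 \<le> m\<close>, recovers the curl. The form \<open>c_h\<close> sees \<open>u\<close> through its divergence and
its normal jumps, and choosing \<open>q\<close> and \<open>qh\<close> as multiples of these recovers them (lemma \<open>scalar_test_function\<close>). The
remaining part is the gradient of \<open>p\<close> (lemma \<open>vector_test_function\<close>). For \<open>\<alpha> = 1\<close> it is weighted with \<open>h\<^sup>2\<close>, and
\<open>v = - h\<^sup>2 * grad p\<close> has small traces, so that \<open>vh = 0\<close> will do. For \<open>\<alpha> = - 1\<close> there is no weight to spare: the
tangential traces of \<open>v\<close> have to be single-valued and to vanish on the boundary. This holds for \<open>v = - grad pc\<close>
where \<open>pc\<close> is continuous, vanishes on the boundary, and satisfies
\<open>norm (grad (p - pc))\<^sup>2 \<le> C * (\<Sum>F. norm (p - ph)\<^sup>2 / h\<^sub>F)\<close>. In both cases \<open>curl v = 0\<close>. The resulting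
inequalities combine by elementary algebra (lemma \<open>quadratic_bound\<close>).

The continuous \<open>pc\<close> is found by picking the Bernstein coefficients of \<open>p\<close>, one value for each coefficient shared by
several elements (lemma \<open>conforming_approximation\<close>). Two candidate values differ by at most the sum of the jumps across a chain of faces;
such chains exist because the elements around a vertex, edge or face are connected through faces (lemma
\<open>star_connected\<close>), and their length is bounded because shape regularity bounds the number of elements around a
vertex (lemma \<open>star_card\<close>).

The analytic tools are inverse and trace inequalities and integration by parts, for polynomials on tetrahedra. The
former compare norms with the Bernstein coefficients, which on the reference simplex is the equivalence of norms on a
finite-dimensional space. The latter rests on the divergence theorem on a tetrahedron, which need only be checked in
the directions of the edges (lemma \<open>divergence_theorem\<close>). The constants depend on the mesh through the shape parameter
\<open>\<kappa>\<close> alone.\<close>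

section \<open>Polynomials on space\<close>

text \<open>The polynomials of degree at most \<open>j\<close> are generated by constants, sums and multiplication by coordinates. This
form lends itself to induction; \<open>poly_fun_iff_pdeg\<close> relates it to the explicit sum of monomials.\<close>

inductive pdeg :: "nat \<Rightarrow> (real^3 \<Rightarrow> real) \<Rightarrow> bool" where
  pdeg_const: "pdeg j (\<lambda>_. c)"
| pdeg_coord: "pdeg j f \<Longrightarrow> pdeg (Suc j) (\<lambda>x. x $ i * f x)"
| pdeg_add: "pdeg j f \<Longrightarrow> pdeg j g \<Longrightarrow> pdeg j (\<lambda>x. f x + g x)"
| pdeg_Suc: "pdeg j f \<Longrightarrow> pdeg (Suc j) f"

lemma pdeg_mono: "pdeg i f \<Longrightarrow> i \<le> j \<Longrightarrow> pdeg j f"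
  by (induction j) (auto simp: le_Suc_eq intro: pdeg_Suc)

lemma pdeg_cmult: "pdeg j f \<Longrightarrow> pdeg j (\<lambda>x. c * f x)"
proof (induction rule: pdeg.induct)
  case (pdeg_coord j f i)
  then show ?case using pdeg.pdeg_coord[of j "\<lambda>x. c * f x" i] by (simp add: ac_simps)
qed (auto simp: ring_distribs intro: pdeg.intros)

lemma pdeg_mult: "pdeg i f \<Longrightarrow> pdeg j g \<Longrightarrow> pdeg (i + j) (\<lambda>x. f x * g x)"
proof (induction rule: pdeg.induct)
  case (pdeg_const i c)
  then show ?case by (intro pdeg_cmult) (auto intro: pdeg_mono)
next
  case (pdeg_coord i f l)
  then show ?case using pdeg.pdeg_coord[of "i + j" "\<lambda>x. f x * g x" l] by (simp add: ac_simps)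
qed (auto simp: ring_distribs intro: pdeg.intros)

lemma pdeg_diff: "pdeg j f \<Longrightarrow> pdeg j g \<Longrightarrow> pdeg j (\<lambda>x. f x - g x)"
  using pdeg_add[OF _ pdeg_cmult[of j g "-1"]] by simp

lemma pdeg_sum: "(\<And>a. a \<in> A \<Longrightarrow> pdeg j (f a)) \<Longrightarrow> pdeg j (\<lambda>x. \<Sum>a\<in>A. f a x)"
  by (induction A rule: infinite_finite_induct) (auto intro: pdeg.intros)

lemma pdeg_prod:
  "finite A \<Longrightarrow> (\<And>a. a \<in> A \<Longrightarrow> pdeg (d a) (f a)) \<Longrightarrow> pdeg (sum d A) (\<lambda>x. \<Prod>a\<in>A. f a x)"
  by (induction A rule: finite_induct) (auto intro: pdeg.intros pdeg_mult)

lemma pdeg_power: "pdeg i f \<Longrightarrow> pdeg (n * i) (\<lambda>x. f x ^ n)"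
  by (induction n) (auto intro: pdeg_const pdeg_mult)

lemma pdeg_component: "pdeg 1 (\<lambda>x. x $ i)"
  using pdeg_coord[OF pdeg_const[of 0 1]] by simp

lemma pdeg_affine: "pdeg 1 (\<lambda>x. c + g \<bullet> x)"
  unfolding inner_vec_def using pdeg_component by (auto intro!: pdeg_add pdeg_const pdeg_sum pdeg_cmult)

lemma finite_monomial_exponents: "finite {(p, q, r). p + q + r \<le> (j::nat)}"
  by (rule finite_subset[of _ "{..j} \<times> {..j} \<times> {..j}"]) auto

lemma pdeg_imp_poly_fun: "pdeg j f \<Longrightarrow> poly_fun j f"
proof (induction rule: pdeg.induct)
  case (pdeg_const j c)
  have "(\<Sum>(p,q,r)\<in>{(p, q, r). p + q + r \<le> j}. (if (p,q,r) = (0,0,0) then c else 0) *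
      (x $ 1) ^ p * (x $ 2) ^ q * (x $ 3) ^ r) = c" for x :: "real^3"
  proof -
    have "(\<Sum>(p,q,r)\<in>{(p, q, r). p + q + r \<le> j}. (if (p,q,r) = (0,0,0) then c else 0) *
        (x $ 1) ^ p * (x $ 2) ^ q * (x $ 3) ^ r) =
      (\<Sum>y\<in>{(p, q, r). p + q + r \<le> j}. if y = (0,0,0) then c else 0)"
      by (rule sum.cong) (auto simp: power_0_left split: if_splits)
    then show ?thesis using finite_monomial_exponents[of j] by (simp add: sum.delta)
  qed
  then show ?case unfolding poly_fun_def
    by (intro exI[of _ "\<lambda>p q r. if (p,q,r) = (0,0,0) then c else 0"]) simp
next
  case (pdeg_coord j f i)
  then obtain c where c: "\<And>x. f x = (\<Sum>(p, q, r)\<in>{(p, q, r). p + q + r \<le> j}.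
        c p q r * (x $ 1) ^ p * (x $ 2) ^ q * (x $ 3) ^ r)"
    unfolding poly_fun_def by blast
  let ?e = "\<lambda>l. if l = i then 1 else (0::nat)"
  let ?h = "\<lambda>(p,q,r). (p + ?e 1, q + ?e 2, r + ?e 3)"
  let ?c = "\<lambda>p q r. if ?e 1 \<le> p \<and> ?e 2 \<le> q \<and> ?e 3 \<le> r then c (p - ?e 1) (q - ?e 2) (r - ?e 3) else 0"
  have one: "?e 1 + ?e 2 + ?e 3 = 1"
    using exhaust_3[of i] by auto
  have xi: "x $ i = (x $ 1) ^ ?e 1 * (x $ 2) ^ ?e 2 * (x $ 3) ^ ?e 3" for x :: "real^3"
    using exhaust_3[of i] by auto
  have "x $ i * f x = (\<Sum>(p, q, r)\<in>{(p, q, r). p + q + r \<le> Suc j}.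
        ?c p q r * (x $ 1) ^ p * (x $ 2) ^ q * (x $ 3) ^ r)" for x
  proof -
    let ?G = "\<lambda>(p,q,r). ?c p q r * (x $ 1) ^ p * (x $ 2) ^ q * (x $ 3) ^ r"
    have inj: "inj_on ?h {(p, q, r). p + q + r \<le> j}"
      by (auto simp: inj_on_def)
    have "x $ i * f x = (\<Sum>y\<in>{(p, q, r). p + q + r \<le> j}. ?G (?h y))"
      unfolding c sum_distrib_left
      by (rule sum.cong) (auto simp: xi power_add)
    also have "\<dots> = sum ?G (?h ` {(p, q, r). p + q + r \<le> j})"
      by (rule sum.reindex_cong[symmetric, OF inj]) auto
    also have "\<dots> = sum ?G {(p, q, r). p + q + r \<le> Suc j}"
    proof (rule sum.mono_neutral_left[OF finite_monomial_exponents])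
      show "?h ` {(p, q, r). p + q + r \<le> j} \<subseteq> {(p, q, r). p + q + r \<le> Suc j}"
        using one by auto
      show "\<forall>y\<in>{(p, q, r). p + q + r \<le> Suc j} - ?h ` {(p, q, r). p + q + r \<le> j}. ?G y = 0"
      proof
        fix y assume y: "y \<in> {(p, q, r). p + q + r \<le> Suc j} - ?h ` {(p, q, r). p + q + r \<le> j}"
        obtain p q r where pqr: "y = (p,q,r)" by (cases y)
        have "\<not> (?e 1 \<le> p \<and> ?e 2 \<le> q \<and> ?e 3 \<le> r)"
        proof
          assume a: "?e 1 \<le> p \<and> ?e 2 \<le> q \<and> ?e 3 \<le> r"
          then have "y = ?h (p - ?e 1, q - ?e 2, r - ?e 3)" using pqr by simp
          moreover have "(p - ?e 1) + (q - ?e 2) + (r - ?e 3) \<le> j"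
            using y pqr a one by auto
          ultimately show False using y by blast
        qed
        then show "?G y = 0" by (simp only: pqr prod.case if_False mult_zero_left)
      qed
    qed
    finally show ?thesis .
  qed
  then show ?case unfolding poly_fun_def by (intro exI[of _ ?c]) blast
next
  case (pdeg_add j f g)
  then obtain c d where c: "\<And>x. f x = (\<Sum>(p, q, r)\<in>{(p, q, r). p + q + r \<le> j}.
        c p q r * (x $ 1) ^ p * (x $ 2) ^ q * (x $ 3) ^ r)"
    and d: "\<And>x. g x = (\<Sum>(p, q, r)\<in>{(p, q, r). p + q + r \<le> j}.
        d p q r * (x $ 1) ^ p * (x $ 2) ^ q * (x $ 3) ^ r)"
    unfolding poly_fun_def by blast
  show ?case unfolding poly_fun_def c d
    by (intro exI[of _ "\<lambda>p q r. c p q r + d p q r"])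
       (auto simp: sum.distrib[symmetric] ring_distribs case_prod_beta)
next
  case (pdeg_Suc j f)
  then obtain c where c: "\<And>x. f x = (\<Sum>(p, q, r)\<in>{(p, q, r). p + q + r \<le> j}.
        c p q r * (x $ 1) ^ p * (x $ 2) ^ q * (x $ 3) ^ r)"
    unfolding poly_fun_def by blast
  show ?case unfolding poly_fun_def c
    by (intro exI[of _ "\<lambda>p q r. if p + q + r \<le> j then c p q r else 0"] allI
        sum.mono_neutral_cong_left finite_monomial_exponents) (auto split: if_splits)
qed

lemma poly_fun_iff_pdeg: "poly_fun j f \<longleftrightarrow> pdeg j f"
proof
  assume "poly_fun j f"
  then obtain c where c: "\<And>x. f x = (\<Sum>(p, q, r)\<in>{(p, q, r). p + q + r \<le> j}.
        c p q r * (x $ 1) ^ p * (x $ 2) ^ q * (x $ 3) ^ r)"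
    unfolding poly_fun_def by blast
  have "pdeg (0 + p * 1 + q * 1 + r * 1) (\<lambda>x. c p q r * (x $ 1) ^ p * (x $ 2) ^ q * (x $ 3) ^ r)" for p q r
    by (intro pdeg_mult pdeg_power pdeg_component pdeg_const)
  then have "pdeg j (\<lambda>x. \<Sum>y\<in>{(p, q, r). p + q + r \<le> j}.
       (\<lambda>(p,q,r). c p q r * (x $ 1) ^ p * (x $ 2) ^ q * (x $ 3) ^ r) y)"
    by (intro pdeg_sum) (auto intro: pdeg_mono)
  moreover have "f = (\<lambda>x. \<Sum>y\<in>{(p, q, r). p + q + r \<le> j}.
       (\<lambda>(p,q,r). c p q r * (x $ 1) ^ p * (x $ 2) ^ q * (x $ 3) ^ r) y)"
    using c by auto
  ultimately show "pdeg j f" by simp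
qed (rule pdeg_imp_poly_fun)

subsection \<open>Derivatives\<close>

lemma pdeg_differentiable: "pdeg j f \<Longrightarrow> f differentiable (at x)"
proof (induction rule: pdeg.induct)
  case (pdeg_coord j f i)
  have "(\<lambda>x::real^3. x $ i) differentiable (at x)"
    by (intro bounded_linear_imp_differentiable bounded_linear_vec_nth)
  then show ?case using pdeg_coord by (intro differentiable_mult)
qed auto

lemma pdeg_continuous: "pdeg j f \<Longrightarrow> continuous_on S f"
  by (intro differentiable_imp_continuous_on)
     (auto simp: differentiable_on_def intro: pdeg_differentiable differentiable_at_withinI)

lemma pderivative_eq:
  "(f has_derivative f') (at x) \<Longrightarrow> pderivative i f x = f' (axis i 1)"
  unfolding pderivative_def using frechet_derivative_at by metis

lemma has_derivative_grad:
  assumes "f differentiable (at x)"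
  shows "(f has_derivative (\<lambda>h. grad f x \<bullet> h)) (at x)"
proof -
  let ?D = "frechet_derivative f (at x)"
  have D: "(f has_derivative ?D) (at x)" using assms frechet_derivative_works by blast
  then have lin: "linear ?D" using has_derivative_linear by blast
  have "?D h = grad f x \<bullet> h" for h
  proof -
    have "?D h = ?D (\<Sum>i\<in>UNIV. h $ i *\<^sub>R axis i 1)"
      by (simp add: basis_expansion flip: scalar_mult_eq_scaleR)
    also have "\<dots> = (\<Sum>i\<in>UNIV. h $ i * ?D (axis i 1))"
      by (simp add: linear_sum[OF lin] linear_scale[OF lin])
    finally show ?thesis by (simp add: grad_def pderivative_def inner_vec_def mult.commute)
  qed
  then show ?thesis using D by (metis ext)
qed

lemma pderivative_add:
  "f differentiable (at x) \<Longrightarrow> g differentiable (at x) \<Longrightarrow>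
   pderivative i (\<lambda>x. f x + g x) x = pderivative i f x + pderivative i g x"
  by (subst pderivative_eq[OF has_derivative_add[OF has_derivative_grad has_derivative_grad]])
     (auto simp: grad_def inner_axis)

lemma pderivative_diff:
  "f differentiable (at x) \<Longrightarrow> g differentiable (at x) \<Longrightarrow>
   pderivative i (\<lambda>x. f x - g x) x = pderivative i f x - pderivative i g x"
  by (subst pderivative_eq[OF has_derivative_diff[OF has_derivative_grad has_derivative_grad]])
     (auto simp: grad_def inner_axis)

lemma pderivative_mult:
  "f differentiable (at x) \<Longrightarrow> g differentiable (at x) \<Longrightarrow>
   pderivative i (\<lambda>x. f x * g x) x = f x * pderivative i g x + pderivative i f x * g x"
  by (subst pderivative_eq[OF has_derivative_mult[OF has_derivative_grad has_derivative_grad]])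
     (auto simp: grad_def inner_axis)

lemma pderivative_const: "pderivative i (\<lambda>_. c) x = 0"
  by (subst pderivative_eq[OF has_derivative_const]) auto

lemma pderivative_cmult:
  "f differentiable (at x) \<Longrightarrow> pderivative i (\<lambda>x. c * f x) x = c * pderivative i f x"
  by (subst pderivative_mult) (auto simp: pderivative_const)

lemma pderivative_coord: "pderivative i (\<lambda>x. x $ l) x = (if i = l then 1 else 0)"
  by (subst pderivative_eq[OF bounded_linear_imp_has_derivative[OF bounded_linear_vec_nth]])
     (auto simp: axis_def)

lemma coord_differentiable: "(\<lambda>x::real^3. x $ i) differentiable (at x)"
  by (intro bounded_linear_imp_differentiable bounded_linear_vec_nth)

text \<open>The induction needs the claim for degree 0: multiplying the derivative of \<open>f\<close> by a coordinate raises its degree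
\<open>j - 1\<close> back to \<open>j\<close> if \<open>j > 0\<close>, and for \<open>j = 0\<close> the truncated subtraction would be off by one were the derivative
not zero.\<close>

lemma pdeg_pderivative_cases:
  "pdeg j f \<Longrightarrow> (j = 0 \<longrightarrow> pderivative i f = (\<lambda>_. 0)) \<and> pdeg (j - 1) (pderivative i f)"
proof (induction rule: pdeg.induct)
  case (pdeg_const j c)
  then show ?case by (auto simp: pderivative_const[abs_def] intro: pdeg.pdeg_const)
next
  case (pdeg_coord j f l)
  have *: "pderivative i (\<lambda>x. x $ l * f x) = (\<lambda>x. x $ l * pderivative i f x + (if i = l then 1 else 0) * f x)"
    by (rule ext, subst pderivative_mult)
       (use pdeg_coord in \<open>auto intro: pdeg_differentiable coord_differentiable simp: pderivative_coord\<close>)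
  have "pdeg j (\<lambda>x. x $ l * pderivative i f x)"
  proof (cases j)
    case 0
    then show ?thesis using pdeg_coord by (auto intro: pdeg.pdeg_const)
  next
    case (Suc n)
    then show ?thesis using pdeg_coord by (auto intro: pdeg.pdeg_coord)
  qed
  then show ?case using pdeg_coord unfolding * by (auto intro!: pdeg.pdeg_add pdeg_cmult)
next
  case (pdeg_add j f g)
  have *: "pderivative i (\<lambda>x. f x + g x) = (\<lambda>x. pderivative i f x + pderivative i g x)"
    by (rule ext, subst pderivative_add) (use pdeg_add in \<open>auto intro: pdeg_differentiable\<close>)
  then show ?case using pdeg_add unfolding * by (auto intro!: pdeg.pdeg_add)
next
  case (pdeg_Suc j f)
  then show ?case using pdeg_mono[of "j - 1" _ j] by auto
qed

lemma pdeg_pderivative: "pdeg j f \<Longrightarrow> pdeg (j - 1) (pderivative i f)"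
  using pdeg_pderivative_cases by blast

lemma pderivative_differentiable: "pdeg j f \<Longrightarrow> pderivative i f differentiable (at x)"
  using pdeg_pderivative pdeg_differentiable by blast

lemma pderivative_commute:
  "pdeg j f \<Longrightarrow> pderivative a (pderivative b f) x = pderivative b (pderivative a f) x"
proof (induction arbitrary: x rule: pdeg.induct)
  case (pdeg_const j c)
  then show ?case by (simp add: pderivative_const[abs_def] pderivative_const)
next
  case (pdeg_coord j f l)
  have *: "pderivative i (\<lambda>x. x $ l * f x) = (\<lambda>x. x $ l * pderivative i f x + (if i = l then 1 else 0) * f x)" for i
    by (rule ext, subst pderivative_mult)
       (use pdeg_coord in \<open>auto intro: pdeg_differentiable coord_differentiable simp: pderivative_coord\<close>)
  have "pderivative m (pderivative i (\<lambda>x. x $ l * f x)) x =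
     x $ l * pderivative m (pderivative i f) x + (if m = l then 1 else 0) * pderivative i f x
       + (if i = l then 1 else 0) * pderivative m f x" for m i
  proof -
    note d = pderivative_differentiable[OF pdeg_coord(1)] pdeg_differentiable[OF pdeg_coord(1)]
      coord_differentiable
    show ?thesis
      unfolding * pderivative_add[OF differentiable_mult[OF d(3) d(1)] differentiable_mult[OF differentiable_const d(2)]]
        pderivative_mult[OF d(3) d(1)] pderivative_cmult[OF d(2)] pderivative_coord by (simp add: add.commute)
  qed
  then show ?case by (simp add: pdeg_coord.IH)
next
  case (pdeg_add j f g)
  have *: "pderivative i (\<lambda>x. f x + g x) = (\<lambda>x. pderivative i f x + pderivative i g x)" for i
    by (rule ext, subst pderivative_add) (use pdeg_add in \<open>auto intro: pdeg_differentiable\<close>)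
  then show ?case using pdeg_add by (auto simp: pderivative_add[OF pderivative_differentiable pderivative_differentiable])
qed auto

lemma curl_grad: "pdeg j f \<Longrightarrow> curl (grad f) x = 0"
  unfolding curl_def grad_def
  by (simp add: pderivative_commute[of j f] vec_eq_iff forall_3)

subsection \<open>Homogeneous polynomials\<close>

text \<open>In barycentric coordinates every polynomial of degree at most \<open>k\<close> is homogeneous of degree \<open>k\<close>. These exponents
label its Bernstein coefficients.\<close>

definition Hom :: "'i set \<Rightarrow> nat \<Rightarrow> ('i \<Rightarrow> nat) set" where
  "Hom I k = {a. (\<forall>i. i \<notin> I \<longrightarrow> a i = 0) \<and> sum a I = k}"

definition hpoly :: "'i set \<Rightarrow> nat \<Rightarrow> (('i \<Rightarrow> nat) \<Rightarrow> real) \<Rightarrow> ('i \<Rightarrow> real) \<Rightarrow> real" where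
  "hpoly I k c y = (\<Sum>a\<in>Hom I k. c a * (\<Prod>i\<in>I. y i ^ a i))"

lemma finite_Hom: "finite I \<Longrightarrow> finite (Hom I k)"
proof -
  assume I: "finite I"
  have "Hom I k \<subseteq> {f. \<forall>x. (x \<in> I \<longrightarrow> f x \<in> {..k}) \<and> (x \<notin> I \<longrightarrow> f x = 0)}"
    using member_le_sum[of _ I] I by (force simp: Hom_def)
  then show ?thesis using finite_set_of_finite_funs[OF I, of "{..k}" 0] finite_subset by blast
qed

lemma Hom_le: "finite I \<Longrightarrow> a \<in> Hom I k \<Longrightarrow> a i \<le> k"
  using member_le_sum[of i I a] by (cases "i \<in> I") (auto simp: Hom_def)

lemma Hom_mono: "finite J \<Longrightarrow> I \<subseteq> J \<Longrightarrow> a \<in> Hom I k \<Longrightarrow> a \<in> Hom J k"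
  unfolding Hom_def by (auto simp: sum.mono_neutral_right[of J I])

lemma Hom_subset_iff: "finite J \<Longrightarrow> I \<subseteq> J \<Longrightarrow> a \<in> Hom J k \<Longrightarrow> a \<in> Hom I k \<longleftrightarrow> (\<forall>i\<in>J - I. a i = 0)"
  unfolding Hom_def by (auto simp: sum.mono_neutral_right[of J I])

lemma hpoly_restrict:
  assumes "finite J" "I \<subseteq> J" "\<And>i. i \<in> J - I \<Longrightarrow> y i = 0"
  shows "hpoly J k c y = hpoly I k c y"
  unfolding hpoly_def
proof (rule sum.mono_neutral_cong_right)
  show "Hom I k \<subseteq> Hom J k" using Hom_mono assms by blast
  show "\<forall>a\<in>Hom J k - Hom I k. c a * (\<Prod>i\<in>J. y i ^ a i) = 0"
  proof
    fix a assume a: "a \<in> Hom J k - Hom I k"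
    then obtain i where i: "i \<in> J - I" "a i \<noteq> 0" using Hom_subset_iff[OF assms(1,2)] by blast
    then have "(\<Prod>i\<in>J. y i ^ a i) = 0" using assms by (intro prod_zero) (auto intro!: bexI[of _ i])
    then show "c a * (\<Prod>i\<in>J. y i ^ a i) = 0" by simp
  qed
  fix a assume "a \<in> Hom I k"
  then have "(\<Prod>i\<in>J. y i ^ a i) = (\<Prod>i\<in>I. y i ^ a i)"
    using assms by (intro prod.mono_neutral_right) (auto simp: Hom_def)
  then show "c a * (\<Prod>i\<in>J. y i ^ a i) = c a * (\<Prod>i\<in>I. y i ^ a i)" by simp
qed (use assms finite_Hom in auto)

lemma hpoly_add: "hpoly I k c y + hpoly I k d y = hpoly I k (\<lambda>a. c a + d a) y"
  by (simp add: hpoly_def sum.distrib ring_distribs)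

lemma hpoly_diff: "hpoly I k c y - hpoly I k d y = hpoly I k (\<lambda>a. c a - d a) y"
  by (simp add: hpoly_def sum_subtractf ring_distribs)

lemma hpoly_cmult: "t * hpoly I k c y = hpoly I k (\<lambda>a. t * c a) y"
  by (simp add: hpoly_def sum_distrib_left ac_simps)

lemma hpoly_shift:
  assumes "finite I" "j \<in> I"
  shows "y j * hpoly I k c y = hpoly I (Suc k) (\<lambda>a. if 0 < a j then c (a(j := a j - 1)) else 0) y"
proof -
  let ?h = "\<lambda>a. a(j := Suc (a j))"
  have sum_upd: "sum (a(j := n)) I + a j = sum a I + n" for a :: "'a \<Rightarrow> nat" and n
    using assms by (simp add: sum.remove[of I j])
  have inj: "inj_on ?h (Hom I k)"
    by (auto simp: inj_on_def fun_eq_iff split: if_splits)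
  let ?G = "\<lambda>a. (if 0 < a j then c (a(j := a j - 1)) else 0) * (\<Prod>i\<in>I. y i ^ a i)"
  have "y j * hpoly I k c y = (\<Sum>a\<in>Hom I k. ?G (?h a))"
    unfolding hpoly_def sum_distrib_left using assms
    by (intro sum.cong) (auto simp: prod.remove[of I j])
  also have "\<dots> = sum ?G (?h ` Hom I k)"
    by (rule sum.reindex_cong[symmetric, OF inj]) auto
  also have "\<dots> = sum ?G (Hom I (Suc k))"
  proof (rule sum.mono_neutral_left)
    show "finite (Hom I (Suc k))" using assms finite_Hom by blast
    show "?h ` Hom I k \<subseteq> Hom I (Suc k)"
    proof
      fix b assume "b \<in> ?h ` Hom I k"
      then obtain a where a: "a \<in> Hom I k" "b = ?h a" by blast
      then show "b \<in> Hom I (Suc k)" using assms sum_upd[of a "Suc (a j)"] by (auto simp: Hom_def)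
    qed
    show "\<forall>a\<in>Hom I (Suc k) - ?h ` Hom I k. ?G a = 0"
    proof
      fix a assume a: "a \<in> Hom I (Suc k) - ?h ` Hom I k"
      have "a j = 0"
      proof (rule ccontr)
        assume n: "a j \<noteq> 0"
        then have "a = ?h (a(j := a j - 1))" by auto
        moreover have "a(j := a j - 1) \<in> Hom I k"
          using a n assms sum_upd[of a "a j - 1"] by (auto simp: Hom_def)
        ultimately show False using a by blast
      qed
      then show "?G a = 0" by simp
    qed
  qed
  finally show ?thesis by (simp add: hpoly_def)
qed

text \<open>Raising the degree is multiplication by the sum of the barycentric coordinates, which is 1.\<close>

lemma hpoly_raise:
  fixes \<mu> :: "'i \<Rightarrow> 'x \<Rightarrow> real"
  assumes I: "finite I" and f: "\<And>x. f x = hpoly I k c (\<lambda>i. \<mu> i x)"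
  shows "\<exists>d. \<forall>x. (\<Sum>i\<in>I. w i * \<mu> i x) * f x = hpoly I (Suc k) d (\<lambda>i. \<mu> i x)"
proof -
  have "\<exists>d. \<forall>x. (\<Sum>i\<in>J. w i * \<mu> i x) * f x = hpoly I (Suc k) d (\<lambda>i. \<mu> i x)" if "J \<subseteq> I" for J
    using finite_subset[OF that I] that
  proof (induction J rule: finite_induct)
    case empty
    then show ?case by (intro exI[of _ "\<lambda>_. 0"]) (simp add: hpoly_def)
  next
    case (insert j J)
    then obtain d where d: "\<And>x. (\<Sum>i\<in>J. w i * \<mu> i x) * f x = hpoly I (Suc k) d (\<lambda>i. \<mu> i x)" by blast
    have 1: "(\<Sum>i\<in>insert j J. w i * \<mu> i x) * f x =
       w j * (\<mu> j x * hpoly I k c (\<lambda>i. \<mu> i x)) + hpoly I (Suc k) d (\<lambda>i. \<mu> i x)" for x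
      using insert d[of x, symmetric] by (simp add: f[symmetric] ring_distribs)
    have 2: "\<mu> j x * hpoly I k c (\<lambda>i. \<mu> i x) = hpoly I (Suc k) (\<lambda>a. if 0 < a j then c (a(j := a j - 1)) else 0) (\<lambda>i. \<mu> i x)" for x
      using hpoly_shift[OF I, of j "\<lambda>i. \<mu> i x" k c] insert by auto
    show ?case unfolding 1 2 unfolding hpoly_cmult hpoly_add by blast
  qed
  then show ?thesis by blast
qed

text \<open>A coordinate is a linear combination of the barycentric coordinates \<open>\<mu>\<close>, and terms of lower degree are raised to
degree \<open>k\<close>.\<close>

lemma pdeg_imp_hpoly:
  fixes \<mu> :: "'i \<Rightarrow> real^3 \<Rightarrow> real" and w :: "'i \<Rightarrow> real^3"
  assumes I: "finite I"
    and one: "\<And>x. (\<Sum>i\<in>I. \<mu> i x) = 1" and pt: "\<And>x. (\<Sum>i\<in>I. \<mu> i x *\<^sub>R w i) = x"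
  shows "pdeg k f \<Longrightarrow> \<exists>c. \<forall>x. f x = hpoly I k c (\<lambda>i. \<mu> i x)"
proof (induction rule: pdeg.induct)
  case (pdeg_const k c)
  show ?case
  proof (induction k)
    case 0
    have "Hom I 0 = {\<lambda>_. 0}" using I by (auto simp: Hom_def)
    then show ?case by (intro exI[of _ "\<lambda>_. c"]) (simp add: hpoly_def)
  next
    case (Suc k)
    then obtain d where "\<And>x. c = hpoly I k d (\<lambda>i. \<mu> i x)" by blast
    from hpoly_raise[OF I this, of "\<lambda>_. 1"] show ?case by (simp add: one)
  qed
next
  case (pdeg_coord k f l)
  then obtain d where "\<And>x. f x = hpoly I k d (\<lambda>i. \<mu> i x)" by blast
  from hpoly_raise[OF I this, of "\<lambda>i. w i $ l"]
  have "\<exists>d. \<forall>x. (\<Sum>i\<in>I. w i $ l * \<mu> i x) * f x = hpoly I (Suc k) d (\<lambda>i. \<mu> i x)" .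
  moreover have "(\<Sum>i\<in>I. w i $ l * \<mu> i x) = x $ l" for x
    using arg_cong[OF pt[of x], of "\<lambda>v. v $ l"] by (simp add: sum_component mult.commute)
  ultimately show ?case by simp
next
  case (pdeg_add k f g)
  then obtain c d where "\<And>x. f x = hpoly I k c (\<lambda>i. \<mu> i x)" "\<And>x. g x = hpoly I k d (\<lambda>i. \<mu> i x)" by blast
  then show ?case by (auto simp: hpoly_add)
next
  case (pdeg_Suc k f)
  then obtain d where "\<And>x. f x = hpoly I k d (\<lambda>i. \<mu> i x)" by blast
  from hpoly_raise[OF I this, of "\<lambda>_. 1"] show ?case by (simp add: one)
qed

lemma hpoly_pdeg:
  assumes "finite I" "\<And>i. i \<in> I \<Longrightarrow> pdeg 1 (\<mu> i)"
  shows "pdeg k (\<lambda>x. hpoly I k c (\<lambda>i. \<mu> i x))"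
  unfolding hpoly_def
proof (intro pdeg_sum pdeg_cmult)
  fix a assume a: "a \<in> Hom I k"
  have "pdeg (\<Sum>i\<in>I. a i * 1) (\<lambda>x. \<Prod>i\<in>I. \<mu> i x ^ a i)"
    using assms by (intro pdeg_prod pdeg_power) auto
  then show "pdeg k (\<lambda>x. \<Prod>i\<in>I. \<mu> i x ^ a i)" using a by (simp add: Hom_def)
qed

text \<open>Fixing all variables but one leaves a polynomial in one variable with infinitely many positive zeros. Its
coefficients are therefore zero; they are polynomials in fewer variables. Positive values suffice, which are the ones
that a simplex provides up to scaling.\<close>

lemma monomials_independent:
  assumes "finite I" "finite A"
    and "\<And>a b. a \<in> A \<Longrightarrow> b \<in> A \<Longrightarrow> (\<forall>i\<in>I. a i = b i) \<Longrightarrow> a = b"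
    and "\<And>y. (\<And>i. i \<in> I \<Longrightarrow> y i > 0) \<Longrightarrow> (\<Sum>a\<in>A. c a * (\<Prod>i\<in>I. y i ^ a i)) = (0::real)"
    and "a \<in> A"
  shows "c a = (0::real)"
  using assms
proof (induction I arbitrary: A a rule: finite_induct)
  case empty
  then have "A = {a}" by auto
  then show ?case using empty.prems(3) by simp
next
  case (insert j I)
  define N where "N = Max ((\<lambda>a. a j) ` A)"
  have N: "b j \<le> N" if "b \<in> A" for b unfolding N_def using insert that by auto
  let ?B = "\<lambda>n. {b \<in> A. b j = n}"
  have slice: "(\<Sum>b\<in>?B n. c b * (\<Prod>i\<in>I. y i ^ b i)) = 0" if y: "\<And>i. i \<in> I \<Longrightarrow> y i > 0" and n: "n \<le> N" for y n
  proof -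
    let ?q = "\<lambda>n. \<Sum>b\<in>?B n. c b * (\<Prod>i\<in>I. y i ^ b i)"
    have 0: "(\<Sum>n\<le>N. ?q n * t ^ n) = 0" if "t > 0" for t
    proof -
      have "0 = (\<Sum>b\<in>A. c b * (\<Prod>i\<in>insert j I. (y(j := t)) i ^ b i))"
        using y \<open>t > 0\<close> insert.hyps by (intro insert.prems(3)[symmetric]) auto
      also have "\<dots> = (\<Sum>b\<in>A. c b * (\<Prod>i\<in>I. y i ^ b i) * t ^ b j)"
      proof (rule sum.cong)
        fix b
        have "(\<Prod>i\<in>I. (y(j := t)) i ^ b i) = (\<Prod>i\<in>I. y i ^ b i)"
          using insert.hyps by (intro prod.cong) auto
        then show "c b * (\<Prod>i\<in>insert j I. (y(j := t)) i ^ b i) = c b * (\<Prod>i\<in>I. y i ^ b i) * t ^ b j"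
          using insert.hyps by (simp add: ac_simps)
      qed simp
      also have "\<dots> = (\<Sum>n\<le>N. \<Sum>b\<in>?B n. c b * (\<Prod>i\<in>I. y i ^ b i) * t ^ b j)"
        using N insert.prems by (intro sum.group[symmetric]) auto
      also have "\<dots> = (\<Sum>n\<le>N. ?q n * t ^ n)"
        unfolding sum_distrib_right by (intro sum.cong) auto
      finally show ?thesis by simp
    qed
    have "\<exists>i\<le>N. ?q i \<noteq> 0 \<Longrightarrow> finite {t. (\<Sum>n\<le>N. ?q n * t ^ n) = 0}"
      using polyfun_finite_roots[of ?q N] by blast
    moreover have "infinite {t. (\<Sum>n\<le>N. ?q n * t ^ n) = 0}"
      using 0 infinite_Ioi[of "0::real"] finite_subset[of "{0<..}" "{t. (\<Sum>n\<le>N. ?q n * t ^ n) = 0}"] by auto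
    ultimately show ?thesis using n by blast
  qed
  show ?case
  proof (rule insert.IH[of "?B (a j)"])
    show "b = b'" if "b \<in> ?B (a j)" "b' \<in> ?B (a j)" "\<forall>i\<in>I. b i = b' i" for b b'
      using insert.prems(2)[of b b'] that by auto
  qed (use insert.prems slice N in auto)
qed

section \<open>The reference simplex\<close>

lemma sum_option: "(\<Sum>j\<in>UNIV. f j) = f None + (\<Sum>i\<in>UNIV. f (Some (i :: 'n::finite)))"
  by (simp add: UNIV_option_conv sum.reindex)

definition refs :: "(real^'n) set" where
  "refs = {z. (\<forall>i. 0 \<le> z $ i) \<and> (\<Sum>i\<in>UNIV. z $ i) \<le> 1}"

text \<open>Barycentric coordinates on the reference simplex; the index \<open>None\<close> stands for the vertex at
  the origin.\<close>

definition bc :: "real^'n \<Rightarrow> 'n option \<Rightarrow> real" where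
  "bc z j = (case j of None \<Rightarrow> 1 - (\<Sum>i\<in>UNIV. z $ i) | Some i \<Rightarrow> z $ i)"

definition param :: "('n option \<Rightarrow> 'b::real_vector) \<Rightarrow> real^'n \<Rightarrow> 'b" where
  "param \<beta> z = (\<Sum>j\<in>UNIV. bc z j *\<^sub>R \<beta> j)"

lemma sum_bc: "(\<Sum>j\<in>UNIV. bc z j) = 1"
  by (simp add: sum_option bc_def)

lemma refs_iff: "z \<in> refs \<longleftrightarrow> (\<forall>j. 0 \<le> bc z j)"
  by (auto simp: refs_def bc_def split: option.splits)

lemma bc_le_one: "z \<in> refs \<Longrightarrow> bc z j \<le> 1"
  using member_le_sum[of j UNIV "bc z"] by (auto simp: refs_iff sum_bc)

lemma param_alt: "param \<beta> z = \<beta> None + (\<Sum>i\<in>UNIV. z $ i *\<^sub>R (\<beta> (Some i) - \<beta> None))"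
  by (simp add: param_def sum_option bc_def scaleR_diff_right sum_subtractf scaleR_sum_left algebra_simps)

lemma continuous_on_bc: "continuous_on S (\<lambda>z. bc z j)"
  unfolding bc_def by (cases j) (auto intro!: continuous_intros)

lemma continuous_on_param: "continuous_on S (param (\<beta> :: _ \<Rightarrow> 'b::real_normed_vector))"
  unfolding param_def by (intro continuous_intros continuous_on_bc)

lemma convex_refs: "convex (refs :: (real^'n) set)"
  unfolding convex_def refs_def
  by (auto simp: sum.distrib sum_distrib_left[symmetric] intro!: convex_bound_le)

lemma compact_refs: "compact (refs :: (real^'n) set)"
proof -
  have "bounded (refs :: (real^'n) set)"
  proof (rule bounded_subset[OF bounded_cbox])
    show "(refs :: (real^'n) set) \<subseteq> cbox 0 (\<chi> i. 1)"
    proof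
      fix z :: "real^'n" assume z: "z \<in> refs"
      have "z $ i \<le> 1" for i using bc_le_one[OF z, of "Some i"] by (simp add: bc_def)
      then show "z \<in> cbox 0 (\<chi> i. 1)" using z by (simp add: mem_box_cart refs_def)
    qed
  qed
  moreover have "closed (refs :: (real^'n) set)"
    unfolding refs_def by (auto intro!: closed_Collect_conj closed_Collect_all closed_Collect_le continuous_intros)
  ultimately show ?thesis by (simp add: compact_eq_bounded_closed)
qed

lemma small_box_in_refs:
  "\<exists>a b. box a b \<noteq> {} \<and> cbox a b \<subseteq> (refs :: (real^'n) set)"
proof (intro exI conjI)
  let ?a = "0 :: real^'n" and ?b = "(\<chi> i. 1 / real CARD('n)) :: real^'n"
  show "box ?a ?b \<noteq> {}" by (auto simp: interval_ne_empty_cart)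
  show "cbox ?a ?b \<subseteq> refs"
  proof
    fix z assume z: "z \<in> cbox ?a ?b"
    then have "(\<Sum>i\<in>UNIV. z $ i) \<le> (\<Sum>i\<in>(UNIV::'n set). 1 / real CARD('n))"
      by (intro sum_mono) (auto simp: mem_box_cart)
    then show "z \<in> refs" using z by (auto simp: refs_def mem_box_cart)
  qed
qed

lemma interior_refs_nonempty: "interior (refs :: (real^'n) set) \<noteq> {}"
  using small_box_in_refs interior_maximal[OF _ open_box] box_subset_cbox by (metis empty_subsetI subset_antisym subset_trans)

lemma continuous_absolutely_integrable:
  fixes f :: "'a::euclidean_space \<Rightarrow> 'b::euclidean_space"
  assumes "compact S" "continuous_on S f"
  shows "f absolutely_integrable_on S"
  unfolding set_integrable_def
  using borel_integrable_compact[OF assms] borel_measurable_integrable[OF borel_integrable_compact[OF assms]]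
  by (subst integrable_completion) auto

lemma continuous_integrable_on:
  fixes f :: "'a::euclidean_space \<Rightarrow> real"
  assumes "compact S" "continuous_on S f"
  shows "f integrable_on S"
  using continuous_absolutely_integrable[OF assms] set_lebesgue_integral_eq_integral(1) by blast

lemma integral_lborel:
  fixes f :: "'a::euclidean_space \<Rightarrow> real"
  assumes "compact S" "continuous_on S f"
  shows "integral S f = integral\<^sup>L lborel (\<lambda>x. indicator S x * f x)"
  using set_borel_integral_eq_integral(2)[of S f] borel_integrable_compact[OF assms]
  by (simp add: set_integrable_def set_lebesgue_integral_def)

definition rvol :: "'n::finite itself \<Rightarrow> real" where
  "rvol _ = measure lebesgue (refs :: (real^'n) set)"

lemma rvol_pos: "rvol TYPE('n::finite) > 0"
  unfolding rvol_def
proof -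
  have "interior (refs :: (real^'n) set) \<noteq> {}" by (rule interior_refs_nonempty)
  then have "\<not> negligible (refs :: (real^'n) set)"
    using negligible_iff_null_sets negligible_imp_measurable open_not_negligible[OF open_interior] negligible_subset[OF _ interior_subset] by blast
  moreover have "(refs :: (real^'n) set) \<in> lmeasurable" using compact_refs lmeasurable_compact by blast
  ultimately show "0 < measure lebesgue (refs :: (real^'n) set)"
    by (simp add: negligible_iff_measure zero_less_measure_iff)
qed

lemma integral_refs_const: "integral (refs :: (real^'n::finite) set) (\<lambda>_. c) = c * rvol TYPE('n)"
proof -
  have "(refs :: (real^'n) set) \<in> lmeasurable" using compact_refs lmeasurable_compact by blast
  then show ?thesis
    using lmeasure_integral[of "refs :: (real^'n) set"] integral_mult_right[of refs c "\<lambda>_. 1"]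
    by (simp add: rvol_def)
qed

subsection \<open>Equivalence of norms\<close>

text \<open>The coefficient vectors live in a function space. Those of Euclidean norm 1 that vanish outside \<open>A\<close> form a compact
set for the product topology, on which the form attains a positive minimum.\<close>

lemma quadratic_form_lower_bound:
  fixes M :: "'a \<Rightarrow> 'a \<Rightarrow> real"
  assumes A: "finite A"
    and pos: "\<And>c. \<exists>a\<in>A. c a \<noteq> 0 \<Longrightarrow> 0 < (\<Sum>a\<in>A. \<Sum>b\<in>A. c a * c b * M a b)"
  shows "\<exists>m>0. \<forall>c. m * (\<Sum>a\<in>A. (c a)\<^sup>2) \<le> (\<Sum>a\<in>A. \<Sum>b\<in>A. c a * c b * M a b)"
proof (cases "A = {}")
  case True
  then show ?thesis by (intro exI[of _ 1]) auto
next
  case False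
  let ?Q = "\<lambda>c. \<Sum>a\<in>A. \<Sum>b\<in>A. c a * c b * M a b"
  let ?S = "\<lambda>a. if a \<in> A then {-1..1::real} else {0}"
  let ?K = "PiE UNIV ?S \<inter> {c. (\<Sum>a\<in>A. (c a)\<^sup>2) = 1}"
  have "compactin (product_topology (\<lambda>_. euclidean) UNIV) (PiE UNIV ?S)"
    unfolding compactin_PiE by auto
  then have "compact (PiE UNIV ?S)" by (simp add: euclidean_product_topology)
  moreover have cont: "continuous_on UNIV (\<lambda>c :: 'a \<Rightarrow> real. c a)" for a
    by (rule continuous_on_product_coordinates)
  have "closed {c :: 'a \<Rightarrow> real. (\<Sum>a\<in>A. (c a)\<^sup>2) = 1}"
    by (intro closed_Collect_eq continuous_intros cont)
  ultimately have K: "compact ?K" by blast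
  obtain a0 where a0: "a0 \<in> A" using False by blast
  have "(\<Sum>a\<in>A. (if a = a0 then 1 else 0 :: real)\<^sup>2) = 1"
    using A a0 by (simp add: if_distrib[of "\<lambda>x. x\<^sup>2"] sum.delta cong: if_cong)
  then have "(\<lambda>a. if a = a0 then 1 else 0) \<in> ?K" using a0 by auto
  then have ne: "?K \<noteq> {}" by blast
  have "continuous_on ?K ?Q"
    by (rule continuous_on_subset[OF _ subset_UNIV]) (intro continuous_intros cont)
  then obtain c0 where c0: "c0 \<in> ?K" "\<And>c. c \<in> ?K \<Longrightarrow> ?Q c0 \<le> ?Q c"
    using continuous_attains_inf[OF K ne, of ?Q] by blast
  have "\<exists>a\<in>A. c0 a \<noteq> 0"
  proof (rule ccontr)
    assume "\<not> ?thesis"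
    then have "(\<Sum>a\<in>A. (c0 a)\<^sup>2) = 0" by simp
    then show False using c0 by simp
  qed
  then have m: "?Q c0 > 0" by (rule pos)
  have "?Q c0 * (\<Sum>a\<in>A. (c a)\<^sup>2) \<le> ?Q c" for c
  proof (cases "(\<Sum>a\<in>A. (c a)\<^sup>2) = 0")
    case True
    then have "\<forall>a\<in>A. c a = 0" using A by (simp add: sum_nonneg_eq_0_iff)
    then have "?Q c = 0" by simp
    then show ?thesis using True by simp
  next
    case False
    let ?s = "sqrt (\<Sum>a\<in>A. (c a)\<^sup>2)"
    have s2: "?s\<^sup>2 = (\<Sum>a\<in>A. (c a)\<^sup>2)" by (simp add: sum_nonneg)
    have "(\<Sum>a\<in>A. (c a)\<^sup>2) \<ge> 0" by (simp add: sum_nonneg)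
    then have s: "?s > 0" using False by simp
    let ?c = "\<lambda>a. if a \<in> A then c a / ?s else 0"
    have "(\<Sum>a\<in>A. (?c a)\<^sup>2) = (\<Sum>a\<in>A. (c a)\<^sup>2) / ?s\<^sup>2"
      unfolding sum_divide_distrib by (intro sum.cong) (auto simp: power_divide)
    then have one: "(\<Sum>a\<in>A. (?c a)\<^sup>2) = 1" using s2 False by simp
    have "?c a \<in> ?S a" for a
    proof (cases "a \<in> A")
      case True
      then have "(?c a)\<^sup>2 \<le> 1"
        using one A member_le_sum[of a A "\<lambda>a. (?c a)\<^sup>2"] by simp
      then have "\<bar>?c a\<bar> \<le> 1" by (simp only: abs_square_le_1)
      then have "-1 \<le> ?c a \<and> ?c a \<le> 1" by linarith
      then show ?thesis using True by (simp only: if_True atLeastAtMost_iff)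
    qed simp
    then have "?c \<in> ?K" using one by auto
    then have "?Q c0 \<le> ?Q ?c" by (rule c0)
    also have "?Q ?c = ?Q c / ?s\<^sup>2"
      unfolding sum_divide_distrib by (intro sum.cong refl) (simp add: power2_eq_square)
    finally show ?thesis using s s2 False by (simp add: field_simps)
  qed
  then show ?thesis using m by blast
qed

text \<open>A nonnegative continuous function with integral 0 over the closure of an open set vanishes on that closure. The
reference simplex is of this kind, being convex with nonempty interior.\<close>

lemma integral_nonneg_zero_on_refs:
  fixes f :: "real^'n \<Rightarrow> real"
  assumes f: "continuous_on UNIV f" and nn: "\<And>z. f z \<ge> 0" and 0: "integral refs f \<le> 0" and z: "z \<in> refs"
  shows "f z = 0"
proof -
  let ?S = "interior (refs :: (real^'n) set)"
  have cl: "closure ?S = refs"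
    using convex_closure_interior[OF convex_refs interior_refs_nonempty] compact_refs
    by (metis closure_closed compact_imp_closed)
  have bd: "bounded ?S" using compact_refs by (meson bounded_interior compact_imp_bounded)
  show ?thesis
  proof (rule has_integral_0_closure_imp_0[of ?S f])
    show "0 < emeasure lborel ?S"
    proof -
      have "\<not> negligible ?S" using open_not_negligible[OF open_interior interior_refs_nonempty] .
      then have "?S \<notin> null_sets lebesgue" by (simp add: negligible_iff_null_sets)
      then have "emeasure lborel ?S \<noteq> 0" by (auto simp: null_sets_def)
      then show ?thesis by (simp add: zero_less_iff_neq_zero)
    qed
    show "emeasure lborel ?S < \<infinity>" using emeasure_bounded_finite[OF bd] by simp
    show "emeasure lborel (closure ?S) = emeasure lborel ?S"
    proof -
      have "negligible (frontier ?S)" by (intro negligible_convex_frontier convex_interior convex_refs)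
      then have n: "frontier ?S \<in> null_sets lborel"
        by (simp add: negligible_iff_null_sets null_sets_completion_iff)
      have "closure ?S = ?S \<union> frontier ?S" using closure_Un_frontier by blast
      then show ?thesis using emeasure_Un_null_set[OF _ n, of ?S] by auto
    qed
    show "(f has_integral 0) (closure ?S)"
    proof -
      have i: "f integrable_on refs" using continuous_integrable_on[OF compact_refs] f continuous_on_subset by blast
      have "integral refs f \<ge> 0" using nn by (intro integral_nonneg i) auto
      then have "integral refs f = 0" using 0 by simp
      then show ?thesis using i cl by (metis integrable_integral)
    qed
  qed (use f continuous_on_subset nn z cl in auto)
qed

lemma continuous_on_hpoly:
  "(\<And>i. i \<in> I \<Longrightarrow> continuous_on S (\<lambda>x. \<mu> x i)) \<Longrightarrow> continuous_on S (\<lambda>x. hpoly I k c (\<mu> x))"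
  unfolding hpoly_def by (intro continuous_intros) auto

text \<open>A homogeneous polynomial that vanishes on the simplex vanishes on the cone over it, hence has zero coefficients.
The integral is therefore a positive definite quadratic form in the coefficients.\<close>

lemma coefficients_bounded_by_integral:
  "\<exists>C>0. \<forall>c. (\<Sum>a\<in>Hom (UNIV :: 'n::finite option set) k. (c a)\<^sup>2)
      \<le> C * integral refs (\<lambda>z. (hpoly UNIV k c (bc z))\<^sup>2)"
proof -
  let ?A = "Hom (UNIV :: 'n option set) k"
  let ?m = "\<lambda>a z. \<Prod>i\<in>UNIV. bc z i ^ a i"
  let ?M = "\<lambda>a b. integral (refs :: (real^'n) set) (\<lambda>z. ?m a z * ?m b z)"
  have A: "finite ?A" by (intro finite_Hom) simp
  have cont: "continuous_on S (?m a)" for a and S :: "(real^'n) set" by (intro continuous_intros continuous_on_bc)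
  have sq: "(hpoly UNIV k c (bc z))\<^sup>2 = (\<Sum>a\<in>?A. \<Sum>b\<in>?A. c a * c b * (?m a z * ?m b z))" for c and z :: "real^'n"
    unfolding hpoly_def power2_eq_square sum_product by (simp add: ac_simps)
  have Q: "integral refs (\<lambda>z. (hpoly UNIV k c (bc z))\<^sup>2) = (\<Sum>a\<in>?A. \<Sum>b\<in>?A. c a * c b * ?M a b)" for c
  proof -
    have i: "(\<lambda>z. c a * c b * (?m a z * ?m b z)) integrable_on refs" for a b
      by (intro continuous_integrable_on[OF compact_refs] continuous_intros cont)
    show ?thesis unfolding sq
      by (subst integral_sum, simp_all add: A i integrable_sum integral_sum)
  qed
  have "0 < (\<Sum>a\<in>?A. \<Sum>b\<in>?A. c a * c b * ?M a b)" if "\<exists>a\<in>?A. c a \<noteq> 0" for c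
  proof (rule ccontr)
    assume "\<not> ?thesis"
    then have le: "integral refs (\<lambda>z :: real^'n. (hpoly UNIV k c (bc z))\<^sup>2) \<le> 0" unfolding Q by simp
    have z: "hpoly UNIV k c (bc z) = 0" if "z \<in> refs" for z :: "real^'n"
      using integral_nonneg_zero_on_refs[OF _ _ le that]
      by (simp add: continuous_on_hpoly continuous_on_bc continuous_on_power)
    have "c a = 0" if "a \<in> ?A" for a
    proof (rule monomials_independent[of UNIV ?A])
      show "(\<Sum>a\<in>?A. c a * (\<Prod>i\<in>UNIV. y i ^ a i)) = 0" if y: "\<And>i. i \<in> UNIV \<Longrightarrow> 0 < y i" for y :: "'n option \<Rightarrow> real"
      proof -
        let ?s = "\<Sum>j\<in>UNIV. y j"
        let ?z = "(\<chi> i. y (Some i) / ?s) :: real^'n"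
        have s: "?s > 0" using y by (intro sum_pos) auto
        have b: "bc ?z j = y j / ?s" for j
        proof (cases j)
          case None
          have "(\<Sum>i\<in>UNIV. y (Some i) / ?s) = (?s - y None) / ?s"
            by (simp only: sum_divide_distrib[symmetric]) (simp add: sum_option)
          then show ?thesis using None s by (simp add: bc_def field_simps)
        qed (simp add: bc_def)
        have "?z \<in> refs" unfolding refs_iff b using y s by (simp add: less_imp_le)
        then have "0 = hpoly UNIV k c (bc ?z)" using z by simp
        also have "\<dots> = hpoly UNIV k c y / ?s ^ k"
          unfolding hpoly_def sum_divide_distrib
        proof (rule sum.cong[OF refl])
          fix a assume a: "a \<in> ?A"
          have "(\<Prod>i\<in>UNIV. bc ?z i ^ a i) = (\<Prod>i\<in>UNIV. y i ^ a i) / (\<Prod>i\<in>UNIV. ?s ^ a i)"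
            unfolding b power_divide by (rule prod_dividef)
          also have "(\<Prod>i\<in>UNIV. ?s ^ a i) = ?s ^ k" using a by (simp add: power_sum[symmetric] Hom_def)
          finally show "c a * (\<Prod>i\<in>UNIV. bc ?z i ^ a i) = c a * (\<Prod>i\<in>UNIV. y i ^ a i) / ?s ^ k" by simp
        qed
        finally show ?thesis using s by (simp add: hpoly_def)
      qed
    qed (use A that in auto)
    then show False using \<open>\<exists>a\<in>?A. c a \<noteq> 0\<close> by blast
  qed
  from quadratic_form_lower_bound[OF A, of ?M, OF this]
  obtain m where m: "m > 0" "\<And>c. m * (\<Sum>a\<in>?A. (c a)\<^sup>2) \<le> integral refs (\<lambda>z. (hpoly UNIV k c (bc z))\<^sup>2)"
    unfolding Q by blast
  have "(\<Sum>a\<in>?A. (c a)\<^sup>2) \<le> 1 / m * integral refs (\<lambda>z. (hpoly UNIV k c (bc z))\<^sup>2)" for c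
    using m by (simp add: field_simps)
  then show ?thesis using m(1) by (intro exI[of _ "1 / m"]) auto
qed

subsection \<open>Change of variables\<close>

lemma param_image: "inj \<beta> \<Longrightarrow> param \<beta> ` refs = convex hull (range \<beta>)" for \<beta> :: "'n::finite option \<Rightarrow> 'b::real_vector"
proof
  assume "inj \<beta>"
  show "param \<beta> ` refs \<subseteq> convex hull (range \<beta>)"
  proof
    fix y assume "y \<in> param \<beta> ` refs"
    then obtain z where z: "z \<in> refs" "y = (\<Sum>j\<in>UNIV. bc z j *\<^sub>R \<beta> j)" by (auto simp: param_def)
    show "y \<in> convex hull (range \<beta>)" unfolding z(2)
      by (rule convex_sum) (use z in \<open>auto simp: sum_bc refs_iff hull_inc\<close>)
  qed
  show "convex hull (range \<beta>) \<subseteq> param \<beta> ` refs"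
  proof
    fix y assume "y \<in> convex hull (range \<beta>)"
    then obtain u where u: "\<forall>x\<in>range \<beta>. 0 \<le> u x" "sum u (range \<beta>) = 1" "(\<Sum>x\<in>range \<beta>. u x *\<^sub>R x) = y"
      by (auto simp: convex_hull_finite)
    have s: "(\<Sum>j\<in>UNIV. u (\<beta> j)) = 1" using u(2) \<open>inj \<beta>\<close> by (simp add: sum.reindex)
    let ?z = "(\<chi> i. u (\<beta> (Some i))) :: real^'n"
    have b: "bc ?z j = u (\<beta> j)" for j
      using s by (cases j) (auto simp: bc_def sum_option)
    have "param \<beta> ?z = y" using u(3) \<open>inj \<beta>\<close> by (simp add: param_def b sum.reindex)
    moreover have "?z \<in> refs" using u(1) by (simp add: refs_iff b)
    ultimately show "y \<in> param \<beta> ` refs" by blast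
  qed
qed

lemma integral_affine_image:
  fixes \<beta> :: "'n::{finite,wellorder} option \<Rightarrow> real^'n::_"
  assumes "continuous_on (param \<beta> ` refs) f"
  shows "integral (param \<beta> ` refs) f
       = measure lebesgue (param \<beta> ` refs) / rvol TYPE('n) * integral refs (\<lambda>z. f (param \<beta> z) :: real)"
proof -
  let ?g = "\<lambda>z :: real^'n::_. \<Sum>i\<in>UNIV. z $ i *\<^sub>R (\<beta> (Some i) - \<beta> None)"
  have lin: "linear ?g"
    by (auto intro!: linear_compose_sum linearI simp: algebra_simps)
  have im: "param \<beta> ` refs = (+) (\<beta> None) ` (?g ` refs)"
    unfolding image_image param_alt ..
  let ?f = "\<lambda>x. vec (f (\<beta> None + x)) :: real^1"
  have cont: "continuous_on (?g ` refs) (\<lambda>x. f (\<beta> None + x))"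
    using assms unfolding im by (intro continuous_on_compose2[OF assms, unfolded im]) (auto intro!: continuous_intros)
  have cg: "compact (?g ` refs)"
    using compact_refs lin by (intro compact_continuous_image linear_continuous_on) (auto simp: linear_conv_bounded_linear)
  have "continuous_on (?g ` refs) ?f"
    unfolding vec_def by (intro continuous_on_vec_lambda cont)
  then have ai: "?f absolutely_integrable_on ?g ` refs" using cg by (rule continuous_absolutely_integrable[rotated])
  have "integral (?g ` refs) ?f = \<bar>det (matrix ?g)\<bar> *\<^sub>R integral refs (?f \<circ> ?g)"
    using integral_change_of_variables_linear[OF lin] ai by blast
  then have 1: "integral (?g ` refs) (\<lambda>x. f (\<beta> None + x)) = \<bar>det (matrix ?g)\<bar> * integral refs (\<lambda>z. f (param \<beta> z))"
    by (simp add: integral_on_1_eq vec_eq_iff o_def param_alt)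
  have "measure lebesgue (?g ` refs) = \<bar>det (matrix ?g)\<bar> * rvol TYPE('n)"
    unfolding rvol_def using measure_linear_image[OF lin] compact_refs lmeasurable_compact by blast
  moreover have "measure lebesgue (param \<beta> ` refs) = measure lebesgue (?g ` refs)"
    unfolding im by (rule measure_translation)
  ultimately have 2: "\<bar>det (matrix ?g)\<bar> = measure lebesgue (param \<beta> ` refs) / rvol TYPE('n)"
    using rvol_pos[where 'n='n] by simp
  have "integral (param \<beta> ` refs) f = integral (?g ` refs) (\<lambda>x. f (\<beta> None + x))"
  proof -
    have "integral (param \<beta> ` refs) f = integral\<^sup>L lborel (\<lambda>x. indicator (param \<beta> ` refs) x * f x)"
      using integral_lborel[OF _ assms] compact_continuous_image[OF continuous_on_param compact_refs] by blast
    also have "\<dots> = integral\<^sup>L lborel (\<lambda>x. indicator (param \<beta> ` refs) (\<beta> None + x) * f (\<beta> None + x))"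
    proof -
      have "(\<lambda>x. indicator (param \<beta> ` refs) x * f x) \<in> borel_measurable lborel"
        using borel_measurable_integrable[OF borel_integrable_compact[OF _ assms]]
          compact_continuous_image[OF continuous_on_param compact_refs, of \<beta>] by simp
      then show ?thesis
        by (subst lborel_distr_plus[of "\<beta> None", symmetric], subst integral_distr) auto
    qed
    also have "(\<lambda>x. indicator (param \<beta> ` refs) (\<beta> None + x)) = indicator (?g ` refs)"
      unfolding im by (auto simp: indicator_def fun_eq_iff)
    also have "integral\<^sup>L lborel (\<lambda>x. indicator (?g ` refs) x * f (\<beta> None + x)) = integral (?g ` refs) (\<lambda>x. f (\<beta> None + x))"
      using integral_lborel[OF cg cont] by simp
    finally show ?thesis .
  qed
  then show ?thesis using 1 2 by simp
qed

text \<open>The relabelled parametrisation is an affine map of the reference simplex onto itself, hence preserves volume.\<close>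

lemma integral_relabel:
  fixes \<beta> :: "'n::{finite,wellorder} option \<Rightarrow> 'b::real_normed_vector" and \<pi> :: "'n option \<Rightarrow> 'n option"
  assumes \<pi>: "bij \<pi>" and f: "continuous_on (param \<beta> ` refs) f"
  shows "integral refs (\<lambda>z. f (param (\<beta> \<circ> \<pi>) z) :: real) = integral refs (\<lambda>z. f (param \<beta> z))"
proof -
  define \<sigma> :: "'n option \<Rightarrow> real^'n::_" where "\<sigma> = (\<lambda>j. case j of None \<Rightarrow> 0 | Some i \<Rightarrow> axis i 1)"
  have \<sigma>: "param \<sigma> z = z" for z
    by (simp add: param_alt \<sigma>_def basis_expansion flip: scalar_mult_eq_scaleR)
  have inj: "inj \<sigma>"
    by (auto simp: inj_on_def \<sigma>_def axis_eq_axis split: option.splits)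
  have im: "param (\<sigma> \<circ> \<pi>) ` refs = refs"
  proof -
    have "inj (\<sigma> \<circ> \<pi>)" using inj \<pi> by (simp add: inj_compose bij_is_inj)
    moreover have "range (\<sigma> \<circ> \<pi>) = range \<sigma>" using \<pi> by (metis bij_is_surj image_comp)
    ultimately have "param (\<sigma> \<circ> \<pi>) ` refs = param \<sigma> ` refs" using inj by (simp only: param_image)
    then show ?thesis by (simp add: \<sigma>)
  qed
  have b: "bc (param (\<sigma> \<circ> \<pi>) z) (\<pi> j) = bc z j" for z j
  proof -
    let ?i = "inv \<pi>"
    have i: "\<pi> (?i l) = l" "?i (\<pi> l) = l" for l using \<pi> by (simp_all add: bij_is_surj bij_is_inj surj_f_inv_f)
    have c: "param (\<sigma> \<circ> \<pi>) z $ l = bc z (?i (Some l))" for l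
    proof -
      have e: "(\<sigma> \<circ> \<pi>) j $ l = (if j = ?i (Some l) then 1 else 0)" for j
      proof -
        have "\<sigma> m $ l = (if m = Some l then 1 else 0)" for m
          by (cases m) (auto simp: \<sigma>_def axis_def)
        then show ?thesis using i by (auto simp: o_def) metis
      qed
      show ?thesis unfolding param_def sum_component vector_scaleR_component e
        by (simp add: if_distrib sum.delta cong: if_cong)
    qed
    have "bc (param (\<sigma> \<circ> \<pi>) z) l = bc z (?i l)" for l
    proof (cases l)
      case (Some m)
      then show ?thesis using c by (simp add: bc_def)
    next
      case None
      have "(\<Sum>l\<in>UNIV. bc z (?i l)) = 1"
        using sum.reindex_bij_betw[of ?i UNIV UNIV "bc z"] bij_imp_bij_inv[OF \<pi>] sum_bc[of z] by simp
      then have "(\<Sum>l\<in>UNIV. bc z (?i (Some l))) = 1 - bc z (?i None)" by (simp add: sum_option)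
      then show ?thesis using None by (simp add: bc_def[of "param _ _"] c)
    qed
    then show ?thesis using i by simp
  qed
  have comp: "param \<beta> (param (\<sigma> \<circ> \<pi>) z) = param (\<beta> \<circ> \<pi>) z" for z
    unfolding param_def[of \<beta>] param_def[of "\<beta> \<circ> \<pi>"]
    using sum.reindex_bij_betw[of \<pi> UNIV UNIV "\<lambda>j. bc (param (\<sigma> \<circ> \<pi>) z) j *\<^sub>R \<beta> j"] \<pi> by (simp add: b)
  have "integral refs (\<lambda>z. f (param \<beta> z)) = integral refs (\<lambda>z. f (param \<beta> (param (\<sigma> \<circ> \<pi>) z)))"
    using integral_affine_image[of "\<sigma> \<circ> \<pi>" "\<lambda>z. f (param \<beta> z)"] rvol_pos[where 'n='n]
    unfolding im by (simp add: rvol_def continuous_on_compose2[OF f continuous_on_param])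
  then show ?thesis by (simp add: comp)
qed

subsection \<open>Slicing the reference tetrahedron\<close>

lemma prod_Basis_cart: "(\<Prod>b\<in>Basis. (w :: real^'n) \<bullet> b) = (\<Prod>i\<in>UNIV. w $ i)"
proof -
  have B: "(Basis :: (real^'n) set) = (\<lambda>i. axis i 1) ` UNIV" by (auto simp: Basis_vec_def)
  have "inj (\<lambda>i :: 'n. axis i (1::real))" by (auto simp: inj_on_def axis_eq_axis)
  then show ?thesis unfolding B by (subst prod.reindex) (auto simp: inner_axis)
qed

lemma continuous_on_vector3:
  assumes "continuous_on S f" "continuous_on S g" "continuous_on S h"
  shows "continuous_on S (\<lambda>x. vector [f x, g x, h x] :: real^3)"
proof -
  have "continuous_on S (\<lambda>x. (vector [f x, g x, h x] :: real^3) $ i)" for i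
    using exhaust_3[of i] assms by auto
  then have "continuous_on S (\<lambda>x. \<chi> i. (vector [f x, g x, h x] :: real^3) $ i)"
    by (rule continuous_on_vec_lambda)
  then show ?thesis by (simp only: vec_nth_inverse)
qed

lemma continuous_on_slice: "continuous_on S (\<lambda>(y :: real^2, t). vector [t, y $ 1, y $ 2] :: real^3)"
  unfolding case_prod_beta by (intro continuous_on_vector3 continuous_intros)

text \<open>The first coordinate is split off, so that Fubini applies to the reference tetrahedron.\<close>

lemma lborel_slice: "(lborel :: (real^3) measure) = distr (lborel \<Otimes>\<^sub>M lborel) borel (\<lambda>(y :: real^2, t). vector [t, y $ 1, y $ 2])"
proof (rule lborel_eqI)
  let ?\<Psi> = "\<lambda>(y :: real^2, t). vector [t, y $ 1, y $ 2] :: real^3"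
  have cont: "continuous_on UNIV ?\<Psi>" by (rule continuous_on_slice)
  then have m: "?\<Psi> \<in> measurable (lborel \<Otimes>\<^sub>M lborel) borel"
    unfolding lborel_prod by (simp add: borel_measurable_continuous_onI)
  fix l u :: "real^3" assume le: "\<And>b. b \<in> Basis \<Longrightarrow> l \<bullet> b \<le> u \<bullet> b"
  have le': "l $ i \<le> u $ i" for i using le[of "axis i 1"] by (auto simp: inner_axis Basis_vec_def)
  have pre: "?\<Psi> -` box l u = box (vector [l $ 2, l $ 3]) (vector [u $ 2, u $ 3]) \<times> box (l $ 1) (u $ 1)"
  proof (rule set_eqI)
    fix p :: "(real^2) \<times> real"
    show "p \<in> ?\<Psi> -` box l u \<longleftrightarrow> p \<in> box (vector [l $ 2, l $ 3]) (vector [u $ 2, u $ 3]) \<times> box (l $ 1) (u $ 1)"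
      unfolding vimage_eq mem_Times_iff case_prod_beta mem_box_cart forall_3 forall_2 vector_3 vector_2 box_real greaterThanLessThan_iff
      by blast
  qed
  have prod3: "(\<Prod>b\<in>Basis. (w :: real^3) \<bullet> b) = w $ 1 * w $ 2 * w $ 3" for w
    unfolding prod_Basis_cart UNIV_3 by simp
  have prod2: "(\<Prod>b\<in>Basis. (w :: real^2) \<bullet> b) = w $ 1 * w $ 2" for w
    unfolding prod_Basis_cart UNIV_2 by simp
  have e2: "emeasure lborel (box (vector [l $ 2, l $ 3]) (vector [u $ 2, u $ 3]) :: (real^2) set) = ennreal ((u $ 2 - l $ 2) * (u $ 3 - l $ 3))"
  proof (subst emeasure_lborel_box)
    fix b :: "real^2" assume "b \<in> Basis"
    then obtain i where "b = axis i 1" by (auto simp: Basis_vec_def)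
    then show "vector [l $ 2, l $ 3] \<bullet> b \<le> vector [u $ 2, u $ 3] \<bullet> b"
      using le' exhaust_2[of i] by (auto simp: inner_axis)
  qed (simp add: prod2)
  have "emeasure (distr (lborel \<Otimes>\<^sub>M lborel) borel ?\<Psi>) (box l u)
     = emeasure lborel (box (vector [l $ 2, l $ 3]) (vector [u $ 2, u $ 3]) :: (real^2) set) * emeasure lborel (box (l $ 1) (u $ 1))"
    by (subst emeasure_distr[OF m]) (auto simp: space_pair_measure pre lborel.emeasure_pair_measure_Times)
  also have "\<dots> = ennreal ((u $ 2 - l $ 2) * (u $ 3 - l $ 3)) * ennreal (u $ 1 - l $ 1)"
    using le'[of 1] by (simp add: e2)
  also have "\<dots> = ennreal ((u $ 1 - l $ 1) * (u $ 2 - l $ 2) * (u $ 3 - l $ 3))"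
    using le' by (subst ennreal_mult[symmetric]) (auto simp: ac_simps)
  finally show "emeasure (distr (lborel \<Otimes>\<^sub>M lborel) borel ?\<Psi>) (box l u) = (\<Prod>b\<in>Basis. (u - l) \<bullet> b)"
    by (simp add: prod3)
qed simp

lemma refs_slice: "(vector [t, y $ 1, y $ 2] :: real^3) \<in> refs \<longleftrightarrow> y \<in> (refs :: (real^2) set) \<and> 0 \<le> t \<and> t \<le> 1 - y $ 1 - y $ 2"
  by (auto simp: refs_def forall_3 forall_2 sum_3 sum_2)

lemma integral_refs_slice:
  fixes G :: "real^3 \<Rightarrow> real"
  assumes G: "continuous_on UNIV G"
  shows "integral refs G = integral (refs :: (real^2) set) (\<lambda>y. integral {0..1 - y $ 1 - y $ 2} (\<lambda>t. G (vector [t, y $ 1, y $ 2])))"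
proof -
  let ?\<Psi> = "\<lambda>(y :: real^2, t). vector [t, y $ 1, y $ 2] :: real^3"
  let ?h = "\<lambda>x. indicator refs x * G x"
  let ?in = "\<lambda>y :: real^2. integral {0..1 - y $ 1 - y $ 2} (\<lambda>t. G (vector [t, y $ 1, y $ 2]))"
  have cont: "continuous_on UNIV ?\<Psi>" by (rule continuous_on_slice)
  then have m: "?\<Psi> \<in> measurable (lborel \<Otimes>\<^sub>M lborel) borel"
    unfolding lborel_prod by (simp add: borel_measurable_continuous_onI)
  have ih: "integrable lborel ?h"
    using borel_integrable_compact[OF compact_refs continuous_on_subset[OF G subset_UNIV]] by simp
  have hm: "?h \<in> borel_measurable borel" using ih by (simp add: borel_measurable_integrable)
  have ip: "integrable (lborel \<Otimes>\<^sub>M lborel) (\<lambda>p. ?h (?\<Psi> p))"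
    using ih integrable_distr_eq[OF m hm] lborel_slice by simp
  have "integral refs G = integral\<^sup>L lborel ?h"
    using integral_lborel[OF compact_refs continuous_on_subset[OF G subset_UNIV]] .
  also have "\<dots> = integral\<^sup>L (lborel \<Otimes>\<^sub>M lborel) (\<lambda>p. ?h (?\<Psi> p))"
    by (subst lborel_slice, rule integral_distr[OF m hm])
  also have "\<dots> = integral\<^sup>L lborel (\<lambda>y. integral\<^sup>L lborel (\<lambda>t. ?h (?\<Psi> (y, t))))"
    using lborel_pair.integral_fst'[OF ip] by simp
  also have "(\<lambda>y. integral\<^sup>L lborel (\<lambda>t. ?h (?\<Psi> (y, t)))) = (\<lambda>y. indicator refs y * ?in y)"
  proof
    fix y :: "real^2"
    have c: "continuous_on S (\<lambda>t. G (vector [t, y $ 1, y $ 2]))" for S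
      by (intro continuous_on_compose2[OF G] continuous_on_vector3) (auto intro!: continuous_intros)
    have "integral\<^sup>L lborel (\<lambda>t. ?h (?\<Psi> (y, t))) = integral\<^sup>L lborel (\<lambda>t. indicator refs y * (indicator {0..1 - y $ 1 - y $ 2} t * G (vector [t, y $ 1, y $ 2])))"
      by (rule Bochner_Integration.integral_cong[OF refl]) (auto simp: indicator_def refs_slice)
    also have "\<dots> = indicator refs y * ?in y"
      by (simp add: integral_lborel[OF _ c])
    finally show "integral\<^sup>L lborel (\<lambda>t. ?h (?\<Psi> (y, t))) = indicator refs y * ?in y" .
  qed
  note slices = this
  also have "integral\<^sup>L lborel (\<lambda>y. indicator refs y * ?in y) = integral refs ?in"
  proof -
    have "integrable lborel (\<lambda>y. integral\<^sup>L lborel (\<lambda>t. ?h (?\<Psi> (y, t))))"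
      using lborel_pair.integrable_fst'[OF ip] by simp
    then have "set_integrable lborel refs ?in" unfolding slices by (simp add: set_integrable_def)
    from set_borel_integral_eq_integral(2)[OF this] show ?thesis by (simp add: set_lebesgue_integral_def)
  qed
  finally show ?thesis .
qed

section \<open>Barycentric coordinates\<close>

definition bary :: "'a::real_vector set \<Rightarrow> 'a \<Rightarrow> 'a \<Rightarrow> real" where
  "bary V x = (SOME u. sum u V = 1 \<and> (\<Sum>v\<in>V. u v *\<^sub>R v) = x)"

lemma bary_works:
  assumes "finite V" "x \<in> affine hull V"
  shows "sum (bary V x) V = 1" "(\<Sum>v\<in>V. bary V x v *\<^sub>R v) = x"
proof -
  have "\<exists>u. sum u V = 1 \<and> (\<Sum>v\<in>V. u v *\<^sub>R v) = x"
    using assms by (simp add: affine_hull_finite)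
  from someI_ex[OF this] show "sum (bary V x) V = 1" "(\<Sum>v\<in>V. bary V x v *\<^sub>R v) = x"
    unfolding bary_def by blast+
qed

lemma bary_unique:
  fixes V :: "'a::euclidean_space set"
  assumes "\<not> affine_dependent V" "sum u V = 1" "(\<Sum>v\<in>V. u v *\<^sub>R v) = x" "w \<in> V"
  shows "bary V x w = u w"
proof -
  have fin: "finite V" using assms(1) aff_independent_finite by blast
  have x: "x \<in> affine hull V" using assms fin by (auto simp: affine_hull_finite)
  let ?d = "\<lambda>v. bary V x v - u v"
  have "sum ?d V = 0" "(\<Sum>v\<in>V. ?d v *\<^sub>R v) = 0"
    using bary_works[OF fin x] assms by (simp_all add: sum_subtractf scaleR_diff_left)
  then have "\<not> (\<exists>v\<in>V. ?d v \<noteq> 0)" using assms(1) affine_dependent_explicit_finite[OF fin] by blast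
  then show ?thesis using assms(4) by simp
qed

lemma bary_subset:
  fixes V :: "'a::euclidean_space set"
  assumes V: "\<not> affine_dependent V" and W: "W \<subseteq> V" "x \<in> affine hull W"
  shows "v \<in> W \<Longrightarrow> bary V x v = bary W x v" "v \<in> V - W \<Longrightarrow> bary V x v = 0"
proof -
  have fin: "finite V" "finite W" using assms aff_independent_finite finite_subset by blast+
  let ?u = "\<lambda>v. if v \<in> W then bary W x v else 0"
  have "sum ?u V = 1" "(\<Sum>v\<in>V. ?u v *\<^sub>R v) = x"
    using bary_works[OF fin(2) W(2)] W(1) fin
    by (simp_all add: if_distrib if_distribR sum.If_cases Int_absorb1 cong: if_cong)
  from bary_unique[OF V this] show "v \<in> W \<Longrightarrow> bary V x v = bary W x v" "v \<in> V - W \<Longrightarrow> bary V x v = 0"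
    using W(1) by auto
qed

lemma bary_vertex:
  fixes V :: "'a::euclidean_space set"
  assumes V: "\<not> affine_dependent V" and "v \<in> V" "w \<in> V"
  shows "bary V w v = (if v = w then 1 else 0)"
proof -
  have fin: "finite V" using V aff_independent_finite by blast
  have "(\<Sum>u\<in>V. (if u = w then 1 else 0 :: real) *\<^sub>R u) = (\<Sum>u\<in>V. if u = w then u else 0)"
    by (rule sum.cong) auto
  then show ?thesis
    by (intro bary_unique[OF V _ _ assms(2)]) (use fin assms in \<open>auto simp: sum.delta\<close>)
qed

lemma in_convex_hull_iff_bary:
  fixes V :: "'a::euclidean_space set"
  assumes V: "\<not> affine_dependent V" and x: "x \<in> affine hull V"
  shows "x \<in> convex hull V \<longleftrightarrow> (\<forall>v\<in>V. 0 \<le> bary V x v)"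
proof -
  have fin: "finite V" using V aff_independent_finite by blast
  show ?thesis
  proof
    assume "x \<in> convex hull V"
    then obtain u where u: "\<forall>v\<in>V. 0 \<le> u v" "sum u V = 1" "(\<Sum>v\<in>V. u v *\<^sub>R v) = x"
      using fin by (auto simp: convex_hull_finite)
    then show "\<forall>v\<in>V. 0 \<le> bary V x v" using bary_unique[OF V] by metis
  next
    assume "\<forall>v\<in>V. 0 \<le> bary V x v"
    then show "x \<in> convex hull V" using bary_works[OF fin x] fin by (auto simp: convex_hull_finite)
  qed
qed

lemma bary_bounds:
  fixes V :: "'a::euclidean_space set"
  assumes V: "\<not> affine_dependent V" and x: "x \<in> convex hull V" and v: "v \<in> V"
  shows "0 \<le> bary V x v" "bary V x v \<le> 1"
proof -
  have fin: "finite V" using V aff_independent_finite by blast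
  have xa: "x \<in> affine hull V" using x convex_hull_subset_affine_hull by blast
  have nn: "\<forall>v\<in>V. 0 \<le> bary V x v" using in_convex_hull_iff_bary[OF V xa] x by blast
  then show "0 \<le> bary V x v" using v by blast
  show "bary V x v \<le> 1"
    using member_le_sum[of v V "bary V x"] bary_works(1)[OF fin xa] nn fin v by simp
qed

lemma bary_param:
  fixes \<beta> :: "'n::finite option \<Rightarrow> 'a::euclidean_space"
  assumes "\<not> affine_dependent (range \<beta>)" "inj \<beta>"
  shows "bary (range \<beta>) (param \<beta> z) (\<beta> j) = bc z j"
proof -
  let ?u = "\<lambda>v. bc z (inv \<beta> v)"
  have "bary (range \<beta>) (param \<beta> z) (\<beta> j) = ?u (\<beta> j)"
    by (rule bary_unique[OF assms(1)]) (use assms(2) in \<open>auto simp: sum.reindex sum_bc param_def\<close>)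
  then show ?thesis using assms(2) by simp
qed

lemma hpoly_reindex:
  assumes g: "bij_betw g I J"
  shows "hpoly J k c y = hpoly I k (\<lambda>a. c (\<lambda>j. if j \<in> J then a (inv_into I g j) else 0)) (\<lambda>i. y (g i))"
    and "finite I \<Longrightarrow> (\<Sum>a\<in>Hom J k. F (c a)) = (\<Sum>a\<in>Hom I k. F (c (\<lambda>j. if j \<in> J then a (inv_into I g j) else 0)))"
proof -
  let ?h = "\<lambda>a j. if j \<in> J then a (inv_into I g j) else 0"
  let ?h' = "\<lambda>b i. if i \<in> I then b (g i) else 0"
  have i: "inv_into I g (g x) = x" "g x \<in> J" if "x \<in> I" for x using g that by (auto simp: bij_betw_def)
  have i': "g (inv_into I g y) = y" "inv_into I g y \<in> I" if "y \<in> J" for y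
    using g that by (auto simp: bij_betw_def f_inv_into_f inv_into_into)
  have s1: "sum (?h a) J = sum a I" for a :: "'a \<Rightarrow> nat"
    using sum.reindex_bij_betw[OF g, of "?h a"] i by (auto intro!: sum.cong)
  have s2: "sum (?h' b) I = sum b J" for b :: "'b \<Rightarrow> nat"
    using sum.reindex_bij_betw[OF g, of b] by (auto intro!: sum.cong)
  have b: "bij_betw ?h (Hom I k) (Hom J k)"
  proof (rule bij_betwI[of _ _ _ ?h'])
    show "?h \<in> Hom I k \<rightarrow> Hom J k" using s1 by (auto simp: Hom_def)
    show "?h' \<in> Hom J k \<rightarrow> Hom I k" using s2 by (auto simp: Hom_def)
    show "?h' (?h a) = a" if "a \<in> Hom I k" for a using that i by (auto simp: Hom_def fun_eq_iff)
    show "?h (?h' a) = a" if "a \<in> Hom J k" for a using that i' by (auto simp: Hom_def fun_eq_iff)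
  qed
  show "(\<Sum>a\<in>Hom J k. F (c a)) = (\<Sum>a\<in>Hom I k. F (c (?h a)))"
    using sum.reindex_bij_betw[OF b, of "\<lambda>a. F (c a)"] by simp
  have p: "(\<Prod>j\<in>J. y j ^ ?h a j) = (\<Prod>i\<in>I. y (g i) ^ a i)" for a
    using prod.reindex_bij_betw[OF g, of "\<lambda>j. y j ^ ?h a j"] i by (auto intro!: prod.cong)
  show "hpoly J k c y = hpoly I k (\<lambda>a. c (?h a)) (\<lambda>i. y (g i))"
    unfolding hpoly_def using sum.reindex_bij_betw[OF b, of "\<lambda>a. c a * (\<Prod>j\<in>J. y j ^ a j)"] p by simp
qed

section \<open>Tetrahedra and their faces\<close>

definition tri :: "real^3 \<Rightarrow> real^3 \<Rightarrow> real^3 \<Rightarrow> 2 option \<Rightarrow> real^3" where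
  "tri a b c j = (case j of None \<Rightarrow> a | Some i \<Rightarrow> if i = 1 then b else c)"

definition tet :: "real^3 \<Rightarrow> real^3 \<Rightarrow> real^3 \<Rightarrow> real^3 \<Rightarrow> 3 option \<Rightarrow> real^3" where
  "tet v a b c j = (case j of None \<Rightarrow> v | Some i \<Rightarrow> if i = 1 then a else if i = 2 then b else c)"

lemma exhaust_2_option: "j = None \<or> j = Some 1 \<or> j = Some (2 :: 2)"
  using exhaust_2 by (cases j) auto

lemma exhaust_3_option: "j = None \<or> j = Some 1 \<or> j = Some 2 \<or> j = Some (3 :: 3)"
  using exhaust_3 by (cases j) auto

lemma UNIV_2_option: "(UNIV :: 2 option set) = {None, Some 1, Some 2}"
  using exhaust_2_option by auto

lemma UNIV_3_option: "(UNIV :: 3 option set) = {None, Some 1, Some 2, Some 3}"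
  using exhaust_3_option by auto

lemma range_tri: "range (tri a b c) = {a, b, c}"
  unfolding UNIV_2_option by (auto simp: tri_def)

lemma range_tet: "range (tet v a b c) = {v, a, b, c}"
  unfolding UNIV_3_option by (auto simp: tet_def)

lemma inj_tri: "distinct [a, b, c] \<Longrightarrow> inj (tri a b c)"
  unfolding inj_def using exhaust_2_option by (auto simp: tri_def split: option.splits)

lemma inj_tet: "distinct [v, a, b, c] \<Longrightarrow> inj (tet v a b c)"
  unfolding inj_def using exhaust_3_option by (auto simp: tet_def split: option.splits)

lemma param_tri: "param (tri a b c) z = a + (z $ 1) *\<^sub>R (b - a) + (z $ 2) *\<^sub>R (c - a)"
  by (simp add: param_alt tri_def sum_2)

lemma param_tet: "param (tet v a b c) z = v + (z $ 1) *\<^sub>R (a - v) + (z $ 2) *\<^sub>R (b - v) + (z $ 3) *\<^sub>R (c - v)"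
  by (simp add: param_alt tet_def sum_3)

lemma refs_2: "(refs :: (real^2) set) = {z. 0 \<le> z $ 1 \<and> 0 \<le> z $ 2 \<and> z $ 1 + z $ 2 \<le> 1}"
  by (auto simp: refs_def forall_2 sum_2)

subsection \<open>Surface integrals\<close>

text \<open>The surface integral is defined by an unspecified labelling of the vertices. Exchanging two labels changes neither
the integral over the reference triangle nor the area factor, which is antisymmetric up to a norm; so every labelling
gives the same value.\<close>

lemma face_integral_labelled:
  assumes ind: "\<not> affine_dependent {a, b, c}" and dist: "distinct [a, b, c]"
    and f: "continuous_on (convex hull {a, b, c}) f"
  shows "face_integral (convex hull {a, b, c}) f = norm (cross3 (b - a) (c - a)) * integral refs (\<lambda>z. f (param (tri a b c) z))"
proof -
  let ?P = "\<lambda>a b c. norm (cross3 (b - a) (c - a)) * integral refs (\<lambda>z. f (param (tri a b c) z))"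
  have swap: "?P x z y = ?P x y z \<and> ?P y x z = ?P x y z" if xyz: "{x, y, z} = {a, b, c}" for x y z
  proof
    have d: "distinct [x, y, z]"
      using dist xyz card_distinct[of "[x, y, z]"] distinct_card[of "[a,b,c]"] by simp
    have f': "continuous_on (param (tri x y z) ` refs) f"
      using f by (simp only: param_image[OF inj_tri[OF d]] range_tri xyz)
    let ?\<pi> = "\<lambda>j. case j of None \<Rightarrow> None | Some i \<Rightarrow> if i = (1::2) then Some (2::2) else Some 1"
    have \<pi>: "bij ?\<pi>" by (rule involuntory_imp_bij) (use exhaust_2 in \<open>auto split: option.splits\<close>)
    have e1: "tri x z y = tri x y z \<circ> ?\<pi>"
      by (rule ext) (auto simp: tri_def split: option.splits)
    have "integral refs (\<lambda>w. f (param (tri x z y) w)) = integral refs (\<lambda>w. f (param (tri x y z) w))"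
      using integral_relabel[OF \<pi> f'] unfolding e1 .
    moreover have "norm (cross3 (z - x) (y - x)) = norm (cross3 (y - x) (z - x))"
      by (subst cross_skew) simp
    ultimately show "?P x z y = ?P x y z" by simp
    let ?\<rho> = "\<lambda>j. case j of None \<Rightarrow> Some 1 | Some i \<Rightarrow> if i = (1::2) then None else Some i"
    have \<rho>: "bij ?\<rho>" by (rule involuntory_imp_bij) (use exhaust_2 in \<open>auto split: option.splits if_splits\<close>)
    have e2: "tri y x z = tri x y z \<circ> ?\<rho>"
      by (rule ext) (auto simp: tri_def split: option.splits)
    have "integral refs (\<lambda>w. f (param (tri y x z) w)) = integral refs (\<lambda>w. f (param (tri x y z) w))"
      using integral_relabel[OF \<rho> f'] unfolding e2 .
    moreover have "cross3 (x - y) (z - y) = - cross3 (y - x) (z - x)"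
      by (simp add: cross3_simps)
    ultimately show "?P y x z = ?P x y z" by simp
  qed
  let ?F = "convex hull {a, b, c}"
  obtain a' b' c' where abc: "(SOME (a', b', c'). ?F = convex hull {a', b', c'}) = (a', b', c')"
    using prod_cases3 by blast
  have "\<exists>p. case p of (a', b', c') \<Rightarrow> ?F = convex hull {a', b', c'}" by (intro exI[of _ "(a, b, c)"]) simp
  from someI_ex[OF this] have F: "?F = convex hull {a', b', c'}" by (simp add: abc)
  \<comment> \<open>the labels chosen in the definition are the vertices, since these are the extreme points\<close>
  have "{a, b, c} \<subseteq> {a', b', c'}"
  proof
    fix z assume "z \<in> {a, b, c}"
    then have "z extreme_point_of (convex hull {a', b', c'})"
      unfolding F[symmetric] by (simp only: extreme_point_of_convex_hull_affine_independent[OF ind])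
    then show "z \<in> {a', b', c'}" by (rule extreme_point_of_convex_hull)
  qed
  moreover have "card {a', b', c'} \<le> card {a, b, c}"
    using dist by (simp add: card_insert_if)
  ultimately have eq: "{a', b', c'} = {a, b, c}" by (metis card_seteq finite.emptyI finite.insertI)
  then have mem: "a' \<in> {a, b, c}" "b' \<in> {a, b, c}" "c' \<in> {a, b, c}" by blast+
  have dist': "a' \<noteq> b'" "a' \<noteq> c'" "b' \<noteq> c'"
    using eq dist card_distinct[of "[a', b', c']"] distinct_card[of "[a, b, c]"] by auto
  have "{b, a, c} = {a, b, c}" "{a, c, b} = {a, b, c}" "{b, c, a} = {a, b, c}" by blast+
  note P = swap[OF refl] swap[OF this(1)] swap[OF this(2)] swap[OF this(3)]
  have P': "?P a c b = ?P a b c" "?P b a c = ?P a b c" "?P b c a = ?P b a c" "?P c a b = ?P a c b" "?P c b a = ?P b c a"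
    using P by blast+
  consider "a' = a" "b' = b" "c' = c" | "a' = a" "b' = c" "c' = b" | "a' = b" "b' = a" "c' = c"
    | "a' = b" "b' = c" "c' = a" | "a' = c" "b' = a" "c' = b" | "a' = c" "b' = b" "c' = a"
    using mem dist' by blast
  then have "?P a' b' c' = ?P a b c" by cases (simp_all only: P')
  then show ?thesis
    unfolding face_integral_def abc Let_def by (simp add: param_tri refs_2)
qed

subsection \<open>Volumes and normals\<close>

definition tetra :: "(real^3) set \<Rightarrow> bool" where
  "tetra V \<longleftrightarrow> \<not> affine_dependent V \<and> card V = 4"

lemma tetraD:
  assumes "tetra V"
  shows "\<not> affine_dependent V" "card V = 4" "finite V" "affine hull V = UNIV"
proof -
  show 1: "\<not> affine_dependent V" "card V = 4" "finite V" using assms aff_independent_finite by (auto simp: tetra_def)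
  have "aff_dim V = 3" using aff_dim_affine_independent[OF 1(1)] 1(2) by simp
  then show "affine hull V = UNIV" using aff_dim_eq_full[of V] by simp
qed

lemma tetra_labels:
  assumes "tetra V" "v \<in> V"
  obtains a b c where "V = {v, a, b, c}" "distinct [v, a, b, c]" "V - {v} = {a, b, c}"
proof -
  have "card (V - {v}) = 3" using tetraD[OF assms(1)] assms(2) by simp
  then obtain a b c where "V - {v} = {a, b, c}" "distinct [a, b, c]" by (auto simp: card_3_iff)
  then show ?thesis using assms(2) by (intro that[of a b c]) auto
qed

lemma tetra_labels2:
  assumes "tetra V" "v \<in> V" "w \<in> V" "v \<noteq> w"
  obtains a b where "V = {v, w, a, b}" "distinct [v, w, a, b]"
proof -
  have "card (V - {v} - {w}) = 2" using tetraD[OF assms(1)] assms by simp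
  then obtain a b where "V - {v} - {w} = {a, b}" "a \<noteq> b" by (auto simp: card_2_iff)
  then show ?thesis using assms by (intro that[of a b]) auto
qed

text \<open>The Jacobian of the affine parametrisation over the reference tetrahedron, which is six times the volume.\<close>

definition jac :: "(real^3) set \<Rightarrow> real" where
  "jac T = measure lebesgue T / rvol TYPE(3)"

lemma jac_pos: "tetra V \<Longrightarrow> jac (convex hull V) > 0"
proof -
  assume V: "tetra V"
  have "rel_interior (convex hull V) \<noteq> {}"
    using tetraD[OF V] by (subst rel_interior_eq_empty) auto
  moreover have "affine hull (convex hull V) = UNIV" using tetraD[OF V] by (simp add: affine_hull_convex_hull)
  ultimately have "interior (convex hull V) \<noteq> {}" by (simp add: rel_interior_interior)
  then have "\<not> negligible (convex hull V)"
    using open_not_negligible[OF open_interior] negligible_subset[OF _ interior_subset] by blast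
  moreover have "convex hull V \<in> lmeasurable" using tetraD[OF V] by (intro lmeasurable_compact finite_imp_compact_convex_hull)
  ultimately show ?thesis unfolding jac_def using rvol_pos[where 'n=3]
    by (simp add: negligible_iff_measure zero_less_measure_iff)
qed

lemma integral_tet:
  assumes d: "distinct [v, a, b, c]" and f: "continuous_on (convex hull {v, a, b, c}) f"
  shows "integral (convex hull {v, a, b, c}) f = jac (convex hull {v, a, b, c}) * integral refs (\<lambda>z. f (param (tet v a b c) z))"
  using integral_affine_image[of "tet v a b c" f] f
  by (simp add: param_image[OF inj_tet[OF d]] range_tet jac_def)

lemma jac_tet:
  assumes d: "distinct [v, a, b, c]"
  shows "jac (convex hull {v, a, b, c}) = \<bar>cross3 (b - a) (c - a) \<bullet> (a - v)\<bar>"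
proof -
  let ?g = "\<lambda>z :: real^3. (z $ 1) *\<^sub>R (a - v) + (z $ 2) *\<^sub>R (b - v) + (z $ 3) *\<^sub>R (c - v)"
  have lin: "linear ?g" by (auto intro!: linearI simp: algebra_simps)
  have im: "convex hull {v, a, b, c} = (+) v ` (?g ` refs)"
    using param_image[OF inj_tet[OF d]] by (simp add: range_tet image_image param_tet[abs_def] add.assoc)
  have "measure lebesgue (convex hull {v, a, b, c}) = measure lebesgue (?g ` refs)"
    unfolding im by (rule measure_translation)
  also have "\<dots> = \<bar>det (matrix ?g)\<bar> * rvol TYPE(3)"
    unfolding rvol_def using measure_linear_image[OF lin] compact_refs lmeasurable_compact by blast
  also have "det (matrix ?g) = cross3 (b - a) (c - a) \<bullet> (a - v)"
  proof -
    have "matrix ?g = (\<chi> i j. if j = 1 then a $ i - v $ i else if j = 2 then b $ i - v $ i else c $ i - v $ i)"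
      by (auto simp: matrix_def vec_eq_iff forall_3 axis_def)
    then show ?thesis by (simp add: det_3 cross3_def inner_vec_def sum_3 vector_def) (simp add: algebra_simps)
  qed
  finally show ?thesis using rvol_pos[where 'n=3] by (simp add: jac_def)
qed

lemma orthogonal_to_edges:
  assumes "n \<bullet> p = 0" "n \<bullet> q = 0" "cross3 p q \<noteq> 0"
  shows "\<exists>t. n = t *\<^sub>R cross3 p q"
proof -
  have "cross3 n (cross3 p q) = (n \<bullet> q) *\<^sub>R p - (n \<bullet> p) *\<^sub>R q"
    by (simp add: cross3_simps forall_3)
  then have "cross3 (cross3 p q) n = 0" using assms cross_skew[of "cross3 p q" n] by simp
  then have "collinear {0, cross3 p q, n}" by (simp add: cross_eq_0)
  then show ?thesis using assms(3) by (auto simp: collinear_lemma intro: exI[of _ 0])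
qed

text \<open>A unit normal of the face is a multiple of the cross product \<open>k\<close> of two edges, and the vertex \<open>v\<close> opposite to the
face determines its sign. The number \<open>n \<bullet> (a - v)\<close> is the height over the face, so its product with the area factor
\<open>norm k\<close> is the Jacobian.\<close>

lemma outward_normal_tet:
  fixes v a b c :: "real^3"
  defines "T \<equiv> convex hull {v, a, b, c}" and "F \<equiv> convex hull {a, b, c}"
  defines "n \<equiv> outward_normal T F" and "k \<equiv> cross3 (b - a) (c - a)"
  assumes V: "tetra {v, a, b, c}" and d: "distinct [v, a, b, c]"
  shows "n = (sgn (k \<bullet> (a - v)) / norm k) *\<^sub>R k" and "norm n = 1" and "n \<bullet> (b - a) = 0" and "n \<bullet> (c - a) = 0"
    and "n \<bullet> (a - v) * norm k = jac T" and "0 < n \<bullet> (a - v)" and "norm k > 0"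
proof -
  have J: "jac T = \<bar>k \<bullet> (a - v)\<bar>" "jac T > 0" using jac_tet[OF d] jac_pos[OF V] by (simp_all add: T_def k_def)
  then have k0: "k \<noteq> 0" "k \<bullet> (a - v) \<noteq> 0" by auto
  let ?s = "sgn (k \<bullet> (a - v))"
  let ?n = "(?s / norm k) *\<^sub>R k"
  have s: "\<bar>?s\<bar> = 1" using k0 by (simp add: sgn_real_def)
  have n1: "norm ?n = 1" using k0 s by simp
  have nb: "?n \<bullet> (b - a) = 0" "?n \<bullet> (c - a) = 0"
    by (simp_all add: k_def dot_cross_self inner_commute)
  have nv: "?n \<bullet> (a - v) = jac T / norm k"
    using J by (simp add: abs_sgn mult.commute)
  have hyper: "F \<subseteq> {x. m \<bullet> x = m \<bullet> a}" if "m \<bullet> (b - a) = 0" "m \<bullet> (c - a) = 0" for m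
    unfolding F_def using that by (intro hull_minimal convex_hyperplane) (auto simp: inner_diff_right)
  have half: "T \<subseteq> {x. m \<bullet> x \<le> m \<bullet> a}" if "m \<bullet> (b - a) = 0" "m \<bullet> (c - a) = 0" "m \<bullet> (a - v) \<ge> 0" for m
    unfolding T_def using that by (intro hull_minimal convex_halfspace_le) (auto simp: inner_diff_right)
  have "(THE n. norm n = 1 \<and> (\<exists>c. F \<subseteq> {x. n \<bullet> x = c} \<and> T \<subseteq> {x. n \<bullet> x \<le> c})) = ?n"
  proof (rule the_equality)
    have "0 \<le> ?n \<bullet> (a - v)" unfolding nv using J by simp
    then show "norm ?n = 1 \<and> (\<exists>c. F \<subseteq> {x. ?n \<bullet> x = c} \<and> T \<subseteq> {x. ?n \<bullet> x \<le> c})"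
      using n1 hyper[OF nb] half[OF nb] by blast
  next
    fix m assume m: "norm m = 1 \<and> (\<exists>c. F \<subseteq> {x. m \<bullet> x = c} \<and> T \<subseteq> {x. m \<bullet> x \<le> c})"
    then obtain e where e: "F \<subseteq> {x. m \<bullet> x = e}" "T \<subseteq> {x. m \<bullet> x \<le> e}" by blast
    have "a \<in> F" "b \<in> F" "c \<in> F" "v \<in> T" by (simp_all add: F_def T_def hull_inc)
    then have me: "m \<bullet> (b - a) = 0" "m \<bullet> (c - a) = 0" "m \<bullet> (a - v) \<ge> 0" using e by (auto simp: inner_diff_right)
    obtain t where t: "m = t *\<^sub>R k" using orthogonal_to_edges[OF me(1,2)] k0 by (auto simp: k_def)
    then have "\<bar>t\<bar> * norm k = 1" using m by simp
    then have "\<bar>t\<bar> = 1 / norm k" using k0 by (simp add: field_simps)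
    moreover have "t * (k \<bullet> (a - v)) \<ge> 0" using me(3) t by simp
    ultimately have "t = ?s / norm k" using k0
      by (auto simp: sgn_real_def abs_if zero_le_mult_iff split: if_splits)
    then show "m = ?n" using t by simp
  qed
  then show n: "n = ?n" by (simp add: n_def outward_normal_def)
  show "norm n = 1" "n \<bullet> (b - a) = 0" "n \<bullet> (c - a) = 0" "norm k > 0" using n1 nb n k0 by simp_all
  show "n \<bullet> (a - v) * norm k = jac T" "0 < n \<bullet> (a - v)" unfolding n nv using k0 J by simp_all
qed

subsection \<open>The divergence theorem on a tetrahedron\<close>

lemma integral_refs_derivative:
  fixes H D :: "real^3 \<Rightarrow> real"
  assumes der: "\<And>t (y :: real^2). ((\<lambda>t. H (vector [t, y $ 1, y $ 2])) has_real_derivative D (vector [t, y $ 1, y $ 2])) (at t)"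
    and H: "continuous_on UNIV H" and D: "continuous_on UNIV D"
  shows "integral refs D = integral refs (\<lambda>y :: real^2. H (vector [1 - y $ 1 - y $ 2, y $ 1, y $ 2])) - integral refs (\<lambda>y :: real^2. H (vector [0, y $ 1, y $ 2]))"
proof -
  have "integral refs D = integral refs (\<lambda>y :: real^2. H (vector [1 - y $ 1 - y $ 2, y $ 1, y $ 2]) - H (vector [0, y $ 1, y $ 2]))"
    unfolding integral_refs_slice[OF D]
  proof (rule Henstock_Kurzweil_Integration.integral_cong)
    fix y :: "real^2" assume y: "y \<in> refs"
    have "((\<lambda>t. D (vector [t, y $ 1, y $ 2])) has_integral (H (vector [1 - y $ 1 - y $ 2, y $ 1, y $ 2]) - H (vector [0, y $ 1, y $ 2]))) {0..1 - y $ 1 - y $ 2}"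
      using y der[of y] by (intro fundamental_theorem_of_calculus)
        (auto simp: refs_2 has_real_derivative_iff_has_vector_derivative intro: has_vector_derivative_at_within)
    then show "integral {0..1 - y $ 1 - y $ 2} (\<lambda>t. D (vector [t, y $ 1, y $ 2])) = H (vector [1 - y $ 1 - y $ 2, y $ 1, y $ 2]) - H (vector [0, y $ 1, y $ 2])"
      by (rule integral_unique)
  qed
  also have "\<dots> = integral refs (\<lambda>y :: real^2. H (vector [1 - y $ 1 - y $ 2, y $ 1, y $ 2])) - integral refs (\<lambda>y :: real^2. H (vector [0, y $ 1, y $ 2]))"
    by (intro integral_diff continuous_integrable_on compact_refs continuous_on_compose2[OF H] continuous_on_vector3 continuous_intros) auto
  finally show ?thesis .
qed

lemma pdeg_continuous_grad: "pdeg j f \<Longrightarrow> continuous_on S (grad f)"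
  unfolding grad_def by (intro continuous_on_vec_lambda pdeg_continuous[OF pdeg_pderivative])

text \<open>The parametrisation is taken with the edge as first coordinate direction. The fundamental theorem of calculus along
it leaves the difference between the two faces that the edge joins.\<close>

lemma divergence_along_edge:
  assumes f: "pdeg j f" and d: "distinct [v, a, b, c]"
  shows "integral (convex hull {v, a, b, c}) (\<lambda>x. grad f x \<bullet> (a - v)) =
     jac (convex hull {v, a, b, c}) * (integral refs (\<lambda>y. f (param (tri a b c) y)) - integral refs (\<lambda>y. f (param (tri v b c) y)))"
proof -
  let ?T = "convex hull {v, a, b, c}"
  let ?P = "param (tet v a b c)"
  have c1: "continuous_on S (\<lambda>x. grad f x \<bullet> (a - v))" for S
    by (intro continuous_intros pdeg_continuous_grad[OF f])
  have "integral ?T (\<lambda>x. grad f x \<bullet> (a - v)) = jac ?T * integral refs (\<lambda>z. grad f (?P z) \<bullet> (a - v))"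
    using integral_tet[OF d c1] .
  also have "integral refs (\<lambda>z. grad f (?P z) \<bullet> (a - v)) =
      integral refs (\<lambda>y :: real^2. f (?P (vector [1 - y $ 1 - y $ 2, y $ 1, y $ 2]))) - integral refs (\<lambda>y :: real^2. f (?P (vector [0, y $ 1, y $ 2])))"
  proof (rule integral_refs_derivative)
    fix t and y :: "real^2"
    have "((\<lambda>t. ?P (vector [t, y $ 1, y $ 2])) has_derivative (\<lambda>h. h *\<^sub>R (a - v))) (at t)"
      unfolding param_tet by (auto intro!: derivative_eq_intros)
    from has_derivative_compose[OF this has_derivative_grad[OF pdeg_differentiable[OF f]]]
    have "((\<lambda>t. f (?P (vector [t, y $ 1, y $ 2]))) has_derivative (\<lambda>h. grad f (?P (vector [t, y $ 1, y $ 2])) \<bullet> (h *\<^sub>R (a - v)))) (at t)" .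
    then show "((\<lambda>t. f (?P (vector [t, y $ 1, y $ 2]))) has_real_derivative grad f (?P (vector [t, y $ 1, y $ 2])) \<bullet> (a - v)) (at t)"
      by (simp add: has_field_derivative_def mult.commute[of _ "grad _ _ \<bullet> _"] mult_commute_abs)
  qed (auto intro!: continuous_on_compose2[OF c1[of UNIV]] continuous_on_compose2[OF pdeg_continuous[OF f, of UNIV]] continuous_on_param)
  also have "(\<lambda>y :: real^2. f (?P (vector [1 - y $ 1 - y $ 2, y $ 1, y $ 2]))) = (\<lambda>y. f (param (tri a b c) y))"
    by (rule ext, rule arg_cong[of _ _ f]) (simp add: param_tet param_tri algebra_simps)
  also have "(\<lambda>y :: real^2. f (?P (vector [0, y $ 1, y $ 2]))) = (\<lambda>y. f (param (tri v b c) y))"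
    by (rule ext, rule arg_cong[of _ _ f]) (simp add: param_tet param_tri)
  finally show ?thesis .
qed

lemma affine_dependent_diff_singleton: "tetra V \<Longrightarrow> \<not> affine_dependent (V - {w})"
  using tetraD affine_dependent_subset by (metis Diff_subset)

lemma tetra_facets:
  assumes "tetra V"
  shows "{F. F facet_of (convex hull V)} = (\<lambda>w. convex hull (V - {w})) ` V" and "inj_on (\<lambda>w. convex hull (V - {w})) V"
proof -
  have ne: "V - {w} \<noteq> {}" for w
  proof
    assume "V - {w} = {}"
    then have "card V \<le> card {w}" by (intro card_mono) auto
    then show False using tetraD[OF assms] by simp
  qed
  show "{F. F facet_of (convex hull V)} = (\<lambda>w. convex hull (V - {w})) ` V"
    using ne facet_of_convex_hull_affine_independent[OF tetraD(1)[OF assms]] by (auto simp: convex_hull_eq_empty)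
  show "inj_on (\<lambda>w. convex hull (V - {w})) V"
  proof (rule inj_onI)
    fix x y assume xy: "x \<in> V" "y \<in> V" "convex hull (V - {x}) = convex hull (V - {y})"
    have e: "z extreme_point_of (convex hull (V - {w})) \<longleftrightarrow> z \<in> V - {w}" for z w
      by (rule extreme_point_of_convex_hull_affine_independent[OF affine_dependent_diff_singleton[OF assms]])
    have "z \<in> V - {x} \<longleftrightarrow> z \<in> V - {y}" for z using e[of z x] e[of z y] xy(3) by simp
    then show "x = y" using xy by blast
  qed
qed

text \<open>Both sides are linear in \<open>\<xi>\<close>, and the edges at one vertex span the space. In the direction of an edge, the two
faces that contain the edge do not contribute, because their normals are orthogonal to it; the other two are those
of \<open>divergence_along_edge\<close>.\<close>

lemma divergence_theorem:
  assumes f: "pdeg j f" and V: "tetra V"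
  shows "integral (convex hull V) (\<lambda>x. grad f x \<bullet> \<xi>) =
     (\<Sum>F | F facet_of (convex hull V). (outward_normal (convex hull V) F \<bullet> \<xi>) * face_integral F f)"
proof -
  let ?T = "convex hull V" and ?F = "\<lambda>w. convex hull (V - {w})"
  let ?n = "\<lambda>w. outward_normal ?T (?F w)"
  let ?L = "\<lambda>\<xi>. integral ?T (\<lambda>x. grad f x \<bullet> \<xi>)" and ?R = "\<lambda>\<xi>. \<Sum>w\<in>V. (?n w \<bullet> \<xi>) * face_integral (?F w) f"
  have cT: "compact ?T" using tetraD[OF V] by (simp add: finite_imp_compact_convex_hull)
  have edge: "?L (a - v) = ?R (a - v)" if av: "v \<in> V" "a \<in> V" "v \<noteq> a" for a v
  proof -
    obtain b c where bc: "V = {v, a, b, c}" "distinct [v, a, b, c]" using tetra_labels2[OF V av] .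
    have V1: "tetra {v, a, b, c}" and V2: "tetra {a, v, b, c}" and V3: "tetra {b, v, a, c}" and V4: "tetra {c, v, a, b}"
      using V bc(1) by (auto simp: insert_commute)
    have F: "V - {v} = {a, b, c}" "V - {a} = {v, b, c}" "V - {b} = {v, a, c}" "V - {c} = {v, a, b}"
      "{a, v, b, c} = V" "{b, v, a, c} = V" "{c, v, a, b} = V" "{v, a, b, c} = V" using bc by auto
    note o = outward_normal_tet[OF V1] outward_normal_tet[OF V2] outward_normal_tet[OF V3] outward_normal_tet[OF V4]
    note o1 = outward_normal_tet[OF V1, unfolded F] and o2 = outward_normal_tet[OF V2, unfolded F] and o3 = outward_normal_tet[OF V3, unfolded F] and o4 = outward_normal_tet[OF V4, unfolded F]
    have n3: "?n b \<bullet> (a - v) = 0" using o3(3) bc(2) F by auto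
    have n4: "?n c \<bullet> (a - v) = 0" using o4(3) bc(2) F by auto
    have n1: "?n v \<bullet> (a - v) * norm (cross3 (b - a) (c - a)) = jac ?T" using o1(5) bc(2) F by auto
    have "?n a \<bullet> (v - a) * norm (cross3 (b - v) (c - v)) = jac ?T" using o2(5) bc(2) F by auto
    then have n2: "?n a \<bullet> (a - v) * norm (cross3 (b - v) (c - v)) = - jac ?T"
      by (simp add: inner_diff_right left_diff_distrib)
    have ind: "\<not> affine_dependent {a, b, c}" "\<not> affine_dependent {v, b, c}"
      using affine_dependent_diff_singleton[OF V] F by metis+
    have S1: "face_integral (?F v) f = norm (cross3 (b - a) (c - a)) * integral refs (\<lambda>z. f (param (tri a b c) z))"
      unfolding F using bc(2) by (intro face_integral_labelled ind pdeg_continuous[OF f]) auto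
    have S2: "face_integral (?F a) f = norm (cross3 (b - v) (c - v)) * integral refs (\<lambda>z. f (param (tri v b c) z))"
      unfolding F using bc(2) by (intro face_integral_labelled ind pdeg_continuous[OF f]) auto
    have "?R (a - v) = (?n v \<bullet> (a - v)) * face_integral (?F v) f + (?n a \<bullet> (a - v)) * face_integral (?F a) f"
    proof -
      have "?R (a - v) = (\<Sum>w\<in>{v, a, b, c}. (?n w \<bullet> (a - v)) * face_integral (?F w) f)"
        by (rule sum.cong[OF bc(1)]) simp
      also have "\<dots> = (?n v \<bullet> (a - v)) * face_integral (?F v) f + (?n a \<bullet> (a - v)) * face_integral (?F a) f"
        using bc(2) n3 n4 by simp
      finally show ?thesis .
    qed
    also have "\<dots> = jac ?T * integral refs (\<lambda>z. f (param (tri a b c) z)) - jac ?T * integral refs (\<lambda>z. f (param (tri v b c) z))"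
      unfolding S1 S2 mult.assoc[symmetric] n1 n2 by simp
    also have "\<dots> = ?L (a - v)"
      using divergence_along_edge[OF f bc(2)] unfolding F by (simp add: right_diff_distrib)
    finally show ?thesis by simp
  qed
  have i: "(\<lambda>x. grad f x \<bullet> \<xi>) integrable_on ?T" for \<xi>
    by (intro continuous_integrable_on[OF cT] continuous_intros pdeg_continuous_grad[OF f])
  have L0: "?L (a - v) = ?R (a - v)" if "v \<in> V" "a \<in> V" for a v
    using edge[OF that] by (cases "a = v") auto
  obtain v where v: "v \<in> V" using tetraD(2)[OF V] by (metis card.empty ex_in_conv zero_neq_numeral)
  define u where "u = bary V (v + \<xi>)"
  have u: "sum u V = 1" "(\<Sum>a\<in>V. u a *\<^sub>R a) = v + \<xi>"
    unfolding u_def using bary_works[of V "v + \<xi>"] tetraD[OF V] by auto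
  have \<xi>: "\<xi> = (\<Sum>a\<in>V. u a *\<^sub>R (a - v))"
    using u by (simp add: scaleR_diff_right sum_subtractf scaleR_sum_left[symmetric])
  have "?L \<xi> = (\<Sum>a\<in>V. u a * ?L (a - v))"
    by (subst \<xi>, simp add: inner_sum_right)
       (subst integral_sum, use tetraD[OF V] i in \<open>auto intro: integrable_on_mult_right\<close>)
  also have "\<dots> = (\<Sum>a\<in>V. u a * ?R (a - v))" using L0[OF v] by simp
  also have "\<dots> = ?R (\<Sum>a\<in>V. u a *\<^sub>R (a - v))"
    by (simp add: inner_sum_right sum_distrib_left sum_distrib_right, subst sum.swap) (simp add: ac_simps)
  also have "\<dots> = ?R \<xi>" by (simp only: \<xi>[symmetric])
  also have "\<dots> = (\<Sum>F | F facet_of ?T. (outward_normal ?T F \<bullet> \<xi>) * face_integral F f)"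
    unfolding tetra_facets(1)[OF V] by (subst sum.reindex[OF tetra_facets(2)[OF V]]) simp
  finally show ?thesis .
qed

section \<open>Shape-regular tetrahedra\<close>

text \<open>The gradient of a barycentric coordinate, computed from its values because the coordinate is an affine
function.\<close>

definition bgrad :: "(real^3) set \<Rightarrow> real^3 \<Rightarrow> real^3" where
  "bgrad V v = (\<chi> i. bary V (axis i 1) v - bary V 0 v)"

lemma bary_affine:
  assumes V: "tetra V" and v: "v \<in> V"
  shows "bary V x v = bary V 0 v + bgrad V v \<bullet> x"
proof -
  note D = tetraD[OF V]
  have B: "sum (bary V y) V = 1" "(\<Sum>v\<in>V. bary V y v *\<^sub>R v) = y" for y using bary_works[of V y] D by auto
  let ?u = "\<lambda>w. bary V 0 w + (\<Sum>i\<in>UNIV. x $ i * (bary V (axis i 1) w - bary V 0 w))"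
  have 1: "sum ?u V = 1"
    by (simp add: sum.distrib, subst sum.swap) (simp add: sum_distrib_left[symmetric] sum_subtractf B)
  have "(\<Sum>w\<in>V. ?u w *\<^sub>R w) = (\<Sum>w\<in>V. \<Sum>i\<in>UNIV. x $ i *\<^sub>R (bary V (axis i 1) w *\<^sub>R w - bary V 0 w *\<^sub>R w))"
    by (simp add: scaleR_add_left sum.distrib B scaleR_sum_left scaleR_diff_left scaleR_diff_right right_diff_distrib)
  also have "\<dots> = (\<Sum>i\<in>UNIV. x $ i *\<^sub>R axis i 1)"
    by (subst sum.swap) (simp add: scaleR_sum_right[symmetric] sum_subtractf B)
  also have "\<dots> = x" by (simp add: basis_expansion flip: scalar_mult_eq_scaleR)
  finally have 2: "(\<Sum>w\<in>V. ?u w *\<^sub>R w) = x" .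
  show ?thesis using bary_unique[OF D(1) 1 2 v]
    by (simp add: bgrad_def inner_vec_def mult.commute)
qed

lemma pdeg_bary: "tetra V \<Longrightarrow> v \<in> V \<Longrightarrow> pdeg 1 (\<lambda>x. bary V x v)"
proof -
  assume "tetra V" "v \<in> V"
  then have "(\<lambda>x. bary V x v) = (\<lambda>x. bary V 0 v + bgrad V v \<bullet> x)" by (intro ext bary_affine)
  then show ?thesis using pdeg_affine by metis
qed

text \<open>Across a ball of radius \<open>r\<close> the barycentric coordinate varies by \<open>2 * r * norm (bgrad V v)\<close>, and it stays between
0 and 1.\<close>

lemma ball_bgrad:
  assumes V: "tetra V" and v: "v \<in> V" and b: "cball a r \<subseteq> convex hull V" and r: "0 \<le> r"
  shows "2 * r * norm (bgrad V v) \<le> 1"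
proof (cases "bgrad V v = 0")
  case False
  let ?g = "bgrad V v"
  let ?e = "(1 / norm ?g) *\<^sub>R ?g"
  have "a + r *\<^sub>R ?e \<in> cball a r" "a - r *\<^sub>R ?e \<in> cball a r" using r False by (auto simp: dist_norm)
  then have "bary V (a + r *\<^sub>R ?e) v \<le> 1" "0 \<le> bary V (a - r *\<^sub>R ?e) v"
    using bary_bounds[OF tetraD(1)[OF V] _ v] b by blast+
  then have "?g \<bullet> (r *\<^sub>R ?e) + ?g \<bullet> (r *\<^sub>R ?e) \<le> 1"
    using bary_affine[OF V v, of "a + r *\<^sub>R ?e"] bary_affine[OF V v, of "a - r *\<^sub>R ?e"]
    unfolding inner_add_right inner_diff_right by linarith
  moreover have "?g \<bullet> (r *\<^sub>R ?e) = r * norm ?g" using False by (simp add: dot_square_norm power2_eq_square)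
  ultimately show ?thesis by simp
qed simp

lemma inscr_diam_le:
  assumes "S \<noteq> {}" "\<And>a r. 0 \<le> r \<Longrightarrow> cball a r \<subseteq> S \<Longrightarrow> 2 * r \<le> B"
  shows "inscr_diam S \<le> B"
proof -
  obtain x where "x \<in> S" using assms(1) by blast
  then have "{2 * r | r a. 0 \<le> r \<and> cball a r \<subseteq> S} \<noteq> {}" by (auto intro!: exI[of _ 0] exI[of _ x])
  then show ?thesis unfolding inscr_diam_def using assms(2) by (auto intro!: cSup_least)
qed

lemma inscr_ball:
  assumes "0 < inscr_diam S" "S \<noteq> {}"
  obtains a r where "cball a r \<subseteq> S" "inscr_diam S < 4 * r" "0 \<le> r"
proof (rule ccontr)
  assume no: "\<not> thesis"
  have "inscr_diam S \<le> inscr_diam S / 2"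
  proof (rule inscr_diam_le[OF assms(2)])
    fix a r assume "0 \<le> (r::real)" "cball a r \<subseteq> S"
    then show "2 * r \<le> inscr_diam S / 2" using that[of a r] no by force
  qed
  then show False using assms by simp
qed

lemma dist_le_encl_diam:
  assumes "bounded S" "x \<in> S" "y \<in> S"
  shows "dist x y \<le> encl_diam S"
  unfolding encl_diam_def
proof (rule cInf_greatest)
  obtain e where "\<forall>y\<in>S. dist x y \<le> e" using assms(1) by (auto simp: bounded_any_center[of _ x])
  then have "S \<subseteq> cball x e" by auto
  moreover have "x \<in> affine hull S" using assms(2) by (rule hull_inc)
  ultimately show "{2 * r | r a. a \<in> affine hull S \<and> S \<subseteq> cball a r} \<noteq> {}" by blast
  fix z assume "z \<in> {2 * r | r a. a \<in> affine hull S \<and> S \<subseteq> cball a r}"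
  then obtain r a where "z = 2 * r" "S \<subseteq> cball a r" by blast
  then have "dist a x \<le> r" "dist a y \<le> r" using assms by auto
  then show "dist x y \<le> z" using dist_triangle[of x y a] \<open>z = 2 * r\<close> by (simp add: dist_commute)
qed

lemma encl_diam_le:
  assumes "a \<in> S" "S \<subseteq> cball a r"
  shows "encl_diam S \<le> 2 * r"
  unfolding encl_diam_def
proof (rule cInf_lower)
  show "2 * r \<in> {2 * r | r a. a \<in> affine hull S \<and> S \<subseteq> cball a r}" using assms(2) hull_inc[OF assms(1), of affine] by blast
  show "bdd_below {2 * r | r a. a \<in> affine hull S \<and> S \<subseteq> cball a r}"
  proof (rule bdd_belowI[of _ 0])
    fix z assume "z \<in> {2 * r | r a. a \<in> affine hull S \<and> S \<subseteq> cball a r}"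
    then obtain r b where "z = 2 * r" "S \<subseteq> cball b r" by blast
    then have "z = 2 * r" "dist b a \<le> r" using assms by auto
    then show "0 \<le> z" using zero_le_dist[of b a] by linarith
  qed
qed

definition regular :: "real \<Rightarrow> (real^3) set \<Rightarrow> bool" where
  "regular \<kappa> V \<longleftrightarrow> tetra V \<and> 1 \<le> \<kappa> \<and> encl_diam (convex hull V) \<le> \<kappa> * inscr_diam (convex hull V)"

context
  fixes \<kappa> :: real and V :: "(real^3) set"
  assumes reg: "regular \<kappa> V"
begin

lemma regD: "tetra V" "1 \<le> \<kappa>" "encl_diam (convex hull V) \<le> \<kappa> * inscr_diam (convex hull V)"
  "\<not> affine_dependent V" "card V = 4" "finite V" "affine hull V = UNIV"
  "compact (convex hull V)" "bounded (convex hull V)" "convex hull V \<noteq> {}" "V \<noteq> {}"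
proof -
  show V: "tetra V" "1 \<le> \<kappa>" "encl_diam (convex hull V) \<le> \<kappa> * inscr_diam (convex hull V)" using reg by (auto simp: regular_def)
  show D: "\<not> affine_dependent V" "card V = 4" "finite V" "affine hull V = UNIV" using tetraD V by blast+
  show c: "compact (convex hull V)" using D by (simp add: finite_imp_compact_convex_hull)
  then show "bounded (convex hull V)" by (rule compact_imp_bounded)
  show "V \<noteq> {}" using D by auto
  then show "convex hull V \<noteq> {}" by (simp add: convex_hull_eq_empty)
qed

lemma encl_diam_pos: "encl_diam (convex hull V) > 0"
proof -
  obtain v where v: "v \<in> V" using regD by blast
  obtain a b c where "V = {v, a, b, c}" "distinct [v, a, b, c]" "V - {v} = {a, b, c}" using tetra_labels[OF regD(1) v] .
  then have "v \<in> V" "a \<in> V" "v \<noteq> a" by simp_all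
  then show ?thesis
    using dist_le_encl_diam[OF regD(9) hull_inc hull_inc, of v a] zero_less_dist_iff[of v a] by linarith
qed

lemma inscr_diam_pos: "inscr_diam (convex hull V) > 0"
proof (rule ccontr)
  assume "\<not> ?thesis"
  then have "\<kappa> * inscr_diam (convex hull V) \<le> 0" using regD(2) by (intro mult_nonneg_nonpos) auto
  then show False using regD(3) encl_diam_pos by linarith
qed

lemma inscr_bgrad: "v \<in> V \<Longrightarrow> inscr_diam (convex hull V) * norm (bgrad V v) \<le> 1"
proof (cases "norm (bgrad V v) = 0")
  case False
  assume v: "v \<in> V"
  have "inscr_diam (convex hull V) \<le> 1 / norm (bgrad V v)"
    by (rule inscr_diam_le[OF regD(10)]) (use ball_bgrad[OF regD(1) v] False in \<open>auto simp: field_simps\<close>)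
  then show ?thesis using False by (simp add: field_simps)
qed simp

lemma encl_bgrad: "v \<in> V \<Longrightarrow> encl_diam (convex hull V) * norm (bgrad V v) \<le> \<kappa>"
proof -
  assume v: "v \<in> V"
  have "encl_diam (convex hull V) * norm (bgrad V v) \<le> \<kappa> * (inscr_diam (convex hull V) * norm (bgrad V v))"
    using regD(3) mult_right_mono[OF regD(3), of "norm (bgrad V v)"] by (simp add: ac_simps)
  also have "\<dots> \<le> \<kappa> * 1" using inscr_bgrad[OF v] regD(2) by (intro mult_left_mono) auto
  finally show ?thesis by simp
qed

text \<open>Along an edge a barycentric coordinate drops from 1 to 0, while its gradient is at most \<open>\<kappa>\<close> over the diameter.\<close>

lemma encl_le_edge:
  assumes "v \<in> V" "w \<in> V" "v \<noteq> w"
  shows "encl_diam (convex hull V) \<le> \<kappa> * dist v w"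
proof -
  let ?h = "encl_diam (convex hull V)"
  have "1 = bgrad V v \<bullet> (v - w)"
    using bary_affine[OF regD(1) assms(1), of v] bary_affine[OF regD(1) assms(1), of w]
      bary_vertex[OF regD(4) assms(1,1)] bary_vertex[OF regD(4) assms(1,2)] assms(3)
    by (simp add: inner_diff_right)
  also have "\<dots> \<le> norm (bgrad V v) * dist v w" unfolding dist_norm by (rule norm_cauchy_schwarz)
  finally have "?h * 1 \<le> ?h * (norm (bgrad V v) * dist v w)" using encl_diam_pos by (intro mult_left_mono) auto
  also have "\<dots> \<le> \<kappa> * dist v w"
    using mult_right_mono[OF encl_bgrad[OF assms(1)], of "dist v w"] by (simp add: ac_simps)
  finally show ?thesis by simp
qed

text \<open>The factor 2 is due to the circles around a face being centred in its plane.\<close>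

lemma facet_diam:
  assumes F: "F facet_of (convex hull V)"
  shows "encl_diam F \<le> 2 * encl_diam (convex hull V)" "encl_diam (convex hull V) \<le> \<kappa> * encl_diam F" "0 < encl_diam F"
proof -
  obtain w where w: "w \<in> V" "F = convex hull (V - {w})" using F tetra_facets(1)[OF regD(1)] by blast
  obtain a b c where abc: "V = {w, a, b, c}" "distinct [w, a, b, c]" "V - {w} = {a, b, c}" using tetra_labels[OF regD(1) w(1)] .
  have sub: "F \<subseteq> convex hull V" using w by (auto intro: hull_mono[THEN subsetD])
  have bF: "bounded F" using sub regD(9) bounded_subset by blast
  have ab: "a \<in> F" "b \<in> F" using w abc by (auto intro: hull_inc)
  show "encl_diam F \<le> 2 * encl_diam (convex hull V)"
    by (rule encl_diam_le[OF ab(1)]) (use sub ab dist_le_encl_diam[OF regD(9)] in \<open>auto simp: subset_iff\<close>)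
  have "encl_diam (convex hull V) \<le> \<kappa> * dist a b" using abc by (intro encl_le_edge) auto
  also have "\<dots> \<le> \<kappa> * encl_diam F" using dist_le_encl_diam[OF bF ab] regD(2) by (intro mult_left_mono) auto
  finally show 1: "encl_diam (convex hull V) \<le> \<kappa> * encl_diam F" .
  show "0 < encl_diam F"
  proof (rule ccontr)
    assume "\<not> 0 < encl_diam F"
    then have "\<kappa> * encl_diam F \<le> 0" using regD(2) by (intro mult_nonneg_nonpos) auto
    then show False using 1 encl_diam_pos by linarith
  qed
qed

text \<open>The tetrahedron is contained in a ball of radius \<open>encl_diam\<close>, and contains one whose radius is at least a quarter of
the inscribed diameter.\<close>

lemma jac_bounds:
  "jac (convex hull V) \<le> unit_ball_vol 3 / rvol TYPE(3) * encl_diam (convex hull V) ^ 3"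
  "unit_ball_vol 3 / rvol TYPE(3) * encl_diam (convex hull V) ^ 3 \<le> 64 * \<kappa> ^ 3 * jac (convex hull V)"
proof -
  let ?T = "convex hull V"
  have lm: "?T \<in> lmeasurable" using regD lmeasurable_compact by blast
  obtain v where v: "v \<in> ?T" using regD by blast
  have "measure lebesgue ?T \<le> measure lebesgue (cball v (encl_diam ?T))"
    by (rule measure_mono_fmeasurable) (use v dist_le_encl_diam[OF regD(9)] lm in auto)
  also have "\<dots> = unit_ball_vol 3 * encl_diam ?T ^ 3"
    using content_cball[of "encl_diam ?T" v] encl_diam_pos by simp
  finally show "jac ?T \<le> unit_ball_vol 3 / rvol TYPE(3) * encl_diam ?T ^ 3"
    unfolding jac_def using rvol_pos[where 'n=3] by (simp add: divide_simps)
  obtain a r where ar: "cball a r \<subseteq> ?T" "inscr_diam ?T < 4 * r" "0 \<le> r"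
    using inscr_ball[OF inscr_diam_pos regD(10)] .
  have "encl_diam ?T \<le> \<kappa> * (4 * r)"
    using regD(3) mult_left_mono[of "inscr_diam ?T" "4 * r" \<kappa>] ar(2) regD(2) by linarith
  then have "encl_diam ?T ^ 3 \<le> (\<kappa> * (4 * r)) ^ 3" using encl_diam_pos by (intro power_mono) auto
  then have "encl_diam ?T ^ 3 \<le> 64 * \<kappa> ^ 3 * r ^ 3" by (simp add: power_mult_distrib ac_simps)
  then have "unit_ball_vol 3 * encl_diam ?T ^ 3 \<le> unit_ball_vol 3 * (64 * \<kappa> ^ 3 * r ^ 3)" by (intro mult_left_mono) auto
  also have "\<dots> = 64 * \<kappa> ^ 3 * measure lebesgue (cball a r)"
    using content_cball[of r a] ar by simp
  also have "\<dots> \<le> 64 * \<kappa> ^ 3 * measure lebesgue ?T"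
    using regD(2) by (intro mult_left_mono measure_mono_fmeasurable ar lm) auto
  finally show "unit_ball_vol 3 / rvol TYPE(3) * encl_diam ?T ^ 3 \<le> 64 * \<kappa> ^ 3 * jac ?T"
    unfolding jac_def using rvol_pos[where 'n=3] by (simp add: divide_simps)
qed

text \<open>The height over a face lies between the inscribed and the enclosing diameter, so the area of the
  face is comparable to volume over diameter.\<close>

lemma area_bounds:
  assumes abc: "V = {v, a, b, c}" "distinct [v, a, b, c]"
  defines "A \<equiv> norm (cross3 (b - a) (c - a))"
  shows "A * encl_diam (convex hull V) \<le> \<kappa> * jac (convex hull V)" "jac (convex hull V) \<le> A * encl_diam (convex hull V)" "0 < A"
proof -
  let ?T = "convex hull V" and ?n = "outward_normal (convex hull V) (convex hull {a, b, c})"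
  have V: "tetra {v, a, b, c}" using regD(1) abc by simp
  note o = outward_normal_tet[OF V abc(2), folded abc(1), folded A_def]
  let ?\<eta> = "?n \<bullet> (a - v)"
  show A: "0 < A" using o by simp
  have "?\<eta> \<le> norm ?n * norm (a - v)" by (rule norm_cauchy_schwarz)
  also have "\<dots> \<le> encl_diam ?T" using o(2) dist_le_encl_diam[OF regD(9), of a v] abc by (simp add: dist_norm hull_inc)
  finally have \<eta>1: "?\<eta> \<le> encl_diam ?T" .
  have *: "?n \<bullet> v \<le> ?n \<bullet> x \<and> ?n \<bullet> x \<le> ?n \<bullet> a" if "x \<in> ?T" for x
  proof -
    have "?T \<subseteq> {x. ?n \<bullet> v \<le> ?n \<bullet> x} \<inter> {x. ?n \<bullet> x \<le> ?n \<bullet> a}"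
      using o(3,4,6) unfolding abc(1)
      by (intro hull_minimal convex_Int convex_halfspace_le convex_halfspace_ge[unfolded atLeast_def]) (auto simp: inner_diff_right)
    then show ?thesis using that by blast
  qed
  have "inscr_diam ?T \<le> ?\<eta>"
  proof (rule inscr_diam_le[OF regD(10)])
    fix x r assume r: "0 \<le> (r::real)" "cball x r \<subseteq> ?T"
    have "x + r *\<^sub>R ?n \<in> cball x r" "x - r *\<^sub>R ?n \<in> cball x r" using r o(2) by (auto simp: dist_norm)
    then have "?n \<bullet> (x + r *\<^sub>R ?n) \<le> ?n \<bullet> a" "?n \<bullet> v \<le> ?n \<bullet> (x - r *\<^sub>R ?n)" using * r by blast+
    moreover have "?n \<bullet> ?n = 1" using o(2) by (simp add: dot_square_norm)
    ultimately show "2 * r \<le> ?\<eta>" by (simp add: inner_diff_right inner_add_right)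
  qed
  then have "encl_diam ?T \<le> \<kappa> * ?\<eta>" using regD(2,3) mult_left_mono[of "inscr_diam ?T" ?\<eta> \<kappa>] by linarith
  then have "A * encl_diam ?T \<le> A * (\<kappa> * ?\<eta>)" using A by (intro mult_left_mono) auto
  then show "A * encl_diam ?T \<le> \<kappa> * jac ?T" by (simp add: o(5)[symmetric] ac_simps)
  show "jac ?T \<le> A * encl_diam ?T" using mult_left_mono[OF \<eta>1, of A] A by (simp add: o(5)[symmetric] ac_simps)
qed

end

subsection \<open>Inverse and trace inequalities\<close>

lemma bary_representation:
  assumes V: "tetra V" and q: "pdeg k q"
  shows "\<exists>c. \<forall>x. q x = hpoly V k c (bary V x)"
proof -
  have "finite V" "x \<in> affine hull V" for x using tetraD[OF V] by simp_all
  from pdeg_imp_hpoly[OF this(1) bary_works(1)[OF this] bary_works(2)[OF this] q]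
  show ?thesis by simp
qed

lemma element_coefficients:
  "\<exists>C>0. \<forall>V c. tetra V \<longrightarrow> jac (convex hull V) * (\<Sum>a\<in>Hom V k. (c a)\<^sup>2) \<le> C * integral (convex hull V) (\<lambda>x. (hpoly V k c (bary V x))\<^sup>2)"
proof -
  obtain C where C: "C > 0" "\<And>c. (\<Sum>a\<in>Hom (UNIV :: 3 option set) k. (c a)\<^sup>2) \<le> C * integral refs (\<lambda>z. (hpoly UNIV k c (bc z))\<^sup>2)"
    using coefficients_bounded_by_integral[where 'n=3] by blast
  have "jac (convex hull V) * (\<Sum>a\<in>Hom V k. (c a)\<^sup>2) \<le> C * integral (convex hull V) (\<lambda>x. (hpoly V k c (bary V x))\<^sup>2)" if V: "tetra V" for V c
  proof -
    obtain v where v: "v \<in> V" using tetraD[OF V] by (metis card.empty ex_in_conv zero_neq_numeral)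
    obtain a b d where abd: "V = {v, a, b, d}" "distinct [v, a, b, d]" "V - {v} = {a, b, d}" using tetra_labels[OF V v] .
    let ?\<beta> = "tet v a b d"
    have rng: "range ?\<beta> = V" using abd by (simp add: range_tet)
    have inj: "inj ?\<beta>" using abd by (intro inj_tet)
    have bij: "bij_betw ?\<beta> UNIV V" using rng inj by (simp add: bij_betw_def)
    note re = hpoly_reindex[OF bij]
    let ?c = "\<lambda>a. c (\<lambda>j. if j \<in> V then a (inv_into UNIV ?\<beta> j) else 0)"
    have cont: "continuous_on S (\<lambda>x. (hpoly V k c (bary V x))\<^sup>2)" for S
      by (intro continuous_intros continuous_on_hpoly pdeg_continuous[OF pdeg_bary[OF V]])
    have "(\<Sum>a\<in>Hom V k. (c a)\<^sup>2) = (\<Sum>a\<in>Hom UNIV k. (?c a)\<^sup>2)"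
      using re(2)[of "\<lambda>x. x\<^sup>2"] by simp
    also have "\<dots> \<le> C * integral refs (\<lambda>z. (hpoly UNIV k ?c (bc z))\<^sup>2)" by (rule C)
    also have "(\<lambda>z. (hpoly UNIV k ?c (bc z))\<^sup>2) = (\<lambda>z. (hpoly V k c (bary V (param ?\<beta> z)))\<^sup>2)"
      using bary_param[of ?\<beta>] inj rng tetraD[OF V] by (simp add: re(1))
    finally have "jac (convex hull V) * (\<Sum>a\<in>Hom V k. (c a)\<^sup>2) \<le> jac (convex hull V) * (C * integral refs (\<lambda>z. (hpoly V k c (bary V (param ?\<beta> z)))\<^sup>2))"
      using jac_pos[OF V] by (intro mult_left_mono) auto
    also have "\<dots> = C * integral (convex hull V) (\<lambda>x. (hpoly V k c (bary V x))\<^sup>2)"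
      using integral_tet[OF abd(2) cont] abd(1) by simp
    finally show ?thesis .
  qed
  then show ?thesis using C(1) by blast
qed

text \<open>The bound on the reference triangle is carried over by the parametrisation, which relabels the exponents; the area
factor appears on both sides.\<close>

lemma face_coefficients:
  "\<exists>C>0. \<forall>x y z c. \<not> affine_dependent {x, y, z} \<longrightarrow> distinct [x, y, z] \<longrightarrow>
     norm (cross3 (y - x) (z - x)) * (\<Sum>a\<in>Hom {x, y, z} k. (c a)\<^sup>2)
       \<le> C * face_integral (convex hull {x, y, z}) (\<lambda>p. (hpoly {x, y, z} k c (bary {x, y, z} p))\<^sup>2)"
proof -
  obtain C where C: "C > 0" "\<And>c. (\<Sum>a\<in>Hom (UNIV :: 2 option set) k. (c a)\<^sup>2) \<le> C * integral refs (\<lambda>z. (hpoly UNIV k c (bc z))\<^sup>2)"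
    using coefficients_bounded_by_integral[where 'n=2] by blast
  have "norm (cross3 (y - x) (z - x)) * (\<Sum>a\<in>Hom {x, y, z} k. (c a)\<^sup>2)
       \<le> C * face_integral (convex hull {x, y, z}) (\<lambda>p. (hpoly {x, y, z} k c (bary {x, y, z} p))\<^sup>2)"
    if ind: "\<not> affine_dependent {x, y, z}" and d: "distinct [x, y, z]" for x y z c
  proof -
    let ?\<beta> = "tri x y z" let ?W = "{x, y, z}"
    have rng: "range ?\<beta> = ?W" by (simp add: range_tri)
    have inj: "inj ?\<beta>" using d by (intro inj_tri)
    have bij: "bij_betw ?\<beta> UNIV ?W" using rng inj by (simp add: bij_betw_def)
    note re = hpoly_reindex[OF bij]
    let ?c = "\<lambda>a. c (\<lambda>j. if j \<in> ?W then a (inv_into UNIV ?\<beta> j) else 0)"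
    have im: "convex hull ?W = param ?\<beta> ` refs" using param_image[OF inj] rng by simp
    have bp: "bary ?W (param ?\<beta> z) (?\<beta> j) = bc z j" for z j
      using bary_param[of ?\<beta>] inj rng ind by simp
    have eq: "hpoly UNIV k ?c (bc z) = hpoly ?W k c (bary ?W (param ?\<beta> z))" for z
      unfolding re(1)[of k c] bp ..
    have contp: "continuous_on UNIV (\<lambda>z. (hpoly UNIV k ?c (bc z))\<^sup>2)"
      by (intro continuous_intros continuous_on_hpoly continuous_on_bc)
    have cont: "continuous_on (convex hull ?W) (\<lambda>p. (hpoly ?W k c (bary ?W p))\<^sup>2)"
    proof -
      \<comment> \<open>the barycentric coordinates are continuous on the triangle as the inverse of a continuous bijection of compact
sets\<close>
      have "inj_on (param ?\<beta>) refs"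
      proof (rule inj_onI)
        fix z w assume "param ?\<beta> z = param ?\<beta> w"
        then have "bc z j = bc w j" for j using bp[of z j] bp[of w j] by simp
        then have "z $ i = w $ i" for i using bc_def[of z "Some i"] bc_def[of w "Some i"] by simp
        then show "z = w" by (simp add: vec_eq_iff)
      qed
      then obtain g where g: "homeomorphism refs (convex hull ?W) (param ?\<beta>) g"
        using homeomorphism_compact[OF compact_refs continuous_on_param im[symmetric]] by blast
      have "continuous_on (convex hull ?W) (\<lambda>p. (hpoly UNIV k ?c (bc (g p)))\<^sup>2)"
        using g by (intro continuous_on_compose2[OF contp]) (auto simp: homeomorphism_def)
      then show ?thesis
        by (rule continuous_on_eq) (use g eq in \<open>auto simp: homeomorphism_def\<close>)
    qed
    have "(\<Sum>a\<in>Hom ?W k. (c a)\<^sup>2) = (\<Sum>a\<in>Hom UNIV k. (?c a)\<^sup>2)"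
      using re(2)[of "\<lambda>x. x\<^sup>2"] by simp
    also have "\<dots> \<le> C * integral refs (\<lambda>z. (hpoly UNIV k ?c (bc z))\<^sup>2)" by (rule C)
    finally have "norm (cross3 (y - x) (z - x)) * (\<Sum>a\<in>Hom ?W k. (c a)\<^sup>2) \<le> norm (cross3 (y - x) (z - x)) * (C * integral refs (\<lambda>z. (hpoly ?W k c (bary ?W (param ?\<beta> z)))\<^sup>2))"
      unfolding eq by (intro mult_left_mono) auto
    also have "\<dots> = C * face_integral (convex hull ?W) (\<lambda>p. (hpoly ?W k c (bary ?W p))\<^sup>2)"
      unfolding face_integral_labelled[OF ind d cont] by simp
    finally show ?thesis .
  qed
  then show ?thesis using C(1) by blast
qed

lemma hpoly_abs_le:
  assumes "finite I" "\<And>i. i \<in> I \<Longrightarrow> 0 \<le> y i \<and> y i \<le> 1"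
  shows "\<bar>hpoly I k c y\<bar> \<le> (\<Sum>a\<in>Hom I k. \<bar>c a\<bar>)"
proof -
  have "\<bar>hpoly I k c y\<bar> \<le> (\<Sum>a\<in>Hom I k. \<bar>c a * (\<Prod>i\<in>I. y i ^ a i)\<bar>)" unfolding hpoly_def by (rule sum_abs)
  also have "\<dots> \<le> (\<Sum>a\<in>Hom I k. \<bar>c a\<bar>)"
  proof (rule sum_mono)
    fix a
    have "(\<Prod>i\<in>I. y i ^ a i) \<ge> 0" "(\<Prod>i\<in>I. y i ^ a i) \<le> 1" using assms by (auto intro!: prod_nonneg prod_le_1 power_le_one)
    then show "\<bar>c a * (\<Prod>i\<in>I. y i ^ a i)\<bar> \<le> \<bar>c a\<bar>" by (simp add: abs_mult mult_left_le)
  qed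
  finally show ?thesis .
qed

lemma card_Hom: "card I = n \<Longrightarrow> finite I \<Longrightarrow> card (Hom I k) \<le> (k + 1) ^ n"
proof -
  assume n: "card I = n" "finite I"
  let ?h = "\<lambda>a i. if i \<in> I then a i else undefined"
  have "inj_on ?h (Hom I k)" by (rule inj_onI) (auto simp: Hom_def fun_eq_iff, metis)
  moreover have "?h ` Hom I k \<subseteq> PiE I (\<lambda>_. {..k})" using Hom_le[OF n(2)] by auto
  ultimately have "card (Hom I k) \<le> card (PiE I (\<lambda>_. {..k}))" using n by (intro card_inj_on_le finite_PiE) auto
  also have "\<dots> = (k + 1) ^ n" using n by (simp add: card_PiE)
  finally show ?thesis .
qed

lemma sum_abs_squared_le:
  fixes c :: "'a \<Rightarrow> real"
  shows "(\<Sum>a\<in>A. \<bar>c a\<bar>)\<^sup>2 \<le> real (card A) * (\<Sum>a\<in>A. (c a)\<^sup>2)"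
  using Cauchy_Schwarz_ineq_sum[of "\<lambda>_. 1" "\<lambda>a. \<bar>c a\<bar>" A] by simp

text \<open>In the product rule every barycentric coordinate is between 0 and 1 and its gradient is at most \<open>\<kappa>\<close> over the
diameter; the factor 4 counts the vertices. The derivative is evaluated in the direction of the gradient itself.\<close>

lemma grad_hpoly_le:
  assumes V: "regular \<kappa> V" and x: "x \<in> convex hull V" and q: "\<And>x. q x = hpoly V k c (bary V x)"
  shows "encl_diam (convex hull V) * norm (grad q x) \<le> 4 * real k * \<kappa> * (\<Sum>a\<in>Hom V k. \<bar>c a\<bar>)"
proof -
  note R = regD[OF V]
  let ?h = "encl_diam (convex hull V)" and ?b = "\<lambda>v. bary V x v"
  have h: "?h > 0" using encl_diam_pos[OF V] .
  have db: "((\<lambda>x. bary V x v) has_derivative (\<lambda>\<xi>. bgrad V v \<bullet> \<xi>)) (at x)" if "v \<in> V" for v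
  proof -
    have "(\<lambda>x. bary V x v) = (\<lambda>x. bary V 0 v + bgrad V v \<bullet> x)" using bary_affine[OF R(1) that] by blast
    then show ?thesis by (auto intro!: derivative_eq_intros)
  qed
  have "((\<lambda>x. hpoly V k c (bary V x)) has_derivative (\<lambda>\<xi>. \<Sum>a\<in>Hom V k. c a *
      (\<Sum>v\<in>V. (real (a v) * (bgrad V v \<bullet> \<xi>) * ?b v ^ (a v - 1)) * (\<Prod>w\<in>V - {v}. ?b w ^ a w)))) (at x)"
    unfolding hpoly_def
    by (rule has_derivative_sum has_derivative_mult_right has_derivative_prod has_derivative_power db | assumption)+
  then have D: "(q has_derivative (\<lambda>\<xi>. \<Sum>a\<in>Hom V k. c a *
      (\<Sum>v\<in>V. (real (a v) * (bgrad V v \<bullet> \<xi>) * ?b v ^ (a v - 1)) * (\<Prod>w\<in>V - {v}. ?b w ^ a w)))) (at x)"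
    unfolding q[symmetric] .
  have q': "q differentiable (at x)" using D differentiable_def by blast
  let ?g = "grad q x"
  have "?g \<bullet> ?g = (\<Sum>a\<in>Hom V k. c a *
      (\<Sum>v\<in>V. (real (a v) * (bgrad V v \<bullet> ?g) * ?b v ^ (a v - 1)) * (\<Prod>w\<in>V - {v}. ?b w ^ a w)))"
    using has_derivative_unique[OF has_derivative_grad[OF q'] D] by metis
  also have "\<bar>\<dots>\<bar> \<le> (\<Sum>a\<in>Hom V k. \<bar>c a\<bar> * (4 * real k * \<kappa> / ?h * norm ?g))"
  proof (rule order.trans[OF sum_abs sum_mono])
    fix a assume a: "a \<in> Hom V k"
    have "\<bar>\<Sum>v\<in>V. (real (a v) * (bgrad V v \<bullet> ?g) * ?b v ^ (a v - 1)) * (\<Prod>w\<in>V - {v}. ?b w ^ a w)\<bar>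
        \<le> (\<Sum>v\<in>V. real k * (\<kappa> / ?h * norm ?g))"
    proof (rule order.trans[OF sum_abs sum_mono])
      fix v assume v: "v \<in> V"
      have b: "0 \<le> ?b w" "?b w \<le> 1" if "w \<in> V" for w using bary_bounds[OF R(4) x that] by auto
      have 1: "\<bar>\<Prod>w\<in>V - {v}. ?b w ^ a w\<bar> \<le> 1" using b by (auto simp: abs_prod intro!: prod_le_1 power_le_one)
      have 2: "\<bar>?b v ^ (a v - 1)\<bar> \<le> 1" using b[OF v] by (simp add: power_le_one)
      have 3: "\<bar>bgrad V v \<bullet> ?g\<bar> \<le> \<kappa> / ?h * norm ?g"
      proof -
        have "\<bar>bgrad V v \<bullet> ?g\<bar> \<le> norm (bgrad V v) * norm ?g" by (rule Cauchy_Schwarz_ineq2)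
        also have "\<dots> \<le> \<kappa> / ?h * norm ?g" using encl_bgrad[OF V v] h by (intro mult_right_mono) (auto simp: field_simps)
        finally show ?thesis .
      qed
      have 4: "real (a v) \<le> real k" using Hom_le[OF R(6) a] by simp
      have "\<bar>(real (a v) * (bgrad V v \<bullet> ?g) * ?b v ^ (a v - 1)) * (\<Prod>w\<in>V - {v}. ?b w ^ a w)\<bar>
        = real (a v) * \<bar>bgrad V v \<bullet> ?g\<bar> * \<bar>?b v ^ (a v - 1)\<bar> * \<bar>\<Prod>w\<in>V - {v}. ?b w ^ a w\<bar>"
        by (simp add: abs_mult)
      also have "\<dots> \<le> real k * (\<kappa> / ?h * norm ?g) * 1 * 1"
        using 1 2 3 4 R(2) h by (intro mult_mono) auto
      finally show "\<bar>(real (a v) * (bgrad V v \<bullet> ?g) * ?b v ^ (a v - 1)) * (\<Prod>w\<in>V - {v}. ?b w ^ a w)\<bar> \<le> real k * (\<kappa> / ?h * norm ?g)" by simp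
    qed
    also have "\<dots> = 4 * real k * \<kappa> / ?h * norm ?g" using R(5) by simp
    finally show "\<bar>c a * (\<Sum>v\<in>V. (real (a v) * (bgrad V v \<bullet> ?g) * ?b v ^ (a v - 1)) * (\<Prod>w\<in>V - {v}. ?b w ^ a w))\<bar>
       \<le> \<bar>c a\<bar> * (4 * real k * \<kappa> / ?h * norm ?g)"
      unfolding abs_mult by (intro mult_left_mono) auto
  qed
  also have "\<dots> = (\<Sum>a\<in>Hom V k. \<bar>c a\<bar>) * (4 * real k * \<kappa> / ?h * norm ?g)" by (simp only: sum_distrib_right)
  finally have "norm ?g * norm ?g \<le> (\<Sum>a\<in>Hom V k. \<bar>c a\<bar>) * (4 * real k * \<kappa> / ?h) * norm ?g"
    by (simp add: dot_square_norm power2_eq_square)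
  then have "norm ?g \<le> (\<Sum>a\<in>Hom V k. \<bar>c a\<bar>) * (4 * real k * \<kappa> / ?h)"
  proof (cases "norm ?g = 0")
    case True
    then show ?thesis using R(2) h by (simp add: sum_nonneg)
  next
    case False
    then have "norm ?g > 0" by simp
    then show ?thesis using \<open>norm ?g * norm ?g \<le> _\<close> mult_right_le_imp_le by blast
  qed
  then show ?thesis using h by (simp add: field_simps)
qed

lemma integral_tetra_le:
  assumes V: "tetra V" and f: "continuous_on (convex hull V) f" and le: "\<And>x. x \<in> convex hull V \<Longrightarrow> f x \<le> B"
  shows "integral (convex hull V) f \<le> jac (convex hull V) * (B * rvol TYPE(3))"
proof -
  let ?T = "convex hull V"
  have c: "compact ?T" using tetraD[OF V] by (simp add: finite_imp_compact_convex_hull)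
  have "integral ?T f \<le> integral ?T (\<lambda>_. B)"
    by (intro integral_le continuous_integrable_on c f le continuous_on_const)
  also have "\<dots> = jac ?T * (B * rvol TYPE(3))"
  proof -
    have "integral ?T (\<lambda>x. 1) = measure lebesgue ?T" using lmeasurable_compact[OF c] lmeasure_integral by metis
    then have "integral ?T (\<lambda>_. B) = B * measure lebesgue ?T"
      using integral_mult_right[of ?T B "\<lambda>_. 1"] by simp
    then show ?thesis using rvol_pos[where 'n=3] by (simp add: jac_def)
  qed
  finally show ?thesis .
qed

lemma face_integral_le:
  assumes ind: "\<not> affine_dependent {a, b, c}" "distinct [a, b, c]" and f: "continuous_on (convex hull {a, b, c}) f"
    and le: "\<And>x. x \<in> convex hull {a, b, c} \<Longrightarrow> f x \<le> B"
  shows "face_integral (convex hull {a, b, c}) f \<le> norm (cross3 (b - a) (c - a)) * (B * rvol TYPE(2))"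
proof -
  have im: "convex hull {a, b, c} = param (tri a b c) ` refs"
    using param_image[OF inj_tri[OF ind(2)]] by (simp add: range_tri)
  have m: "param (tri a b c) z \<in> convex hull {a, b, c}" if "z \<in> refs" for z using that im by blast
  have "integral refs (\<lambda>z. f (param (tri a b c) z)) \<le> integral refs (\<lambda>z :: real^2. B)"
    by (intro integral_le continuous_integrable_on compact_refs continuous_on_const continuous_on_compose2[OF f continuous_on_param])
       (use m le in auto)
  then show ?thesis
    unfolding face_integral_labelled[OF ind f] by (intro mult_left_mono) (auto simp: integral_refs_const)
qed

text \<open>The Bernstein coefficients bound the gradient pointwise and are bounded by the function in the mean. The Jacobian
appears in both estimates and cancels.\<close>

lemma inverse_inequality:
  "\<exists>C>0. \<forall>V q. regular \<kappa> V \<longrightarrow> pdeg k q \<longrightarrow>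
     (encl_diam (convex hull V))\<^sup>2 * integral (convex hull V) (\<lambda>x. (norm (grad q x))\<^sup>2) \<le> C * integral (convex hull V) (\<lambda>x. (q x)\<^sup>2)"
proof -
  obtain C where C: "C > 0" "\<And>V c. tetra V \<Longrightarrow> jac (convex hull V) * (\<Sum>a\<in>Hom V k. (c a)\<^sup>2) \<le> C * integral (convex hull V) (\<lambda>x. (hpoly V k c (bary V x))\<^sup>2)"
    using element_coefficients by blast
  let ?K = "(4 * real k * \<kappa>)\<^sup>2 * real ((k + 1) ^ 4) * rvol TYPE(3) * C"
  have "(encl_diam (convex hull V))\<^sup>2 * integral (convex hull V) (\<lambda>x. (norm (grad q x))\<^sup>2) \<le> (?K + 1) * integral (convex hull V) (\<lambda>x. (q x)\<^sup>2)"
    if V: "regular \<kappa> V" and q: "pdeg k q" for V q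
  proof -
    note R = regD[OF V]
    let ?T = "convex hull V" and ?h = "encl_diam (convex hull V)"
    obtain c where c: "\<And>x. q x = hpoly V k c (bary V x)" using bary_representation[OF R(1) q] by blast
    let ?S = "\<Sum>a\<in>Hom V k. (c a)\<^sup>2"
    have cg: "continuous_on ?T (\<lambda>x. (?h * norm (grad q x))\<^sup>2)"
      by (intro continuous_intros pdeg_continuous_grad[OF q])
    have i: "(\<lambda>x. (q x)\<^sup>2) integrable_on ?T" by (intro continuous_integrable_on R continuous_intros pdeg_continuous[OF q])
    then have i0: "integral ?T (\<lambda>x. (q x)\<^sup>2) \<ge> 0" by (intro integral_nonneg) auto
    have "?h\<^sup>2 * integral ?T (\<lambda>x. (norm (grad q x))\<^sup>2) = integral ?T (\<lambda>x. (?h * norm (grad q x))\<^sup>2)"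
      by (simp add: power_mult_distrib)
    also have "\<dots> \<le> jac ?T * ((4 * real k * \<kappa>)\<^sup>2 * (real ((k + 1) ^ 4) * ?S) * rvol TYPE(3))"
    proof (rule integral_tetra_le[OF R(1) cg])
      fix x assume x: "x \<in> ?T"
      have "(?h * norm (grad q x))\<^sup>2 \<le> (4 * real k * \<kappa> * (\<Sum>a\<in>Hom V k. \<bar>c a\<bar>))\<^sup>2"
        using grad_hpoly_le[OF V x c] encl_diam_pos[OF V] by (intro power_mono) auto
      also have "\<dots> \<le> (4 * real k * \<kappa>)\<^sup>2 * (real (card (Hom V k)) * ?S)"
        unfolding power_mult_distrib[of _ "sum _ _"] by (intro mult_left_mono sum_abs_squared_le) auto
      also have "\<dots> \<le> (4 * real k * \<kappa>)\<^sup>2 * (real ((k + 1) ^ 4) * ?S)"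
        using card_Hom[OF R(5,6), of k] by (intro mult_left_mono mult_right_mono sum_nonneg) (auto simp only: of_nat_le_iff zero_le_power2)
      finally show "(?h * norm (grad q x))\<^sup>2 \<le> (4 * real k * \<kappa>)\<^sup>2 * (real ((k + 1) ^ 4) * ?S)" .
    qed
    also have "\<dots> = (4 * real k * \<kappa>)\<^sup>2 * real ((k + 1) ^ 4) * rvol TYPE(3) * (jac ?T * ?S)" by (simp only: ac_simps)
    also have "\<dots> \<le> (4 * real k * \<kappa>)\<^sup>2 * real ((k + 1) ^ 4) * rvol TYPE(3) * (C * integral ?T (\<lambda>x. (q x)\<^sup>2))"
      using C(2)[OF R(1), of c] rvol_pos[where 'n=3] by (intro mult_left_mono) (auto simp: c)
    also have "\<dots> \<le> (?K + 1) * integral ?T (\<lambda>x. (q x)\<^sup>2)" using i0 by (simp add: distrib_right mult.assoc)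
    finally show ?thesis .
  qed
  moreover have "?K + 1 > 0" using C(1) rvol_pos[where 'n=3] by (intro add_nonneg_pos) (auto intro!: mult_nonneg_nonneg)
  ultimately show ?thesis by blast
qed

text \<open>The Bernstein coefficients bound the function pointwise on the face and are bounded by the function in the mean over
the element. The area of the face times the diameter is of the order of the Jacobian.\<close>

lemma trace_inequality:
  "\<exists>C>0. \<forall>V q F. regular \<kappa> V \<longrightarrow> pdeg k q \<longrightarrow> F facet_of (convex hull V) \<longrightarrow>
     encl_diam (convex hull V) * face_integral F (\<lambda>x. (q x)\<^sup>2) \<le> C * integral (convex hull V) (\<lambda>x. (q x)\<^sup>2)"
proof -
  obtain C where C: "C > 0" "\<And>V c. tetra V \<Longrightarrow> jac (convex hull V) * (\<Sum>a\<in>Hom V k. (c a)\<^sup>2) \<le> C * integral (convex hull V) (\<lambda>x. (hpoly V k c (bary V x))\<^sup>2)"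
    using element_coefficients by blast
  let ?K = "\<kappa> * real ((k + 1) ^ 4) * rvol TYPE(2) * C"
  have "encl_diam (convex hull V) * face_integral F (\<lambda>x. (q x)\<^sup>2) \<le> (\<bar>?K\<bar> + 1) * integral (convex hull V) (\<lambda>x. (q x)\<^sup>2)"
    if V: "regular \<kappa> V" and q: "pdeg k q" and F: "F facet_of (convex hull V)" for V q F
  proof -
    note R = regD[OF V]
    let ?T = "convex hull V" and ?h = "encl_diam (convex hull V)"
    obtain v where v: "v \<in> V" "F = convex hull (V - {v})" using F tetra_facets(1)[OF R(1)] by blast
    obtain a b d where abd: "V = {v, a, b, d}" "distinct [v, a, b, d]" "V - {v} = {a, b, d}" using tetra_labels[OF R(1) v(1)] .
    have F': "F = convex hull {a, b, d}" using v abd by simp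
    have ind: "\<not> affine_dependent {a, b, d}" using affine_dependent_diff_singleton[OF R(1), of v] abd(3) by simp
    obtain c where c: "\<And>x. q x = hpoly V k c (bary V x)" using bary_representation[OF R(1) q] by blast
    let ?S = "\<Sum>a\<in>Hom V k. (c a)\<^sup>2" let ?A = "norm (cross3 (b - a) (d - a))"
    have i: "(\<lambda>x. (q x)\<^sup>2) integrable_on ?T" by (intro continuous_integrable_on R continuous_intros pdeg_continuous[OF q])
    then have i0: "integral ?T (\<lambda>x. (q x)\<^sup>2) \<ge> 0" by (intro integral_nonneg) auto
    have "face_integral F (\<lambda>x. (q x)\<^sup>2) \<le> ?A * (real ((k + 1) ^ 4) * ?S * rvol TYPE(2))"
      unfolding F'
    proof (rule face_integral_le[OF ind])
      show "continuous_on (convex hull {a, b, d}) (\<lambda>x. (q x)\<^sup>2)" by (intro continuous_intros pdeg_continuous[OF q])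
      fix x assume x: "x \<in> convex hull {a, b, d}"
      then have x: "x \<in> ?T" using hull_mono[of "{a, b, d}" V convex] abd(1) by blast
      have "(q x)\<^sup>2 = \<bar>hpoly V k c (bary V x)\<bar>\<^sup>2" by (simp add: c)
      also have "\<dots> \<le> (\<Sum>a\<in>Hom V k. \<bar>c a\<bar>)\<^sup>2"
        using hpoly_abs_le[OF R(6), of "bary V x" k c] bary_bounds[OF R(4) x] by (intro power_mono) auto
      also have "\<dots> \<le> real (card (Hom V k)) * ?S" by (rule sum_abs_squared_le)
      also have "\<dots> \<le> real ((k + 1) ^ 4) * ?S"
        using card_Hom[OF R(5,6), of k] by (intro mult_right_mono sum_nonneg) (auto simp only: of_nat_le_iff zero_le_power2)
      finally show "(q x)\<^sup>2 \<le> real ((k + 1) ^ 4) * ?S" .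
    qed (use abd in auto)
    then have "?h * face_integral F (\<lambda>x. (q x)\<^sup>2) \<le> ?h * (?A * (real ((k + 1) ^ 4) * ?S * rvol TYPE(2)))"
      using encl_diam_pos[OF V] by (intro mult_left_mono) auto
    also have "\<dots> = (?A * ?h) * (real ((k + 1) ^ 4) * ?S * rvol TYPE(2))" by (simp only: ac_simps)
    also have "\<dots> \<le> (\<kappa> * jac ?T) * (real ((k + 1) ^ 4) * ?S * rvol TYPE(2))"
      using area_bounds(1)[OF V abd(1,2)] rvol_pos[where 'n=2] by (intro mult_right_mono mult_nonneg_nonneg sum_nonneg) auto
    also have "\<dots> = \<kappa> * real ((k + 1) ^ 4) * rvol TYPE(2) * (jac ?T * ?S)" by (simp only: ac_simps)
    also have "\<dots> \<le> \<kappa> * real ((k + 1) ^ 4) * rvol TYPE(2) * (C * integral ?T (\<lambda>x. (q x)\<^sup>2))"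
      using C(2)[OF R(1), of c] rvol_pos[where 'n=2] R(2) by (intro mult_left_mono) (auto simp: c)
    also have "\<dots> = ?K * integral ?T (\<lambda>x. (q x)\<^sup>2)" by (simp only: ac_simps)
    also have "\<dots> \<le> (\<bar>?K\<bar> + 1) * integral ?T (\<lambda>x. (q x)\<^sup>2)" using i0 by (intro mult_right_mono) auto
    finally show ?thesis .
  qed
  moreover have "\<bar>?K\<bar> + 1 > 0" by simp
  ultimately show ?thesis by blast
qed

section \<open>Meshes\<close>

definition verts :: "'a::real_vector set \<Rightarrow> 'a set" where
  "verts S = {v. v extreme_point_of S}"

lemma verts_hull:
  fixes W :: "'a::euclidean_space set"
  assumes "\<not> affine_dependent W"
  shows "verts (convex hull W) = W"
  using extreme_point_of_convex_hull_affine_independent[OF assms] by (auto simp: verts_def)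

lemma in_rel_interior_bary:
  fixes W :: "'a::euclidean_space set"
  assumes W: "\<not> affine_dependent W"
  shows "x \<in> rel_interior (convex hull W) \<longleftrightarrow> x \<in> affine hull W \<and> (\<forall>w\<in>W. 0 < bary W x w)"
proof -
  have fin: "finite W" using W aff_independent_finite by blast
  show ?thesis
  proof
    assume "x \<in> rel_interior (convex hull W)"
    then obtain u where u: "\<forall>w\<in>W. 0 < u w" "sum u W = 1" "(\<Sum>w\<in>W. u w *\<^sub>R w) = x"
      unfolding rel_interior_convex_hull_explicit[OF W] by blast
    then have "\<forall>w\<in>W. 0 < bary W x w" using bary_unique[OF W u(2,3)] by simp
    moreover have "x \<in> affine hull W" using u fin by (auto simp: affine_hull_finite)
    ultimately show "x \<in> affine hull W \<and> (\<forall>w\<in>W. 0 < bary W x w)" by blast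
  next
    assume "x \<in> affine hull W \<and> (\<forall>w\<in>W. 0 < bary W x w)"
    then show "x \<in> rel_interior (convex hull W)"
      unfolding rel_interior_convex_hull_explicit[OF W] using bary_works[OF fin, of x] by blast
  qed
qed

lemma in_face_if_bary_zero:
  fixes W :: "'a::euclidean_space set"
  assumes W: "\<not> affine_dependent W" and x: "x \<in> convex hull W" and w: "w \<in> W" "bary W x w = 0"
  shows "x \<in> convex hull (W - {w})"
proof -
  have fin: "finite W" using W aff_independent_finite by blast
  have xa: "x \<in> affine hull W" using x convex_hull_subset_affine_hull by blast
  note b = bary_works[OF fin xa]
  have "sum (bary W x) (W - {w}) = 1" "(\<Sum>v\<in>W - {w}. bary W x v *\<^sub>R v) = x"
    using b fin w by (simp_all add: sum_diff1)
  moreover have "\<forall>v\<in>W - {w}. 0 \<le> bary W x v" using bary_bounds[OF W x] by blast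
  ultimately show ?thesis using fin by (auto simp: convex_hull_finite)
qed

lemma rel_boundary_simplex:
  fixes W :: "'a::euclidean_space set"
  assumes W: "\<not> affine_dependent W" and x: "x \<in> convex hull W" "x \<notin> rel_interior (convex hull W)"
  obtains w where "w \<in> W" "x \<in> convex hull (W - {w})"
proof -
  have "x \<in> affine hull W" using x convex_hull_subset_affine_hull by blast
  then obtain w where w: "w \<in> W" "\<not> 0 < bary W x w" using x in_rel_interior_bary[OF W] by blast
  then have "bary W x w = 0" using bary_bounds[OF W x(1) w(1)] by simp
  then show ?thesis using in_face_if_bary_zero[OF W x(1) w(1)] that w by blast
qed

text \<open>At a relative interior point of a face all barycentric coordinates are positive except that of the opposite vertex.
They remain positive nearby, so that the sign of the last one decides about membership in the tetrahedron; it also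
tells the side of the plane of the face.\<close>

lemma half_ball:
  assumes V: "tetra V" and F: "F facet_of (convex hull V)" and x: "x \<in> rel_interior F"
  shows "\<exists>\<epsilon>>0. \<forall>y\<in>ball x \<epsilon>. outward_normal (convex hull V) F \<bullet> (y - x) \<le> 0 \<longrightarrow> y \<in> convex hull V"
    and "\<And>y. y \<in> convex hull V \<Longrightarrow> outward_normal (convex hull V) F \<bullet> (y - x) \<le> 0"
proof -
  note D = tetraD[OF V]
  obtain v where v: "v \<in> V" "F = convex hull (V - {v})" using F tetra_facets(1)[OF V] by blast
  obtain a b c where abc: "V = {v, a, b, c}" "distinct [v, a, b, c]" "V - {v} = {a, b, c}" using tetra_labels[OF V v(1)] .
  let ?n = "outward_normal (convex hull V) F"
  have V': "tetra {v, a, b, c}" using V abc by simp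
  note o = outward_normal_tet[OF V' abc(2), folded abc(1), folded abc(3), folded v(2)]
  have x0: "x \<in> affine hull (V - {v})" "\<forall>w\<in>V - {v}. 0 < bary (V - {v}) x w"
    using x in_rel_interior_bary[OF affine_dependent_diff_singleton[OF V]] v(2) by blast+
  have xpos: "0 < bary V x w" if "w \<in> V - {v}" for w
    using bary_subset(1)[OF D(1) _ x0(1) that] x0(2) that by auto
  have xv: "bary V x v = 0" using bary_subset(2)[OF D(1) _ x0(1), of v] v(1) by auto
  have nw: "?n \<bullet> (w - a) = 0" if "w \<in> V - {v}" for w
    using that o(3,4) unfolding abc(3) by auto
  have side: "?n \<bullet> (y - a) = - (bary V y v * (?n \<bullet> (a - v)))" for y
  proof -
    have B: "sum (bary V y) V = 1" "(\<Sum>w\<in>V. bary V y w *\<^sub>R w) = y" using bary_works[of V y] D by auto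
    have "y - a = (\<Sum>w\<in>V. bary V y w *\<^sub>R (w - a))"
      using B by (simp add: scaleR_diff_right sum_subtractf scaleR_sum_left[symmetric])
    then have "?n \<bullet> (y - a) = (\<Sum>w\<in>V. bary V y w * (?n \<bullet> (w - a)))" by (simp add: inner_sum_right)
    also have "\<dots> = bary V y v * (?n \<bullet> (v - a))"
      using nw by (subst sum.remove[OF D(3) v(1)]) simp
    finally show ?thesis by (simp add: inner_diff_right right_diff_distrib)
  qed
  have side': "?n \<bullet> (y - x) = - (bary V y v * (?n \<bullet> (a - v)))" for y
    using side[of y] side[of x] xv by (simp add: inner_diff_right)
  show "?n \<bullet> (y - x) \<le> 0" if "y \<in> convex hull V" for y
    using bary_bounds(1)[OF D(1) that v(1)] o(6) unfolding side' by simp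
  have "open {y. \<forall>w\<in>V - {v}. 0 < bary V y w}"
  proof -
    have "open {y. 0 < bary V y w}" if "w \<in> V" for w
      by (intro open_Collect_less continuous_on_const pdeg_continuous[OF pdeg_bary[OF V that]])
    then have "open (\<Inter>w\<in>V - {v}. {y. 0 < bary V y w})" using D(3) by (intro open_INT) auto
    moreover have "(\<Inter>w\<in>V - {v}. {y. 0 < bary V y w}) = {y. \<forall>w\<in>V - {v}. 0 < bary V y w}" by auto
    ultimately show ?thesis by simp
  qed
  then obtain \<epsilon> where e: "\<epsilon> > 0" "ball x \<epsilon> \<subseteq> {y. \<forall>w\<in>V - {v}. 0 < bary V y w}"
    using xpos unfolding open_contains_ball by blast
  have "y \<in> convex hull V" if y: "y \<in> ball x \<epsilon>" "?n \<bullet> (y - x) \<le> 0" for y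
  proof -
    have "0 \<le> bary V y v" using y(2) o(6) unfolding side' by (simp add: zero_le_mult_iff)
    moreover have "y \<in> {y. \<forall>w\<in>V - {v}. 0 < bary V y w}" using e(2) y(1) by blast
    then have "0 \<le> bary V y w" if "w \<in> V - {v}" for w using that by (simp add: less_imp_le)
    ultimately show ?thesis using in_convex_hull_iff_bary[OF D(1), of y] D(4) by auto
  qed
  then show "\<exists>\<epsilon>>0. \<forall>y\<in>ball x \<epsilon>. ?n \<bullet> (y - x) \<le> 0 \<longrightarrow> y \<in> convex hull V" using e(1) by blast
qed

locale mesh =
  fixes \<Omega> :: "(real^3) set" and \<T> :: mesh and \<kappa> :: real
  assumes open_domain: "open \<Omega>"
    and conforming: "conforming_triangulation \<Omega> \<T>"
    and shape: "shape_regular \<kappa> \<T>"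
    and kappa: "1 \<le> \<kappa>"
begin

lemma finite_mesh: "finite \<T>"
  using conforming by (auto simp: conforming_triangulation_def triangulation_def)

lemma element:
  assumes "T \<in> \<T>"
  shows "regular \<kappa> (verts T)" "convex hull (verts T) = T" "tetra (verts T)"
proof -
  obtain C where C: "\<not> affine_dependent C" "int (card C) = 3 + 1" "T = convex hull C"
    using conforming assms by (auto simp: conforming_triangulation_def simplex_def)
  then have v: "verts T = C" using verts_hull by blast
  then show "convex hull (verts T) = T" "tetra (verts T)" using C by (auto simp: tetra_def)
  then show "regular \<kappa> (verts T)" using shape assms kappa by (auto simp: regular_def shape_regular_def)
qed

lemma element_indep: "T \<in> \<T> \<Longrightarrow> \<not> affine_dependent (verts T)"
  using element tetraD by blast

lemma facet:
  assumes T: "T \<in> \<T>" and F: "F facet_of T"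
  obtains w where "w \<in> verts T" "F = convex hull (verts T - {w})" "verts F = verts T - {w}"
    "\<not> affine_dependent (verts F)" "card (verts F) = 3" "F = convex hull (verts F)"
proof -
  note E = element[OF T]
  obtain w where w: "w \<in> verts T" "F = convex hull (verts T - {w})"
    using F tetra_facets(1)[OF E(3)] unfolding E(2) by blast
  have i: "\<not> affine_dependent (verts T - {w})" by (rule affine_dependent_diff_singleton[OF E(3)])
  have v: "verts F = verts T - {w}" using verts_hull[OF i] w by simp
  show ?thesis
    by (rule that[OF w v]) (use i v w tetraD[OF E(3)] in auto)
qed

lemma finite_facets: "T \<in> \<T> \<Longrightarrow> finite {F. F facet_of T}"
  using tetra_facets(1)[of "verts T"] element[of T] tetraD(3)[of "verts T"] by simp

lemma facet_subset: "F facet_of T \<Longrightarrow> F \<subseteq> T"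
  by (simp add: facet_of_imp_subset)

lemma element_compact: "T \<in> \<T> \<Longrightarrow> compact T"
  using element(2)[of T] tetraD(3)[OF element(3), of T] finite_imp_compact_convex_hull by metis

lemma element_convex: "T \<in> \<T> \<Longrightarrow> convex T"
  using element(2)[of T] convex_convex_hull by metis

lemma facet_compact: "T \<in> \<T> \<Longrightarrow> F facet_of T \<Longrightarrow> compact F"
  by (meson element_compact element_convex facet_of_imp_face_of face_of_imp_compact)

lemma element_interior:
  assumes "T \<in> \<T>"
  shows "interior T \<noteq> {}" "closure (interior T) = T" "rel_interior T = interior T"
proof -
  note E = element[OF assms]
  have aff: "affine hull T = UNIV" using tetraD(4)[OF E(3)] E(2) affine_hull_convex_hull by metis
  then show ri: "rel_interior T = interior T" by (rule rel_interior_interior)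
  have "T \<noteq> {}" using tetraD[OF E(3)] aff by auto
  then show ne: "interior T \<noteq> {}" using ri rel_interior_eq_empty[OF element_convex[OF assms]] by simp
  show "closure (interior T) = T"
    using convex_closure_interior[OF element_convex[OF assms] ne] element_compact[OF assms] by (simp add: compact_imp_closed)
qed

lemma inter_face: "T \<in> \<T> \<Longrightarrow> T' \<in> \<T> \<Longrightarrow> (T \<inter> T') face_of T"
  using conforming by (auto simp: conforming_triangulation_def triangulation_def)

lemma not_nested:
  assumes "T \<in> \<T>" "T' \<in> \<T>" "T \<subseteq> T'"
  shows "T = T'"
proof (rule ccontr)
  assume ne: "T \<noteq> T'"
  have "T face_of T'" using inter_face[OF assms(2,1)] assms(3) by (simp add: Int_absorb1)
  then have "aff_dim T < aff_dim T'" using face_of_aff_dim_lt[OF element_convex[OF assms(2)]] ne by blast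
  moreover have "aff_dim S = 3" if "S \<in> \<T>" for S
  proof -
    have "affine hull S = UNIV" using tetraD(4)[OF element(3)[OF that]] element(2)[OF that] affine_hull_convex_hull by metis
    then show ?thesis using aff_dim_eq_full[of S] by simp
  qed
  ultimately show False using assms by simp
qed

lemma same_element:
  assumes "T \<in> \<T>" "T' \<in> \<T>" "y \<in> interior T" "y \<in> T'"
  shows "T = T'"
proof -
  have "y \<in> T \<inter> T'" using assms interior_subset by blast
  then have "T \<inter> T' = T" using face_of_disjoint_interior[OF inter_face[OF assms(1,2)]] assms(3) by blast
  then show ?thesis using not_nested assms by blast
qed

lemma inter_vertices:
  assumes "T \<in> \<T>" "T' \<in> \<T>"
  shows "T \<inter> T' = convex hull (verts T \<inter> verts T')"
proof -
  note E = element[OF assms(1)] and E' = element[OF assms(2)]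
  obtain c where c: "c \<subseteq> verts T" "T \<inter> T' = convex hull c"
    using inter_face[OF assms] face_of_convex_hull_affine_independent[OF element_indep[OF assms(1)]] E(2) by metis
  obtain c' where c': "c' \<subseteq> verts T'" "T' \<inter> T = convex hull c'"
    using inter_face[OF assms(2,1)] face_of_convex_hull_affine_independent[OF element_indep[OF assms(2)]] E'(2) by metis
  have "\<not> affine_dependent c" "\<not> affine_dependent c'" using c c' element_indep assms affine_dependent_subset by metis+
  then have "c = c'" using verts_hull c(2) c'(2) by (metis Int_commute)
  have "verts T \<inter> verts T' \<subseteq> c"
  proof
    fix v assume v: "v \<in> verts T \<inter> verts T'"
    then have "v \<in> T" "v \<in> T'" using E(2) E'(2) hull_inc by (metis IntE)+
    then have "v \<in> convex hull c" using c by blast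
    show "v \<in> c"
    proof (rule ccontr)
      assume "v \<notin> c"
      have "v \<in> affine hull c" using \<open>v \<in> convex hull c\<close> convex_hull_subset_affine_hull by blast
      then have "bary (verts T) v v = 0" using bary_subset(2)[OF element_indep[OF assms(1)] c(1)] v \<open>v \<notin> c\<close> by blast
      then show False using bary_vertex[OF element_indep[OF assms(1)], of v v] v by simp
    qed
  qed
  then have "c = verts T \<inter> verts T'" using c c' \<open>c = c'\<close> by blast
  then show ?thesis using c by simp
qed

subsection \<open>The two sides of a face\<close>

text \<open>With equal normals the two elements would overlap near a relative interior point of the face.\<close>

lemma opposite_normal:
  assumes T: "T \<in> \<T>" "F facet_of T" and T': "T' \<in> \<T>" "F facet_of T'" and ne: "T \<noteq> T'"
  shows "outward_normal T' F = - outward_normal T F"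
proof -
  note E = element[OF T(1)] and E' = element[OF T'(1)]
  obtain v where v: "v \<in> verts T" "F = convex hull (verts T - {v})" "verts F = verts T - {v}" using facet[OF T] by metis
  obtain v' where v': "v' \<in> verts T'" "F = convex hull (verts T' - {v'})" "verts F = verts T' - {v'}" using facet[OF T'] by metis
  obtain a b c where abc: "verts T = {v, a, b, c}" "distinct [v, a, b, c]" "verts T - {v} = {a, b, c}" using tetra_labels[OF E(3) v(1)] .
  have abc': "verts T' = {v', a, b, c}" "distinct [v', a, b, c]" using v' v abc by auto
  let ?n = "outward_normal T F" and ?n' = "outward_normal T' F"
  have F: "F = convex hull {a, b, c}" using v(2) abc(3) by simp
  have V: "tetra {v, a, b, c}" "tetra {v', a, b, c}" using E(3) E'(3) abc(1) abc'(1) by simp_all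
  have hT: "convex hull {v, a, b, c} = T" "convex hull {v', a, b, c} = T'" using E(2) E'(2) abc(1) abc'(1) by simp_all
  note o = outward_normal_tet[OF V(1) abc(2), unfolded hT, folded F] and o' = outward_normal_tet[OF V(2) abc'(2), unfolded hT, folded F]
  have "cross3 (b - a) (c - a) \<bullet> (a - v) \<noteq> 0" "cross3 (b - a) (c - a) \<bullet> (a - v') \<noteq> 0"
    using o(1,6) o'(1,6) by auto
  then have "?n' = ?n \<or> ?n' = - ?n"
    unfolding o(1) o'(1) by (auto simp: sgn_real_def)
  moreover have "?n' \<noteq> ?n"
  proof
    assume eq: "?n' = ?n"
    have fne: "rel_interior F \<noteq> {}" unfolding F by (subst rel_interior_eq_empty) auto
    then obtain x where x: "x \<in> rel_interior F" by blast
    obtain e1 where e1: "e1 > 0" "\<And>y. y \<in> ball x e1 \<Longrightarrow> ?n \<bullet> (y - x) \<le> 0 \<Longrightarrow> y \<in> T"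
      using half_ball(1)[OF E(3), unfolded E(2), OF T(2) x] by blast
    obtain e2 where e2: "e2 > 0" "\<And>y. y \<in> ball x e2 \<Longrightarrow> ?n \<bullet> (y - x) \<le> 0 \<Longrightarrow> y \<in> T'"
      using half_ball(1)[OF E'(3), unfolded E'(2), OF T'(2) x] eq by auto
    let ?U = "ball x (min e1 e2) \<inter> {y. ?n \<bullet> y < ?n \<bullet> x}"
    have U: "open ?U" by (intro open_Int open_ball open_halfspace_lt)
    have "?U \<subseteq> T" using e1 by (auto simp: inner_diff_right)
    then have "?U \<subseteq> interior T" using U interior_maximal by blast
    let ?d = "min e1 e2 / 2"
    have "x - ?d *\<^sub>R ?n \<in> ?U"
      using e1(1) e2(1) o(2) by (auto simp: dist_norm inner_diff_right dot_square_norm)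
    then have y: "x - ?d *\<^sub>R ?n \<in> interior T" "x - ?d *\<^sub>R ?n \<in> T'"
      using \<open>?U \<subseteq> interior T\<close> e2 by (auto simp: inner_diff_right)
    then show False using same_element[OF T(1) T'(1)] ne by blast
  qed
  ultimately show ?thesis by blast
qed

lemma covers: "\<Omega> \<subseteq> \<Union>\<T>"
  using conforming closure_subset by (auto simp: conforming_triangulation_def)

text \<open>Some relative interior point of the face lies in the domain. A small step from there across the face ends in some element,
which contains that point and hence the whole face, as its intersection with the first element is a face of the latter.\<close>

lemma interior_face_neighbour:
  assumes T: "T \<in> \<T>" "F facet_of T" and F: "\<not> F \<subseteq> frontier \<Omega>"
  shows "\<exists>T'\<in>\<T>. T' \<noteq> T \<and> F facet_of T'"
proof -
  note E = element[OF T(1)]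
  let ?n = "outward_normal T F"
  obtain p where p: "p \<in> F" "p \<notin> frontier \<Omega>" using F by blast
  have "p \<in> closure \<Omega>"
    using p(1) facet_subset[OF T(2)] T(1) conforming by (auto simp: conforming_triangulation_def)
  then have "p \<in> \<Omega>" using p(2) open_domain by (simp add: frontier_def interior_open)
  have convF: "convex F" using facet[OF T] convex_convex_hull by metis
  have "closure (rel_interior F) = F"
    using convex_closure_rel_interior[OF convF] facet_compact[OF T] by (simp add: compact_imp_closed)
  then obtain x where x: "x \<in> rel_interior F" "x \<in> \<Omega>"
    using p(1) \<open>p \<in> \<Omega>\<close> open_Int_closure_eq_empty[OF open_domain, of "rel_interior F"] by blast
  have nrm: "norm ?n = 1"
  proof -
    obtain v where v: "v \<in> verts T" "F = convex hull (verts T - {v})" using facet[OF T] by metis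
    obtain a b c where abc: "verts T = {v, a, b, c}" "distinct [v, a, b, c]" "verts T - {v} = {a, b, c}" using tetra_labels[OF E(3) v(1)] .
    show ?thesis using outward_normal_tet(2)[of v a b c] E abc v by simp
  qed
  \<comment> \<open>a neighbourhood of \<open>x\<close> in the domain that only meets elements containing \<open>x\<close>\<close>
  let ?U = "\<Omega> \<inter> (\<Inter>S\<in>{S \<in> \<T>. x \<notin> S}. - S)"
  have "open ?U" using finite_mesh open_domain element_compact by (intro open_Int open_INT) (auto simp: compact_imp_closed open_Compl)
  moreover have "x \<in> ?U" using x by auto
  ultimately obtain e where e: "e > 0" "ball x e \<subseteq> ?U" by (meson open_contains_ball)
  let ?y = "x + (e / 2) *\<^sub>R ?n"
  have yb: "?y \<in> ball x e" using e(1) nrm by (simp add: dist_norm)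
  then obtain T' where T': "T' \<in> \<T>" "?y \<in> T'" using e(2) covers by blast
  have xT': "x \<in> T'" using T' yb e(2) by blast
  have xT: "x \<in> T" using x(1) rel_interior_subset facet_subset[OF T(2)] by blast
  have "?n \<bullet> (?y - x) > 0" using e(1) nrm by (simp add: dot_square_norm)
  then have yT: "?y \<notin> T" using half_ball(2)[OF E(3), unfolded E(2), OF T(2) x(1), of ?y] by auto
  have ne: "T' \<noteq> T" using yT T' by blast
  have "F \<subseteq> T \<inter> T'"
    by (rule subset_of_face_of[OF inter_face[OF T(1) T'(1)] facet_subset[OF T(2)]]) (use x(1) xT xT' in blast)
  then have vF: "verts F \<subseteq> verts T \<inter> verts T'"
  proof -
    obtain w where w: "F = convex hull (verts F)" "verts F \<subseteq> verts T" "\<not> affine_dependent (verts F)" using facet[OF T] by (metis Diff_subset)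
    show ?thesis
    proof
      fix u assume u: "u \<in> verts F"
      then have "u \<in> F" using w(1) hull_inc by metis
      then have "u \<in> convex hull (verts T \<inter> verts T')" using \<open>F \<subseteq> T \<inter> T'\<close> inter_vertices[OF T(1) T'(1)] by blast
      then have ua: "u \<in> affine hull (verts T \<inter> verts T')" using convex_hull_subset_affine_hull by blast
      show "u \<in> verts T \<inter> verts T'"
      proof (rule ccontr)
        assume "u \<notin> verts T \<inter> verts T'"
        then have "bary (verts T) u u = 0" using bary_subset(2)[OF element_indep[OF T(1)] _ ua] u w(2) by blast
        then show False using bary_vertex[OF element_indep[OF T(1)], of u u] u w(2) by auto
      qed
    qed
  qed
  obtain w where w: "w \<in> verts T" "verts F = verts T - {w}" "card (verts F) = 3" "F = convex hull (verts F)" using facet[OF T] by metis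
  have "w \<notin> verts T'"
  proof
    assume "w \<in> verts T'"
    then have "verts T \<subseteq> verts T'" using vF w by blast
    then have "T \<subseteq> T'" using element(2)[OF T(1)] element(2)[OF T'(1)] hull_mono by metis
    then show False using not_nested[OF T(1) T'(1)] ne by blast
  qed
  have c4: "card (verts T') = 4" "finite (verts T')" using tetraD[OF element(3)[OF T'(1)]] by auto
  have "card (verts T' - verts F) = 1" using c4 w(3) vF by (subst card_Diff_subset) (auto intro: finite_subset)
  then obtain w' where w': "verts T' - verts F = {w'}" by (auto simp: card_1_singleton_iff)
  then have "verts F = verts T' - {w'}" "w' \<in> verts T'" using vF by blast+
  then have "F facet_of T'"
    using tetra_facets(1)[OF element(3)[OF T'(1)]] w(4) unfolding element(2)[OF T'(1)] by auto
  then show ?thesis using T'(1) ne by blast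
qed

text \<open>A third element would have a normal opposite to two opposite normals.\<close>

lemma face_sides:
  assumes F: "F \<in> mesh_faces \<T>" "\<not> F \<subseteq> frontier \<Omega>"
  shows "{T \<in> \<T>. F facet_of T} = {elem1 \<T> F, elem2 \<T> F}" "elem1 \<T> F \<noteq> elem2 \<T> F"
    "elem1 \<T> F \<in> \<T>" "F facet_of elem1 \<T> F" "elem2 \<T> F \<in> \<T>" "F facet_of elem2 \<T> F"
    "outward_normal (elem1 \<T> F) F = face_normal \<T> F" "outward_normal (elem2 \<T> F) F = - face_normal \<T> F"
proof -
  obtain T where "T \<in> \<T>" "F facet_of T" using F(1) by (auto simp: mesh_faces_def)
  then have "\<exists>T. T \<in> \<T> \<and> F facet_of T" by blast
  from someI_ex[OF this] show 1: "elem1 \<T> F \<in> \<T>" "F facet_of elem1 \<T> F" by (auto simp: elem1_def)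
  have "\<exists>T. T \<in> \<T> \<and> F facet_of T \<and> T \<noteq> elem1 \<T> F" using interior_face_neighbour[OF 1 F(2)] by blast
  from someI_ex[OF this] show 2: "elem2 \<T> F \<in> \<T>" "F facet_of elem2 \<T> F" and ne: "elem1 \<T> F \<noteq> elem2 \<T> F"
    by (auto simp: elem2_def)
  show n: "outward_normal (elem1 \<T> F) F = face_normal \<T> F" by (simp add: face_normal_def)
  show n2: "outward_normal (elem2 \<T> F) F = - face_normal \<T> F" using opposite_normal[OF 1 2 ne] n by simp
  have "T = elem1 \<T> F \<or> T = elem2 \<T> F" if T: "T \<in> \<T>" "F facet_of T" for T
  proof (rule ccontr)
    assume no: "\<not> ?thesis"
    have "outward_normal T F = - outward_normal (elem1 \<T> F) F" "outward_normal T F = - outward_normal (elem2 \<T> F) F"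
      using opposite_normal[OF 1 T] opposite_normal[OF 2 T] no by auto
    then have "face_normal \<T> F = 0" using n n2 by (metis add.inverse_inverse eq_neg_iff_add_eq_0 scaleR_2 scaleR_eq_0_iff zero_neq_numeral)
    moreover have "norm (outward_normal T F) = 1"
    proof -
      obtain v where v: "v \<in> verts T" "F = convex hull (verts T - {v})" using facet[OF T] by metis
      obtain a b c where abc: "verts T = {v, a, b, c}" "distinct [v, a, b, c]" "verts T - {v} = {a, b, c}" using tetra_labels[OF element(3)[OF T(1)] v(1)] .
      show ?thesis using outward_normal_tet(2)[of v a b c] element[OF T(1)] abc v by simp
    qed
    ultimately show False using \<open>outward_normal T F = - outward_normal (elem1 \<T> F) F\<close> n by simp
  qed
  then show "{T \<in> \<T>. F facet_of T} = {elem1 \<T> F, elem2 \<T> F}" using 1 2 by blast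
qed

subsection \<open>Stars\<close>

definition star :: "(real^3) set \<Rightarrow> mesh" where
  "star \<sigma> = {T \<in> \<T>. \<sigma> \<subseteq> verts T}"

text \<open>The hypotheses say that \<open>K\<close> is closed under passing through faces that contain \<open>\<sigma>\<close>, and that none of these faces
is on the boundary. A generic segment close to the barycentre of \<open>\<sigma>\<close> meets no edge of the mesh, so it passes from
element to element through the relative interior of such faces, and \<open>K\<close> covers the segment as soon as it covers one
end.\<close>

lemma star_connected:
  assumes \<sigma>: "\<sigma> \<noteq> {}" and K: "K \<subseteq> star \<sigma>" "K \<noteq> {}"
    and closed: "\<And>T F. T \<in> K \<Longrightarrow> F facet_of T \<Longrightarrow> \<sigma> \<subseteq> verts F \<Longrightarrow> \<not> F \<subseteq> frontier \<Omega>"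
      "\<And>T F T'. T \<in> K \<Longrightarrow> F facet_of T \<Longrightarrow> \<sigma> \<subseteq> verts F \<Longrightarrow> T' \<in> \<T> \<Longrightarrow> F facet_of T' \<Longrightarrow> T' \<in> K"
  shows "K = star \<sigma>"
proof -
  obtain T0 where T0: "T0 \<in> K" using K by blast
  have T0': "T0 \<in> \<T>" "\<sigma> \<subseteq> verts T0" using T0 K by (auto simp: star_def)
  have fin\<sigma>: "finite \<sigma>" using T0'(2) tetraD(3)[OF element(3)[OF T0'(1)]] finite_subset by blast
  have ind\<sigma>: "\<not> affine_dependent \<sigma>" using T0' element_indep affine_dependent_subset by metis
  define z where "z = (\<Sum>v\<in>\<sigma>. (1 / real (card \<sigma>)) *\<^sub>R v)"
  have one: "(\<Sum>v\<in>\<sigma>. 1 / real (card \<sigma>)) = 1" using \<sigma> fin\<sigma> by simp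
  have zaff: "z \<in> affine hull \<sigma>" using one fin\<sigma> by (auto simp: affine_hull_finite z_def intro!: exI[of _ "\<lambda>_. 1 / real (card \<sigma>)"])
  have zconv: "z \<in> convex hull \<sigma>" using one fin\<sigma> by (auto simp: convex_hull_finite z_def intro!: exI[of _ "\<lambda>_. 1 / real (card \<sigma>)"])
  have zpos: "bary V z v > 0" if "\<not> affine_dependent V" "\<sigma> \<subseteq> V" "v \<in> \<sigma>" for V v
  proof -
    have "bary V z v = bary \<sigma> z v" by (rule bary_subset(1)[OF that(1,2) zaff that(3)])
    also have "\<dots> = 1 / real (card \<sigma>)" by (rule bary_unique[OF ind\<sigma> one z_def[symmetric] that(3)])
    finally show ?thesis using that(3) fin\<sigma> by (auto simp: card_gt_0_iff)
  qed
  have zin: "z \<in> T" if "T \<in> star \<sigma>" for T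
  proof -
    have "convex hull \<sigma> \<subseteq> T" using that element(2)[of T] hull_mono[of \<sigma> "verts T" convex] by (auto simp: star_def)
    then show ?thesis using zconv by blast
  qed
  have z_face: "\<sigma> \<subseteq> W" if V: "\<not> affine_dependent V" "\<sigma> \<subseteq> V" and W: "W \<subseteq> V" "z \<in> convex hull W" for V W
  proof (rule ccontr)
    assume "\<not> \<sigma> \<subseteq> W"
    then obtain v where v: "v \<in> \<sigma>" "v \<notin> W" by blast
    have "z \<in> affine hull W" using W(2) convex_hull_subset_affine_hull by blast
    then have "bary V z v = 0" using bary_subset(2)[OF V(1) W(1)] v V(2) by blast
    then show False using zpos[OF V v(1)] by simp
  qed
  have z_elem: "T \<in> star \<sigma>" if "T \<in> \<T>" "z \<in> T" for T
  proof -
    have "z \<in> T0 \<inter> T" using zin[of T0] T0 K that by blast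
    then have "\<sigma> \<subseteq> verts T0 \<inter> verts T"
      using z_face[OF element_indep[OF T0'(1)] T0'(2), of "verts T0 \<inter> verts T"] inter_vertices[OF T0'(1) that(1)] by auto
    then show ?thesis using that by (auto simp: star_def)
  qed
  \<comment> \<open>a neighbourhood of \<open>z\<close> that only meets faces containing \<open>z\<close>\<close>
  let ?far = "{F. (\<exists>T\<in>\<T>. F facet_of T) \<and> z \<notin> F}"
  have "finite {F. \<exists>T\<in>\<T>. F facet_of T}"
  proof -
    have "{F. \<exists>T\<in>\<T>. F facet_of T} = (\<Union>T\<in>\<T>. {F. F facet_of T})" by blast
    then show ?thesis using finite_mesh finite_facets by auto
  qed
  then have finfar: "finite ?far" by (rule finite_subset[rotated]) blast
  let ?U = "\<Inter>F\<in>?far. - F"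
  have "open ?U" using finfar facet_compact by (intro open_INT) (auto simp: compact_imp_closed open_Compl)
  moreover have "z \<in> ?U" by auto
  ultimately obtain e where e: "e > 0" "ball z e \<subseteq> ?U" by (meson open_contains_ball)
  let ?E = "\<Union>T\<in>\<T>. verts T \<times> verts T"
  have finE: "finite ?E" using finite_mesh tetraD(3)[OF element(3)] by auto
  have thin: "negligible (affine hull {x, u, w})" for x u w :: "real^3"
  proof -
    have "interior (affine hull {x, u, w}) = {}"
      by (rule empty_interior_affine_hull) (auto simp: card_insert_if)
    then show ?thesis by (subst negligible_convex_interior) (auto intro: affine_imp_convex)
  qed
  \<comment> \<open>Points near \<open>z\<close> may be chosen off the finitely many affine hulls of an edge and a further point. If that point is
an end of the edge itself, this avoids the lines through the edges.\<close>
  have generic: "\<exists>y. y \<in> interior T \<and> y \<in> ball z e \<and> (\<forall>(u, w)\<in>?E. y \<notin> affine hull {x u, u, w})"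
    if "T \<in> star \<sigma>" for T and x :: "real^3 \<Rightarrow> real^3"
  proof (rule ccontr)
    assume no: "\<not> ?thesis"
    have T: "T \<in> \<T>" using that by (simp add: star_def)
    have "z \<in> closure (interior T)" using element_interior[OF T] zin[OF that] by simp
    moreover have "z \<in> ball z e" using e(1) by simp
    ultimately have "interior T \<inter> ball z e \<noteq> {}"
      using open_Int_closure_eq_empty[OF open_ball, of z e "interior T"] by blast
    then have "\<not> negligible (interior T \<inter> ball z e)" by (intro open_not_negligible open_Int) auto
    moreover have "interior T \<inter> ball z e \<subseteq> (\<Union>p\<in>?E. affine hull {x (fst p), fst p, snd p})"
      using no by fastforce
    moreover have "negligible (\<Union>p\<in>?E. affine hull {x (fst p), fst p, snd p})"
      using finE thin by (intro negligible_Union) auto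
    ultimately show False using negligible_subset by blast
  qed
  have "T1 \<in> K" if T1: "T1 \<in> star \<sigma>" for T1
  proof -
    obtain x where x: "x \<in> interior T0" "x \<in> ball z e" "\<And>u w. (u, w) \<in> ?E \<Longrightarrow> x \<notin> affine hull {u, u, w}"
      using generic[of T0 "\<lambda>u. u"] T0 K by fast
    obtain y where y: "y \<in> interior T1" "y \<in> ball z e" "\<And>u w. (u, w) \<in> ?E \<Longrightarrow> y \<notin> affine hull {x, u, w}"
      using generic[OF T1, of "\<lambda>_. x"] by fast
    let ?S = "closed_segment x y" and ?UK = "\<Union>K"
    have Sb: "?S \<subseteq> ball z e" using x(2) y(2) by (simp add: closed_segment_subset)
    have no_edge: "p \<notin> convex hull {u, w}" if p: "p \<in> ?S" and uw: "(u, w) \<in> ?E" for p u w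
    proof
      assume "p \<in> convex hull {u, w}"
      then have pa: "p \<in> affine hull {u, w}" using convex_hull_subset_affine_hull by blast
      obtain t where t: "p = (1 - t) *\<^sub>R x + t *\<^sub>R y" "0 \<le> t" "t \<le> 1" using p by (auto simp: closed_segment_def)
      have "t \<noteq> 0" using pa x(3)[OF uw] t by auto
      then have "y = (1 - 1 / t) *\<^sub>R x + (1 / t) *\<^sub>R p"
        unfolding t(1) by (simp add: algebra_simps)
      moreover have "x \<in> affine hull {x, u, w}" by (simp add: hull_inc)
      moreover have "p \<in> affine hull {x, u, w}" using pa hull_mono[of "{u, w}" "{x, u, w}" affine] by blast
      ultimately have "y \<in> affine hull {x, u, w}" using mem_affine[OF affine_affine_hull, of x "{x, u, w}" p "1 - 1 / t" "1 / t"] by simp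
      then show False using y(3)[OF uw] by blast
    qed
    have finK: "finite K" using K finite_mesh by (auto simp: star_def intro: finite_subset)
    have clK: "closed ?UK" using finK K element_compact by (intro closed_Union) (auto simp: star_def compact_imp_closed)
    \<comment> \<open>the segment leaves an element of \<open>K\<close> only through the relative interior of a face, and \<open>K\<close> contains the element on
the other side\<close>
    have inner: "p \<in> interior ?UK" if p: "p \<in> ?S" "p \<in> ?UK" for p
    proof -
      obtain T where T: "T \<in> K" "p \<in> T" using p by blast
      have T': "T \<in> \<T>" using T K by (auto simp: star_def)
      note E = element[OF T']
      show ?thesis
      proof (cases "p \<in> interior T")
        case True
        then show ?thesis using T interior_mono[of T ?UK] by blast
      next
        case False
        have "p \<in> convex hull (verts T)" "p \<notin> rel_interior (convex hull (verts T))"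
          using T False element_interior[OF T'] E by auto
        then obtain w where w: "w \<in> verts T" "p \<in> convex hull (verts T - {w})"
          using rel_boundary_simplex[OF element_indep[OF T']] by blast
        let ?F = "convex hull (verts T - {w})"
        have F: "?F facet_of T" using tetra_facets(1)[OF E(3)] w(1) unfolding E(2) by blast
        have indF: "\<not> affine_dependent (verts T - {w})" by (rule affine_dependent_diff_singleton[OF E(3)])
        have vF: "verts ?F = verts T - {w}" by (rule verts_hull[OF indF])
        have ri: "p \<in> rel_interior ?F"
        proof (rule ccontr)
          assume "p \<notin> rel_interior ?F"
          then obtain w' where w': "w' \<in> verts T - {w}" "p \<in> convex hull (verts T - {w} - {w'})"
            using rel_boundary_simplex[OF indF w(2)] by blast
          have w'T: "w' \<in> verts T" "w \<noteq> w'" using w' by auto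
          obtain a b where ab: "verts T = {w, w', a, b}" "distinct [w, w', a, b]" using tetra_labels2[OF E(3) w(1) w'T] .
          have "verts T - {w} - {w'} = {a, b}" using ab by auto
          moreover have "(a, b) \<in> verts T \<times> verts T" unfolding ab(1) by simp
          then have "(a, b) \<in> ?E" using T' by blast
          ultimately show False using no_edge[OF p(1), of a b] w'(2) by simp
        qed
        have "z \<in> ?F"
        proof (rule ccontr)
          assume "z \<notin> ?F"
          then have "?F \<in> ?far" using F T' by blast
          then show False using e(2) Sb p(1) w(2) by blast
        qed
        then have \<sigma>F: "\<sigma> \<subseteq> verts ?F"
          using z_face[OF element_indep[OF T'], of "verts T - {w}"] T(1) K vF by (auto simp: star_def)
        have nb: "\<not> ?F \<subseteq> frontier \<Omega>" by (rule closed(1)[OF T(1) F \<sigma>F])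
        obtain T2 where T2: "T2 \<in> \<T>" "T2 \<noteq> T" "?F facet_of T2" using interior_face_neighbour[OF T' F nb] by blast
        have T2K: "T2 \<in> K" by (rule closed(2)[OF T(1) F \<sigma>F T2(1,3)])
        let ?n = "outward_normal T ?F"
        have opp: "outward_normal T2 ?F = - ?n" using opposite_normal[OF T' F T2(1,3)] T2(2) by blast
        note E2 = element[OF T2(1)]
        obtain e1 where e1: "e1 > 0" "\<And>q. q \<in> ball p e1 \<Longrightarrow> ?n \<bullet> (q - p) \<le> 0 \<Longrightarrow> q \<in> T"
          using half_ball(1)[OF E(3), unfolded E(2), OF F ri] by blast
        obtain e2 where e2: "e2 > 0" "\<And>q. q \<in> ball p e2 \<Longrightarrow> - ?n \<bullet> (q - p) \<le> 0 \<Longrightarrow> q \<in> T2"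
          using half_ball(1)[OF E2(3), unfolded E2(2), OF T2(3) ri] opp by auto
        have "ball p (min e1 e2) \<subseteq> ?UK"
        proof
          fix q assume q: "q \<in> ball p (min e1 e2)"
          show "q \<in> ?UK"
          proof (cases "?n \<bullet> (q - p) \<le> 0")
            case True
            then have "q \<in> T" using e1(2)[of q] q by simp
            then show ?thesis using T(1) by blast
          next
            case False
            then have "q \<in> T2" using e2(2)[of q] q by simp
            then show ?thesis using T2K by blast
          qed
        qed
        then show ?thesis using e1(1) e2(1) by (meson centre_in_ball interior_maximal min_less_iff_conj open_ball subsetD)
      qed
    qed
    \<comment> \<open>the part of the segment covered by \<open>K\<close> is open and closed in it\<close>
    have "openin (top_of_set ?S) (?S \<inter> ?UK)"
    proof -
      have "?S \<inter> ?UK = ?S \<inter> interior ?UK" using inner interior_subset by blast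
      then show ?thesis using openin_open_Int[OF open_interior, of ?S ?UK] by simp
    qed
    moreover have "closedin (top_of_set ?S) (?S \<inter> ?UK)" using clK closedin_closed_Int by blast
    moreover have "x \<in> ?S \<inter> ?UK" using x(1) T0 interior_subset by auto
    ultimately have "?S \<inter> ?UK = ?S" using connected_segment(1)[of x y] unfolding connected_clopen by blast
    then have "y \<in> ?UK" by auto
    then obtain T2 where T2: "T2 \<in> K" "y \<in> T2" by blast
    have "T1 = T2" using same_element[of T1 T2 y] y(1) T2 K T1 by (auto simp: star_def)
    then show ?thesis using T2 by simp
  qed
  then show ?thesis using K by blast
qed

lemma elements_overlap_negligible: "T \<in> \<T> \<Longrightarrow> T' \<in> \<T> \<Longrightarrow> T \<noteq> T' \<Longrightarrow> negligible (T \<inter> T')"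
proof (subst negligible_convex_interior)
  assume T: "T \<in> \<T>" "T' \<in> \<T>" "T \<noteq> T'"
  show "convex (T \<inter> T')" using T element_convex by (simp add: convex_Int)
  have "y \<notin> interior (T \<inter> T')" for y using same_element[OF T(1,2), of y] T(3) interior_subset[of T'] by auto
  then show "interior (T \<inter> T') = {}" by blast
qed

text \<open>Shrunk towards a common vertex to a common diameter, the elements around it stay disjoint and
  fill a fixed fraction of a ball.\<close>

lemma star_card: "real (card (star {v})) \<le> 64 * \<kappa> ^ 3"
proof (cases "star {v} = {}")
  case False
  let ?S = "star {v}"
  have fin: "finite ?S" using finite_mesh by (simp add: star_def)
  define d where "d = Min (encl_diam ` ?S)"
  have elem: "T \<in> \<T>" "v \<in> verts T" if "T \<in> ?S" for T using that by (auto simp: star_def)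
  have hpos: "encl_diam T > 0" if "T \<in> \<T>" for T using encl_diam_pos[OF element(1)[OF that]] element(2)[OF that] by simp
  have dle: "d \<le> encl_diam T" if "T \<in> ?S" for T unfolding d_def using fin that by simp
  have d: "d > 0" unfolding d_def using fin False hpos elem by (subst Min_gr_iff) auto
  let ?\<epsilon> = "\<lambda>T. d / encl_diam T"
  let ?G = "\<lambda>T. (\<lambda>x. ?\<epsilon> T *\<^sub>R x + (1 - ?\<epsilon> T) *\<^sub>R v) ` T"
  have e: "0 < ?\<epsilon> T" "?\<epsilon> T \<le> 1" if "T \<in> ?S" for T using d dle[OF that] hpos elem[OF that] by auto
  have vT: "v \<in> T" if "T \<in> ?S" for T using elem[OF that] element(2)[of T] hull_inc by metis
  have sub: "?G T \<subseteq> T" if "T \<in> ?S" for T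
  proof
    fix y assume "y \<in> ?G T"
    then obtain x where x: "x \<in> T" "y = ?\<epsilon> T *\<^sub>R x + (1 - ?\<epsilon> T) *\<^sub>R v" by blast
    show "y \<in> T" unfolding x(2)
      by (rule convexD[OF element_convex[OF elem(1)[OF that]] x(1) vT[OF that]]) (use e[OF that] in auto)
  qed
  let ?c = "unit_ball_vol 3 / rvol TYPE(3)"
  have meas: "measure lebesgue (?G T) \<ge> unit_ball_vol 3 * d ^ 3 / (64 * \<kappa> ^ 3)" if "T \<in> ?S" for T
  proof -
    have "?c * encl_diam T ^ 3 \<le> 64 * \<kappa> ^ 3 * (measure lebesgue T / rvol TYPE(3))"
      using jac_bounds(2)[OF element(1)[OF elem(1)[OF that]]] unfolding element(2)[OF elem(1)[OF that]] jac_def .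
    then have "unit_ball_vol 3 * encl_diam T ^ 3 \<le> 64 * \<kappa> ^ 3 * measure lebesgue T"
      using rvol_pos[where 'n=3] by (simp add: divide_simps)
    then have "(d / encl_diam T) ^ 3 * (unit_ball_vol 3 * encl_diam T ^ 3) \<le> (d / encl_diam T) ^ 3 * (64 * \<kappa> ^ 3 * measure lebesgue T)"
      using e[OF that] by (intro mult_left_mono) auto
    also have "\<dots> = measure lebesgue (?G T) * (64 * \<kappa> ^ 3)"
      using measure_lebesgue_affine[of "?\<epsilon> T" "(1 - ?\<epsilon> T) *\<^sub>R v" T] d hpos[OF elem(1)[OF that]] by simp
    also have "(d / encl_diam T) ^ 3 * (unit_ball_vol 3 * encl_diam T ^ 3) = unit_ball_vol 3 * d ^ 3"
      using hpos[OF elem(1)[OF that]] by (simp add: power_divide)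
    finally show ?thesis using kappa by (subst pos_divide_le_eq) auto
  qed
  have lm: "?G T \<in> lmeasurable" if "T \<in> ?S" for T
    by (intro lmeasurable_compact compact_continuous_image continuous_intros element_compact elem[OF that])
  have "real (card ?S) * (unit_ball_vol 3 * d ^ 3 / (64 * \<kappa> ^ 3)) = (\<Sum>T\<in>?S. unit_ball_vol 3 * d ^ 3 / (64 * \<kappa> ^ 3))" by simp
  also have "\<dots> \<le> (\<Sum>T\<in>?S. measure lebesgue (?G T))" using meas by (rule sum_mono)
  also have "\<dots> = measure lebesgue (\<Union>T\<in>?S. ?G T)"
  proof (rule measure_negligible_finite_Union_image[symmetric, OF fin lm])
    show "pairwise (\<lambda>T T'. negligible (?G T \<inter> ?G T')) ?S"
    proof (rule pairwiseI)
      fix T T' assume T: "T \<in> ?S" "T' \<in> ?S" "T \<noteq> T'"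
      show "negligible (?G T \<inter> ?G T')"
        by (rule negligible_subset[OF elements_overlap_negligible[OF elem(1)[OF T(1)] elem(1)[OF T(2)] T(3)]]) (use sub T in blast)
    qed
  qed
  also have "\<dots> \<le> measure lebesgue (cball v d)"
  proof (rule measure_mono_fmeasurable)
    show "(\<Union>T\<in>?S. ?G T) \<subseteq> cball v d"
    proof
      fix y assume "y \<in> (\<Union>T\<in>?S. ?G T)"
      then obtain T x where T: "T \<in> ?S" "x \<in> T" "y = ?\<epsilon> T *\<^sub>R x + (1 - ?\<epsilon> T) *\<^sub>R v" by blast
      have "dist v y = ?\<epsilon> T * dist v x"
      proof -
        have "v - y = ?\<epsilon> T *\<^sub>R (v - x)" unfolding T(3) by (simp add: algebra_simps)
        then show ?thesis using d hpos[OF elem(1)[OF T(1)]] by (simp add: dist_norm)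
      qed
      also have "\<dots> \<le> ?\<epsilon> T * encl_diam T"
        using e[OF T(1)] dist_le_encl_diam[OF compact_imp_bounded[OF element_compact[OF elem(1)[OF T(1)]]] vT[OF T(1)] T(2)] by (intro mult_left_mono) auto
      finally show "y \<in> cball v d" using hpos[OF elem(1)[OF T(1)]] by simp
    qed
    show "(\<Union>T\<in>?S. ?G T) \<in> sets lebesgue" using fin lm by (intro sets.finite_UN) (auto simp: fmeasurable_def)
  qed auto
  also have "\<dots> = unit_ball_vol 3 * d ^ 3" using content_cball[of d v] d by simp
  finally show ?thesis using d kappa by (simp add: field_simps)
qed (use kappa in auto)

end

section \<open>Conforming approximation of piecewise polynomials\<close>

lemma face_integral_cong:
  assumes F: "\<exists>a b c. F = convex hull {a, b, c}" and fg: "\<And>x. x \<in> F \<Longrightarrow> f x = g x"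
  shows "face_integral F f = face_integral F g"
proof -
  obtain a b c where abc: "(SOME (a, b, c). F = convex hull {a, b, c}) = (a, b, c)" using prod_cases3 by blast
  have "\<exists>p. case p of (a, b, c) \<Rightarrow> F = convex hull {a, b, c}" using F by auto
  from someI_ex[OF this] have h: "F = convex hull {a, b, c}" by (simp add: abc)
  have "param (tri a b c) z \<in> F" if "z \<in> refs" for z
    unfolding h param_def
    by (rule convex_sum) (use that in \<open>auto simp: sum_bc refs_iff tri_def intro!: hull_inc split: option.splits\<close>)
  then have "integral refs (\<lambda>z. f (param (tri a b c) z)) = integral refs (\<lambda>z. g (param (tri a b c) z))"
    by (intro Henstock_Kurzweil_Integration.integral_cong) (simp add: fg)
  then show ?thesis unfolding face_integral_def abc Let_def by (simp add: param_tri refs_2)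
qed

lemma Hom_iff_support:
  assumes "a \<in> Hom V k" "finite V" "finite W"
  shows "a \<in> Hom W k \<longleftrightarrow> {v. a v \<noteq> 0} \<subseteq> W"
proof -
  have s: "sum a V = sum a {v. a v \<noteq> 0}"
    using assms by (intro sum.mono_neutral_right) (auto simp: Hom_def)
  have "sum a W = sum a {v. a v \<noteq> 0}" if "{v. a v \<noteq> 0} \<subseteq> W"
    using assms that by (intro sum.mono_neutral_right) auto
  then show ?thesis using assms(1) s by (auto simp: Hom_def)
qed

definition around :: "mesh \<Rightarrow> (real^3) set \<Rightarrow> mesh" where
  "around \<T> T = {T' \<in> \<T>. verts T' \<inter> verts T \<noteq> {}}"

context mesh
begin

lemma mesh_facesE:
  assumes "F \<in> mesh_faces \<T>"
  obtains T where "T \<in> \<T>" "F facet_of T"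
  using assms by (auto simp: mesh_faces_def)

lemma finite_verts: "T \<in> \<T> \<Longrightarrow> finite (verts T)" "T \<in> \<T> \<Longrightarrow> card (verts T) = 4"
  using tetraD[OF element(3)] by auto

lemma facet_verts:
  assumes "T \<in> \<T>" "F facet_of T"
  shows "verts F \<subseteq> verts T" "finite (verts F)" "F = convex hull (verts F)" "\<not> affine_dependent (verts F)"
  using facet[OF assms] finite_verts[OF assms(1)] by (metis Diff_subset finite_Diff)+

lemma facet_triangle:
  assumes "T \<in> \<T>" "F facet_of T"
  obtains v a b c where "verts T = {v, a, b, c}" "distinct [v, a, b, c]" "verts F = {a, b, c}" "F = convex hull {a, b, c}" "\<not> affine_dependent {a, b, c}"
proof -
  obtain w where w: "w \<in> verts T" "verts F = verts T - {w}" "\<not> affine_dependent (verts F)" "F = convex hull (verts F)"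
    using facet[OF assms] by metis
  obtain a b c where abc: "verts T = {w, a, b, c}" "distinct [w, a, b, c]" "verts T - {w} = {a, b, c}"
    using tetra_labels[OF element(3)[OF assms(1)] w(1)] .
  show ?thesis by (rule that[OF abc(1,2)]) (use w abc in auto)
qed

lemma facet_is_triangle: "T \<in> \<T> \<Longrightarrow> F facet_of T \<Longrightarrow> \<exists>a b c. F = convex hull {a, b, c}"
  by (erule (1) facet_triangle) blast

lemma hpoly_on_facet:
  assumes T: "T \<in> \<T>" "F facet_of T" and x: "x \<in> F"
  shows "hpoly (verts T) k c (bary (verts T) x) = hpoly (verts F) k c (bary (verts F) x)"
proof -
  note f = facet_verts[OF T]
  have xa: "x \<in> affine hull (verts F)" using x f(3) convex_hull_subset_affine_hull by blast
  note b = bary_subset[OF element_indep[OF T(1)] f(1) xa]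
  have "hpoly (verts T) k c (bary (verts T) x) = hpoly (verts F) k c (bary (verts T) x)"
    by (rule hpoly_restrict[OF finite_verts(1)[OF T(1)] f(1)]) (rule b(2))
  also have "\<dots> = hpoly (verts F) k c (bary (verts F) x)"
    unfolding hpoly_def by (intro sum.cong arg_cong2[of _ _ _ _ "(*)"] prod.cong refl) (simp add: b(1))
  finally show ?thesis .
qed

lemma shared_facet_diam:
  assumes "T \<in> \<T>" "F facet_of T" "T' \<in> \<T>" "F facet_of T'"
  shows "encl_diam T \<le> 2 * \<kappa> * encl_diam T'"
proof -
  have "encl_diam T \<le> \<kappa> * encl_diam F"
    using facet_diam(2)[OF element(1)[OF assms(1)]] element(2)[OF assms(1)] assms(2) by simp
  also have "encl_diam F \<le> 2 * encl_diam T'"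
    using facet_diam(1)[OF element(1)[OF assms(3)]] element(2)[OF assms(3)] assms(4) by simp
  finally show ?thesis using kappa by simp
qed

lemma encl_diam_element_pos: "T \<in> \<T> \<Longrightarrow> encl_diam T > 0"
  using encl_diam_pos[OF element(1)] element(2) by metis

lemma encl_diam_facet_pos: "T \<in> \<T> \<Longrightarrow> F facet_of T \<Longrightarrow> encl_diam F > 0"
  using facet_diam(3)[OF element(1)] element(2) by metis

lemma finite_around: "finite (around \<T> T)"
  using finite_mesh by (simp add: around_def)

lemma card_around: "T \<in> \<T> \<Longrightarrow> real (card (around \<T> T)) \<le> 256 * \<kappa> ^ 3"
proof -
  assume T: "T \<in> \<T>"
  have "around \<T> T = (\<Union>v\<in>verts T. star {v})" by (auto simp: around_def star_def)
  then have "card (around \<T> T) \<le> (\<Sum>v\<in>verts T. card (star {v}))" using card_UN_le[OF finite_verts(1)[OF T]] by simp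
  then have "real (card (around \<T> T)) \<le> (\<Sum>v\<in>verts T. real (card (star {v})))" by (metis of_nat_le_iff of_nat_sum)
  also have "\<dots> \<le> (\<Sum>v\<in>verts T. 64 * \<kappa> ^ 3)" by (intro sum_mono star_card)
  also have "\<dots> = 256 * \<kappa> ^ 3" using finite_verts(2)[OF T] by simp
  finally show ?thesis .
qed

text \<open>Every element is near at most \<open>256 * \<kappa> ^ 3\<close> elements, \<open>64 * \<kappa> ^ 3\<close> for each vertex, so that local sums add up to a multiple of
the global one.\<close>

lemma sum_around_le:
  assumes "\<And>T. T \<in> \<T> \<Longrightarrow> 0 \<le> g T"
  shows "(\<Sum>T\<in>\<T>. \<Sum>T'\<in>around \<T> T. g T') \<le> 256 * \<kappa> ^ 3 * (\<Sum>T\<in>\<T>. g T)"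
proof -
  have "(\<Sum>T\<in>\<T>. \<Sum>T'\<in>around \<T> T. g T') = (\<Sum>T'\<in>\<T>. \<Sum>T\<in>around \<T> T'. g T')"
  proof -
    have "(\<Sum>T\<in>\<T>. \<Sum>T'\<in>around \<T> T. g T') = (\<Sum>T\<in>\<T>. \<Sum>T' | T' \<in> \<T> \<and> verts T' \<inter> verts T \<noteq> {}. g T')"
      by (simp add: around_def)
    also have "\<dots> = (\<Sum>T'\<in>\<T>. \<Sum>T | T \<in> \<T> \<and> verts T' \<inter> verts T \<noteq> {}. g T')"
      by (rule sum.swap_restrict[OF finite_mesh finite_mesh])
    finally show ?thesis by (simp add: around_def Int_commute)
  qed
  also have "\<dots> = (\<Sum>T'\<in>\<T>. real (card (around \<T> T')) * g T')" by simp
  also have "\<dots> \<le> (\<Sum>T'\<in>\<T>. 256 * \<kappa> ^ 3 * g T')"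
    using card_around assms by (intro sum_mono mult_right_mono) auto
  finally show ?thesis by (simp add: sum_distrib_left)
qed

end

text \<open>The area of the face is of the order of the square of the diameter of the element.\<close>

lemma face_coefficients_mesh:
  "\<exists>C>0. \<forall>\<Omega> \<T> T F c. mesh \<Omega> \<T> \<kappa> \<longrightarrow> T \<in> \<T> \<longrightarrow> F facet_of T \<longrightarrow>
     (encl_diam T)\<^sup>2 * (\<Sum>a\<in>Hom (verts F) k. (c a)\<^sup>2) \<le> C * face_integral F (\<lambda>x. (hpoly (verts F) k c (bary (verts F) x))\<^sup>2)"
proof -
  obtain C where C: "C > 0" "\<And>x y z c. \<not> affine_dependent {x, y, z} \<Longrightarrow> distinct [x, y, z] \<Longrightarrow>
     norm (cross3 (y - x) (z - x)) * (\<Sum>a\<in>Hom {x, y, z} k. (c a)\<^sup>2)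
       \<le> C * face_integral (convex hull {x, y, z}) (\<lambda>p. (hpoly {x, y, z} k c (bary {x, y, z} p))\<^sup>2)"
    using face_coefficients[of k] by blast
  define K where "K = 64 * \<bar>\<kappa>\<bar> ^ 3 / (unit_ball_vol 3 / rvol TYPE(3))"
  have u: "unit_ball_vol 3 / rvol TYPE(3) > 0" using rvol_pos[where 'n=3] by simp
  have K: "K \<ge> 0" unfolding K_def by (rule divide_nonneg_pos[OF _ u]) simp
  have "(encl_diam T)\<^sup>2 * (\<Sum>a\<in>Hom (verts F) k. (c a)\<^sup>2) \<le> (K * C + 1) * face_integral F (\<lambda>x. (hpoly (verts F) k c (bary (verts F) x))\<^sup>2)"
    if M: "mesh \<Omega> \<T> \<kappa>" and T: "T \<in> \<T>" "F facet_of T" for \<Omega> \<T> T F c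
  proof -
    interpret mesh \<Omega> \<T> \<kappa> by (rule M)
    obtain v a b d where abd: "verts T = {v, a, b, d}" "distinct [v, a, b, d]" "verts F = {a, b, d}" "F = convex hull {a, b, d}" "\<not> affine_dependent {a, b, d}"
      using facet_triangle[OF T] .
    let ?A = "norm (cross3 (b - a) (d - a))" and ?h = "encl_diam T" and ?S = "\<Sum>a\<in>Hom (verts F) k. (c a)\<^sup>2"
    let ?I = "face_integral F (\<lambda>x. (hpoly (verts F) k c (bary (verts F) x))\<^sup>2)"
    have h: "?h > 0" by (rule encl_diam_element_pos[OF T(1)])
    have "unit_ball_vol 3 / rvol TYPE(3) * ?h ^ 3 \<le> 64 * \<kappa> ^ 3 * jac T"
      using jac_bounds(2)[OF element(1)[OF T(1)]] element(2)[OF T(1)] by simp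
    also have "\<dots> \<le> 64 * \<kappa> ^ 3 * (?A * ?h)"
      using area_bounds(2)[OF element(1)[OF T(1)] abd(1,2)] element(2)[OF T(1)] kappa by (intro mult_left_mono) auto
    finally have "?h * (unit_ball_vol 3 / rvol TYPE(3) * ?h\<^sup>2) \<le> ?h * (64 * \<kappa> ^ 3 * ?A)"
      by (simp add: power2_eq_square power3_eq_cube ac_simps)
    then have "unit_ball_vol 3 / rvol TYPE(3) * ?h\<^sup>2 \<le> 64 * \<kappa> ^ 3 * ?A" by (rule mult_left_le_imp_le[OF _ h])
    then have "?h\<^sup>2 \<le> K * ?A" unfolding K_def using u kappa rvol_pos[where 'n=3] by (simp add: field_simps)
    then have "?h\<^sup>2 * ?S \<le> K * (?A * ?S)"
      using mult_right_mono[of "?h\<^sup>2" "K * ?A" ?S] by (simp add: sum_nonneg ac_simps)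
    also have "?A * ?S \<le> C * ?I" using C(2)[OF abd(5), of c] abd(2) unfolding abd(3) unfolding abd(4) by simp
    finally have "?h\<^sup>2 * ?S \<le> K * (C * ?I)" using K by (simp add: mult_left_mono)
    moreover have "0 \<le> ?I"
    proof -
      have "0 \<le> ?A * ?S" by (simp add: sum_nonneg)
      then have "0 \<le> C * ?I" using \<open>?A * ?S \<le> C * ?I\<close> by linarith
      then show ?thesis using C(1) by (simp add: zero_le_mult_iff)
    qed
    ultimately show ?thesis by (simp add: distrib_right mult.assoc)
  qed
  moreover have "K * C + 1 > 0" using K C(1) by (simp add: add_nonneg_pos)
  ultimately show ?thesis by blast
qed

text \<open>One value is picked for every Bernstein coefficient: zero at the boundary, and otherwise the coefficient of one of the
elements sharing it. The coefficients of two elements sharing it differ by at most the sum of the jumps along a chain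
of faces whose vertices include the support of the exponent. A chain either joins the two elements or ends at the
boundary.\<close>

lemma coefficient_averaging:
  "\<exists>C>0. \<forall>\<Omega> \<T> cT cF. mesh \<Omega> \<T> \<kappa> \<longrightarrow> 1 \<le> k \<longrightarrow> (\<forall>F\<in>mesh_faces \<T>. F \<subseteq> frontier \<Omega> \<longrightarrow> cF F = (\<lambda>_. 0)) \<longrightarrow>
     (\<exists>c. (\<forall>F\<in>mesh_faces \<T>. F \<subseteq> frontier \<Omega> \<longrightarrow> (\<forall>a\<in>Hom (verts F) k. c a = 0)) \<and>
        (\<forall>T\<in>\<T>. \<forall>a\<in>Hom (verts T) k. encl_diam T * (cT T a - c a)\<^sup>2 \<le> C *
           (\<Sum>T'\<in>around \<T> T. \<Sum>F | F facet_of T' \<and> a \<in> Hom (verts F) k. encl_diam T' * (cT T' a - cF F a)\<^sup>2)))"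
  (is "\<exists>C>0. ?P C")
proof -
  \<comment> \<open>at most \<open>N\<close> elements share a coefficient, a chain has at most \<open>M\<close> links, and along it the diameter changes by a
factor of at most \<open>L\<close>\<close>
  define N where "N = nat \<lceil>64 * \<kappa> ^ 3\<rceil>"
  define M where "M = N * N"
  define L where "L = (2 * \<bar>\<kappa>\<bar> + 1) ^ M"
  define C where "C = L * (2 * real M + 1)\<^sup>2 * (4 * real N) + 1"
  have L: "L \<ge> 1" unfolding L_def by (intro one_le_power) auto
  have "?P C"
  proof (intro allI impI)
    fix \<Omega> \<T> and cT cF :: "(real^3) set \<Rightarrow> (real^3 \<Rightarrow> nat) \<Rightarrow> real"
    assume Me: "mesh \<Omega> \<T> \<kappa>" and k: "1 \<le> k" and cF0: "\<forall>F\<in>mesh_faces \<T>. F \<subseteq> frontier \<Omega> \<longrightarrow> cF F = (\<lambda>_. 0)"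
    interpret mesh \<Omega> \<T> \<kappa> by (rule Me)
    let ?S = "\<lambda>a. {T \<in> \<T>. a \<in> Hom (verts T) k}"
    let ?bd = "\<lambda>a. \<exists>F\<in>mesh_faces \<T>. F \<subseteq> frontier \<Omega> \<and> a \<in> Hom (verts F) k"
    define c where "c = (\<lambda>a. if ?bd a then 0 else cT (SOME T. T \<in> ?S a) a)"
    have "encl_diam T * (cT T a - c a)\<^sup>2 \<le> C *
           (\<Sum>T'\<in>around \<T> T. \<Sum>F | F facet_of T' \<and> a \<in> Hom (verts F) k. encl_diam T' * (cT T' a - cF F a)\<^sup>2)"
      if T: "T \<in> \<T>" and a: "a \<in> Hom (verts T) k" for T a
    proof -
      let ?\<sigma> = "{v. a v \<noteq> 0}"
      have \<sigma>ne: "?\<sigma> \<noteq> {}"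
      proof
        assume "?\<sigma> = {}"
        then have "sum a (verts T) = 0" by auto
        then show False using a k by (simp add: Hom_def)
      qed
      have supp: "a \<in> Hom W k \<longleftrightarrow> ?\<sigma> \<subseteq> W" if "finite W" for W
        using Hom_iff_support[OF a finite_verts(1)[OF T] that] .
      have Sstar: "?S a = star ?\<sigma>" using supp finite_verts by (auto simp: star_def)
      obtain v where v: "v \<in> ?\<sigma>" using \<sigma>ne by blast
      have Ssub: "?S a \<subseteq> star {v}" unfolding Sstar using v by (auto simp: star_def)
      have fin: "finite (?S a)" using finite_mesh by simp
      have "real (card (?S a)) \<le> 64 * \<kappa> ^ 3"
        using card_mono[OF _ Ssub] star_card[of v] finite_mesh by (simp add: star_def)
      then have cardS: "card (?S a) \<le> N" unfolding N_def by linarith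
      have Saround: "?S a \<subseteq> around \<T> T"
      proof
        fix T' assume T': "T' \<in> ?S a"
        then have "v \<in> verts T'" "v \<in> verts T" using supp[OF finite_verts(1)] v T a by blast+
        then show "T' \<in> around \<T> T" using T' by (auto simp: around_def)
      qed
      \<comment> \<open>the elements that a chain reaches from \<open>T\<close>\<close>
      define R where "R = {(T1, T2). T1 \<in> ?S a \<and> T2 \<in> ?S a \<and> (\<exists>F. F facet_of T1 \<and> F facet_of T2 \<and> a \<in> Hom (verts F) k)}"
      define K where "K = R\<^sup>* `` {T}"
      have TS: "T \<in> ?S a" using T a by simp
      have KS: "K \<subseteq> ?S a"
      proof
        fix T' assume "T' \<in> K"
        then have "(T, T') \<in> R\<^sup>*" by (simp add: K_def)
        then show "T' \<in> ?S a" using TS by (induction rule: rtrancl_induct) (auto simp: R_def)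
      qed
      have TK: "T \<in> K" by (simp add: K_def)
      let ?e = "\<lambda>T' F. \<bar>cT T' a - cF F a\<bar>"
      let ?Fs = "\<lambda>T'. {F. F facet_of T' \<and> a \<in> Hom (verts F) k}"
      have finFs: "finite (?Fs T')" if "T' \<in> \<T>" for T' using finite_facets[OF that] by (rule finite_subset[rotated]) blast
      have finK: "finite K" using KS fin finite_subset by blast
      \<comment> \<open>all the jumps that a chain may meet\<close>
      define D where "D = (\<Sum>T'\<in>K. \<Sum>F\<in>?Fs T'. ?e T' F)"
      have eD: "?e T' F \<le> D" if "T' \<in> K" "F \<in> ?Fs T'" for T' F
      proof -
        have "?e T' F \<le> (\<Sum>F\<in>?Fs T'. ?e T' F)" using that KS finFs by (intro member_le_sum) auto
        also have "\<dots> \<le> D" unfolding D_def using that finK by (intro member_le_sum) (auto intro: sum_nonneg)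
        finally show ?thesis .
      qed
      have D0: "D \<ge> 0" unfolding D_def by (intro sum_nonneg) auto
      have chain: "\<bar>cT T a - cT T' a\<bar> \<le> 2 * real n * D \<and> encl_diam T \<le> (2 * \<kappa>) ^ n * encl_diam T' \<and> T' \<in> K" if "(T, T') \<in> R ^^ n" for n T'
        using that
      proof (induction n arbitrary: T')
        case 0
        then show ?case using TK by simp
      next
        case (Suc n)
        then obtain T1 where T1: "(T, T1) \<in> R ^^ n" "(T1, T') \<in> R" by auto
        note IH = Suc.IH[OF T1(1)]
        have T'K: "T' \<in> K" using IH T1(2) unfolding K_def by (auto intro: rtrancl_into_rtrancl)
        obtain F where F: "T1 \<in> \<T>" "T' \<in> \<T>" "F facet_of T1" "F facet_of T'" "a \<in> Hom (verts F) k" using T1(2) by (auto simp: R_def)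
        have "?e T1 F \<le> D" "?e T' F \<le> D" using eD IH T'K F by auto
        then have "\<bar>cT T a - cT T' a\<bar> \<le> 2 * real n * D + 2 * D" using IH by linarith
        moreover have "encl_diam T \<le> (2 * \<kappa>) ^ n * (2 * \<kappa> * encl_diam T')"
        proof -
          have "(2 * \<kappa>) ^ n * encl_diam T1 \<le> (2 * \<kappa>) ^ n * (2 * \<kappa> * encl_diam T')"
            using kappa by (intro mult_left_mono shared_facet_diam[OF F(1,3,2,4)]) auto
          then show ?thesis using IH by linarith
        qed
        ultimately show ?case using T'K by (simp add: algebra_simps)
      qed
      have finR: "finite R" by (rule finite_subset[OF _ finite_cartesian_product[OF fin fin]]) (auto simp: R_def)
      have "card R \<le> card (?S a \<times> ?S a)" using fin by (intro card_mono) (auto simp: R_def)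
      also have "\<dots> = card (?S a) * card (?S a)" by (rule card_cartesian_product)
      also have "\<dots> \<le> M" unfolding M_def using cardS by (intro mult_mono) auto
      finally have cardR: "card R \<le> M" .
      have comp: "\<bar>cT T a - cT T' a\<bar> \<le> 2 * real M * D \<and> encl_diam T \<le> L * encl_diam T'" if "T' \<in> K" for T'
      proof -
        have "(T, T') \<in> (\<Union>n\<in>{n. n \<le> card R}. R ^^ n)" using that rtrancl_finite_eq_relpow[OF finR] by (simp add: K_def)
        then obtain n where n: "n \<le> card R" "(T, T') \<in> R ^^ n" by blast
        have nM: "n \<le> M" using n cardR by simp
        have "2 * real n * D \<le> 2 * real M * D" using nM D0 by (intro mult_right_mono) auto
        moreover have "(2 * \<kappa>) ^ n \<le> L"
        proof -
          have "(2 * \<kappa>) ^ n \<le> (2 * \<kappa>) ^ M" using nM kappa by (intro power_increasing) auto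
          also have "\<dots> \<le> L" unfolding L_def using kappa by (intro power_mono) auto
          finally show ?thesis .
        qed
        moreover have "encl_diam T' > 0" using that KS encl_diam_element_pos by blast
        ultimately show ?thesis using chain[OF n(2)] mult_right_mono[of "(2 * \<kappa>) ^ n" L "encl_diam T'"] by linarith
      qed
      have diff: "\<bar>cT T a - c a\<bar> \<le> (2 * real M + 1) * D"
      \<comment> \<open>a chain reaches the boundary, where the picked value is 0, or the chains reach all elements sharing the coefficient\<close>
      proof (cases "\<exists>T'\<in>K. \<exists>F. F facet_of T' \<and> a \<in> Hom (verts F) k \<and> F \<subseteq> frontier \<Omega>")
        case True
        then obtain T' F where F: "T' \<in> K" "F facet_of T'" "a \<in> Hom (verts F) k" "F \<subseteq> frontier \<Omega>" by blast
        have mf: "F \<in> mesh_faces \<T>" using F KS by (auto simp: mesh_faces_def)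
        then have "c a = 0" using F by (auto simp: c_def)
        moreover have "cF F a = 0" using cF0 mf F(4) by simp
        then have "\<bar>cT T' a\<bar> \<le> D" using eD[OF F(1), of F] F by simp
        moreover have "(2 * real M + 1) * D = 2 * real M * D + D" by (simp add: distrib_right)
        moreover have "\<bar>cT T a - cT T' a\<bar> \<le> 2 * real M * D" using comp[OF F(1)] by blast
        ultimately show ?thesis by linarith
      next
        case False
        have KS': "K = star ?\<sigma>"
        proof (rule star_connected[OF \<sigma>ne])
          show "K \<subseteq> star ?\<sigma>" using KS Sstar by simp
          show "K \<noteq> {}" using TK by blast
          show "\<not> F \<subseteq> frontier \<Omega>" if "T' \<in> K" "F facet_of T'" "?\<sigma> \<subseteq> verts F" for T' F
          proof -
            have "T' \<in> \<T>" using that KS by blast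
            then have "a \<in> Hom (verts F) k" using supp facet_verts(2) that by blast
            then show ?thesis using False that by blast
          qed
          show "T2 \<in> K" if "T1 \<in> K" "F facet_of T1" "?\<sigma> \<subseteq> verts F" "T2 \<in> \<T>" "F facet_of T2" for T1 F T2
          proof -
            have T1: "T1 \<in> ?S a" using that KS by blast
            have "a \<in> Hom (verts F) k" using supp facet_verts(2)[OF that(4,5)] that by blast
            moreover have "a \<in> Hom (verts T2) k" using supp[OF finite_verts(1)[OF that(4)]] facet_verts(1)[OF that(4,5)] that(3) by blast
            ultimately have "(T1, T2) \<in> R" using T1 that by (auto simp: R_def)
            then show ?thesis using that(1) unfolding K_def by (auto intro: rtrancl_into_rtrancl)
          qed
        qed
        have "\<not> ?bd a"
        proof
          assume "?bd a"
          then obtain F where F: "F \<in> mesh_faces \<T>" "F \<subseteq> frontier \<Omega>" "a \<in> Hom (verts F) k" by blast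
          obtain T' where T': "T' \<in> \<T>" "F facet_of T'" using F(1) by (rule mesh_facesE)
          have "?\<sigma> \<subseteq> verts T'" using supp[OF facet_verts(2)[OF T']] F(3) facet_verts(1)[OF T'] by blast
          then have "T' \<in> K" using KS' T' by (simp add: star_def)
          then show False using False T' F by blast
        qed
        then have "c a = cT (SOME T. T \<in> ?S a) a" unfolding c_def by (simp only: if_False)
        moreover have "(SOME T. T \<in> ?S a) \<in> ?S a" using TS by (rule someI)
        then have "(SOME T. T \<in> ?S a) \<in> K" unfolding KS' Sstar .
        ultimately show ?thesis using comp[of "SOME T. T \<in> ?S a"] D0 by (simp add: algebra_simps)
      qed
      have D2: "D\<^sup>2 \<le> 4 * real N * (\<Sum>T'\<in>K. \<Sum>F\<in>?Fs T'. (?e T' F)\<^sup>2)"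
      proof -
        let ?P = "Sigma K ?Fs"
        have D': "D = (\<Sum>(T', F)\<in>?P. ?e T' F)" unfolding D_def using finK finFs KS by (subst sum.Sigma) auto
        have "card ?P = (\<Sum>T'\<in>K. card (?Fs T'))" using finK finFs KS by (subst card_SigmaI) auto
        also have "\<dots> \<le> (\<Sum>T'\<in>K. 4)"
        proof (rule sum_mono)
          fix T' assume "T' \<in> K"
          then have T': "T' \<in> \<T>" using KS by blast
          have "card (?Fs T') \<le> card {F. F facet_of T'}" using finite_facets[OF T'] by (intro card_mono) auto
          also have "\<dots> \<le> card (verts T')"
            using tetra_facets(1)[OF element(3)[OF T']] card_image_le[OF finite_verts(1)[OF T']] unfolding element(2)[OF T'] by simp
          finally show "card (?Fs T') \<le> 4" using finite_verts(2)[OF T'] by simp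
        qed
        also have "\<dots> \<le> 4 * N" using card_mono[OF fin KS] cardS by simp
        finally have cP: "real (card ?P) \<le> 4 * real N" by linarith
        have "D\<^sup>2 = (\<Sum>p\<in>?P. \<bar>case p of (T', F) \<Rightarrow> cT T' a - cF F a\<bar>)\<^sup>2"
          unfolding D' by (simp add: case_prod_beta)
        also have "\<dots> \<le> real (card ?P) * (\<Sum>p\<in>?P. (case p of (T', F) \<Rightarrow> cT T' a - cF F a)\<^sup>2)"
          by (rule sum_abs_squared_le)
        also have "\<dots> \<le> 4 * real N * (\<Sum>p\<in>?P. (case p of (T', F) \<Rightarrow> cT T' a - cF F a)\<^sup>2)"
          using cP by (intro mult_right_mono sum_nonneg) auto
        also have "(\<Sum>p\<in>?P. (case p of (T', F) \<Rightarrow> cT T' a - cF F a)\<^sup>2) = (\<Sum>T'\<in>K. \<Sum>F\<in>?Fs T'. (?e T' F)\<^sup>2)"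
          using finK finFs KS by (subst sum.Sigma) (auto simp: case_prod_beta)
        finally show ?thesis .
      qed
      let ?X = "\<Sum>T'\<in>around \<T> T. \<Sum>F\<in>?Fs T'. encl_diam T' * (cT T' a - cF F a)\<^sup>2"
      have "encl_diam T * (\<Sum>T'\<in>K. \<Sum>F\<in>?Fs T'. (?e T' F)\<^sup>2) \<le> L * ?X"
      proof -
        have "encl_diam T * (\<Sum>T'\<in>K. \<Sum>F\<in>?Fs T'. (?e T' F)\<^sup>2) = (\<Sum>T'\<in>K. \<Sum>F\<in>?Fs T'. encl_diam T * (cT T' a - cF F a)\<^sup>2)"
          by (simp add: sum_distrib_left)
        also have "\<dots> \<le> (\<Sum>T'\<in>K. \<Sum>F\<in>?Fs T'. L * (encl_diam T' * (cT T' a - cF F a)\<^sup>2))"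
          unfolding mult.assoc[symmetric] using comp by (intro sum_mono mult_right_mono) auto
        also have "\<dots> = L * (\<Sum>T'\<in>K. \<Sum>F\<in>?Fs T'. encl_diam T' * (cT T' a - cF F a)\<^sup>2)"
          by (simp add: sum_distrib_left)
        also have "\<dots> \<le> L * ?X"
        proof (intro mult_left_mono sum_mono2 finite_around)
          show "K \<subseteq> around \<T> T" using KS Saround by blast
          show "0 \<le> (\<Sum>F\<in>?Fs T'. encl_diam T' * (cT T' a - cF F a)\<^sup>2)" if "T' \<in> around \<T> T - K" for T'
            using that encl_diam_element_pos[of T'] by (intro sum_nonneg) (auto simp: around_def)
        qed (use L in auto)
        finally show ?thesis .
      qed
      have "(cT T a - c a)\<^sup>2 \<le> ((2 * real M + 1) * D)\<^sup>2" using diff by (rule abs_le_square_iff[THEN iffD1, OF order.trans]) simp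
      then have "encl_diam T * (cT T a - c a)\<^sup>2 \<le> encl_diam T * ((2 * real M + 1)\<^sup>2 * D\<^sup>2)"
        using encl_diam_element_pos[OF T] by (intro mult_left_mono) (auto simp: power_mult_distrib)
      also have "\<dots> \<le> encl_diam T * ((2 * real M + 1)\<^sup>2 * (4 * real N * (\<Sum>T'\<in>K. \<Sum>F\<in>?Fs T'. (?e T' F)\<^sup>2)))"
        using encl_diam_element_pos[OF T] D2 by (intro mult_left_mono) auto
      also have "\<dots> = (2 * real M + 1)\<^sup>2 * (4 * real N) * (encl_diam T * (\<Sum>T'\<in>K. \<Sum>F\<in>?Fs T'. (?e T' F)\<^sup>2))" by (simp only: ac_simps)
      also have "\<dots> \<le> (2 * real M + 1)\<^sup>2 * (4 * real N) * (L * ?X)"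
        using \<open>encl_diam T * (\<Sum>T'\<in>K. \<Sum>F\<in>?Fs T'. (?e T' F)\<^sup>2) \<le> L * ?X\<close> by (intro mult_left_mono) auto
      also have "\<dots> \<le> C * ?X"
      proof -
        have "0 \<le> ?X" by (intro sum_nonneg mult_nonneg_nonneg) (auto simp: around_def dest: encl_diam_element_pos)
        then show ?thesis unfolding C_def by (simp add: distrib_right ac_simps)
      qed
      finally show ?thesis .
    qed
    moreover have "\<forall>F\<in>mesh_faces \<T>. F \<subseteq> frontier \<Omega> \<longrightarrow> (\<forall>a\<in>Hom (verts F) k. c a = 0)" by (auto simp: c_def)
    ultimately show "\<exists>c. (\<forall>F\<in>mesh_faces \<T>. F \<subseteq> frontier \<Omega> \<longrightarrow> (\<forall>a\<in>Hom (verts F) k. c a = 0)) \<and>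
        (\<forall>T\<in>\<T>. \<forall>a\<in>Hom (verts T) k. encl_diam T * (cT T a - c a)\<^sup>2 \<le> C *
           (\<Sum>T'\<in>around \<T> T. \<Sum>F | F facet_of T' \<and> a \<in> Hom (verts F) k. encl_diam T' * (cT T' a - cF F a)\<^sup>2))"
      by blast
  qed
  moreover have "C > 0" unfolding C_def using L by (intro add_nonneg_pos mult_nonneg_nonneg) auto
  ultimately show ?thesis by blast
qed

text \<open>The function \<open>pc\<close> has the picked Bernstein coefficients, which makes it single-valued on faces. The differences of
coefficients are controlled by the jumps of coefficients across faces, and these by \<open>p - ph\<close> on the faces. The
differences in turn control the gradient of \<open>p - pc\<close>.\<close>

lemma conforming_approximation:
  "\<exists>C>0. \<forall>\<Omega> \<T> p ph. mesh \<Omega> \<T> \<kappa> \<longrightarrow> 1 \<le> k \<longrightarrow> (\<forall>T\<in>\<T>. pdeg k (p T)) \<longrightarrow>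
     (\<forall>F\<in>mesh_faces \<T>. \<exists>q. pdeg k q \<and> (\<forall>x\<in>F. ph F x = q x)) \<longrightarrow>
     (\<forall>F\<in>mesh_faces \<T>. F \<subseteq> frontier \<Omega> \<longrightarrow> (\<forall>x\<in>F. ph F x = 0)) \<longrightarrow>
     (\<exists>pc. (\<forall>T\<in>\<T>. pdeg k (pc T)) \<and>
        (\<forall>T\<in>\<T>. \<forall>T'\<in>\<T>. \<forall>F. F facet_of T \<longrightarrow> F facet_of T' \<longrightarrow> (\<forall>x\<in>F. pc T x = pc T' x)) \<and>
        (\<forall>T\<in>\<T>. \<forall>F. F facet_of T \<longrightarrow> F \<subseteq> frontier \<Omega> \<longrightarrow> (\<forall>x\<in>F. pc T x = 0)) \<and>
        (\<Sum>T\<in>\<T>. integral T (\<lambda>x. (norm (grad (\<lambda>y. p T y - pc T y) x))\<^sup>2))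
          \<le> C * (\<Sum>T\<in>\<T>. \<Sum>F | F facet_of T. inverse (encl_diam F) * face_integral F (\<lambda>x. (p T x - ph F x)\<^sup>2)))"
proof -
  obtain C0 where C0: "C0 > 0 \<and> (\<forall>\<Omega> \<T> cT cF. mesh \<Omega> \<T> \<kappa> \<longrightarrow> 1 \<le> k \<longrightarrow> (\<forall>F\<in>mesh_faces \<T>. F \<subseteq> frontier \<Omega> \<longrightarrow> cF F = (\<lambda>_. 0)) \<longrightarrow>
     (\<exists>c. (\<forall>F\<in>mesh_faces \<T>. F \<subseteq> frontier \<Omega> \<longrightarrow> (\<forall>a\<in>Hom (verts F) k. c a = 0)) \<and>
        (\<forall>T\<in>\<T>. \<forall>a\<in>Hom (verts T) k. encl_diam T * (cT T a - c a)\<^sup>2 \<le> C0 *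
           (\<Sum>T'\<in>around \<T> T. \<Sum>F | F facet_of T' \<and> a \<in> Hom (verts F) k. encl_diam T' * (cT T' a - cF F a)\<^sup>2))))"
    by (rule exE[OF coefficient_averaging[of \<kappa> k]])
  obtain C1 where C1: "C1 > 0" "\<And>\<Omega> \<T> T F c. mesh \<Omega> \<T> \<kappa> \<Longrightarrow> T \<in> \<T> \<Longrightarrow> F facet_of T \<Longrightarrow>
     (encl_diam T)\<^sup>2 * (\<Sum>a\<in>Hom (verts F) k. (c a)\<^sup>2) \<le> C1 * face_integral F (\<lambda>x. (hpoly (verts F) k c (bary (verts F) x))\<^sup>2)"
    using face_coefficients_mesh[of \<kappa> k] by blast
  define H where "H = real ((k + 1) ^ 4)"
  define C3 where "C3 = unit_ball_vol 3 / rvol TYPE(3) * ((4 * real k * \<kappa>)\<^sup>2 * H * rvol TYPE(3))"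
  define C where "C = C3 * (H * C0 * (256 * \<bar>\<kappa>\<bar> ^ 3 * (2 * C1))) + 1"
  have H0: "H \<ge> 0" by (simp add: H_def)
  have C30: "C3 \<ge> 0" unfolding C3_def using rvol_pos[where 'n=3] H0 by (intro mult_nonneg_nonneg divide_nonneg_nonneg) auto
  show ?thesis
  proof (intro exI[of _ C] conjI allI impI)
    show "0 < C" unfolding C_def using C30 H0 conjunct1[OF C0] C1(1) by (intro add_nonneg_pos mult_nonneg_nonneg) auto
    fix \<Omega> \<T> p ph
    assume Me: "mesh \<Omega> \<T> \<kappa>" and k: "1 \<le> k" and p: "\<forall>T\<in>\<T>. pdeg k (p T)"
      and ph: "\<forall>F\<in>mesh_faces \<T>. \<exists>q. pdeg k q \<and> (\<forall>x\<in>F. ph F x = q x)"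
      and ph0: "\<forall>F\<in>mesh_faces \<T>. F \<subseteq> frontier \<Omega> \<longrightarrow> (\<forall>x\<in>F. ph F x = (0::real))"
    interpret mesh \<Omega> \<T> \<kappa> by (rule Me)
    have "\<forall>T\<in>\<T>. \<exists>c. \<forall>x. p T x = hpoly (verts T) k c (bary (verts T) x)"
      using bary_representation[OF element(3)] p by blast
    then obtain cT where cT: "\<And>T x. T \<in> \<T> \<Longrightarrow> p T x = hpoly (verts T) k (cT T) (bary (verts T) x)" by metis
    have "\<exists>c. (\<forall>x\<in>F. ph F x = hpoly (verts F) k c (bary (verts F) x)) \<and> (F \<subseteq> frontier \<Omega> \<longrightarrow> c = (\<lambda>_. 0))"
      if F: "F \<in> mesh_faces \<T>" for F
    proof (cases "F \<subseteq> frontier \<Omega>")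
      case True
      then show ?thesis using ph0 F by (intro exI[of _ "\<lambda>_. 0"]) (auto simp: hpoly_def)
    next
      case False
      obtain T where T: "T \<in> \<T>" "F facet_of T" using F by (rule mesh_facesE)
      obtain q where q: "pdeg k q" "\<forall>x\<in>F. ph F x = q x" using ph F by blast
      obtain c where "\<forall>x. q x = hpoly (verts T) k c (bary (verts T) x)" using bary_representation[OF element(3)[OF T(1)] q(1)] by blast
      then show ?thesis using q(2) hpoly_on_facet[OF T] False by (intro exI[of _ c]) auto
    qed
    then obtain cF where cF: "\<And>F x. F \<in> mesh_faces \<T> \<Longrightarrow> x \<in> F \<Longrightarrow> ph F x = hpoly (verts F) k (cF F) (bary (verts F) x)"
      "\<And>F. F \<in> mesh_faces \<T> \<Longrightarrow> F \<subseteq> frontier \<Omega> \<Longrightarrow> cF F = (\<lambda>_. 0)" by metis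
    have z: "\<forall>F\<in>mesh_faces \<T>. F \<subseteq> frontier \<Omega> \<longrightarrow> cF F = (\<lambda>_. 0)" using cF(2) by blast
    obtain c where c0: "(\<forall>F\<in>mesh_faces \<T>. F \<subseteq> frontier \<Omega> \<longrightarrow> (\<forall>a\<in>Hom (verts F) k. c a = 0)) \<and>
        (\<forall>T\<in>\<T>. \<forall>a\<in>Hom (verts T) k. encl_diam T * (cT T a - c a)\<^sup>2 \<le> C0 *
           (\<Sum>T'\<in>around \<T> T. \<Sum>F | F facet_of T' \<and> a \<in> Hom (verts F) k. encl_diam T' * (cT T' a - cF F a)\<^sup>2))"
      by (rule exE[OF C0[THEN conjunct2, THEN spec, THEN spec, THEN spec, THEN spec, THEN mp, OF Me, THEN mp, OF k, THEN mp, OF z]])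
    have c1: "c a = 0" if "F \<in> mesh_faces \<T>" "F \<subseteq> frontier \<Omega>" "a \<in> Hom (verts F) k" for F a
      using c0[THEN conjunct1] that by blast
    note c2 = c0[THEN conjunct2, THEN bspec, THEN bspec]
    define pc where "pc = (\<lambda>T x. hpoly (verts T) k c (bary (verts T) x))"
    let ?\<delta> = "\<lambda>T F. face_integral F (\<lambda>x. (p T x - ph F x)\<^sup>2)"
    have mf: "F \<in> mesh_faces \<T>" if "T \<in> \<T>" "F facet_of T" for T F using that by (auto simp: mesh_faces_def)
    have jump: "(encl_diam T)\<^sup>2 * (cT T a - cF F a)\<^sup>2 \<le> C1 * ?\<delta> T F" if T: "T \<in> \<T>" "F facet_of T" and a: "a \<in> Hom (verts F) k" for T F a
    proof -
      have "(cT T a - cF F a)\<^sup>2 \<le> (\<Sum>a\<in>Hom (verts F) k. (cT T a - cF F a)\<^sup>2)"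
        using a finite_Hom[OF facet_verts(2)[OF T]] by (intro member_le_sum) auto
      then have "(encl_diam T)\<^sup>2 * (cT T a - cF F a)\<^sup>2 \<le> (encl_diam T)\<^sup>2 * (\<Sum>a\<in>Hom (verts F) k. (cT T a - cF F a)\<^sup>2)"
        by (intro mult_left_mono) auto
      also have "\<dots> \<le> C1 * face_integral F (\<lambda>x. (hpoly (verts F) k (\<lambda>a. cT T a - cF F a) (bary (verts F) x))\<^sup>2)"
        by (rule C1(2)[OF Me T])
      also have "face_integral F (\<lambda>x. (hpoly (verts F) k (\<lambda>a. cT T a - cF F a) (bary (verts F) x))\<^sup>2) = ?\<delta> T F"
      proof (rule face_integral_cong)
        show "\<exists>a b c. F = convex hull {a, b, c}" by (rule facet_is_triangle[OF T])
        show "(hpoly (verts F) k (\<lambda>a. cT T a - cF F a) (bary (verts F) x))\<^sup>2 = (p T x - ph F x)\<^sup>2" if "x \<in> F" for x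
          using cT[OF T(1)] cF(1)[OF mf[OF T] that] hpoly_on_facet[OF T that] by (simp add: hpoly_diff)
      qed
      finally show ?thesis .
    qed
    define G where "G = (\<lambda>T. \<Sum>F | F facet_of T. 2 * C1 * (inverse (encl_diam F) * ?\<delta> T F))"
    have \<delta>0: "0 \<le> ?\<delta> T F" if T: "T \<in> \<T>" "F facet_of T" for T F
    proof -
      have eq: "?\<delta> T F = face_integral F (\<lambda>x. (hpoly (verts F) k (\<lambda>a. cT T a - cF F a) (bary (verts F) x))\<^sup>2)"
      proof (rule face_integral_cong)
        show "\<exists>a b c. F = convex hull {a, b, c}" by (rule facet_is_triangle[OF T])
        show "(p T x - ph F x)\<^sup>2 = (hpoly (verts F) k (\<lambda>a. cT T a - cF F a) (bary (verts F) x))\<^sup>2" if "x \<in> F" for x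
          using cT[OF T(1)] cF(1)[OF mf[OF T] that] hpoly_on_facet[OF T that] by (simp add: hpoly_diff)
      qed
      have "0 \<le> (encl_diam T)\<^sup>2 * (\<Sum>a\<in>Hom (verts F) k. (cT T a - cF F a)\<^sup>2)" by (simp add: sum_nonneg)
      also have "\<dots> \<le> C1 * ?\<delta> T F" unfolding eq by (rule C1(2)[OF Me T])
      finally show ?thesis using C1(1) by (simp add: zero_le_mult_iff)
    qed
    have G0: "0 \<le> G T" if "T \<in> \<T>" for T
      unfolding G_def using \<delta>0[OF that] C1(1) encl_diam_facet_pos[OF that] by (intro sum_nonneg mult_nonneg_nonneg) (auto simp: less_imp_le)
    have coef: "encl_diam T * (cT T a - c a)\<^sup>2 \<le> C0 * (\<Sum>T'\<in>around \<T> T. G T')" if T: "T \<in> \<T>" and a: "a \<in> Hom (verts T) k" for T a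
    proof -
      have "(\<Sum>F | F facet_of T' \<and> a \<in> Hom (verts F) k. encl_diam T' * (cT T' a - cF F a)\<^sup>2) \<le> G T'" if T': "T' \<in> around \<T> T" for T'
      proof -
        have T'm: "T' \<in> \<T>" using T' by (simp add: around_def)
        note h = encl_diam_element_pos[OF T'm]
        have "encl_diam T' * (cT T' a - cF F a)\<^sup>2 \<le> 2 * C1 * (inverse (encl_diam F) * ?\<delta> T' F)" if F: "F facet_of T'" "a \<in> Hom (verts F) k" for F
        proof -
          have hF: "0 < encl_diam F" "encl_diam F \<le> 2 * encl_diam T'"
            using encl_diam_facet_pos[OF T'm F(1)] facet_diam(1)[OF element(1)[OF T'm]] element(2)[OF T'm] F(1) by auto
          have "encl_diam F * (encl_diam T' * (cT T' a - cF F a)\<^sup>2) \<le> 2 * encl_diam T' * (encl_diam T' * (cT T' a - cF F a)\<^sup>2)"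
            using hF h by (intro mult_right_mono) auto
          also have "\<dots> = 2 * ((encl_diam T')\<^sup>2 * (cT T' a - cF F a)\<^sup>2)" by (simp add: power2_eq_square)
          also have "\<dots> \<le> 2 * (C1 * ?\<delta> T' F)" using jump[OF T'm F] by simp
          finally show ?thesis using hF(1) by (simp add: field_simps)
        qed
        then have "(\<Sum>F | F facet_of T' \<and> a \<in> Hom (verts F) k. encl_diam T' * (cT T' a - cF F a)\<^sup>2)
           \<le> (\<Sum>F | F facet_of T' \<and> a \<in> Hom (verts F) k. 2 * C1 * (inverse (encl_diam F) * ?\<delta> T' F))" by (intro sum_mono) auto
        also have "\<dots> \<le> G T'" unfolding G_def
          using finite_facets[OF T'm] \<delta>0[OF T'm] C1(1) encl_diam_facet_pos[OF T'm]
          by (intro sum_mono2) (auto intro!: mult_nonneg_nonneg simp: less_imp_le)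
        finally show ?thesis .
      qed
      then have "(\<Sum>T'\<in>around \<T> T. \<Sum>F | F facet_of T' \<and> a \<in> Hom (verts F) k. encl_diam T' * (cT T' a - cF F a)\<^sup>2) \<le> (\<Sum>T'\<in>around \<T> T. G T')"
        by (rule sum_mono)
      then show ?thesis using c2[OF T a] conjunct1[OF C0] by (meson mult_left_mono less_imp_le order.trans)
    qed
    have pcdeg: "pdeg k (pc T)" if "T \<in> \<T>" for T
      unfolding pc_def using hpoly_pdeg[OF finite_verts(1)[OF that], of "\<lambda>v x. bary (verts T) x v"] pdeg_bary[OF element(3)[OF that]] by simp
    have elem: "integral T (\<lambda>x. (norm (grad (\<lambda>y. p T y - pc T y) x))\<^sup>2) \<le> C3 * (H * C0) * (\<Sum>T'\<in>around \<T> T. G T')" if T: "T \<in> \<T>" for T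
    proof -
      note E = element[OF T]
      let ?q = "\<lambda>y. p T y - pc T y" and ?d = "\<lambda>a. cT T a - c a" and ?h = "encl_diam T"
      have h: "?h > 0" by (rule encl_diam_element_pos[OF T])
      have q: "?q x = hpoly (verts T) k ?d (bary (verts T) x)" for x by (simp add: cT[OF T] pc_def hpoly_diff)
      have qd: "pdeg k ?q" using p T pcdeg[OF T] by (intro pdeg_diff) auto
      let ?S = "\<Sum>a\<in>Hom (verts T) k. (?d a)\<^sup>2"
      have cH: "real (card (Hom (verts T) k)) \<le> H" unfolding H_def of_nat_le_iff by (rule card_Hom[OF finite_verts(2)[OF T] finite_verts(1)[OF T]])
      have "?h\<^sup>2 * integral T (\<lambda>x. (norm (grad ?q x))\<^sup>2) = integral T (\<lambda>x. (?h * norm (grad ?q x))\<^sup>2)"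
        by (simp add: power_mult_distrib)
      also have "\<dots> \<le> jac T * ((4 * real k * \<kappa>)\<^sup>2 * (H * ?S) * rvol TYPE(3))"
      proof (rule integral_tetra_le[OF E(3), unfolded E(2)])
        show "continuous_on T (\<lambda>x. (?h * norm (grad ?q x))\<^sup>2)" by (intro continuous_intros pdeg_continuous_grad[OF qd])
        fix x assume x: "x \<in> T"
        have "?h * norm (grad ?q x) \<le> 4 * real k * \<kappa> * (\<Sum>a\<in>Hom (verts T) k. \<bar>?d a\<bar>)"
          using grad_hpoly_le[OF E(1) _ q, unfolded E(2), OF x] .
        then have "(?h * norm (grad ?q x))\<^sup>2 \<le> (4 * real k * \<kappa> * (\<Sum>a\<in>Hom (verts T) k. \<bar>?d a\<bar>))\<^sup>2"
          using h by (intro power_mono) auto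
        also have "\<dots> = (4 * real k * \<kappa>)\<^sup>2 * (\<Sum>a\<in>Hom (verts T) k. \<bar>?d a\<bar>)\<^sup>2" by (rule power_mult_distrib)
        also have "\<dots> \<le> (4 * real k * \<kappa>)\<^sup>2 * (real (card (Hom (verts T) k)) * ?S)"
          by (intro mult_left_mono sum_abs_squared_le) auto
        also have "\<dots> \<le> (4 * real k * \<kappa>)\<^sup>2 * (H * ?S)"
          using cH by (intro mult_left_mono mult_right_mono sum_nonneg) auto
        finally show "(?h * norm (grad ?q x))\<^sup>2 \<le> (4 * real k * \<kappa>)\<^sup>2 * (H * ?S)" .
      qed
      also have "\<dots> \<le> (unit_ball_vol 3 / rvol TYPE(3) * ?h ^ 3) * ((4 * real k * \<kappa>)\<^sup>2 * (H * ?S) * rvol TYPE(3))"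
        using jac_bounds(1)[OF E(1)] H0 rvol_pos[where 'n=3] unfolding E(2) by (intro mult_right_mono mult_nonneg_nonneg sum_nonneg) auto
      also have "\<dots> = ?h\<^sup>2 * (C3 * (?h * ?S))" unfolding C3_def by (simp only: power2_eq_square power3_eq_cube ac_simps)
      finally have A: "integral T (\<lambda>x. (norm (grad ?q x))\<^sup>2) \<le> C3 * (?h * ?S)" using h by (simp add: mult_le_cancel_left_pos)
      have "?h * ?S = (\<Sum>a\<in>Hom (verts T) k. ?h * (?d a)\<^sup>2)" by (simp add: sum_distrib_left)
      also have "\<dots> \<le> (\<Sum>a\<in>Hom (verts T) k. C0 * (\<Sum>T'\<in>around \<T> T. G T'))" by (intro sum_mono coef[OF T])
      also have "\<dots> = real (card (Hom (verts T) k)) * (C0 * (\<Sum>T'\<in>around \<T> T. G T'))" by simp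
      also have "\<dots> \<le> H * (C0 * (\<Sum>T'\<in>around \<T> T. G T'))"
        using cH conjunct1[OF C0] G0 by (intro mult_right_mono mult_nonneg_nonneg sum_nonneg) (auto simp: around_def)
      finally have B: "?h * ?S \<le> H * (C0 * (\<Sum>T'\<in>around \<T> T. G T'))" .
      show ?thesis using order.trans[OF A mult_left_mono[OF B C30]] by (simp only: ac_simps)
    qed
    have "(\<Sum>T\<in>\<T>. integral T (\<lambda>x. (norm (grad (\<lambda>y. p T y - pc T y) x))\<^sup>2)) \<le> (\<Sum>T\<in>\<T>. C3 * (H * C0) * (\<Sum>T'\<in>around \<T> T. G T'))"
      using elem by (rule sum_mono)
    also have "\<dots> = C3 * (H * C0) * (\<Sum>T\<in>\<T>. \<Sum>T'\<in>around \<T> T. G T')" by (simp only: sum_distrib_left)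
    also have "\<dots> \<le> C3 * (H * C0) * (256 * \<kappa> ^ 3 * (\<Sum>T\<in>\<T>. G T))"
      using C30 H0 conjunct1[OF C0] by (intro mult_left_mono sum_around_le G0) auto
    also have "(\<Sum>T\<in>\<T>. G T) = 2 * C1 * (\<Sum>T\<in>\<T>. \<Sum>F | F facet_of T. inverse (encl_diam F) * ?\<delta> T F)"
      by (simp only: G_def sum_distrib_left)
    also have "C3 * (H * C0) * (256 * \<kappa> ^ 3 * (2 * C1 * (\<Sum>T\<in>\<T>. \<Sum>F | F facet_of T. inverse (encl_diam F) * ?\<delta> T F)))
        = (C - 1) * (\<Sum>T\<in>\<T>. \<Sum>F | F facet_of T. inverse (encl_diam F) * ?\<delta> T F)"
      unfolding C_def using kappa by (simp add: ac_simps)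
    also have "\<dots> \<le> C * (\<Sum>T\<in>\<T>. \<Sum>F | F facet_of T. inverse (encl_diam F) * ?\<delta> T F)"
      using \<delta>0 encl_diam_facet_pos by (intro mult_right_mono sum_nonneg mult_nonneg_nonneg) (auto simp: less_imp_le)
    finally have bound: "(\<Sum>T\<in>\<T>. integral T (\<lambda>x. (norm (grad (\<lambda>y. p T y - pc T y) x))\<^sup>2))
          \<le> C * (\<Sum>T\<in>\<T>. \<Sum>F | F facet_of T. inverse (encl_diam F) * ?\<delta> T F)" .
    have agree: "pc T x = pc T' x" if "T \<in> \<T>" "T' \<in> \<T>" "F facet_of T" "F facet_of T'" "x \<in> F" for T T' F x
      using that hpoly_on_facet by (simp add: pc_def)
    have zero: "pc T x = 0" if "T \<in> \<T>" "F facet_of T" "F \<subseteq> frontier \<Omega>" "x \<in> F" for T F x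
      using that hpoly_on_facet[OF that(1,2,4)] c1[OF mf[OF that(1,2)] that(3)] by (simp add: pc_def hpoly_def)
    show "\<exists>pc. (\<forall>T\<in>\<T>. pdeg k (pc T)) \<and>
        (\<forall>T\<in>\<T>. \<forall>T'\<in>\<T>. \<forall>F. F facet_of T \<longrightarrow> F facet_of T' \<longrightarrow> (\<forall>x\<in>F. pc T x = pc T' x)) \<and>
        (\<forall>T\<in>\<T>. \<forall>F. F facet_of T \<longrightarrow> F \<subseteq> frontier \<Omega> \<longrightarrow> (\<forall>x\<in>F. pc T x = 0)) \<and>
        (\<Sum>T\<in>\<T>. integral T (\<lambda>x. (norm (grad (\<lambda>y. p T y - pc T y) x))\<^sup>2))
          \<le> C * (\<Sum>T\<in>\<T>. \<Sum>F | F facet_of T. inverse (encl_diam F) * ?\<delta> T F)"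
      using bound agree zero pcdeg by (intro exI[of _ pc]) blast
  qed
qed

section \<open>Inner products on the mesh\<close>

text \<open>What integration over an element and over a face have in common. These properties imply the Cauchy--Schwarz inequality.\<close>

definition posfun :: "'x::topological_space set \<Rightarrow> (('x \<Rightarrow> real) \<Rightarrow> real) \<Rightarrow> bool" where
  "posfun K L \<longleftrightarrow>
     (\<forall>f g. continuous_on K f \<longrightarrow> continuous_on K g \<longrightarrow> L (\<lambda>x. f x + g x) = L f + L g) \<and>
     (\<forall>c f. continuous_on K f \<longrightarrow> L (\<lambda>x. c * f x) = c * L f) \<and>
     (\<forall>f. continuous_on K f \<longrightarrow> (\<forall>x\<in>K. 0 \<le> f x) \<longrightarrow> 0 \<le> L f)"

lemma posfunD:
  assumes "posfun K L"
  shows posfun_add: "continuous_on K f \<Longrightarrow> continuous_on K g \<Longrightarrow> L (\<lambda>x. f x + g x) = L f + L g"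
    and posfun_cmult: "continuous_on K f \<Longrightarrow> L (\<lambda>x. c * f x) = c * L f"
    and posfun_nonneg: "continuous_on K f \<Longrightarrow> (\<And>x. x \<in> K \<Longrightarrow> 0 \<le> f x) \<Longrightarrow> 0 \<le> L f"
  using assms unfolding posfun_def by blast+

lemma posfun_diff:
  assumes L: "posfun K L" and f: "continuous_on K f" and g: "continuous_on K g"
  shows "L (\<lambda>x. f x - g x) = L f - L g"
  using posfun_add[OF L f, of "\<lambda>x. -1 * g x"] posfun_cmult[OF L g, of "-1"] g by (simp add: continuous_on_minus)

lemma posfun_mono:
  assumes L: "posfun K L" and f: "continuous_on K f" and g: "continuous_on K g" and le: "\<And>x. x \<in> K \<Longrightarrow> f x \<le> g x"
  shows "L f \<le> L g"
  using posfun_nonneg[OF L continuous_on_diff[OF g f]] posfun_diff[OF L g f] le by simp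

lemma posfun_sum:
  assumes L: "posfun K L" and f: "\<And>i. i \<in> I \<Longrightarrow> continuous_on K (f i)"
  shows "L (\<lambda>x. \<Sum>i\<in>I. f i x) = (\<Sum>i\<in>I. L (f i))"
  using f
proof (induction I rule: infinite_finite_induct)
  case (insert i I)
  then have "L (\<lambda>x. f i x + (\<Sum>i\<in>I. f i x)) = L (f i) + L (\<lambda>x. \<Sum>i\<in>I. f i x)"
    by (intro posfun_add[OF L] continuous_on_sum) auto
  then show ?case using insert by simp
qed (use posfun_cmult[OF L continuous_on_const, of 0] in auto)

lemma posfun_Cauchy_Schwarz:
  fixes u v :: "'x::topological_space \<Rightarrow> 'b::euclidean_space"
  assumes L: "posfun K L" and u: "continuous_on K u" and v: "continuous_on K v"
  shows "\<bar>L (\<lambda>x. u x \<bullet> v x)\<bar> \<le> sqrt (L (\<lambda>x. u x \<bullet> u x)) * sqrt (L (\<lambda>x. v x \<bullet> v x))"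
proof -
  let ?A = "L (\<lambda>x. u x \<bullet> u x)" and ?B = "L (\<lambda>x. u x \<bullet> v x)" and ?C = "L (\<lambda>x. v x \<bullet> v x)"
  have c: "continuous_on K (\<lambda>x. u x \<bullet> u x)" "continuous_on K (\<lambda>x. u x \<bullet> v x)" "continuous_on K (\<lambda>x. v x \<bullet> v x)"
    using u v by (auto intro: continuous_intros)
  have q: "0 \<le> t\<^sup>2 * ?A + (2 * t * ?B + ?C)" for t
  proof -
    have "0 \<le> L (\<lambda>x. (t *\<^sub>R u x + v x) \<bullet> (t *\<^sub>R u x + v x))"
      using u v by (intro posfun_nonneg[OF L] continuous_intros) auto
    also have "(\<lambda>x. (t *\<^sub>R u x + v x) \<bullet> (t *\<^sub>R u x + v x)) = (\<lambda>x. t\<^sup>2 * (u x \<bullet> u x) + (2 * t * (u x \<bullet> v x) + v x \<bullet> v x))"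
      by (rule ext) (simp add: inner_add_left inner_add_right inner_commute power2_eq_square)
    also have "L \<dots> = t\<^sup>2 * ?A + (2 * t * ?B + ?C)"
      using c by (simp only: posfun_add[OF L] posfun_cmult[OF L] continuous_on_add continuous_on_mult_const continuous_on_mult_left)
    finally show ?thesis .
  qed
  have A: "0 \<le> ?A" and C: "0 \<le> ?C" using posfun_nonneg[OF L c(1)] posfun_nonneg[OF L c(3)] by auto
  have "?B\<^sup>2 \<le> ?A * ?C"
  proof (cases "?A = 0")
    case True
    have "?B = 0"
    proof (rule ccontr)
      assume "?B \<noteq> 0"
      then have "2 * (- (?C + 1) / (2 * ?B)) * ?B = - (?C + 1)" by simp
      then show False using q[of "- (?C + 1) / (2 * ?B)"] True by simp
    qed
    then show ?thesis using True by simp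
  next
    case False
    have "0 \<le> ?A * ((- ?B / ?A)\<^sup>2 * ?A + (2 * (- ?B / ?A) * ?B + ?C))" by (rule mult_nonneg_nonneg[OF A q])
    also have "\<dots> = ?A * ?C - ?B\<^sup>2" using False by (simp add: field_simps power2_eq_square)
    finally show ?thesis by simp
  qed
  then have "sqrt (?B\<^sup>2) \<le> sqrt (?A * ?C)" by (rule real_sqrt_le_mono)
  then show ?thesis by (simp add: real_sqrt_mult)
qed

lemma sum_posfun_Cauchy_Schwarz:
  fixes u v :: "'i \<Rightarrow> 'x::topological_space \<Rightarrow> 'b::euclidean_space"
  assumes L: "\<And>i. i \<in> I \<Longrightarrow> posfun (K i) (L i)" and u: "\<And>i. i \<in> I \<Longrightarrow> continuous_on (K i) (u i)" and v: "\<And>i. i \<in> I \<Longrightarrow> continuous_on (K i) (v i)"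
  shows "\<bar>\<Sum>i\<in>I. L i (\<lambda>x. u i x \<bullet> v i x)\<bar> \<le> sqrt (\<Sum>i\<in>I. L i (\<lambda>x. u i x \<bullet> u i x)) * sqrt (\<Sum>i\<in>I. L i (\<lambda>x. v i x \<bullet> v i x))"
proof -
  have nn: "0 \<le> L i (\<lambda>x. w i x \<bullet> w i x)" if "i \<in> I" "continuous_on (K i) (w i)" for i and w :: "'i \<Rightarrow> 'x \<Rightarrow> 'b"
    using that by (intro posfun_nonneg[OF L] continuous_intros) auto
  let ?a = "\<lambda>i. sqrt (L i (\<lambda>x. u i x \<bullet> u i x))" and ?b = "\<lambda>i. sqrt (L i (\<lambda>x. v i x \<bullet> v i x))"
  have "\<bar>\<Sum>i\<in>I. L i (\<lambda>x. u i x \<bullet> v i x)\<bar> \<le> (\<Sum>i\<in>I. ?a i * ?b i)"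
    using assms by (intro order.trans[OF sum_abs] sum_mono posfun_Cauchy_Schwarz) auto
  also have "\<dots> \<le> (\<Sum>i\<in>I. \<bar>?a i\<bar> * \<bar>?b i\<bar>)" by (intro sum_mono mult_mono) (use nn u v in auto)
  also have "\<dots> \<le> L2_set ?a I * L2_set ?b I" by (rule L2_set_mult_ineq)
  also have "L2_set ?a I = sqrt (\<Sum>i\<in>I. L i (\<lambda>x. u i x \<bullet> u i x))"
    unfolding L2_set_def using nn u by (intro arg_cong[of _ _ sqrt] sum.cong) auto
  also have "L2_set ?b I = sqrt (\<Sum>i\<in>I. L i (\<lambda>x. v i x \<bullet> v i x))"
    unfolding L2_set_def using nn v by (intro arg_cong[of _ _ sqrt] sum.cong) auto
  finally show ?thesis .
qed

subsection \<open>Polynomial vector fields\<close>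

definition vdeg :: "nat \<Rightarrow> (real^3 \<Rightarrow> real^3) \<Rightarrow> bool" where
  "vdeg j w \<longleftrightarrow> (\<forall>i. pdeg j (\<lambda>x. w x $ i))"

lemma vdeg_continuous: "vdeg j w \<Longrightarrow> continuous_on S w"
proof -
  assume "vdeg j w"
  then have "continuous_on S (\<lambda>x. \<chi> i. w x $ i)" by (intro continuous_on_vec_lambda pdeg_continuous) (auto simp: vdeg_def)
  then show ?thesis by (simp only: vec_nth_inverse)
qed

lemma vdeg_mono: "vdeg i w \<Longrightarrow> i \<le> j \<Longrightarrow> vdeg j w"
  using pdeg_mono by (auto simp: vdeg_def)

lemma vdeg_grad: "pdeg j f \<Longrightarrow> vdeg (j - 1) (grad f)"
  using pdeg_pderivative by (auto simp: vdeg_def grad_def)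

lemma vdeg_scaleR: "vdeg j w \<Longrightarrow> vdeg j (\<lambda>x. c *\<^sub>R w x)"
  by (auto simp: vdeg_def intro: pdeg_cmult)

lemma pdeg_divergence: "vdeg j w \<Longrightarrow> pdeg (j - 1) (divergence w)"
  unfolding divergence_def[abs_def] vdeg_def by (intro pdeg_sum pdeg_pderivative) auto

lemma vdeg_curl: "vdeg j w \<Longrightarrow> vdeg (j - 1) (curl w)"
  unfolding vdeg_def curl_def
proof
  fix i assume w: "\<forall>i. pdeg j (\<lambda>x. w x $ i)"
  show "pdeg (j - 1) (\<lambda>x. (vector [pderivative 2 (\<lambda>y. w y $ 3) x - pderivative 3 (\<lambda>y. w y $ 2) x,
      pderivative 3 (\<lambda>y. w y $ 1) x - pderivative 1 (\<lambda>y. w y $ 3) x,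
      pderivative 1 (\<lambda>y. w y $ 2) x - pderivative 2 (\<lambda>y. w y $ 1) x] :: real^3) $ i)"
    using exhaust_3[of i] w by (auto intro!: pdeg_diff pdeg_pderivative simp del: One_nat_def)
qed

lemma pdeg_inner: "vdeg j w \<Longrightarrow> pdeg j (\<lambda>x. n \<bullet> w x)"
  unfolding inner_vec_def vdeg_def by (auto intro!: pdeg_sum pdeg_cmult)

lemma continuous_on_cross_const: "continuous_on S w \<Longrightarrow> continuous_on S (\<lambda>x :: real^3. cross3 n (w x))"
  by (intro continuous_on_cross continuous_on_const)

lemma curl_zero: "curl (\<lambda>_. 0) = (\<lambda>_. 0)"
  by (rule ext) (simp add: curl_def pderivative_const vec_eq_iff forall_3)

lemma divergence_zero: "divergence (\<lambda>_. 0) = (\<lambda>_. 0)"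
  by (rule ext) (simp add: divergence_def pderivative_const)

lemma grad_zero: "grad (\<lambda>_. 0) = (\<lambda>_. 0)"
  by (rule ext) (simp add: grad_def pderivative_const vec_eq_iff)

lemma vpoly_elemD: "v \<in> vpoly_elem j \<T> \<Longrightarrow> vdeg j (v T)"
proof -
  assume v: "v \<in> vpoly_elem j \<T>"
  have "pdeg j (\<lambda>x. v T x $ i)" for i
  proof (cases "T \<in> \<T>")
    case True
    then show ?thesis using v by (auto simp: vpoly_elem_def poly_elem_def poly_fun_iff_pdeg)
  next
    case False
    then have "(\<lambda>x. v T x $ i) = (\<lambda>_. 0)" using v by (auto simp: vpoly_elem_def poly_elem_def)
    then show ?thesis by (simp add: pdeg_const)
  qed
  then show ?thesis by (simp add: vdeg_def)
qed

lemma vpoly_elemI: "(\<And>T. T \<in> \<T> \<Longrightarrow> vdeg j (v T)) \<Longrightarrow> (\<And>T. T \<notin> \<T> \<Longrightarrow> v T = (\<lambda>_. 0)) \<Longrightarrow> v \<in> vpoly_elem j \<T>"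
  by (auto simp: vpoly_elem_def poly_elem_def poly_fun_iff_pdeg vdeg_def)

lemma vpoly_elem_outside: "v \<in> vpoly_elem j \<T> \<Longrightarrow> T \<notin> \<T> \<Longrightarrow> v T = (\<lambda>_. 0)"
  by (auto simp: vpoly_elem_def poly_elem_def fun_eq_iff vec_eq_iff)

lemma poly_elemD: "q \<in> poly_elem j \<T> \<Longrightarrow> pdeg j (q T)"
  by (cases "T \<in> \<T>") (auto simp: poly_elem_def poly_fun_iff_pdeg intro: pdeg_const)

lemma poly_elemI: "(\<And>T. T \<in> \<T> \<Longrightarrow> pdeg j (q T)) \<Longrightarrow> (\<And>T. T \<notin> \<T> \<Longrightarrow> q T = (\<lambda>_. 0)) \<Longrightarrow> q \<in> poly_elem j \<T>"
  by (auto simp: poly_elem_def poly_fun_iff_pdeg)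

lemma poly_faceD: "q \<in> poly_face j \<T> \<Longrightarrow> F \<in> mesh_faces \<T> \<Longrightarrow> \<exists>p. pdeg j p \<and> (\<forall>x\<in>F. q F x = p x)"
  by (fastforce simp: poly_face_def poly_fun_iff_pdeg)

lemma poly_face_continuous: "q \<in> poly_face j \<T> \<Longrightarrow> F \<in> mesh_faces \<T> \<Longrightarrow> continuous_on F (q F)"
  using poly_faceD[of q j \<T> F] pdeg_continuous continuous_on_cong[of F F "q F"] by metis

lemma vpoly_face_continuous:
  assumes "v \<in> vpoly_face j \<T>" "F \<in> mesh_faces \<T>"
  shows "continuous_on F (v F)"
proof -
  have "continuous_on F (\<lambda>x. v F x $ i)" for i
    using poly_face_continuous[of "\<lambda>T x. v T x $ i"] assms by (auto simp: vpoly_face_def)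
  then have "continuous_on F (\<lambda>x. \<chi> i. v F x $ i)" by (rule continuous_on_vec_lambda)
  then show ?thesis by (simp only: vec_nth_inverse)
qed

subsection \<open>Integration by parts\<close>

context mesh
begin

lemma posfun_element: "T \<in> \<T> \<Longrightarrow> posfun T (integral T)"
  unfolding posfun_def
  by (auto intro!: integral_add integral_nonneg continuous_integrable_on element_compact)

lemma posfun_facet:
  assumes T: "T \<in> \<T>" "F facet_of T"
  shows "posfun F (face_integral F)"
proof -
  obtain v a b c where abc: "distinct [v, a, b, c]" "F = convex hull {a, b, c}" "\<not> affine_dependent {a, b, c}" using facet_triangle[OF T] by metis
  have d: "distinct [a, b, c]" using abc(1) by simp
  let ?P = "param (tri a b c)" and ?A = "norm (cross3 (b - a) (c - a))"
  have I: "face_integral F f = ?A * integral refs (\<lambda>z. f (?P z))" if "continuous_on F f" for f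
    using face_integral_labelled[OF abc(3) d, of f] that abc(2) by simp
  have im: "?P z \<in> F" if "z \<in> refs" for z
    using imageI[OF that, of ?P] by (simp only: param_image[OF inj_tri[OF d]] range_tri abc(2))
  have c: "continuous_on refs (\<lambda>z. f (?P z))" if "continuous_on F f" for f :: "real^3 \<Rightarrow> real"
    by (rule continuous_on_compose2[OF that continuous_on_param]) (use im in auto)
  note i = continuous_integrable_on[OF compact_refs c]
  show ?thesis unfolding posfun_def
  proof (intro conjI allI impI)
    fix f g :: "real^3 \<Rightarrow> real" assume f: "continuous_on F f" and g: "continuous_on F g"
    show "face_integral F (\<lambda>x. f x + g x) = face_integral F f + face_integral F g"
      using I[OF f] I[OF g] I[OF continuous_on_add[OF f g]] integral_add[OF i[OF f] i[OF g]] by (simp add: distrib_left)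
  next
    fix e and f :: "real^3 \<Rightarrow> real" assume f: "continuous_on F f"
    show "face_integral F (\<lambda>x. e * f x) = e * face_integral F f"
      using I[OF f] I[OF continuous_on_mult_left[OF f]] by simp
  next
    fix f :: "real^3 \<Rightarrow> real" assume f: "continuous_on F f" "\<forall>x\<in>F. 0 \<le> f x"
    then show "0 \<le> face_integral F f" using I[OF f(1)] im by (simp add: integral_nonneg[OF i[OF f(1)]])
  qed
qed

lemma mesh_faceI: "T \<in> \<T> \<Longrightarrow> F facet_of T \<Longrightarrow> F \<in> mesh_faces \<T>"
  by (auto simp: mesh_faces_def)

lemma norm_outward_normal:
  assumes T: "T \<in> \<T>" "F facet_of T"
  shows "norm (outward_normal T F) = 1"
proof -
  obtain v a b c where abc: "verts T = {v, a, b, c}" "distinct [v, a, b, c]" "F = convex hull {a, b, c}" using facet_triangle[OF T] by metis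
  then show ?thesis using outward_normal_tet(2)[of v a b c] element[OF T(1)] by simp
qed

lemma divergence_theorem_vector:
  assumes T: "T \<in> \<T>" and w: "vdeg j w"
  shows "integral T (divergence w) = (\<Sum>F | F facet_of T. face_integral F (\<lambda>x. outward_normal T F \<bullet> w x))"
proof -
  note E = element[OF T]
  have wi: "pdeg j (\<lambda>x. w x $ i)" for i using w by (simp add: vdeg_def)
  have "divergence w = (\<lambda>x. \<Sum>i\<in>UNIV. grad (\<lambda>y. w y $ i) x \<bullet> axis i 1)"
    by (auto simp: divergence_def grad_def inner_axis)
  then have "integral T (divergence w) = (\<Sum>i\<in>UNIV. integral T (\<lambda>x. grad (\<lambda>y. w y $ i) x \<bullet> axis i 1))"
    using posfun_sum[OF posfun_element[OF T], of UNIV "\<lambda>i x. grad (\<lambda>y. w y $ i) x \<bullet> axis i 1"]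
    by (simp add: continuous_intros pdeg_continuous_grad[OF wi])
  also have "\<dots> = (\<Sum>i\<in>UNIV. \<Sum>F | F facet_of T. (outward_normal T F \<bullet> axis i 1) * face_integral F (\<lambda>x. w x $ i))"
    using divergence_theorem[OF wi E(3)] unfolding E(2) by (intro sum.cong) auto
  also have "\<dots> = (\<Sum>F | F facet_of T. \<Sum>i\<in>UNIV. (outward_normal T F \<bullet> axis i 1) * face_integral F (\<lambda>x. w x $ i))"
    by (rule sum.swap)
  also have "\<dots> = (\<Sum>F | F facet_of T. face_integral F (\<lambda>x. outward_normal T F \<bullet> w x))"
  proof (rule sum.cong[OF refl])
    fix F assume "F \<in> {F. F facet_of T}"
    then have L: "posfun F (face_integral F)" using posfun_facet[OF T] by simp
    show "(\<Sum>i\<in>UNIV. (outward_normal T F \<bullet> axis i 1) * face_integral F (\<lambda>x. w x $ i)) = face_integral F (\<lambda>x. outward_normal T F \<bullet> w x)"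
      unfolding inner_vec_def[of "outward_normal T F" "w _"]
      by (subst posfun_sum[OF L])
        (auto intro!: continuous_intros pdeg_continuous[OF wi] simp: posfun_cmult[OF L pdeg_continuous[OF wi]] inner_axis)
  qed
  finally show ?thesis .
qed

text \<open>The divergence theorem is applied to \<open>cross3 (u x) (s x)\<close>.\<close>

lemma curl_by_parts:
  assumes T: "T \<in> \<T>" and u: "vdeg i u" and s: "vdeg j s"
  shows "integral T (\<lambda>x. u x \<bullet> curl s x) = integral T (\<lambda>x. curl u x \<bullet> s x)
     - (\<Sum>F | F facet_of T. face_integral F (\<lambda>x. cross3 (outward_normal T F) (u x) \<bullet> s x))"
proof -
  let ?w = "\<lambda>x. cross3 (u x) (s x)"
  have ui: "pdeg i (\<lambda>x. u x $ l)" and sj: "pdeg j (\<lambda>x. s x $ l)" for l using u s by (auto simp: vdeg_def)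
  note d = pdeg_differentiable[OF ui] pdeg_differentiable[OF sj]
  have comp: "(\<lambda>y. ?w y $ 1) = (\<lambda>y. u y $ 2 * s y $ 3 - u y $ 3 * s y $ 2)"
    "(\<lambda>y. ?w y $ 2) = (\<lambda>y. u y $ 3 * s y $ 1 - u y $ 1 * s y $ 3)"
    "(\<lambda>y. ?w y $ 3) = (\<lambda>y. u y $ 1 * s y $ 2 - u y $ 2 * s y $ 1)"
    by (auto simp: cross3_def)
  have w: "vdeg (i + j) ?w" unfolding vdeg_def forall_3 comp by (intro conjI pdeg_diff pdeg_mult ui sj)
  have prod: "pderivative l (\<lambda>y. u y $ a * s y $ b - u y $ c * s y $ e) x =
      (u x $ a * pderivative l (\<lambda>y. s y $ b) x + pderivative l (\<lambda>y. u y $ a) x * s x $ b)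
      - (u x $ c * pderivative l (\<lambda>y. s y $ e) x + pderivative l (\<lambda>y. u y $ c) x * s x $ e)" for l a b c e x
    by (simp add: pderivative_diff pderivative_mult d differentiable_mult)
  have div: "divergence ?w x = curl u x \<bullet> s x - u x \<bullet> curl s x" for x
    unfolding divergence_def sum_3 comp prod by (simp add: curl_def inner_vec_def sum_3 algebra_simps)
  have c: "continuous_on T (\<lambda>x. curl u x \<bullet> s x)" "continuous_on T (\<lambda>x. u x \<bullet> curl s x)"
    using vdeg_continuous[OF u] vdeg_continuous[OF s] vdeg_continuous[OF vdeg_curl[OF u]] vdeg_continuous[OF vdeg_curl[OF s]]
    by (auto intro: continuous_intros)
  have "integral T (\<lambda>x. curl u x \<bullet> s x) - integral T (\<lambda>x. u x \<bullet> curl s x) = integral T (divergence ?w)"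
    using posfun_diff[OF posfun_element[OF T] c] by (simp add: div[abs_def] fun_eq_iff cong: Henstock_Kurzweil_Integration.integral_cong) (simp add: div)?
  also have "\<dots> = (\<Sum>F | F facet_of T. face_integral F (\<lambda>x. outward_normal T F \<bullet> ?w x))" by (rule divergence_theorem_vector[OF T w])
  also have "\<dots> = (\<Sum>F | F facet_of T. face_integral F (\<lambda>x. cross3 (outward_normal T F) (u x) \<bullet> s x))"
    by (intro sum.cong refl arg_cong2[of _ _ _ _ face_integral] ext) (simp add: cross3_simps)
  finally show ?thesis by simp
qed

text \<open>The divergence theorem is applied to \<open>q x *\<^sub>R u x\<close>.\<close>

lemma divergence_by_parts:
  assumes T: "T \<in> \<T>" and u: "vdeg i u" and q: "pdeg j q"
  shows "integral T (\<lambda>x. divergence u x * q x) = - integral T (\<lambda>x. u x \<bullet> grad q x)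
     + (\<Sum>F | F facet_of T. face_integral F (\<lambda>x. (outward_normal T F \<bullet> u x) * q x))"
proof -
  let ?w = "\<lambda>x. q x *\<^sub>R u x"
  have ui: "pdeg i (\<lambda>x. u x $ l)" for l using u by (auto simp: vdeg_def)
  have w: "vdeg (j + i) ?w" unfolding vdeg_def vector_scaleR_component real_scaleR_def by (intro allI pdeg_mult q ui)
  have div: "divergence ?w = (\<lambda>x. divergence u x * q x + u x \<bullet> grad q x)"
  proof
    fix x
    have "pderivative l (\<lambda>y. q y * u y $ l) x = q x * pderivative l (\<lambda>y. u y $ l) x + pderivative l q x * u x $ l" for l
      by (intro pderivative_mult pdeg_differentiable[OF q] pdeg_differentiable[OF ui])
    then show "divergence ?w x = divergence u x * q x + u x \<bullet> grad q x"
      by (simp add: divergence_def grad_def inner_vec_def sum.distrib sum_distrib_left sum_distrib_right mult.commute)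
  qed
  have c: "continuous_on T (\<lambda>x. divergence u x * q x)" "continuous_on T (\<lambda>x. u x \<bullet> grad q x)"
    using vdeg_continuous[OF u] pdeg_continuous[OF q] pdeg_continuous[OF pdeg_divergence[OF u]] pdeg_continuous_grad[OF q]
    by (auto intro: continuous_intros)
  have "integral T (\<lambda>x. divergence u x * q x) + integral T (\<lambda>x. u x \<bullet> grad q x) = integral T (divergence ?w)"
    unfolding div using posfun_add[OF posfun_element[OF T] c] by simp
  also have "\<dots> = (\<Sum>F | F facet_of T. face_integral F (\<lambda>x. outward_normal T F \<bullet> ?w x))" by (rule divergence_theorem_vector[OF T w])
  finally show ?thesis by (simp add: mult.commute)
qed

lemma sum_faces_swap:
  "(\<Sum>T\<in>\<T>. \<Sum>F | F facet_of T. g T F) = (\<Sum>F\<in>mesh_faces \<T>. \<Sum>T | T \<in> \<T> \<and> F facet_of T. g T F)"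
proof -
  have fin: "finite (mesh_faces \<T>)"
  proof -
    have "mesh_faces \<T> = (\<Union>T\<in>\<T>. {F. F facet_of T})" by (auto simp: mesh_faces_def)
    then show ?thesis using finite_mesh finite_facets by auto
  qed
  have "(\<Sum>T\<in>\<T>. \<Sum>F | F facet_of T. g T F) = (\<Sum>T\<in>\<T>. \<Sum>F | F \<in> mesh_faces \<T> \<and> F facet_of T. g T F)"
    by (intro sum.cong refl) (auto simp: mesh_faces_def)
  also have "\<dots> = (\<Sum>F\<in>mesh_faces \<T>. \<Sum>T | T \<in> \<T> \<and> F facet_of T. g T F)"
    by (rule sum.swap_restrict[OF finite_mesh fin])
  finally show ?thesis .
qed

lemma finite_mesh_faces: "finite (mesh_faces \<T>)"
proof -
  have "mesh_faces \<T> = (\<Union>T\<in>\<T>. {F. F facet_of T})" by (auto simp: mesh_faces_def)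
  then show ?thesis using finite_mesh finite_facets by auto
qed

lemma interior_facesD: "F \<in> interior_faces \<Omega> \<T> \<Longrightarrow> F \<in> mesh_faces \<T> \<and> \<not> F \<subseteq> frontier \<Omega>"
  by (auto simp: interior_faces_def boundary_faces_def)

lemma sum_interior_sides:
  assumes "F \<in> interior_faces \<Omega> \<T>"
  shows "(\<Sum>T | T \<in> \<T> \<and> F facet_of T. g T) = g (elem1 \<T> F) + g (elem2 \<T> F)"
  using face_sides[of F] interior_facesD[OF assms] by simp

lemma b_h_by_parts:
  assumes u: "u \<in> vpoly_elem k \<T>" and uh: "uh \<in> vpoly_face k \<T>" and s: "s \<in> vpoly_elem m \<T>"
  shows "b_h \<T> u uh s = - ip_elem \<T> (\<lambda>T. curl (u T)) s
     + ip_bdry \<T> (\<lambda>T F x. cross3 (outward_normal T F) (u T x - uh F x)) (\<lambda>T F x. s T x)"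
proof -
  have T: "integral T (\<lambda>x. u T x \<bullet> curl (s T) x) + (\<Sum>F | F facet_of T. face_integral F (\<lambda>x. cross3 (outward_normal T F) (uh F x) \<bullet> s T x))
     = integral T (\<lambda>x. curl (u T) x \<bullet> s T x) - (\<Sum>F | F facet_of T. face_integral F (\<lambda>x. cross3 (outward_normal T F) (u T x - uh F x) \<bullet> s T x))"
    if T: "T \<in> \<T>" for T
  proof -
    have "face_integral F (\<lambda>x. cross3 (outward_normal T F) (u T x - uh F x) \<bullet> s T x)
       = face_integral F (\<lambda>x. cross3 (outward_normal T F) (u T x) \<bullet> s T x) - face_integral F (\<lambda>x. cross3 (outward_normal T F) (uh F x) \<bullet> s T x)"
      if F: "F facet_of T" for F
    proof -
      have "face_integral F (\<lambda>x. cross3 (outward_normal T F) (u T x) \<bullet> s T x - cross3 (outward_normal T F) (uh F x) \<bullet> s T x)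
        = face_integral F (\<lambda>x. cross3 (outward_normal T F) (u T x) \<bullet> s T x) - face_integral F (\<lambda>x. cross3 (outward_normal T F) (uh F x) \<bullet> s T x)"
        by (intro posfun_diff[OF posfun_facet[OF T F]] continuous_on_inner continuous_on_cross_const
            vdeg_continuous[OF vpoly_elemD[OF u]] vdeg_continuous[OF vpoly_elemD[OF s]] vpoly_face_continuous[OF uh mesh_faceI[OF T F]])
      moreover have "cross3 n (a - b) \<bullet> c = cross3 n a \<bullet> c - cross3 n b \<bullet> c" for n a b c
        by (simp add: cross3_simps)
      ultimately show ?thesis by simp
    qed
    then show ?thesis
      using curl_by_parts[OF T vpoly_elemD[OF u] vpoly_elemD[OF s]] by (simp add: sum_subtractf)
  qed
  have "b_h \<T> u uh s = - (\<Sum>T\<in>\<T>. integral T (\<lambda>x. u T x \<bullet> curl (s T) x) + (\<Sum>F | F facet_of T. face_integral F (\<lambda>x. cross3 (outward_normal T F) (uh F x) \<bullet> s T x)))"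
    by (simp add: b_h_def ip_elem_def ip_bdry_def sum.distrib)
  also have "\<dots> = - (\<Sum>T\<in>\<T>. integral T (\<lambda>x. curl (u T) x \<bullet> s T x) - (\<Sum>F | F facet_of T. face_integral F (\<lambda>x. cross3 (outward_normal T F) (u T x - uh F x) \<bullet> s T x)))"
    using T by (intro arg_cong[of _ _ uminus] sum.cong) auto
  finally show ?thesis by (simp add: ip_elem_def ip_bdry_def sum_subtractf)
qed

lemma c_h_by_parts:
  assumes u: "u \<in> vpoly_elem k \<T>" and q: "q \<in> poly_elem k \<T>" and qh: "qh \<in> poly_face k \<T>"
  shows "c_h \<T> q qh u = - ip_elem \<T> u (\<lambda>T. grad (q T))
     + ip_bdry \<T> (\<lambda>T F x. outward_normal T F \<bullet> u T x) (\<lambda>T F x. q T x - qh F x)"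
proof -
  have T: "integral T (\<lambda>x. divergence (u T) x * q T x) - (\<Sum>F | F facet_of T. face_integral F (\<lambda>x. (outward_normal T F \<bullet> u T x) * qh F x))
     = - integral T (\<lambda>x. u T x \<bullet> grad (q T) x) + (\<Sum>F | F facet_of T. face_integral F (\<lambda>x. (outward_normal T F \<bullet> u T x) * (q T x - qh F x)))"
    if T: "T \<in> \<T>" for T
  proof -
    have "face_integral F (\<lambda>x. (outward_normal T F \<bullet> u T x) * (q T x - qh F x))
       = face_integral F (\<lambda>x. (outward_normal T F \<bullet> u T x) * q T x) - face_integral F (\<lambda>x. (outward_normal T F \<bullet> u T x) * qh F x)"
      if F: "F facet_of T" for F
      unfolding right_diff_distrib
      by (intro posfun_diff[OF posfun_facet[OF T F]] continuous_on_mult continuous_on_inner continuous_on_const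
            vdeg_continuous[OF vpoly_elemD[OF u]] pdeg_continuous[OF poly_elemD[OF q]] poly_face_continuous[OF qh mesh_faceI[OF T F]])
    then show ?thesis
      using divergence_by_parts[OF T vpoly_elemD[OF u] poly_elemD[OF q]] by (simp add: sum_subtractf)
  qed
  have "c_h \<T> q qh u = (\<Sum>T\<in>\<T>. integral T (\<lambda>x. divergence (u T) x * q T x) - (\<Sum>F | F facet_of T. face_integral F (\<lambda>x. (outward_normal T F \<bullet> u T x) * qh F x)))"
    by (simp add: c_h_def ip_elem_def ip_bdry_def sum_subtractf)
  also have "\<dots> = (\<Sum>T\<in>\<T>. - integral T (\<lambda>x. u T x \<bullet> grad (q T) x) + (\<Sum>F | F facet_of T. face_integral F (\<lambda>x. (outward_normal T F \<bullet> u T x) * (q T x - qh F x))))"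
    using T by (intro sum.cong) auto
  finally show ?thesis by (simp add: ip_elem_def ip_bdry_def sum.distrib sum_negf sum_subtractf)
qed

text \<open>Summed by faces, the two contributions to an interior face have opposite normals and combine to the jump, while \<open>qh\<close>
vanishes on boundary faces.\<close>

lemma c_h_jumps:
  assumes u: "u \<in> vpoly_elem k \<T>" and qh: "qh \<in> Phat0 k \<Omega> \<T>"
  shows "c_h \<T> q qh u = ip_elem \<T> (\<lambda>T. divergence (u T)) q
     - (\<Sum>F\<in>interior_faces \<Omega> \<T>. face_integral F (\<lambda>x. jump \<Omega> \<T> (\<lambda>T y. face_normal \<T> F \<bullet> u T y) F x * qh F x))"
proof -
  have qh': "qh \<in> poly_face k \<T>" and qh0: "F \<in> boundary_faces \<Omega> \<T> \<Longrightarrow> x \<in> F \<Longrightarrow> qh F x = 0" for F x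
    using qh by (auto simp: Phat0_def)
  let ?g = "\<lambda>T F. face_integral F (\<lambda>x. (outward_normal T F \<bullet> u T x) * qh F x)"
  have "ip_bdry \<T> (\<lambda>T F x. outward_normal T F \<bullet> u T x) (\<lambda>T F x. qh F x) = (\<Sum>F\<in>mesh_faces \<T>. \<Sum>T | T \<in> \<T> \<and> F facet_of T. ?g T F)"
    using sum_faces_swap[of ?g] by (simp add: ip_bdry_def)
  also have "\<dots> = (\<Sum>F\<in>interior_faces \<Omega> \<T>. \<Sum>T | T \<in> \<T> \<and> F facet_of T. ?g T F)"
  proof (rule sum.mono_neutral_right[OF finite_mesh_faces])
    show "interior_faces \<Omega> \<T> \<subseteq> mesh_faces \<T>" by (auto simp: interior_faces_def)
    show "\<forall>F\<in>mesh_faces \<T> - interior_faces \<Omega> \<T>. (\<Sum>T | T \<in> \<T> \<and> F facet_of T. ?g T F) = 0"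
    proof (intro ballI sum.neutral)
      fix F T assume F: "F \<in> mesh_faces \<T> - interior_faces \<Omega> \<T>" and T: "T \<in> {T. T \<in> \<T> \<and> F facet_of T}"
      have "?g T F = face_integral F (\<lambda>x. 0 * 0)"
        by (rule face_integral_cong[OF facet_is_triangle]) (use T F qh0 in \<open>auto simp: interior_faces_def\<close>)
      then show "?g T F = 0" using posfun_cmult[OF posfun_facet, of T F "\<lambda>_. 0" 0] T by simp
    qed
  qed
  also have "\<dots> = (\<Sum>F\<in>interior_faces \<Omega> \<T>. face_integral F (\<lambda>x. jump \<Omega> \<T> (\<lambda>T y. face_normal \<T> F \<bullet> u T y) F x * qh F x))"
  proof (rule sum.cong[OF refl])
    fix F assume F: "F \<in> interior_faces \<Omega> \<T>"
    note S = face_sides[of F] and F' = interior_facesD[OF F]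
    have c: "continuous_on F (\<lambda>x. (face_normal \<T> F \<bullet> u T x) * qh F x)" for T
      using F' by (intro continuous_on_mult continuous_on_inner continuous_on_const
            vdeg_continuous[OF vpoly_elemD[OF u]] poly_face_continuous[OF qh']) auto
    have L: "posfun F (face_integral F)" using posfun_facet S F' by blast
    have "(\<Sum>T | T \<in> \<T> \<and> F facet_of T. ?g T F) = ?g (elem1 \<T> F) F + ?g (elem2 \<T> F) F" by (rule sum_interior_sides[OF F])
    also have "\<dots> = face_integral F (\<lambda>x. (face_normal \<T> F \<bullet> u (elem1 \<T> F) x) * qh F x) + face_integral F (\<lambda>x. -1 * ((face_normal \<T> F \<bullet> u (elem2 \<T> F) x) * qh F x))"
      using S F' by simp
    also have "\<dots> = face_integral F (\<lambda>x. (face_normal \<T> F \<bullet> u (elem1 \<T> F) x) * qh F x) - face_integral F (\<lambda>x. (face_normal \<T> F \<bullet> u (elem2 \<T> F) x) * qh F x)"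
      using posfun_cmult[OF L c, of "-1"] by simp
    also have "\<dots> = face_integral F (\<lambda>x. (face_normal \<T> F \<bullet> u (elem1 \<T> F) x) * qh F x - (face_normal \<T> F \<bullet> u (elem2 \<T> F) x) * qh F x)"
      using posfun_diff[OF L c c] by simp
    also have "\<dots> = face_integral F (\<lambda>x. jump \<Omega> \<T> (\<lambda>T y. face_normal \<T> F \<bullet> u T y) F x * qh F x)"
      using F by (simp add: jump_def interior_faces_def left_diff_distrib)
    finally show "(\<Sum>T | T \<in> \<T> \<and> F facet_of T. ?g T F) = face_integral F (\<lambda>x. jump \<Omega> \<T> (\<lambda>T y. face_normal \<T> F \<bullet> u T y) F x * qh F x)" .
  qed
  finally show ?thesis by (simp add: c_h_def)
qed

subsection \<open>Cauchy--Schwarz\<close>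

definition cont_elem :: "'b::euclidean_space field \<Rightarrow> bool" where
  "cont_elem u \<longleftrightarrow> (\<forall>T\<in>\<T>. continuous_on T (u T))"

definition cont_bdry :: "((real^3) set \<Rightarrow> 'b::euclidean_space field) \<Rightarrow> bool" where
  "cont_bdry u \<longleftrightarrow> (\<forall>T\<in>\<T>. \<forall>F. F facet_of T \<longrightarrow> continuous_on F (u T F))"

lemma ip_elem_le: "cont_elem u \<Longrightarrow> cont_elem v \<Longrightarrow> \<bar>ip_elem \<T> u v\<bar> \<le> sqrt (ip_elem \<T> u u) * sqrt (ip_elem \<T> v v)"
  unfolding ip_elem_def cont_elem_def
  by (rule sum_posfun_Cauchy_Schwarz[of \<T> "\<lambda>T. T" integral]) (auto intro: posfun_element)

lemma ip_bdry_Sigma: "ip_bdry \<T> u v = (\<Sum>p\<in>Sigma \<T> (\<lambda>T. {F. F facet_of T}). face_integral (snd p) (\<lambda>x. u (fst p) (snd p) x \<bullet> v (fst p) (snd p) x))"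
  unfolding ip_bdry_def using finite_mesh finite_facets by (subst sum.Sigma) (auto simp: case_prod_beta)

lemma ip_bdry_le: "cont_bdry u \<Longrightarrow> cont_bdry v \<Longrightarrow> \<bar>ip_bdry \<T> u v\<bar> \<le> sqrt (ip_bdry \<T> u u) * sqrt (ip_bdry \<T> v v)"
  unfolding ip_bdry_Sigma cont_bdry_def
  by (rule sum_posfun_Cauchy_Schwarz[of _ "\<lambda>p. snd p" "\<lambda>p. face_integral (snd p)" "\<lambda>p. u (fst p) (snd p)" "\<lambda>p. v (fst p) (snd p)"])
     (auto intro: posfun_facet)

lemma ip_elem_nonneg: "cont_elem u \<Longrightarrow> 0 \<le> ip_elem \<T> u u"
  unfolding ip_elem_def cont_elem_def by (intro sum_nonneg posfun_nonneg[OF posfun_element] continuous_on_inner) auto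

lemma ip_bdry_nonneg: "cont_bdry u \<Longrightarrow> 0 \<le> ip_bdry \<T> u u"
  unfolding ip_bdry_def cont_bdry_def by (intro sum_nonneg posfun_nonneg[OF posfun_facet] continuous_on_inner) auto

text \<open>The Cauchy--Schwarz inequality is applied with weights that cancel, powers of the diameters.\<close>

lemma ip_bdry_weight:
  assumes "\<And>T F. T \<in> \<T> \<Longrightarrow> F facet_of T \<Longrightarrow> \<omega> T F * \<omega>' T F = 1"
  shows "ip_bdry \<T> u v = ip_bdry \<T> (\<lambda>T F x. \<omega> T F *\<^sub>R u T F x) (\<lambda>T F x. \<omega>' T F *\<^sub>R v T F x)"
proof -
  have "\<omega>' T F * \<omega> T F = 1" if "T \<in> \<T>" "F facet_of T" for T F using assms[OF that] by (simp add: mult.commute)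
  then show ?thesis unfolding ip_bdry_def by (intro sum.cong refl) (simp add: mult.assoc[symmetric])
qed

lemma ip_elem_weight:
  assumes "\<And>T. T \<in> \<T> \<Longrightarrow> \<omega> T * \<omega>' T = 1"
  shows "ip_elem \<T> u v = ip_elem \<T> (\<lambda>T x. \<omega> T *\<^sub>R u T x) (\<lambda>T x. \<omega>' T *\<^sub>R v T x)"
proof -
  have "\<omega>' T * \<omega> T = 1" if "T \<in> \<T>" for T using assms[OF that] by (simp add: mult.commute)
  then show ?thesis unfolding ip_elem_def by (intro sum.cong refl) (simp add: mult.assoc[symmetric])
qed

end

subsection \<open>Vector-valued inverse and trace inequalities\<close>

lemma vector_trace_inequality:
  "\<exists>C>0. \<forall>\<Omega> \<T> T F w. mesh \<Omega> \<T> \<kappa> \<longrightarrow> T \<in> \<T> \<longrightarrow> F facet_of T \<longrightarrow> vdeg k w \<longrightarrow>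
     encl_diam T * face_integral F (\<lambda>x. w x \<bullet> w x) \<le> C * integral T (\<lambda>x. w x \<bullet> w x)"
proof -
  obtain C where C: "C > 0" "\<And>V q F. regular \<kappa> V \<Longrightarrow> pdeg k q \<Longrightarrow> F facet_of (convex hull V) \<Longrightarrow>
     encl_diam (convex hull V) * face_integral F (\<lambda>x. (q x)\<^sup>2) \<le> C * integral (convex hull V) (\<lambda>x. (q x)\<^sup>2)"
    using trace_inequality[of \<kappa> k] by blast
  have "encl_diam T * face_integral F (\<lambda>x. w x \<bullet> w x) \<le> C * integral T (\<lambda>x. w x \<bullet> w x)"
    if M: "mesh \<Omega> \<T> \<kappa>" and T: "T \<in> \<T>" "F facet_of T" and w: "vdeg k w" for \<Omega> \<T> T F w
  proof -
    interpret mesh \<Omega> \<T> \<kappa> by (rule M)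
    note E = element[OF T(1)]
    have wi: "pdeg k (\<lambda>x. w x $ i)" for i using w by (simp add: vdeg_def)
    have sq: "(\<lambda>x. w x \<bullet> w x) = (\<lambda>x. \<Sum>i\<in>UNIV. (w x $ i)\<^sup>2)" by (simp add: inner_vec_def power2_eq_square)
    have c: "continuous_on S (\<lambda>x. (w x $ i)\<^sup>2)" for S i by (intro continuous_intros pdeg_continuous[OF wi])
    have "encl_diam T * face_integral F (\<lambda>x. w x \<bullet> w x) = (\<Sum>i\<in>UNIV. encl_diam T * face_integral F (\<lambda>x. (w x $ i)\<^sup>2))"
      unfolding sq by (subst posfun_sum[OF posfun_facet[OF T] c]) (simp add: sum_distrib_left)
    also have "\<dots> \<le> (\<Sum>i\<in>UNIV. C * integral T (\<lambda>x. (w x $ i)\<^sup>2))"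
      using C(2)[OF E(1) wi, of F] T(2) unfolding E(2) by (intro sum_mono) auto
    also have "\<dots> = C * integral T (\<lambda>x. w x \<bullet> w x)"
      unfolding sq by (subst posfun_sum[OF posfun_element[OF T(1)] c]) (simp add: sum_distrib_left)
    finally show ?thesis .
  qed
  then show ?thesis using C(1) by blast
qed

lemma gradient_inverse_inequality:
  "\<exists>C>0. \<forall>\<Omega> \<T> T q. mesh \<Omega> \<T> \<kappa> \<longrightarrow> T \<in> \<T> \<longrightarrow> pdeg k q \<longrightarrow>
     (encl_diam T)\<^sup>2 * integral T (\<lambda>x. grad q x \<bullet> grad q x) \<le> C * integral T (\<lambda>x. q x * q x)"
proof -
  obtain C where C: "C > 0" "\<And>V q. regular \<kappa> V \<Longrightarrow> pdeg k q \<Longrightarrow>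
     (encl_diam (convex hull V))\<^sup>2 * integral (convex hull V) (\<lambda>x. (norm (grad q x))\<^sup>2) \<le> C * integral (convex hull V) (\<lambda>x. (q x)\<^sup>2)"
    using inverse_inequality[of \<kappa> k] by blast
  have "(encl_diam T)\<^sup>2 * integral T (\<lambda>x. grad q x \<bullet> grad q x) \<le> C * integral T (\<lambda>x. q x * q x)"
    if M: "mesh \<Omega> \<T> \<kappa>" and T: "T \<in> \<T>" and q: "pdeg k q" for \<Omega> \<T> T q
    using C(2)[OF mesh.element(1)[OF M T] q] mesh.element(2)[OF M T] by (simp add: dot_square_norm power2_eq_square)
  then show ?thesis using C(1) by blast
qed

lemma divergence_inverse_inequality:
  "\<exists>C>0. \<forall>\<Omega> \<T> T w. mesh \<Omega> \<T> \<kappa> \<longrightarrow> T \<in> \<T> \<longrightarrow> vdeg k w \<longrightarrow>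
     (encl_diam T)\<^sup>2 * integral T (\<lambda>x. divergence w x * divergence w x) \<le> C * integral T (\<lambda>x. w x \<bullet> w x)"
proof -
  obtain C where C: "C > 0" "\<And>V q. regular \<kappa> V \<Longrightarrow> pdeg k q \<Longrightarrow>
     (encl_diam (convex hull V))\<^sup>2 * integral (convex hull V) (\<lambda>x. (norm (grad q x))\<^sup>2) \<le> C * integral (convex hull V) (\<lambda>x. (q x)\<^sup>2)"
    using inverse_inequality[of \<kappa> k] by blast
  have "(encl_diam T)\<^sup>2 * integral T (\<lambda>x. divergence w x * divergence w x) \<le> (3 * C) * integral T (\<lambda>x. w x \<bullet> w x)"
    if M: "mesh \<Omega> \<T> \<kappa>" and T: "T \<in> \<T>" and w: "vdeg k w" for \<Omega> \<T> T w
  proof -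
    interpret mesh \<Omega> \<T> \<kappa> by (rule M)
    note E = element[OF T] and L = posfun_element[OF T]
    have wi: "pdeg k (\<lambda>x. w x $ i)" for i using w by (simp add: vdeg_def)
    have sq: "(\<lambda>x. w x \<bullet> w x) = (\<lambda>x. \<Sum>i\<in>UNIV. (w x $ i)\<^sup>2)" by (simp add: inner_vec_def power2_eq_square)
    let ?g = "\<lambda>i x. (norm (grad (\<lambda>y. w y $ i) x))\<^sup>2"
    have c: "continuous_on S (\<lambda>x. (w x $ i)\<^sup>2)" for S i by (intro continuous_intros pdeg_continuous[OF wi])
    have cg: "continuous_on S (?g i)" for S i by (intro continuous_intros pdeg_continuous_grad[OF wi])
    have "integral T (\<lambda>x. divergence w x * divergence w x) \<le> integral T (\<lambda>x. 3 * (\<Sum>i\<in>UNIV. ?g i x))"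
    proof (rule posfun_mono[OF L])
      show "continuous_on T (\<lambda>x. divergence w x * divergence w x)" by (intro continuous_intros pdeg_continuous[OF pdeg_divergence[OF w]])
      show "continuous_on T (\<lambda>x. 3 * (\<Sum>i\<in>UNIV. ?g i x))" by (intro continuous_on_mult_left continuous_on_sum cg)
      fix x
      have "\<bar>pderivative i (\<lambda>y. w y $ i) x\<bar> \<le> norm (grad (\<lambda>y. w y $ i) x)" for i
        using component_le_norm_cart[of "grad (\<lambda>y. w y $ i) x" i] by (simp add: grad_def)
      then have p: "(pderivative i (\<lambda>y. w y $ i) x)\<^sup>2 \<le> ?g i x" for i by (rule abs_le_square_iff[THEN iffD1, OF order.trans]) simp
      have "divergence w x * divergence w x \<le> (\<Sum>i\<in>UNIV. \<bar>pderivative i (\<lambda>y. w y $ i) x\<bar>)\<^sup>2"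
        unfolding divergence_def power2_eq_square[symmetric] by (rule abs_le_square_iff[THEN iffD1]) (simp add: sum_abs sum_nonneg)
      also have "\<dots> \<le> real CARD(3) * (\<Sum>i\<in>UNIV. (pderivative i (\<lambda>y. w y $ i) x)\<^sup>2)" by (rule sum_abs_squared_le)
      also have "\<dots> \<le> 3 * (\<Sum>i\<in>UNIV. ?g i x)" using p by (simp add: sum_mono)
      finally show "divergence w x * divergence w x \<le> 3 * (\<Sum>i\<in>UNIV. ?g i x)" .
    qed
    also have "\<dots> = 3 * (\<Sum>i\<in>UNIV. integral T (?g i))"
      by (subst posfun_cmult[OF L continuous_on_sum[OF cg]], subst posfun_sum[OF L cg]) simp
    finally have "(encl_diam T)\<^sup>2 * integral T (\<lambda>x. divergence w x * divergence w x) \<le> 3 * (\<Sum>i\<in>UNIV. (encl_diam T)\<^sup>2 * integral T (?g i))"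
      using mult_left_mono[of _ _ "(encl_diam T)\<^sup>2"] by (fastforce simp: sum_distrib_left ac_simps)
    also have "\<dots> \<le> 3 * (\<Sum>i\<in>UNIV. C * integral T (\<lambda>x. (w x $ i)\<^sup>2))"
      using C(2)[OF E(1) wi] unfolding E(2) by (intro mult_left_mono sum_mono) auto
    also have "\<dots> = (3 * C) * integral T (\<lambda>x. w x \<bullet> w x)"
      unfolding sq by (subst posfun_sum[OF L c]) (simp add: sum_distrib_left mult.assoc)
    finally show ?thesis .
  qed
  then show ?thesis using C(1) by (intro exI[of _ "3 * C"]) auto
qed

section \<open>Stability\<close>

subsection \<open>Symmetry and absorption\<close>

lemma face_integral_zero: "face_integral F (\<lambda>_. 0) = 0"
  by (simp add: face_integral_def split_def Let_def)

lemma face_integral_neg: "face_integral F (\<lambda>x. - f x) = - face_integral F f"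
  by (simp add: face_integral_def split_def Let_def)

lemma ip_elem_zero: "ip_elem \<T> u (\<lambda>_ _. 0) = 0" "ip_elem \<T> (\<lambda>_ _. 0) v = 0"
  by (simp_all add: ip_elem_def)

lemma ip_bdry_zero: "ip_bdry \<T> u (\<lambda>_ _ _. 0) = 0" "ip_bdry \<T> (\<lambda>_ _ _. 0) v = 0"
  by (simp_all add: ip_bdry_def face_integral_zero)

lemma ip_elem_uminus: "ip_elem \<T> (\<lambda>T x. - u T x) v = - ip_elem \<T> u v"
  by (simp add: ip_elem_def sum_negf)

lemma ip_bdry_uminus: "ip_bdry \<T> (\<lambda>T F x. - u T F x) v = - ip_bdry \<T> u v"
  by (simp add: ip_bdry_def face_integral_neg sum_negf)

lemma ip_elem_commute: "ip_elem \<T> u v = ip_elem \<T> v u"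
  by (simp add: ip_elem_def inner_commute)

lemma ip_bdry_commute: "ip_bdry \<T> u v = ip_bdry \<T> v u"
  by (simp add: ip_bdry_def inner_commute)

text \<open>This makes the two inf-sup conditions the same.\<close>

lemma B_h_commute: "B_h \<alpha> \<T> \<sigma> \<tau> = B_h \<alpha> \<T> \<tau> \<sigma>"
proof -
  obtain r u uh p ph where \<sigma>: "\<sigma> = (r, u, uh, p, ph)" by (metis prod_cases5)
  obtain s v vh q qh where \<tau>: "\<tau> = (s, v, vh, q, qh)" by (metis prod_cases5)
  have 1: "su_h \<T> u uh v vh = su_h \<T> v vh u uh"
    unfolding su_h_def by (simp add: ip_bdry_def inner_commute)
  have 2: "sp_h \<alpha> \<T> p ph q qh = sp_h \<alpha> \<T> q qh p ph"
    unfolding sp_h_def by (simp add: ip_bdry_def ac_simps)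
  show ?thesis unfolding \<sigma> \<tau> using ip_elem_commute[of \<T> r s] 1 2 by simp
qed

text \<open>The letters stand for the parts of the norm in the order of its definition, \<open>E\<close> for the last two of \<open>u\<close>. With
\<open>X = M + R + D + P\<close> all of them are at most \<open>(c + 1) * X\<close>; and \<open>X\<^sup>2\<close> is of the order of \<open>M * S\<close>, because \<open>R\<close>, \<open>D\<close>
and \<open>P\<close> are at most \<open>sqrt (M * S)\<close> and \<open>M \<le> S\<close> without loss of generality.\<close>

lemma quadratic_bound:
  fixes R A D E G P M c S :: real
  assumes nn: "0 \<le> R" "0 \<le> A" "0 \<le> D" "0 \<le> E" "0 \<le> G" "0 \<le> P" "0 \<le> M" "1 \<le> c" "0 \<le> S"
    and S: "S\<^sup>2 = R\<^sup>2 + A\<^sup>2 + D\<^sup>2 + E\<^sup>2 + G\<^sup>2 + P\<^sup>2"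
    and h1: "R\<^sup>2 + D\<^sup>2 + P\<^sup>2 \<le> M * S" and h2: "A \<le> M + R + c * D" and h3: "E \<le> c * (M + P)"
    and h4: "G\<^sup>2 \<le> c * (P * G + P\<^sup>2 + (R + D + M) * (G + P))"
  shows "S \<le> 120 * (c + 1)\<^sup>2 * M"
proof (cases "S \<le> M")
  case True
  have "1 * 1 \<le> (c + 1)\<^sup>2" using nn by (intro order.trans[OF _ power_mono[of 1 "c + 1" 2]]) auto
  then have "1 \<le> 120 * (c + 1)\<^sup>2" by linarith
  from mult_right_mono[OF this nn(7)] have "1 * M \<le> 120 * (c + 1)\<^sup>2 * M" .
  then show ?thesis using True by simp
next
  case False
  define y where "y = sqrt (M * S)"
  have y2: "y\<^sup>2 = M * S" and y0: "0 \<le> y" using nn by (auto simp: y_def)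
  have le: "R \<le> y" "D \<le> y" "P \<le> y"
    unfolding y_def using h1 nn by (auto intro!: real_le_rsqrt) (smt (verit) zero_le_power2)+
  define X where "X = M + R + D + P"
  have X0: "0 \<le> X" using nn by (simp add: X_def)
  have RX: "R \<le> X" "D \<le> X" "P \<le> X" "M + R \<le> X" "M + P \<le> X" using nn by (auto simp: X_def)
  have one: "X \<le> c * X" using nn X0 mult_right_mono[of 1 c X] by simp
  have AX: "A \<le> (c + 1) * X"
  proof -
    have "c * D \<le> c * X" using RX nn by (intro mult_left_mono) auto
    then show ?thesis using h2 RX by (simp add: algebra_simps)
  qed
  have EX: "E \<le> (c + 1) * X"
  proof -
    have "c * (M + P) \<le> c * X" using RX nn by (intro mult_left_mono) auto
    then show ?thesis using h3 X0 by (simp add: algebra_simps)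
  qed
  have GX: "G \<le> (c + 1) * X"
  proof (rule ccontr)
    assume g: "\<not> ?thesis"
    have "P * G + P\<^sup>2 + (R + D + M) * (G + P) = X * G + X * P" by (simp add: X_def algebra_simps power2_eq_square)
    also have "\<dots> \<le> X * G + X * X" using RX X0 by (simp add: mult_left_mono)
    finally have "c * (P * G + P\<^sup>2 + (R + D + M) * (G + P)) \<le> c * (X * G + X * X)" using nn by (intro mult_left_mono) auto
    then have "G\<^sup>2 \<le> c * (X * G + X * X)" using h4 by linarith
    then have le1: "G * (G - c * X) \<le> c * X * X" by (simp add: algebra_simps power2_eq_square)
    have "(c + 1) * X * X \<le> G * (G - c * X)" using g X0 nn by (intro mult_mono) (auto simp: algebra_simps)
    then have "X * X \<le> 0" using le1 by (simp add: algebra_simps)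
    then have "X = 0" by (metis mult_eq_0_iff not_real_square_gt_zero linorder_not_le)
    then have "G * G \<le> 0" using le1 by simp
    then have "G = 0" by (metis mult_eq_0_iff not_real_square_gt_zero linorder_not_le)
    then show False using g X0 nn by simp
  qed
  have cX: "X \<le> (c + 1) * X" using one X0 by (simp add: algebra_simps)
  have sq: "z\<^sup>2 \<le> ((c + 1) * X)\<^sup>2" if "0 \<le> z" "z \<le> (c + 1) * X" for z using that by (intro power_mono) auto
  have "S\<^sup>2 \<le> 6 * ((c + 1) * X)\<^sup>2"
    unfolding S using sq[OF nn(1)] sq[OF nn(2) AX] sq[OF nn(3)] sq[OF nn(4) EX] sq[OF nn(5) GX] sq[OF nn(6)] RX cX by linarith
  also have "\<dots> = 6 * (c + 1)\<^sup>2 * X\<^sup>2" by (simp add: power_mult_distrib)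
  also have "\<dots> \<le> 6 * (c + 1)\<^sup>2 * (20 * (M * S))"
  proof (rule mult_left_mono)
    have "X \<le> M + 3 * y" using le by (simp add: X_def)
    then have "X\<^sup>2 \<le> (M + 3 * y)\<^sup>2" using X0 by (intro power_mono) auto
    also have "\<dots> \<le> 2 * M\<^sup>2 + 18 * y\<^sup>2" using sum_squares_bound[of M "3 * y"] by (simp add: power2_sum power_mult_distrib)
    also have "M\<^sup>2 \<le> M * S" using False nn by (simp add: power2_eq_square mult_left_mono)
    finally show "X\<^sup>2 \<le> 20 * (M * S)" using y2 by simp
  qed simp
  finally have "S * S \<le> (120 * (c + 1)\<^sup>2 * M) * S" by (simp add: power2_eq_square ac_simps)
  then show ?thesis using False nn by (simp add: mult_le_cancel_right)
qed

context mesh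
begin

lemma diam_power_compare:
  assumes T: "T \<in> \<T>" "F facet_of T" and e: "\<bar>e\<bar> \<le> 2"
  shows "encl_diam F powr e \<le> 4 * \<kappa>\<^sup>2 * encl_diam T powr e"
proof -
  have hT: "0 < encl_diam T" by (rule encl_diam_element_pos[OF T(1)])
  have hF: "0 < encl_diam F" by (rule encl_diam_facet_pos[OF T])
  have 1: "encl_diam F \<le> 2 * encl_diam T" "encl_diam T \<le> \<kappa> * encl_diam F"
    using facet_diam[OF element(1)[OF T(1)]] element(2)[OF T(1)] T(2) by auto
  have k2: "1 \<le> 2 * \<kappa>" "(2 * \<kappa>) powr 2 = 4 * \<kappa>\<^sup>2" using kappa by (auto simp: powr_numeral power_mult_distrib)
  show ?thesis
  proof (cases "0 \<le> e")
    case True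
    have "encl_diam F powr e \<le> (2 * \<kappa> * encl_diam T) powr e"
    proof (rule powr_mono2[OF True])
      have "2 * encl_diam T \<le> 2 * \<kappa> * encl_diam T" using kappa hT by simp
      then show "encl_diam F \<le> 2 * \<kappa> * encl_diam T" using 1 by linarith
    qed (use hF in simp)
    also have "\<dots> = (2 * \<kappa>) powr e * encl_diam T powr e" using kappa hT by (simp add: powr_mult)
    also have "\<dots> \<le> (2 * \<kappa>) powr 2 * encl_diam T powr e" using e k2(1) by (intro mult_right_mono powr_mono) auto
    finally show ?thesis using k2 by simp
  next
    case False
    have "encl_diam F powr e \<le> (encl_diam T / (2 * \<kappa>)) powr e"
    proof (rule powr_mono2')
      have "0 \<le> \<kappa> * encl_diam F" using kappa hF by simp
      then have "encl_diam T \<le> 2 * (\<kappa> * encl_diam F)" using 1(2) by linarith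
      then have "encl_diam T \<le> 2 * \<kappa> * encl_diam F" by (simp only: mult.assoc)
      then show "encl_diam T / (2 * \<kappa>) \<le> encl_diam F" using kappa by (simp add: field_simps)
    qed (use False hT kappa in auto)
    also have "\<dots> = (2 * \<kappa>) powr (- e) * encl_diam T powr e"
      unfolding powr_minus[of "2 * \<kappa>"] using kappa hT by (subst powr_divide) (simp_all only: divide_inverse mult.commute)
    also have "\<dots> \<le> (2 * \<kappa>) powr 2 * encl_diam T powr e" using e k2(1) by (intro mult_right_mono powr_mono) auto
    finally show ?thesis using k2 by simp
  qed
qed

lemma card_facets: "T \<in> \<T> \<Longrightarrow> card {F. F facet_of T} \<le> 4"
proof -
  assume T: "T \<in> \<T>"
  have eq: "{F. F facet_of T} = (\<lambda>w. convex hull (verts T - {w})) ` verts T"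
    using tetra_facets(1)[OF element(3)[OF T]] by (simp only: element(2)[OF T])
  show ?thesis unfolding eq finite_verts(2)[OF T, symmetric] by (rule card_image_le[OF finite_verts(1)[OF T]])
qed

text \<open>The derivative vanishes in the direction of every other point of the face, and these directions span its plane. At a
relative boundary point the one-sided derivative suffices.\<close>

lemma tangential_gradient_zero:
  assumes T: "T \<in> \<T>" "F facet_of T" and f: "pdeg j f" and z: "\<And>x. x \<in> F \<Longrightarrow> f x = 0" and x: "x \<in> F"
  shows "cross3 (outward_normal T F) (grad f x) = 0"
proof -
  obtain v a b c where abc: "verts T = {v, a, b, c}" "distinct [v, a, b, c]" "F = convex hull {a, b, c}" using facet_triangle[OF T] by metis
  have conv: "convex F" unfolding abc by (rule convex_convex_hull)
  have g0: "grad f x \<bullet> (y - x) = 0" if y: "y \<in> F" for y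
  proof -
    let ?\<phi> = "\<lambda>t. f (x + t *\<^sub>R (y - x))"
    have "((\<lambda>t. x + t *\<^sub>R (y - x)) has_derivative (\<lambda>h. h *\<^sub>R (y - x))) (at 0)" by (auto intro!: derivative_eq_intros)
    moreover have "(f has_derivative (\<lambda>h. grad f x \<bullet> h)) (at (x + 0 *\<^sub>R (y - x)))"
      using has_derivative_grad[OF pdeg_differentiable[OF f], of x] by simp
    ultimately have "(?\<phi> has_derivative (\<lambda>h. grad f x \<bullet> (h *\<^sub>R (y - x)))) (at 0)" by (rule has_derivative_compose)
    then have D: "DERIV ?\<phi> 0 :> grad f x \<bullet> (y - x)"
      by (simp add: has_field_derivative_def mult.commute[of _ "grad f x \<bullet> (y - x)"] mult_commute_abs)
    have 0: "?\<phi> t = 0" if "0 \<le> t" "t \<le> 1" for t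
    proof -
      have "x + t *\<^sub>R (y - x) = (1 - t) *\<^sub>R x + t *\<^sub>R y" by (simp add: algebra_simps)
      then show ?thesis using convexD[OF conv x y, of "1 - t" t] that z by simp
    qed
    show ?thesis
    proof (rule ccontr)
      assume "grad f x \<bullet> (y - x) \<noteq> 0"
      then consider "0 < grad f x \<bullet> (y - x)" | "grad f x \<bullet> (y - x) < 0" by linarith
      then show False
      proof cases
        case 1
        then obtain d where "d > 0" "\<forall>h>0. h < d \<longrightarrow> ?\<phi> 0 < ?\<phi> (0 + h)" using DERIV_pos_inc_right[OF D] by blast
        then show False using 0[of 0] 0[of "min (d / 2) 1"] by (auto dest: spec[of _ "min (d / 2) 1"])
      next
        case 2
        then obtain d where "d > 0" "\<forall>h>0. h < d \<longrightarrow> ?\<phi> (0 + h) < ?\<phi> 0" using DERIV_neg_dec_right[OF D] by blast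
        then show False using 0[of 0] 0[of "min (d / 2) 1"] by (auto dest: spec[of _ "min (d / 2) 1"])
      qed
    qed
  qed
  have in_F: "a \<in> F" "b \<in> F" "c \<in> F" unfolding abc by (simp_all add: hull_inc)
  have e: "grad f x \<bullet> (b - a) = 0" "grad f x \<bullet> (c - a) = 0"
    using g0[OF in_F(1)] g0[OF in_F(2)] g0[OF in_F(3)] by (simp_all add: inner_diff_right)
  have V: "tetra {v, a, b, c}" "convex hull {v, a, b, c} = T" using element[OF T(1)] abc(1) by simp_all
  note o = outward_normal_tet[OF V(1) abc(2), unfolded V(2), folded abc(3)]
  obtain t where "grad f x = t *\<^sub>R cross3 (b - a) (c - a)" using orthogonal_to_edges[OF e] o(7) by auto
  then show ?thesis using o(1) by (simp add: cross_mult_left cross_mult_right)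
qed

end

subsection \<open>The parts of the norm\<close>

text \<open>The analytic inequalities are assumed with given constants, so that the constants derived from them are visibly the
same for all meshes with the same shape parameter.\<close>

locale estimates = mesh +
  fixes k m :: nat and \<alpha> Ct Ci Cd Co :: real
  assumes k: "1 \<le> k" and m: "m \<in> {k - 1, k}" and \<alpha>: "\<alpha> \<in> {- 1, 1}"
    and const_pos: "0 < Ct" "0 < Ci" "0 < Cd" "0 < Co"
    and trace: "\<And>T F w. T \<in> \<T> \<Longrightarrow> F facet_of T \<Longrightarrow> vdeg k w \<Longrightarrow>
       encl_diam T * face_integral F (\<lambda>x. w x \<bullet> w x) \<le> Ct * integral T (\<lambda>x. w x \<bullet> w x)"
    and inverse_grad: "\<And>T q. T \<in> \<T> \<Longrightarrow> pdeg k q \<Longrightarrow>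
       (encl_diam T)\<^sup>2 * integral T (\<lambda>x. grad q x \<bullet> grad q x) \<le> Ci * integral T (\<lambda>x. q x * q x)"
    and inverse_div: "\<And>T w. T \<in> \<T> \<Longrightarrow> vdeg k w \<Longrightarrow>
       (encl_diam T)\<^sup>2 * integral T (\<lambda>x. divergence w x * divergence w x) \<le> Cd * integral T (\<lambda>x. w x \<bullet> w x)"
    and conforming_approx: "\<And>p ph. (\<forall>T\<in>\<T>. pdeg k (p T)) \<Longrightarrow>
     (\<forall>F\<in>mesh_faces \<T>. \<exists>q. pdeg k q \<and> (\<forall>x\<in>F. ph F x = q x)) \<Longrightarrow>
     (\<forall>F\<in>mesh_faces \<T>. F \<subseteq> frontier \<Omega> \<longrightarrow> (\<forall>x\<in>F. ph F x = 0)) \<Longrightarrow>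
     (\<exists>pc. (\<forall>T\<in>\<T>. pdeg k (pc T)) \<and>
        (\<forall>T\<in>\<T>. \<forall>T'\<in>\<T>. \<forall>F. F facet_of T \<longrightarrow> F facet_of T' \<longrightarrow> (\<forall>x\<in>F. pc T x = pc T' x)) \<and>
        (\<forall>T\<in>\<T>. \<forall>F. F facet_of T \<longrightarrow> F \<subseteq> frontier \<Omega> \<longrightarrow> (\<forall>x\<in>F. pc T x = 0)) \<and>
        (\<Sum>T\<in>\<T>. integral T (\<lambda>x. (norm (grad (\<lambda>y. p T y - pc T y) x))\<^sup>2))
          \<le> Co * (\<Sum>T\<in>\<T>. \<Sum>F | F facet_of T. inverse (encl_diam F) * face_integral F (\<lambda>x. (p T x - ph F x)\<^sup>2)))"
begin

text \<open>Four faces for each element, and a factor \<open>4 * \<kappa>\<^sup>2\<close> from exchanging the diameters of a face and its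
element.\<close>

definition K1 :: real where "K1 = 16 * \<kappa>\<^sup>2 * Ct"

lemma K1_pos: "0 < K1"
  unfolding K1_def using kappa const_pos by simp

lemma weighted_trace:
  assumes w: "\<And>T. T \<in> \<T> \<Longrightarrow> vdeg k (w T)" and e: "\<bar>e\<bar> \<le> 2"
  shows "(\<Sum>T\<in>\<T>. \<Sum>F | F facet_of T. encl_diam F powr e * face_integral F (\<lambda>x. w T x \<bullet> w T x))
     \<le> K1 * (\<Sum>T\<in>\<T>. encl_diam T powr (e - 1) * integral T (\<lambda>x. w T x \<bullet> w T x))"
  unfolding sum_distrib_left
proof (rule sum_mono)
  fix T assume T: "T \<in> \<T>"
  let ?h = "encl_diam T" and ?I = "integral T (\<lambda>x. w T x \<bullet> w T x)"
  have h: "?h > 0" by (rule encl_diam_element_pos[OF T])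
  have cw: "continuous_on S (\<lambda>x. w T x \<bullet> w T x)" for S by (intro continuous_intros vdeg_continuous[OF w[OF T]])
  have I0: "0 \<le> ?I" by (rule posfun_nonneg[OF posfun_element[OF T] cw]) simp
  have F: "encl_diam F powr e * face_integral F (\<lambda>x. w T x \<bullet> w T x) \<le> 4 * \<kappa>\<^sup>2 * Ct * (?h powr (e - 1) * ?I)" if F: "F facet_of T" for F
  proof -
    have J0: "0 \<le> face_integral F (\<lambda>x. w T x \<bullet> w T x)" by (rule posfun_nonneg[OF posfun_facet[OF T F] cw]) simp
    have "encl_diam F powr e * face_integral F (\<lambda>x. w T x \<bullet> w T x) \<le> (4 * \<kappa>\<^sup>2 * ?h powr e) * face_integral F (\<lambda>x. w T x \<bullet> w T x)"
      by (rule mult_right_mono[OF diam_power_compare[OF T F e] J0])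
    also have "?h powr e = ?h powr (e - 1) * ?h" using h by (simp add: powr_diff)
    also have "(4 * \<kappa>\<^sup>2 * (?h powr (e - 1) * ?h)) * face_integral F (\<lambda>x. w T x \<bullet> w T x) = 4 * \<kappa>\<^sup>2 * ?h powr (e - 1) * (?h * face_integral F (\<lambda>x. w T x \<bullet> w T x))" by simp
    also have "\<dots> \<le> 4 * \<kappa>\<^sup>2 * ?h powr (e - 1) * (Ct * ?I)"
      by (intro mult_left_mono trace[OF T F w[OF T]]) auto
    finally show ?thesis by (simp add: ac_simps)
  qed
  have "(\<Sum>F | F facet_of T. encl_diam F powr e * face_integral F (\<lambda>x. w T x \<bullet> w T x)) \<le> real (card {F. F facet_of T}) * (4 * \<kappa>\<^sup>2 * Ct * (?h powr (e - 1) * ?I))"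
    using F by (intro sum_bounded_above) auto
  also have "\<dots> \<le> 4 * (4 * \<kappa>\<^sup>2 * Ct * (?h powr (e - 1) * ?I))"
    using card_facets[OF T] const_pos I0 by (intro mult_right_mono mult_nonneg_nonneg) auto
  finally show "(\<Sum>F | F facet_of T. encl_diam F powr e * face_integral F (\<lambda>x. w T x \<bullet> w T x)) \<le> K1 * (?h powr (e - 1) * ?I)"
    by (simp add: K1_def)
qed

text \<open>A scalar polynomial is regarded as a multiple of a fixed vector.\<close>

lemma weighted_trace_scalar:
  assumes q: "\<And>T. T \<in> \<T> \<Longrightarrow> pdeg k (q T)" and e: "\<bar>e\<bar> \<le> 2"
  shows "(\<Sum>T\<in>\<T>. \<Sum>F | F facet_of T. encl_diam F powr e * face_integral F (\<lambda>x. q T x * q T x))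
     \<le> K1 * (\<Sum>T\<in>\<T>. encl_diam T powr (e - 1) * integral T (\<lambda>x. q T x * q T x))"
proof -
  have "vdeg k (\<lambda>x. q T x *\<^sub>R axis 1 1)" if "T \<in> \<T>" for T
    using pdeg_cmult[OF q[OF that], of "axis 1 1 $ i" for i] by (auto simp: vdeg_def mult.commute)
  from weighted_trace[of "\<lambda>T x. q T x *\<^sub>R axis 1 1", OF this e] show ?thesis
    by (simp add: inner_axis_axis)
qed

text \<open>The parts of the squared norm that follow that of \<open>r\<close>, in the order of its definition.\<close>

definition nA :: "(real^3) field \<Rightarrow> real" where "nA u = normsq_elem \<T> (\<lambda>T. curl (u T))"
definition nD :: "(real^3) field \<Rightarrow> (real^3) field \<Rightarrow> real" where "nD u uh = su_h \<T> u uh u uh"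
definition nE :: "(real^3) field \<Rightarrow> real" where
  "nE u = normsq_elem \<T> (\<lambda>T x. encl_diam T powr ((1 - \<alpha>) / 2) * divergence (u T) x)"
definition nJ :: "(real^3) field \<Rightarrow> real" where
  "nJ u = normsq_int_faces \<Omega> \<T> (\<lambda>F x. encl_diam F powr (- \<alpha> / 2) * jump \<Omega> \<T> (\<lambda>T y. face_normal \<T> F \<bullet> u T y) F x)"
definition nG :: "real field \<Rightarrow> real" where
  "nG q = normsq_elem \<T> (\<lambda>T x. (encl_diam T powr ((\<alpha> + 1) / 2)) *\<^sub>R grad (q T) x)"
definition nP :: "real field \<Rightarrow> real field \<Rightarrow> real" where "nP q qh = sp_h \<alpha> \<T> q qh q qh"

lemma powr_half: "0 < h \<Longrightarrow> h powr (e / 2) * h powr (e / 2) = h powr e" for h e :: real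
  by (simp add: powr_add[symmetric])

lemma nD_eq: "normsq_bdry \<T> (\<lambda>T F x. (encl_diam F powr (- 1 / 2)) *\<^sub>R cross3 (outward_normal T F) (v T x - vh F x)) = nD v vh"
  unfolding normsq_bdry_def nD_def su_h_def ip_bdry_def
proof (intro sum.cong refl arg_cong2[of _ _ _ _ face_integral] ext)
  fix T F x assume T: "T \<in> \<T>" "F \<in> {F. F facet_of T}"
  have "encl_diam F powr (- 1 / 2) * encl_diam F powr (- 1 / 2) = inverse (encl_diam F)"
    using powr_half[of "encl_diam F" "-1"] encl_diam_facet_pos[OF T(1)] T(2) by (simp add: powr_minus)
  then show "((encl_diam F powr (- 1 / 2)) *\<^sub>R cross3 (outward_normal T F) (v T x - vh F x)) \<bullet> ((encl_diam F powr (- 1 / 2)) *\<^sub>R cross3 (outward_normal T F) (v T x - vh F x))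
     = (inverse (encl_diam F) *\<^sub>R cross3 (outward_normal T F) (v T x - vh F x)) \<bullet> cross3 (outward_normal T F) (v T x - vh F x)"
    by (simp add: mult.assoc[symmetric])
qed

lemma nP_eq: "normsq_bdry \<T> (\<lambda>T F x. encl_diam F powr (\<alpha> / 2) * (q T x - qh F x)) = nP q qh"
  unfolding normsq_bdry_def nP_def sp_h_def ip_bdry_def
proof (intro sum.cong refl arg_cong2[of _ _ _ _ face_integral] ext)
  fix T F x assume T: "T \<in> \<T>" "F \<in> {F. F facet_of T}"
  have "encl_diam F powr (\<alpha> / 2) * encl_diam F powr (\<alpha> / 2) = encl_diam F powr \<alpha>"
    using powr_half[of "encl_diam F" \<alpha>] encl_diam_facet_pos[OF T(1)] T(2) by simp
  then show "(encl_diam F powr (\<alpha> / 2) * (q T x - qh F x)) \<bullet> (encl_diam F powr (\<alpha> / 2) * (q T x - qh F x)) = (encl_diam F powr \<alpha> * (q T x - qh F x)) \<bullet> (q T x - qh F x)"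
    by (simp add: ac_simps)
qed

lemma norm_Sigma_eq: "norm_Sigma \<alpha> \<Omega> \<T> (r, u, uh, p, ph) = sqrt (ip_elem \<T> r r + (nA u + nD u uh + nE u + nJ u) + (nG p + nP p ph))"
  unfolding norm_Sigma.simps normsq_U_def normsq_P_def nD_eq nP_eq
  by (simp only: nA_def nE_def nJ_def nG_def normsq_elem_def)

lemma nE_alt: "nE u = (\<Sum>T\<in>\<T>. encl_diam T powr (1 - \<alpha>) * integral T (\<lambda>x. divergence (u T) x * divergence (u T) x))"
  unfolding nE_def normsq_elem_def ip_elem_def
proof (intro sum.cong refl)
  fix T assume T: "T \<in> \<T>"
  have "(encl_diam T powr ((1 - \<alpha>) / 2) * divergence (u T) x) \<bullet> (encl_diam T powr ((1 - \<alpha>) / 2) * divergence (u T) x)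
     = encl_diam T powr (1 - \<alpha>) * (divergence (u T) x * divergence (u T) x)" for x
    using powr_half[of "encl_diam T" "1 - \<alpha>"] encl_diam_element_pos[OF T] by (simp add: ac_simps)
  then show "integral T (\<lambda>x. (encl_diam T powr ((1 - \<alpha>) / 2) * divergence (u T) x) \<bullet> (encl_diam T powr ((1 - \<alpha>) / 2) * divergence (u T) x))
     = encl_diam T powr (1 - \<alpha>) * integral T (\<lambda>x. divergence (u T) x * divergence (u T) x)" by (simp only: integral_mult_right)
qed

lemma nG_alt: "nG q = (\<Sum>T\<in>\<T>. encl_diam T powr (\<alpha> + 1) * integral T (\<lambda>x. grad (q T) x \<bullet> grad (q T) x))"
  unfolding nG_def normsq_elem_def ip_elem_def
proof (intro sum.cong refl)
  fix T assume T: "T \<in> \<T>"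
  have "((encl_diam T powr ((\<alpha> + 1) / 2)) *\<^sub>R grad (q T) x) \<bullet> ((encl_diam T powr ((\<alpha> + 1) / 2)) *\<^sub>R grad (q T) x)
     = encl_diam T powr (\<alpha> + 1) * (grad (q T) x \<bullet> grad (q T) x)" for x
    using powr_half[of "encl_diam T" "\<alpha> + 1"] encl_diam_element_pos[OF T] by (simp add: mult.assoc[symmetric])
  then show "integral T (\<lambda>x. ((encl_diam T powr ((\<alpha> + 1) / 2)) *\<^sub>R grad (q T) x) \<bullet> ((encl_diam T powr ((\<alpha> + 1) / 2)) *\<^sub>R grad (q T) x))
     = encl_diam T powr (\<alpha> + 1) * integral T (\<lambda>x. grad (q T) x \<bullet> grad (q T) x)" by (simp only: integral_mult_right)
qed

lemma jump_deg:
  assumes u: "u \<in> vpoly_elem k \<T>" and F: "F \<in> interior_faces \<Omega> \<T>"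
  shows "pdeg k (jump \<Omega> \<T> (\<lambda>T y. face_normal \<T> F \<bullet> u T y) F)"
proof -
  have "jump \<Omega> \<T> (\<lambda>T y. face_normal \<T> F \<bullet> u T y) F = (\<lambda>x. face_normal \<T> F \<bullet> u (elem1 \<T> F) x - face_normal \<T> F \<bullet> u (elem2 \<T> F) x)"
    using F by (auto simp: jump_def interior_faces_def)
  then show ?thesis using pdeg_inner[OF vpoly_elemD[OF u]] by (simp add: pdeg_diff)
qed

lemma posfun_interior_face: "F \<in> interior_faces \<Omega> \<T> \<Longrightarrow> posfun F (face_integral F)"
  using mesh_facesE[of F] posfun_facet interior_facesD by metis

lemma interior_face_diam_pos: "F \<in> interior_faces \<Omega> \<T> \<Longrightarrow> 0 < encl_diam F"
  using mesh_facesE[of F] encl_diam_facet_pos interior_facesD by metis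

lemma nJ_alt:
  assumes u: "u \<in> vpoly_elem k \<T>"
  shows "nJ u = (\<Sum>F\<in>interior_faces \<Omega> \<T>. encl_diam F powr (- \<alpha>) *
     face_integral F (\<lambda>x. jump \<Omega> \<T> (\<lambda>T y. face_normal \<T> F \<bullet> u T y) F x * jump \<Omega> \<T> (\<lambda>T y. face_normal \<T> F \<bullet> u T y) F x))"
  unfolding nJ_def normsq_int_faces_def
proof (intro sum.cong refl)
  fix F assume F: "F \<in> interior_faces \<Omega> \<T>"
  let ?j = "jump \<Omega> \<T> (\<lambda>T y. face_normal \<T> F \<bullet> u T y) F"
  have "(encl_diam F powr (- \<alpha> / 2) * ?j x)\<^sup>2 = encl_diam F powr (- \<alpha>) * (?j x * ?j x)" for x
    using powr_half[of "encl_diam F" "- \<alpha>"] interior_face_diam_pos[OF F] by (simp add: power2_eq_square ac_simps)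
  then show "face_integral F (\<lambda>x. (encl_diam F powr (- \<alpha> / 2) * ?j x)\<^sup>2) = encl_diam F powr (- \<alpha>) * face_integral F (\<lambda>x. ?j x * ?j x)"
    using posfun_cmult[OF posfun_interior_face[OF F], of "\<lambda>x. ?j x * ?j x"] pdeg_continuous[OF jump_deg[OF u F]]
    by (simp add: continuous_on_mult)
qed

lemma m_le_k: "m \<le> k"
  using k m by auto

lemma cont_elem_vdeg: "(\<And>T. T \<in> \<T> \<Longrightarrow> vdeg j (w T)) \<Longrightarrow> cont_elem w"
  unfolding cont_elem_def using vdeg_continuous by blast

lemma cont_elem_pdeg: "(\<And>T. T \<in> \<T> \<Longrightarrow> pdeg j (w T)) \<Longrightarrow> cont_elem w"
  unfolding cont_elem_def using pdeg_continuous by blast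

lemma cont_elem_scaleR: "cont_elem w \<Longrightarrow> cont_elem (\<lambda>T x. \<omega> T *\<^sub>R w T x)"
  unfolding cont_elem_def by (auto intro: continuous_on_scaleR)

lemma cont_bdry_scaleR: "cont_bdry w \<Longrightarrow> cont_bdry (\<lambda>T F x. \<omega> T F *\<^sub>R w T F x)"
  unfolding cont_bdry_def by (auto intro: continuous_on_scaleR)

lemma cont_bdry_element: "(\<And>T. T \<in> \<T> \<Longrightarrow> vdeg j (w T)) \<Longrightarrow> cont_bdry (\<lambda>T F x. w T x)"
  unfolding cont_bdry_def using vdeg_continuous by blast

lemma cont_bdry_tangential:
  assumes "u \<in> vpoly_elem k \<T>" "uh \<in> vpoly_face k \<T>"
  shows "cont_bdry (\<lambda>T F x. cross3 (outward_normal T F) (u T x - uh F x))"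
  unfolding cont_bdry_def
  by (intro ballI allI impI continuous_on_cross_const continuous_on_diff vdeg_continuous[OF vpoly_elemD[OF assms(1)]]
      vpoly_face_continuous[OF assms(2) mesh_faceI])

lemma cont_bdry_normal:
  assumes "u \<in> vpoly_elem k \<T>"
  shows "cont_bdry (\<lambda>T F x. outward_normal T F \<bullet> u T x)"
  unfolding cont_bdry_def
  by (intro ballI allI impI continuous_on_inner continuous_on_const vdeg_continuous[OF vpoly_elemD[OF assms]])

lemma cont_bdry_scalar:
  assumes "q \<in> poly_elem k \<T>" "qh \<in> poly_face k \<T>"
  shows "cont_bdry (\<lambda>T F x. q T x - qh F x)"
  unfolding cont_bdry_def
  by (intro ballI allI impI continuous_on_diff pdeg_continuous[OF poly_elemD[OF assms(1)]]
      poly_face_continuous[OF assms(2) mesh_faceI])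

lemma ip_bdry_scaled:
  assumes "cont_bdry v"
  shows "ip_bdry \<T> (\<lambda>T F x. \<omega> F *\<^sub>R v T F x) (\<lambda>T F x. \<omega> F *\<^sub>R v T F x)
     = (\<Sum>T\<in>\<T>. \<Sum>F | F facet_of T. (\<omega> F)\<^sup>2 * face_integral F (\<lambda>x. v T F x \<bullet> v T F x))"
  unfolding ip_bdry_def
proof (intro sum.cong refl)
  fix T F assume T: "T \<in> \<T>" "F \<in> {F. F facet_of T}"
  have c: "continuous_on F (\<lambda>x. v T F x \<bullet> v T F x)" using assms T unfolding cont_bdry_def by (intro continuous_on_inner) auto
  have "(\<lambda>x. (\<omega> F *\<^sub>R v T F x) \<bullet> (\<omega> F *\<^sub>R v T F x)) = (\<lambda>x. (\<omega> F)\<^sup>2 * (v T F x \<bullet> v T F x))"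
    by (simp add: power2_eq_square ac_simps)
  then show "face_integral F (\<lambda>x. (\<omega> F *\<^sub>R v T F x) \<bullet> (\<omega> F *\<^sub>R v T F x)) = (\<omega> F)\<^sup>2 * face_integral F (\<lambda>x. v T F x \<bullet> v T F x)"
    using posfun_cmult[OF posfun_facet c] T by simp
qed

lemma powr_half_square: "0 < h \<Longrightarrow> (h powr (e / 2))\<^sup>2 = h powr e" for h e :: real
  by (simp add: power2_eq_square powr_half)

lemma powr_inverse_pair: "0 < h \<Longrightarrow> h powr (- e / 2) * h powr (e / 2) = 1" for h e :: real
  by (simp add: powr_add[symmetric])

lemma nD_alt:
  "nD v vh = ip_bdry \<T> (\<lambda>T F x. (encl_diam F powr (- 1 / 2)) *\<^sub>R cross3 (outward_normal T F) (v T x - vh F x))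
     (\<lambda>T F x. (encl_diam F powr (- 1 / 2)) *\<^sub>R cross3 (outward_normal T F) (v T x - vh F x))"
  using nD_eq[of v vh] by (simp only: normsq_bdry_def)

lemma nP_alt:
  "nP q qh = ip_bdry \<T> (\<lambda>T F x. (encl_diam F powr (\<alpha> / 2)) *\<^sub>R (q T x - qh F x)) (\<lambda>T F x. (encl_diam F powr (\<alpha> / 2)) *\<^sub>R (q T x - qh F x))"
  using nP_eq[of q qh] by (simp only: normsq_bdry_def real_scaleR_def)

lemma nE_ip:
  "nE u = ip_elem \<T> (\<lambda>T x. (encl_diam T powr ((1 - \<alpha>) / 2)) *\<^sub>R divergence (u T) x) (\<lambda>T x. (encl_diam T powr ((1 - \<alpha>) / 2)) *\<^sub>R divergence (u T) x)"
  by (simp only: nE_def normsq_elem_def real_scaleR_def)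

lemma nonneg:
  shows "u \<in> vpoly_elem k \<T> \<Longrightarrow> 0 \<le> nA u" "u \<in> vpoly_elem k \<T> \<Longrightarrow> uh \<in> vpoly_face k \<T> \<Longrightarrow> 0 \<le> nD u uh"
    "u \<in> vpoly_elem k \<T> \<Longrightarrow> 0 \<le> nE u" "u \<in> vpoly_elem k \<T> \<Longrightarrow> 0 \<le> nJ u"
    "q \<in> poly_elem k \<T> \<Longrightarrow> 0 \<le> nG q" "q \<in> poly_elem k \<T> \<Longrightarrow> qh \<in> poly_face k \<T> \<Longrightarrow> 0 \<le> nP q qh"
proof -
  show "0 \<le> nA u" if u: "u \<in> vpoly_elem k \<T>"
    unfolding nA_def normsq_elem_def by (intro ip_elem_nonneg cont_elem_vdeg[of "k - 1"] vdeg_curl vpoly_elemD[OF u])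
  show "0 \<le> nD u uh" if u: "u \<in> vpoly_elem k \<T>" "uh \<in> vpoly_face k \<T>"
    unfolding nD_alt by (intro ip_bdry_nonneg cont_bdry_scaleR cont_bdry_tangential u)
  show "0 \<le> nE u" if u: "u \<in> vpoly_elem k \<T>"
    unfolding nE_ip
    by (intro ip_elem_nonneg cont_elem_scaleR cont_elem_pdeg[of "k - 1"] pdeg_divergence vpoly_elemD[OF u])
  show "0 \<le> nJ u" if u: "u \<in> vpoly_elem k \<T>"
    unfolding nJ_alt[OF u]
    by (intro sum_nonneg mult_nonneg_nonneg[OF powr_ge_zero] posfun_nonneg[OF posfun_interior_face] continuous_on_mult pdeg_continuous[OF jump_deg[OF u]] zero_le_square)
  show "0 \<le> nG q" if q: "q \<in> poly_elem k \<T>"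
    unfolding nG_def normsq_elem_def by (intro ip_elem_nonneg cont_elem_scaleR cont_elem_vdeg[of "k - 1"] vdeg_grad poly_elemD[OF q])
  show "0 \<le> nP q qh" if q: "q \<in> poly_elem k \<T>" "qh \<in> poly_face k \<T>"
    unfolding nP_alt by (intro ip_bdry_nonneg cont_bdry_scaleR cont_bdry_scalar q)
qed

subsection \<open>Bounds for the forms\<close>

text \<open>The weights \<open>h\<^sub>F powr (- 1 / 2)\<close> and \<open>h\<^sub>F powr (1 / 2)\<close> are inserted; the trace inequality consumes the second
one.\<close>

lemma tangential_bound:
  assumes u: "u \<in> vpoly_elem k \<T>" "uh \<in> vpoly_face k \<T>" and s: "s \<in> vpoly_elem m \<T>"
  shows "\<bar>ip_bdry \<T> (\<lambda>T F x. cross3 (outward_normal T F) (u T x - uh F x)) (\<lambda>T F x. s T x)\<bar> \<le> sqrt K1 * sqrt (nD u uh) * sqrt (ip_elem \<T> s s)"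
proof -
  have sk: "vdeg k (s T)" for T using vdeg_mono[OF vpoly_elemD[OF s] m_le_k] .
  have cs: "cont_bdry (\<lambda>T F x. s T x)" by (rule cont_bdry_element[OF sk])
  let ?c = "\<lambda>T F x. cross3 (outward_normal T F) (u T x - uh F x)"
  have "ip_bdry \<T> ?c (\<lambda>T F x. s T x) = ip_bdry \<T> (\<lambda>T F x. (encl_diam F powr (- 1 / 2)) *\<^sub>R ?c T F x) (\<lambda>T F x. (encl_diam F powr (1 / 2)) *\<^sub>R s T x)"
    by (rule ip_bdry_weight) (rule powr_inverse_pair[OF encl_diam_facet_pos])
  then have A: "\<bar>ip_bdry \<T> ?c (\<lambda>T F x. s T x)\<bar> \<le> sqrt (nD u uh) * sqrt (ip_bdry \<T> (\<lambda>T F x. (encl_diam F powr (1 / 2)) *\<^sub>R s T x) (\<lambda>T F x. (encl_diam F powr (1 / 2)) *\<^sub>R s T x))"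
    unfolding nD_alt by (simp only:) (intro ip_bdry_le cont_bdry_scaleR cont_bdry_tangential u cs)
  have B: "ip_bdry \<T> (\<lambda>T F x. (encl_diam F powr (1 / 2)) *\<^sub>R s T x) (\<lambda>T F x. (encl_diam F powr (1 / 2)) *\<^sub>R s T x)
      = (\<Sum>T\<in>\<T>. \<Sum>F | F facet_of T. encl_diam F powr 1 * face_integral F (\<lambda>x. s T x \<bullet> s T x))"
    unfolding ip_bdry_scaled[OF cs, of "\<lambda>F. encl_diam F powr (1 / 2)"] using encl_diam_facet_pos by (intro sum.cong refl) (simp add: powr_half_square)
  have C: "sqrt (nD u uh) * sqrt (\<Sum>T\<in>\<T>. \<Sum>F | F facet_of T. encl_diam F powr 1 * face_integral F (\<lambda>x. s T x \<bullet> s T x)) \<le> sqrt (nD u uh) * sqrt (K1 * ip_elem \<T> s s)"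
  proof (intro mult_left_mono real_sqrt_le_mono)
    have "(\<Sum>T\<in>\<T>. \<Sum>F | F facet_of T. encl_diam F powr 1 * face_integral F (\<lambda>x. s T x \<bullet> s T x)) \<le> K1 * (\<Sum>T\<in>\<T>. encl_diam T powr (1 - 1) * integral T (\<lambda>x. s T x \<bullet> s T x))"
      by (rule weighted_trace[OF sk]) simp
    also have "(\<Sum>T\<in>\<T>. encl_diam T powr (1 - 1) * integral T (\<lambda>x. s T x \<bullet> s T x)) = ip_elem \<T> s s"
      unfolding ip_elem_def using encl_diam_element_pos by (intro sum.cong) (auto simp: less_imp_neq[symmetric])
    finally show "(\<Sum>T\<in>\<T>. \<Sum>F | F facet_of T. encl_diam F powr 1 * face_integral F (\<lambda>x. s T x \<bullet> s T x)) \<le> K1 * ip_elem \<T> s s" .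
  qed (use nonneg u in auto)
  show ?thesis using order.trans[OF A[unfolded B] C] by (simp add: real_sqrt_mult ac_simps)
qed

text \<open>The weighted norm that bounds the normal traces in \<open>c_h\<close> and, by \<open>nJ_le_W\<close>, the divergence and the normal jumps.\<close>

definition W :: "(real^3) field \<Rightarrow> real" where
  "W v = (\<Sum>T\<in>\<T>. encl_diam T powr (- \<alpha> - 1) * integral T (\<lambda>x. v T x \<bullet> v T x))"

lemma normal_sum_bound:
  assumes v: "v \<in> vpoly_elem k \<T>"
  shows "(\<Sum>T\<in>\<T>. \<Sum>F | F facet_of T. encl_diam F powr (- \<alpha>) * face_integral F (\<lambda>x. (outward_normal T F \<bullet> v T x) * (outward_normal T F \<bullet> v T x))) \<le> K1 * W v"
proof -
  have "(\<Sum>T\<in>\<T>. \<Sum>F | F facet_of T. encl_diam F powr (- \<alpha>) * face_integral F (\<lambda>x. (outward_normal T F \<bullet> v T x) * (outward_normal T F \<bullet> v T x)))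
    \<le> (\<Sum>T\<in>\<T>. \<Sum>F | F facet_of T. encl_diam F powr (- \<alpha>) * face_integral F (\<lambda>x. v T x \<bullet> v T x))"
  proof (intro sum_mono mult_left_mono)
    fix T F assume T: "T \<in> \<T>" "F \<in> {F. F facet_of T}"
    have F: "F facet_of T" using T by simp
    note cv = vdeg_continuous[OF vpoly_elemD[OF v]]
    show "face_integral F (\<lambda>x. (outward_normal T F \<bullet> v T x) * (outward_normal T F \<bullet> v T x)) \<le> face_integral F (\<lambda>x. v T x \<bullet> v T x)"
    proof (rule posfun_mono[OF posfun_facet[OF T(1) F]])
      fix x
      have "\<bar>outward_normal T F \<bullet> v T x\<bar> \<le> norm (v T x)"
        using Cauchy_Schwarz_ineq2[of "outward_normal T F" "v T x"] norm_outward_normal[OF T(1) F] by simp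
      then have "\<bar>outward_normal T F \<bullet> v T x\<bar>\<^sup>2 \<le> (norm (v T x))\<^sup>2" by (intro power_mono) auto
      then show "(outward_normal T F \<bullet> v T x) * (outward_normal T F \<bullet> v T x) \<le> v T x \<bullet> v T x"
        by (simp add: power2_eq_square dot_square_norm)
    qed (intro continuous_intros cv)+
  qed simp
  also have "\<dots> \<le> K1 * (\<Sum>T\<in>\<T>. encl_diam T powr (- \<alpha> - 1) * integral T (\<lambda>x. v T x \<bullet> v T x))"
    by (rule weighted_trace) (use \<alpha> vpoly_elemD[OF v] in auto)
  finally show ?thesis by (simp add: W_def)
qed

lemma normal_bound:
  assumes v: "v \<in> vpoly_elem k \<T>" and q: "q \<in> poly_elem k \<T>" "qh \<in> poly_face k \<T>"
  shows "\<bar>ip_bdry \<T> (\<lambda>T F x. outward_normal T F \<bullet> v T x) (\<lambda>T F x. q T x - qh F x)\<bar> \<le> sqrt (K1 * W v) * sqrt (nP q qh)"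
proof -
  let ?n = "\<lambda>T F x. outward_normal T F \<bullet> v T x"
  have "ip_bdry \<T> ?n (\<lambda>T F x. q T x - qh F x) = ip_bdry \<T> (\<lambda>T F x. (encl_diam F powr (- \<alpha> / 2)) *\<^sub>R ?n T F x) (\<lambda>T F x. (encl_diam F powr (\<alpha> / 2)) *\<^sub>R (q T x - qh F x))"
    by (rule ip_bdry_weight) (rule powr_inverse_pair[OF encl_diam_facet_pos])
  then have A: "\<bar>ip_bdry \<T> ?n (\<lambda>T F x. q T x - qh F x)\<bar> \<le> sqrt (ip_bdry \<T> (\<lambda>T F x. (encl_diam F powr (- \<alpha> / 2)) *\<^sub>R ?n T F x) (\<lambda>T F x. (encl_diam F powr (- \<alpha> / 2)) *\<^sub>R ?n T F x)) * sqrt (nP q qh)"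
    unfolding nP_alt by (simp only:) (intro ip_bdry_le cont_bdry_scaleR cont_bdry_normal cont_bdry_scalar v q)
  have B: "ip_bdry \<T> (\<lambda>T F x. (encl_diam F powr (- \<alpha> / 2)) *\<^sub>R ?n T F x) (\<lambda>T F x. (encl_diam F powr (- \<alpha> / 2)) *\<^sub>R ?n T F x)
      = (\<Sum>T\<in>\<T>. \<Sum>F | F facet_of T. encl_diam F powr (- \<alpha>) * face_integral F (\<lambda>x. ?n T F x * ?n T F x))"
    unfolding ip_bdry_scaled[OF cont_bdry_normal[OF v], of "\<lambda>F. encl_diam F powr (- \<alpha> / 2)"] using encl_diam_facet_pos
    by (intro sum.cong refl) (simp only: powr_half_square mem_Collect_eq inner_real_def)
  have C: "sqrt (\<Sum>T\<in>\<T>. \<Sum>F | F facet_of T. encl_diam F powr (- \<alpha>) * face_integral F (\<lambda>x. ?n T F x * ?n T F x)) * sqrt (nP q qh) \<le> sqrt (K1 * W v) * sqrt (nP q qh)"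
    by (intro mult_right_mono real_sqrt_le_mono normal_sum_bound v) (use nonneg q in auto)
  show ?thesis by (rule order.trans[OF A[unfolded B] C])
qed

text \<open>A test function of norm zero yields no information from the bound on \<open>B_h\<close>; this lemma and the next one are about
that case.\<close>

lemma c_h_zero_P:
  assumes u: "u \<in> vpoly_elem k \<T>" and q: "q \<in> poly_elem k \<T>" "qh \<in> poly_face k \<T>" and 0: "nG q = 0" "nP q qh = 0"
  shows "c_h \<T> q qh u = 0"
proof -
  have "ip_elem \<T> u (\<lambda>T. grad (q T)) = ip_elem \<T> (\<lambda>T x. (encl_diam T powr (- (\<alpha> + 1) / 2)) *\<^sub>R u T x) (\<lambda>T x. (encl_diam T powr ((\<alpha> + 1) / 2)) *\<^sub>R grad (q T) x)"
    by (rule ip_elem_weight) (rule powr_inverse_pair[OF encl_diam_element_pos])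
  then have "\<bar>ip_elem \<T> u (\<lambda>T. grad (q T))\<bar> \<le> sqrt (ip_elem \<T> (\<lambda>T x. (encl_diam T powr (- (\<alpha> + 1) / 2)) *\<^sub>R u T x) (\<lambda>T x. (encl_diam T powr (- (\<alpha> + 1) / 2)) *\<^sub>R u T x)) * sqrt (nG q)"
    unfolding nG_def normsq_elem_def
    by (simp only:) (intro ip_elem_le cont_elem_scaleR cont_elem_vdeg[OF vpoly_elemD[OF u]] cont_elem_vdeg[OF vdeg_grad[OF poly_elemD[OF q(1)]]])
  then have 1: "ip_elem \<T> u (\<lambda>T. grad (q T)) = 0" using 0 by simp
  have "ip_bdry \<T> (\<lambda>T F x. outward_normal T F \<bullet> u T x) (\<lambda>T F x. q T x - qh F x) = 0"
    using normal_bound[OF u q] 0 by simp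
  then show ?thesis using c_h_by_parts[OF u q] 1 by simp
qed

lemma c_h_zero_U:
  assumes v: "v \<in> vpoly_elem k \<T>" and q: "q \<in> poly_elem k \<T>" "qh \<in> Phat0 k \<Omega> \<T>" and 0: "nE v = 0" "nJ v = 0"
  shows "c_h \<T> q qh v = 0"
proof -
  have qh: "qh \<in> poly_face k \<T>" using q(2) by (simp add: Phat0_def)
  have "ip_elem \<T> (\<lambda>T. divergence (v T)) q = ip_elem \<T> (\<lambda>T x. (encl_diam T powr ((1 - \<alpha>) / 2)) *\<^sub>R divergence (v T) x) (\<lambda>T x. (encl_diam T powr (- (1 - \<alpha>) / 2)) *\<^sub>R q T x)"
    by (rule ip_elem_weight) (subst mult.commute, rule powr_inverse_pair[OF encl_diam_element_pos])
  then have "\<bar>ip_elem \<T> (\<lambda>T. divergence (v T)) q\<bar> \<le> sqrt (nE v) * sqrt (ip_elem \<T> (\<lambda>T x. (encl_diam T powr (- (1 - \<alpha>) / 2)) *\<^sub>R q T x) (\<lambda>T x. (encl_diam T powr (- (1 - \<alpha>) / 2)) *\<^sub>R q T x))"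
    unfolding nE_ip by (simp only:) (intro ip_elem_le cont_elem_scaleR cont_elem_pdeg[OF pdeg_divergence[OF vpoly_elemD[OF v]]] cont_elem_pdeg[OF poly_elemD[OF q(1)]])
  then have 1: "ip_elem \<T> (\<lambda>T. divergence (v T)) q = 0" using 0 by simp
  let ?j = "\<lambda>F. jump \<Omega> \<T> (\<lambda>T y. face_normal \<T> F \<bullet> v T y) F"
  have "face_integral F (\<lambda>x. ?j F x * qh F x) = 0" if F: "F \<in> interior_faces \<Omega> \<T>" for F
  proof -
    have cj: "continuous_on F (?j F)" by (rule pdeg_continuous[OF jump_deg[OF v F]])
    have cq: "continuous_on F (qh F)" using poly_face_continuous[OF qh] interior_facesD[OF F] by blast
    note L = posfun_interior_face[OF F]
    have nn: "0 \<le> encl_diam F powr (- \<alpha>) * face_integral F (\<lambda>x. ?j F x * ?j F x)" if "F \<in> interior_faces \<Omega> \<T>" for F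
      by (intro mult_nonneg_nonneg[OF powr_ge_zero] posfun_nonneg[OF posfun_interior_face[OF that]] continuous_on_mult pdeg_continuous[OF jump_deg[OF v that]] zero_le_square)
    have "finite (interior_faces \<Omega> \<T>)" using finite_mesh_faces by (simp add: interior_faces_def)
    then have "encl_diam F powr (- \<alpha>) * face_integral F (\<lambda>x. ?j F x * ?j F x) = 0"
      using 0(2) nn F unfolding nJ_alt[OF v] by (subst (asm) sum_nonneg_eq_0_iff) auto
    then have "face_integral F (\<lambda>x. ?j F x * ?j F x) = 0" using interior_face_diam_pos[OF F] by simp
    then show ?thesis using posfun_Cauchy_Schwarz[OF L cj cq] by simp
  qed
  then show ?thesis using c_h_jumps[OF v q(2), of q] 1 by simp
qed

lemma su_bound:
  assumes u: "u \<in> vpoly_elem k \<T>" "uh \<in> vpoly_face k \<T>" and v: "v \<in> vpoly_elem k \<T>" "vh \<in> vpoly_face k \<T>"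
  shows "\<bar>su_h \<T> u uh v vh\<bar> \<le> sqrt (nD u uh) * sqrt (nD v vh)"
proof -
  have "su_h \<T> u uh v vh = ip_bdry \<T> (\<lambda>T F x. (encl_diam F powr (- 1 / 2)) *\<^sub>R cross3 (outward_normal T F) (u T x - uh F x))
     (\<lambda>T F x. (encl_diam F powr (- 1 / 2)) *\<^sub>R cross3 (outward_normal T F) (v T x - vh F x))"
    unfolding su_h_def ip_bdry_def
  proof (intro sum.cong refl arg_cong2[of _ _ _ _ face_integral] ext)
    fix T F x assume T: "T \<in> \<T>" "F \<in> {F. F facet_of T}"
    have "inverse (encl_diam F) = encl_diam F powr (- 1 / 2) * encl_diam F powr (- 1 / 2)"
      using powr_half[of "encl_diam F" "-1"] encl_diam_facet_pos[OF T(1)] T(2) by (simp add: powr_minus)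
    then show "(inverse (encl_diam F) *\<^sub>R cross3 (outward_normal T F) (u T x - uh F x)) \<bullet> cross3 (outward_normal T F) (v T x - vh F x)
       = ((encl_diam F powr (- 1 / 2)) *\<^sub>R cross3 (outward_normal T F) (u T x - uh F x)) \<bullet> ((encl_diam F powr (- 1 / 2)) *\<^sub>R cross3 (outward_normal T F) (v T x - vh F x))"
      by simp
  qed
  then show ?thesis unfolding nD_alt by (simp only:) (intro ip_bdry_le cont_bdry_scaleR cont_bdry_tangential u v)
qed

lemma sp_bound:
  assumes p: "p \<in> poly_elem k \<T>" "ph \<in> poly_face k \<T>" and q: "q \<in> poly_elem k \<T>" "qh \<in> poly_face k \<T>"
  shows "\<bar>sp_h \<alpha> \<T> p ph q qh\<bar> \<le> sqrt (nP p ph) * sqrt (nP q qh)"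
proof -
  have "sp_h \<alpha> \<T> p ph q qh = ip_bdry \<T> (\<lambda>T F x. (encl_diam F powr (\<alpha> / 2)) *\<^sub>R (p T x - ph F x)) (\<lambda>T F x. (encl_diam F powr (\<alpha> / 2)) *\<^sub>R (q T x - qh F x))"
    unfolding sp_h_def ip_bdry_def
  proof (intro sum.cong refl arg_cong2[of _ _ _ _ face_integral] ext)
    fix T F x assume T: "T \<in> \<T>" "F \<in> {F. F facet_of T}"
    have "encl_diam F powr \<alpha> = encl_diam F powr (\<alpha> / 2) * encl_diam F powr (\<alpha> / 2)"
      using powr_half[of "encl_diam F" \<alpha>] encl_diam_facet_pos[OF T(1)] T(2) by simp
    then show "(encl_diam F powr \<alpha> * (p T x - ph F x)) \<bullet> (q T x - qh F x) = ((encl_diam F powr (\<alpha> / 2)) *\<^sub>R (p T x - ph F x)) \<bullet> ((encl_diam F powr (\<alpha> / 2)) *\<^sub>R (q T x - qh F x))"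
      by simp
  qed
  then show ?thesis unfolding nP_alt by (simp only:) (intro ip_bdry_le cont_bdry_scaleR cont_bdry_scalar p q)
qed

subsection \<open>Test functions\<close>

text \<open>The inverse inequality bounds the divergence, and the trace inequality bounds both sides of the normal jump.\<close>

lemma nJ_le_W:
  assumes v: "v \<in> vpoly_elem k \<T>"
  shows "nE v + nJ v \<le> (Cd + 2 * K1) * W v"
proof -
  have "nE v \<le> Cd * W v"
    unfolding nE_alt W_def sum_distrib_left
  proof (rule sum_mono)
    fix T assume T: "T \<in> \<T>"
    let ?h = "encl_diam T" and ?d = "integral T (\<lambda>x. divergence (v T) x * divergence (v T) x)"
    have h: "?h > 0" by (rule encl_diam_element_pos[OF T])
    have "?h powr (1 - \<alpha>) = ?h powr (- \<alpha> - 1) * ?h\<^sup>2"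
      using h by (simp add: powr_numeral[symmetric] powr_add[symmetric] del: powr_numeral)
    then have "?h powr (1 - \<alpha>) * ?d = ?h powr (- \<alpha> - 1) * (?h\<^sup>2 * ?d)" by simp
    also have "\<dots> \<le> ?h powr (- \<alpha> - 1) * (Cd * integral T (\<lambda>x. v T x \<bullet> v T x))"
      by (intro mult_left_mono inverse_div[OF T vpoly_elemD[OF v]]) simp
    finally show "?h powr (1 - \<alpha>) * ?d \<le> Cd * (?h powr (- \<alpha> - 1) * integral T (\<lambda>x. v T x \<bullet> v T x))" by (simp add: ac_simps)
  qed
  moreover have "nJ v \<le> 2 * (K1 * W v)"
  proof -
    let ?g = "\<lambda>T F. encl_diam F powr (- \<alpha>) * face_integral F (\<lambda>x. (outward_normal T F \<bullet> v T x) * (outward_normal T F \<bullet> v T x))"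
    have g0: "0 \<le> ?g T F" if "T \<in> \<T>" "F facet_of T" for T F
      by (intro mult_nonneg_nonneg[OF powr_ge_zero] posfun_nonneg[OF posfun_facet[OF that]] continuous_on_mult continuous_on_inner
          continuous_on_const vdeg_continuous[OF vpoly_elemD[OF v]] zero_le_square)
    have "nJ v \<le> (\<Sum>F\<in>interior_faces \<Omega> \<T>. 2 * (\<Sum>T | T \<in> \<T> \<and> F facet_of T. ?g T F))"
      unfolding nJ_alt[OF v]
    proof (rule sum_mono)
      fix F assume F: "F \<in> interior_faces \<Omega> \<T>"
      note S = face_sides[of F] and F' = interior_facesD[OF F] and L = posfun_interior_face[OF F]
      let ?a = "\<lambda>x. face_normal \<T> F \<bullet> v (elem1 \<T> F) x" and ?b = "\<lambda>x. face_normal \<T> F \<bullet> v (elem2 \<T> F) x"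
      let ?j = "jump \<Omega> \<T> (\<lambda>T y. face_normal \<T> F \<bullet> v T y) F"
      have j: "?j x = ?a x - ?b x" for x using F by (simp add: jump_def interior_faces_def)
      have c: "continuous_on F ?a" "continuous_on F ?b" "continuous_on F ?j"
        by (intro continuous_on_inner continuous_on_const vdeg_continuous[OF vpoly_elemD[OF v]] pdeg_continuous[OF jump_deg[OF v F]])+
      have "face_integral F (\<lambda>x. ?j x * ?j x) \<le> face_integral F (\<lambda>x. 2 * (?a x * ?a x + ?b x * ?b x))"
      proof (rule posfun_mono[OF L])
        fix x
        have "0 \<le> (?a x + ?b x) * (?a x + ?b x)" by (rule zero_le_square)
        then show "?j x * ?j x \<le> 2 * (?a x * ?a x + ?b x * ?b x)" unfolding j by (simp add: algebra_simps)
      qed (intro continuous_on_mult continuous_on_add continuous_on_const c)+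
      also have "\<dots> = 2 * (face_integral F (\<lambda>x. ?a x * ?a x) + face_integral F (\<lambda>x. ?b x * ?b x))"
        using c by (simp only: posfun_cmult[OF L] posfun_add[OF L] continuous_on_add continuous_on_mult)
      finally have "encl_diam F powr (- \<alpha>) * face_integral F (\<lambda>x. ?j x * ?j x) \<le> encl_diam F powr (- \<alpha>) * (2 * (face_integral F (\<lambda>x. ?a x * ?a x) + face_integral F (\<lambda>x. ?b x * ?b x)))"
        by (rule mult_left_mono) simp
      also have "\<dots> = 2 * (?g (elem1 \<T> F) F + ?g (elem2 \<T> F) F)" using S F' by (simp add: distrib_left)
      also have "\<dots> = 2 * (\<Sum>T | T \<in> \<T> \<and> F facet_of T. ?g T F)" by (simp only: sum_interior_sides[OF F])
      finally show "encl_diam F powr (- \<alpha>) * face_integral F (\<lambda>x. ?j x * ?j x) \<le> 2 * (\<Sum>T | T \<in> \<T> \<and> F facet_of T. ?g T F)" .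
    qed
    also have "\<dots> \<le> (\<Sum>F\<in>mesh_faces \<T>. 2 * (\<Sum>T | T \<in> \<T> \<and> F facet_of T. ?g T F))"
      using finite_mesh_faces by (intro sum_mono2) (auto simp: interior_faces_def intro!: sum_nonneg g0)
    also have "\<dots> = 2 * (\<Sum>T\<in>\<T>. \<Sum>F | F facet_of T. ?g T F)" by (simp only: sum_faces_swap sum_distrib_left)
    also have "\<dots> \<le> 2 * (K1 * W v)" using normal_sum_bound[OF v] by simp
    finally show ?thesis .
  qed
  ultimately show ?thesis by (simp add: algebra_simps)
qed

definition K3 :: real where "K3 = Ci + 2 * K1 + 4"

text \<open>The form pairs the divergence with \<open>q\<close> and the normal jump with \<open>- qh\<close>. Proportional choices give squares, with the
powers of the diameters that occur in the norm; the inverse inequality bounds the gradient of \<open>q\<close>, the trace inequality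
its values on faces.\<close>

lemma scalar_test_function:
  assumes u: "u \<in> vpoly_elem k \<T>"
  obtains q qh where "q \<in> poly_elem k \<T>" "qh \<in> Phat0 k \<Omega> \<T>" "c_h \<T> q qh u = nE u + nJ u" "nG q + nP q qh \<le> K3 * (nE u + nJ u)"
proof -
  define q where "q = (\<lambda>T x. encl_diam T powr (1 - \<alpha>) * divergence (u T) x)"
  let ?j = "\<lambda>F. jump \<Omega> \<T> (\<lambda>T y. face_normal \<T> F \<bullet> u T y) F"
  define qh where "qh = (\<lambda>F x. if F \<in> interior_faces \<Omega> \<T> \<and> x \<in> F then - (encl_diam F powr (- \<alpha>)) * ?j F x else 0)"
  have dk: "pdeg (k - 1) (divergence (u T))" for T by (rule pdeg_divergence[OF vpoly_elemD[OF u]])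
  have dk': "pdeg k (divergence (u T))" for T using pdeg_mono[OF dk] by simp
  have qd: "pdeg k (q T)" for T unfolding q_def by (rule pdeg_cmult[OF dk'])
  have q: "q \<in> poly_elem k \<T>"
    by (rule poly_elemI[OF qd]) (simp add: q_def vpoly_elem_outside[OF u] divergence_zero)
  have qh: "qh \<in> Phat0 k \<Omega> \<T>"
  proof -
    have "\<exists>p. poly_fun k p \<and> qh F = (\<lambda>x. if x \<in> F then p x else 0)" if F: "F \<in> mesh_faces \<T>" for F
    proof (cases "F \<in> interior_faces \<Omega> \<T>")
      case True
      then show ?thesis unfolding poly_fun_iff_pdeg
        by (intro exI[of _ "\<lambda>x. - (encl_diam F powr (- \<alpha>)) * ?j F x"] conjI pdeg_cmult jump_deg[OF u]) (auto simp: qh_def)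
    next
      case False
      then show ?thesis unfolding poly_fun_iff_pdeg by (intro exI[of _ "\<lambda>_. 0"] conjI pdeg_const) (auto simp: qh_def)
    qed
    moreover have "qh F = (\<lambda>_. 0)" if "F \<notin> mesh_faces \<T>" for F using that by (auto simp: qh_def interior_faces_def)
    moreover have "qh F x = 0" if "F \<in> boundary_faces \<Omega> \<T>" for F x using that by (auto simp: qh_def interior_faces_def)
    ultimately show ?thesis by (auto simp: Phat0_def poly_face_def)
  qed
  then have qh': "qh \<in> poly_face k \<T>" by (simp add: Phat0_def)
  have cj: "continuous_on F (\<lambda>x. ?j F x * ?j F x)" if "F \<in> interior_faces \<Omega> \<T>" for F
    by (intro continuous_on_mult pdeg_continuous[OF jump_deg[OF u that]])
  have tri_int: "\<exists>a b c. F = convex hull {a, b, c}" if F: "F \<in> interior_faces \<Omega> \<T>" for F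
    using mesh_facesE[of F] facet_is_triangle interior_facesD[OF F] by metis
  have c: "c_h \<T> q qh u = nE u + nJ u"
  proof -
    have "ip_elem \<T> (\<lambda>T. divergence (u T)) q = nE u"
      unfolding nE_alt ip_elem_def
    proof (rule sum.cong[OF refl])
      fix T
      have "(\<lambda>x. divergence (u T) x \<bullet> q T x) = (\<lambda>x. encl_diam T powr (1 - \<alpha>) * (divergence (u T) x * divergence (u T) x))"
        by (simp add: q_def ac_simps)
      then show "integral T (\<lambda>x. divergence (u T) x \<bullet> q T x) = encl_diam T powr (1 - \<alpha>) * integral T (\<lambda>x. divergence (u T) x * divergence (u T) x)"
        by (simp only: integral_mult_right)
    qed
    moreover have "face_integral F (\<lambda>x. ?j F x * qh F x) = - (encl_diam F powr (- \<alpha>) * face_integral F (\<lambda>x. ?j F x * ?j F x))"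
      if F: "F \<in> interior_faces \<Omega> \<T>" for F
    proof -
      have eq: "face_integral F (\<lambda>x. ?j F x * qh F x) = face_integral F (\<lambda>x. - (encl_diam F powr (- \<alpha>)) * (?j F x * ?j F x))"
        by (rule face_integral_cong[OF tri_int[OF F]]) (use F in \<open>simp add: qh_def\<close>)
      show ?thesis using trans[OF eq posfun_cmult[OF posfun_interior_face[OF F] cj[OF F]]] by simp
    qed
    then have "(\<Sum>F\<in>interior_faces \<Omega> \<T>. face_integral F (\<lambda>x. ?j F x * qh F x)) = - nJ u"
      unfolding nJ_alt[OF u] sum_negf[symmetric] by (intro sum.cong) auto
    ultimately show ?thesis using c_h_jumps[OF u qh, of q] by simp
  qed
  have G: "nG q \<le> Ci * nE u"
    unfolding nG_alt nE_alt sum_distrib_left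
  proof (rule sum_mono)
    fix T assume T: "T \<in> \<T>"
    let ?h = "encl_diam T" and ?g = "grad (divergence (u T))"
    have h: "?h > 0" by (rule encl_diam_element_pos[OF T])
    have gr: "grad (q T) x = (?h powr (1 - \<alpha>)) *\<^sub>R ?g x" for x
      using pderivative_cmult[OF pdeg_differentiable[OF dk]] by (simp add: q_def grad_def vec_eq_iff)
    have "(\<lambda>x. grad (q T) x \<bullet> grad (q T) x) = (\<lambda>x. (?h powr (1 - \<alpha>) * ?h powr (1 - \<alpha>)) * (?g x \<bullet> ?g x))"
      by (simp add: gr ac_simps)
    then have "?h powr (\<alpha> + 1) * integral T (\<lambda>x. grad (q T) x \<bullet> grad (q T) x) = (?h powr (\<alpha> + 1) * (?h powr (1 - \<alpha>) * ?h powr (1 - \<alpha>))) * integral T (\<lambda>x. ?g x \<bullet> ?g x)"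
      by (simp only: integral_mult_right mult.assoc)
    also have "?h powr (\<alpha> + 1) * (?h powr (1 - \<alpha>) * ?h powr (1 - \<alpha>)) = ?h powr (1 - \<alpha>) * ?h\<^sup>2"
      using h by (simp add: powr_numeral[symmetric] powr_add[symmetric] del: powr_numeral)
    also have "?h powr (1 - \<alpha>) * ?h\<^sup>2 * integral T (\<lambda>x. ?g x \<bullet> ?g x) = ?h powr (1 - \<alpha>) * (?h\<^sup>2 * integral T (\<lambda>x. ?g x \<bullet> ?g x))" by (rule mult.assoc)
    also have "\<dots> \<le> ?h powr (1 - \<alpha>) * (Ci * integral T (\<lambda>x. divergence (u T) x * divergence (u T) x))"
      by (intro mult_left_mono inverse_grad[OF T dk']) simp
    finally show "?h powr (\<alpha> + 1) * integral T (\<lambda>x. grad (q T) x \<bullet> grad (q T) x) \<le> Ci * (?h powr (1 - \<alpha>) * integral T (\<lambda>x. divergence (u T) x * divergence (u T) x))"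
      by (simp only: ac_simps)
  qed
  have P: "nP q qh \<le> 2 * K1 * nE u + 4 * nJ u"
  proof -
    have cq: "continuous_on F (q T)" "continuous_on F (qh F)" if "T \<in> \<T>" "F facet_of T" for T F
      using pdeg_continuous[OF qd] poly_face_continuous[OF qh' mesh_faceI[OF that]] by auto
    have "nP q qh = (\<Sum>T\<in>\<T>. \<Sum>F | F facet_of T. encl_diam F powr \<alpha> * face_integral F (\<lambda>x. (q T x - qh F x) * (q T x - qh F x)))"
      unfolding nP_alt ip_bdry_scaled[OF cont_bdry_scalar[OF q qh'], of "\<lambda>F. encl_diam F powr (\<alpha> / 2)"] using encl_diam_facet_pos
      by (intro sum.cong refl) (simp only: powr_half_square mem_Collect_eq inner_real_def)
    also have "\<dots> \<le> (\<Sum>T\<in>\<T>. \<Sum>F | F facet_of T. 2 * (encl_diam F powr \<alpha> * face_integral F (\<lambda>x. q T x * q T x)) + 2 * (encl_diam F powr \<alpha> * face_integral F (\<lambda>x. qh F x * qh F x)))"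
    proof (intro sum_mono)
      fix T F assume T: "T \<in> \<T>" "F \<in> {F. F facet_of T}"
      have F: "F facet_of T" using T by simp
      note L = posfun_facet[OF T(1) F] and cc = cq[OF T(1) F]
      have "face_integral F (\<lambda>x. (q T x - qh F x) * (q T x - qh F x)) \<le> face_integral F (\<lambda>x. 2 * (q T x * q T x + qh F x * qh F x))"
      proof (rule posfun_mono[OF L])
        fix x
        have "0 \<le> (q T x + qh F x) * (q T x + qh F x)" by (rule zero_le_square)
        then show "(q T x - qh F x) * (q T x - qh F x) \<le> 2 * (q T x * q T x + qh F x * qh F x)" by (simp add: algebra_simps)
      qed (intro continuous_on_mult continuous_on_add continuous_on_diff continuous_on_const cc)+
      also have "\<dots> = 2 * (face_integral F (\<lambda>x. q T x * q T x) + face_integral F (\<lambda>x. qh F x * qh F x))"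
        using cc by (simp only: posfun_cmult[OF L] posfun_add[OF L] continuous_on_add continuous_on_mult)
      finally have "encl_diam F powr \<alpha> * face_integral F (\<lambda>x. (q T x - qh F x) * (q T x - qh F x)) \<le> encl_diam F powr \<alpha> * (2 * (face_integral F (\<lambda>x. q T x * q T x) + face_integral F (\<lambda>x. qh F x * qh F x)))"
        by (rule mult_left_mono) simp
      then show "encl_diam F powr \<alpha> * face_integral F (\<lambda>x. (q T x - qh F x) * (q T x - qh F x)) \<le> 2 * (encl_diam F powr \<alpha> * face_integral F (\<lambda>x. q T x * q T x)) + 2 * (encl_diam F powr \<alpha> * face_integral F (\<lambda>x. qh F x * qh F x))"
        by (simp add: algebra_simps)
    qed
    also have "\<dots> = 2 * (\<Sum>T\<in>\<T>. \<Sum>F | F facet_of T. encl_diam F powr \<alpha> * face_integral F (\<lambda>x. q T x * q T x))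
        + 2 * (\<Sum>T\<in>\<T>. \<Sum>F | F facet_of T. encl_diam F powr \<alpha> * face_integral F (\<lambda>x. qh F x * qh F x))"
      by (simp only: sum.distrib sum_distrib_left)
    finally have split: "nP q qh \<le> 2 * (\<Sum>T\<in>\<T>. \<Sum>F | F facet_of T. encl_diam F powr \<alpha> * face_integral F (\<lambda>x. q T x * q T x))
        + 2 * (\<Sum>T\<in>\<T>. \<Sum>F | F facet_of T. encl_diam F powr \<alpha> * face_integral F (\<lambda>x. qh F x * qh F x))" .
    have A: "(\<Sum>T\<in>\<T>. \<Sum>F | F facet_of T. encl_diam F powr \<alpha> * face_integral F (\<lambda>x. q T x * q T x)) \<le> K1 * nE u"
    proof -
      have "(\<Sum>T\<in>\<T>. \<Sum>F | F facet_of T. encl_diam F powr \<alpha> * face_integral F (\<lambda>x. q T x * q T x)) \<le> K1 * (\<Sum>T\<in>\<T>. encl_diam T powr (\<alpha> - 1) * integral T (\<lambda>x. q T x * q T x))"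
        by (rule weighted_trace_scalar[OF qd]) (use \<alpha> in auto)
      also have "(\<Sum>T\<in>\<T>. encl_diam T powr (\<alpha> - 1) * integral T (\<lambda>x. q T x * q T x)) = nE u"
        unfolding nE_alt
      proof (rule sum.cong[OF refl])
        fix T assume T: "T \<in> \<T>"
        let ?h = "encl_diam T"
        have h: "?h > 0" by (rule encl_diam_element_pos[OF T])
        have "(\<lambda>x. q T x * q T x) = (\<lambda>x. (?h powr (1 - \<alpha>) * ?h powr (1 - \<alpha>)) * (divergence (u T) x * divergence (u T) x))" by (simp add: q_def ac_simps)
        then have "?h powr (\<alpha> - 1) * integral T (\<lambda>x. q T x * q T x) = (?h powr (\<alpha> - 1) * (?h powr (1 - \<alpha>) * ?h powr (1 - \<alpha>))) * integral T (\<lambda>x. divergence (u T) x * divergence (u T) x)"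
          by (simp only: integral_mult_right mult.assoc)
        also have "?h powr (\<alpha> - 1) * (?h powr (1 - \<alpha>) * ?h powr (1 - \<alpha>)) = ?h powr (1 - \<alpha>)"
          using h by (simp add: powr_add[symmetric])
        finally show "?h powr (\<alpha> - 1) * integral T (\<lambda>x. q T x * q T x) = ?h powr (1 - \<alpha>) * integral T (\<lambda>x. divergence (u T) x * divergence (u T) x)" .
      qed
      finally show ?thesis .
    qed
    have B: "(\<Sum>T\<in>\<T>. \<Sum>F | F facet_of T. encl_diam F powr \<alpha> * face_integral F (\<lambda>x. qh F x * qh F x)) = 2 * nJ u"
    proof -
      let ?g = "\<lambda>F. encl_diam F powr \<alpha> * face_integral F (\<lambda>x. qh F x * qh F x)"
      have "(\<Sum>T\<in>\<T>. \<Sum>F | F facet_of T. ?g F) = (\<Sum>F\<in>mesh_faces \<T>. \<Sum>T | T \<in> \<T> \<and> F facet_of T. ?g F)" by (rule sum_faces_swap)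
      also have "\<dots> = (\<Sum>F\<in>interior_faces \<Omega> \<T>. \<Sum>T | T \<in> \<T> \<and> F facet_of T. ?g F)"
      proof (rule sum.mono_neutral_right[OF finite_mesh_faces])
        show "interior_faces \<Omega> \<T> \<subseteq> mesh_faces \<T>" by (auto simp: interior_faces_def)
        show "\<forall>F\<in>mesh_faces \<T> - interior_faces \<Omega> \<T>. (\<Sum>T | T \<in> \<T> \<and> F facet_of T. ?g F) = 0"
          by (auto simp: qh_def face_integral_zero)
      qed
      also have "\<dots> = 2 * nJ u" unfolding nJ_alt[OF u] sum_distrib_left
      proof (rule sum.cong[OF refl])
        fix F assume F: "F \<in> interior_faces \<Omega> \<T>"
        have "face_integral F (\<lambda>x. qh F x * qh F x) = face_integral F (\<lambda>x. (encl_diam F powr (- \<alpha>) * encl_diam F powr (- \<alpha>)) * (?j F x * ?j F x))"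
          by (rule face_integral_cong[OF tri_int[OF F]]) (use F in \<open>simp add: qh_def\<close>)
        then have "?g F = (encl_diam F powr \<alpha> * (encl_diam F powr (- \<alpha>) * encl_diam F powr (- \<alpha>))) * face_integral F (\<lambda>x. ?j F x * ?j F x)"
          using posfun_cmult[OF posfun_interior_face[OF F] cj[OF F]] by simp
        also have "encl_diam F powr \<alpha> * (encl_diam F powr (- \<alpha>) * encl_diam F powr (- \<alpha>)) = encl_diam F powr (- \<alpha>)"
          using interior_face_diam_pos[OF F] by (simp add: powr_add[symmetric])
        finally show "(\<Sum>T | T \<in> \<T> \<and> F facet_of T. ?g F) = 2 * (encl_diam F powr (- \<alpha>) * face_integral F (\<lambda>x. ?j F x * ?j F x))"
          by (simp only: sum_interior_sides[OF F])
      qed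
      finally show ?thesis .
    qed
    show ?thesis using split A B by simp
  qed
  have "nG q + nP q qh \<le> K3 * (nE u + nJ u)"
  proof -
    have "nG q + nP q qh \<le> (Ci + 2 * K1) * nE u + 4 * nJ u" using G P by (simp add: algebra_simps)
    also have "\<dots> \<le> K3 * nE u + K3 * nJ u"
      unfolding K3_def by (rule add_mono; rule mult_right_mono) (use nonneg(3,4)[OF u] const_pos K1_pos in auto)
    finally show ?thesis by (simp add: algebra_simps)
  qed
  then show ?thesis using that[OF q qh c] by blast
qed

definition K4 :: real where "K4 = K1 + 2 + 2 * Co"

lemma normal_field_on_face:
  assumes "F \<in> mesh_faces \<T>"
  shows "elem1 \<T> F \<in> \<T>" "F facet_of elem1 \<T> F" "norm (face_normal \<T> F) = 1"
proof -
  have "\<exists>T. T \<in> \<T> \<and> F facet_of T" using assms by (auto simp: mesh_faces_def)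
  from someI_ex[OF this] show "elem1 \<T> F \<in> \<T>" "F facet_of elem1 \<T> F" by (auto simp: elem1_def)
  then show "norm (face_normal \<T> F) = 1" unfolding face_normal_def by (rule norm_outward_normal)
qed

lemma zero_Uhat0: "(\<lambda>_ _. 0) \<in> Uhat0 k \<Omega> \<T>"
  by (auto simp: Uhat0_def Uhat_def vpoly_face_def poly_face_def poly_fun_iff_pdeg intro!: exI[of _ "\<lambda>_. 0"] pdeg_const)

lemma grad_norm_triangle:
  assumes T: "T \<in> \<T>" and f: "pdeg k f" and g: "pdeg k g"
  shows "integral T (\<lambda>x. grad g x \<bullet> grad g x) \<le> 2 * integral T (\<lambda>x. grad f x \<bullet> grad f x) + 2 * integral T (\<lambda>x. (norm (grad (\<lambda>y. f y - g y) x))\<^sup>2)"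
    and "grad (\<lambda>y. f y - g y) x = grad f x - grad g x"
proof -
  note L = posfun_element[OF T] and cf = pdeg_continuous_grad[OF f] and cg = pdeg_continuous_grad[OF g]
  show d: "grad (\<lambda>y. f y - g y) x = grad f x - grad g x" for x
    using pderivative_diff[OF pdeg_differentiable[OF f] pdeg_differentiable[OF g]] by (simp add: grad_def vec_eq_iff)
  have "integral T (\<lambda>x. grad g x \<bullet> grad g x) \<le> integral T (\<lambda>x. 2 * (grad f x \<bullet> grad f x) + 2 * ((grad f x - grad g x) \<bullet> (grad f x - grad g x)))"
  proof (rule posfun_mono[OF L])
    fix x
    have "0 \<le> (2 *\<^sub>R grad f x - grad g x) \<bullet> (2 *\<^sub>R grad f x - grad g x)" by (rule inner_ge_zero)
    then show "grad g x \<bullet> grad g x \<le> 2 * (grad f x \<bullet> grad f x) + 2 * ((grad f x - grad g x) \<bullet> (grad f x - grad g x))"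
      by (simp add: inner_diff_left inner_diff_right inner_commute)
  qed (intro continuous_intros cf cg)+
  also have "\<dots> = 2 * integral T (\<lambda>x. grad f x \<bullet> grad f x) + 2 * integral T (\<lambda>x. (grad f x - grad g x) \<bullet> (grad f x - grad g x))"
    by (subst posfun_add[OF L]) (auto intro!: continuous_intros cf cg)
  finally show "integral T (\<lambda>x. grad g x \<bullet> grad g x) \<le> 2 * integral T (\<lambda>x. grad f x \<bullet> grad f x) + 2 * integral T (\<lambda>x. (norm (grad (\<lambda>y. f y - g y) x))\<^sup>2)"
    by (simp add: d dot_square_norm)
qed

text \<open>The field is minus a weighted gradient, hence free of curl. For \<open>\<alpha> = 1\<close> the weight \<open>h\<^sup>2\<close> makes its traces so small
that they are compared with \<open>vh = 0\<close>. For \<open>\<alpha> = - 1\<close> the gradient of a conforming approximation is used. Its tangential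
traces are single-valued and vanish on the boundary, so that \<open>vh\<close> can match them exactly; the error of the
approximation costs the product of the two parts of the pressure norm.\<close>

lemma vector_test_function:
  assumes p: "p \<in> poly_elem k \<T>" "ph \<in> Phat0 k \<Omega> \<T>"
  obtains v vh where "v \<in> vpoly_elem k \<T>" "vh \<in> Uhat0 k \<Omega> \<T>" "nA v = 0" "nD v vh \<le> K4 * (nG p + nP p ph)" "W v \<le> K4 * (nG p + nP p ph)"
    "- ip_elem \<T> v (\<lambda>T. grad (p T)) \<ge> nG p - sqrt Co * sqrt (nP p ph) * sqrt (nG p)"
proof -
  have ph: "ph \<in> poly_face k \<T>" using p(2) by (simp add: Phat0_def)
  have G0: "0 \<le> nG p" and P0: "0 \<le> nP p ph" using nonneg p ph by auto
  have pk: "pdeg k (p T)" for T by (rule poly_elemD[OF p(1)])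
  have gk: "vdeg k (grad (p T))" for T using vdeg_mono[OF vdeg_grad[OF pk]] by simp
  have nA0: "nA v = 0" if v: "\<And>T x. T \<in> \<T> \<Longrightarrow> curl (v T) x = 0" for v
    unfolding nA_def normsq_elem_def ip_elem_def using v by (intro sum.neutral) simp
  have curl_scaled: "curl (\<lambda>x. c *\<^sub>R grad f x) y = 0" if f: "pdeg k f" for c f and y :: "real^3"
  proof -
    have "(\<lambda>x. c *\<^sub>R grad f x) = grad (\<lambda>x. c * f x)"
      using pderivative_cmult[OF pdeg_differentiable[OF f]] by (simp add: fun_eq_iff grad_def vec_eq_iff)
    then show ?thesis using curl_grad[OF pdeg_cmult[OF f]] by simp
  qed
  show ?thesis
  proof (cases "\<alpha> = 1")
    case True
    define v where "v = (\<lambda>T x. if T \<in> \<T> then (- ((encl_diam T)\<^sup>2)) *\<^sub>R grad (p T) x else 0)"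
    have vT: "v T = (\<lambda>x. (- ((encl_diam T)\<^sup>2)) *\<^sub>R grad (p T) x)" if "T \<in> \<T>" for T using that by (simp add: v_def)
    have vk: "vdeg k (v T)" if "T \<in> \<T>" for T unfolding vT[OF that] by (rule vdeg_scaleR[OF gk])
    have v: "v \<in> vpoly_elem k \<T>" by (rule vpoly_elemI[OF vk]) (simp_all add: v_def)
    have A: "nA v = 0" by (rule nA0) (simp only: vT curl_scaled[OF pk])
    have vv: "integral T (\<lambda>x. v T x \<bullet> v T x) = encl_diam T ^ 4 * integral T (\<lambda>x. grad (p T) x \<bullet> grad (p T) x)" if T: "T \<in> \<T>" for T
    proof -
      have "(\<lambda>x. v T x \<bullet> v T x) = (\<lambda>x. encl_diam T ^ 4 * (grad (p T) x \<bullet> grad (p T) x))"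
        unfolding vT[OF T] by (simp add: power4_eq_xxxx power2_eq_square ac_simps)
      then show ?thesis by (simp only: integral_mult_right)
    qed
    have pw: "encl_diam T powr (-2) * (encl_diam T ^ 4 * z) = (encl_diam T)\<^sup>2 * z" if "T \<in> \<T>" for T z
      using encl_diam_element_pos[OF that] by (simp add: powr_minus powr_numeral field_simps power4_eq_xxxx power2_eq_square)
    have G: "nG p = (\<Sum>T\<in>\<T>. (encl_diam T)\<^sup>2 * integral T (\<lambda>x. grad (p T) x \<bullet> grad (p T) x))"
      unfolding nG_alt unfolding True using encl_diam_element_pos by (intro sum.cong refl) (simp add: less_imp_le)
    have sumv: "(\<Sum>T\<in>\<T>. encl_diam T powr (-2) * integral T (\<lambda>x. v T x \<bullet> v T x)) = nG p"
      unfolding G by (intro sum.cong refl) (simp only: vv pw)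
    then have W: "W v = nG p" unfolding W_def using True by simp
    have D: "nD v (\<lambda>_ _. 0) \<le> K1 * nG p"
    proof -
      have c: "cont_bdry (\<lambda>T F x. cross3 (outward_normal T F) (v T x - 0))"
        unfolding cont_bdry_def by (intro ballI allI impI continuous_on_cross_const continuous_on_diff continuous_on_const vdeg_continuous[OF vk])
      have "nD v (\<lambda>_ _. 0) = (\<Sum>T\<in>\<T>. \<Sum>F | F facet_of T. encl_diam F powr (- 1) * face_integral F (\<lambda>x. cross3 (outward_normal T F) (v T x - 0) \<bullet> cross3 (outward_normal T F) (v T x - 0)))"
        unfolding nD_alt ip_bdry_scaled[OF c, of "\<lambda>F. encl_diam F powr (- 1 / 2)"] using encl_diam_facet_pos
        by (intro sum.cong refl) (simp only: powr_half_square mem_Collect_eq)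
      also have "\<dots> \<le> (\<Sum>T\<in>\<T>. \<Sum>F | F facet_of T. encl_diam F powr (- 1) * face_integral F (\<lambda>x. v T x \<bullet> v T x))"
      proof (intro sum_mono mult_left_mono)
        fix T F assume T: "T \<in> \<T>" "F \<in> {F. F facet_of T}"
        have F: "F facet_of T" using T by simp
        note cv = vdeg_continuous[OF vk[OF T(1)]]
        show "face_integral F (\<lambda>x. cross3 (outward_normal T F) (v T x - 0) \<bullet> cross3 (outward_normal T F) (v T x - 0)) \<le> face_integral F (\<lambda>x. v T x \<bullet> v T x)"
        proof (rule posfun_mono[OF posfun_facet[OF T(1) F]])
          fix x
          have "(norm (cross3 (outward_normal T F) (v T x)))\<^sup>2 \<le> (norm (v T x))\<^sup>2"
            using norm_cross_dot[of "outward_normal T F" "v T x", unfolded norm_outward_normal[OF T(1) F] mult_1_left] zero_le_power2[of "outward_normal T F \<bullet> v T x"] by linarith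
          then show "cross3 (outward_normal T F) (v T x - 0) \<bullet> cross3 (outward_normal T F) (v T x - 0) \<le> v T x \<bullet> v T x"
            by (simp add: dot_square_norm)
        qed (intro continuous_on_inner continuous_on_cross_const continuous_on_diff continuous_on_const cv)+
      qed simp
      also have "\<dots> \<le> K1 * (\<Sum>T\<in>\<T>. encl_diam T powr (- 1 - 1) * integral T (\<lambda>x. v T x \<bullet> v T x))"
        by (rule weighted_trace[OF vk]) auto
      finally show ?thesis using sumv by simp
    qed
    have I: "- ip_elem \<T> v (\<lambda>T. grad (p T)) = nG p"
      unfolding G ip_elem_def sum_negf[symmetric] by (intro sum.cong refl) (simp add: vT)
    have K: "K1 * nG p \<le> K4 * (nG p + nP p ph)" "nG p \<le> K4 * (nG p + nP p ph)"
    proof -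
      have "K1 \<le> K4" "1 \<le> K4" using K1_pos const_pos by (simp_all add: K4_def)
      from this[THEN mult_right_mono[OF _ G0]] have "K1 * nG p \<le> K4 * nG p" "1 * nG p \<le> K4 * nG p" .
      moreover have "0 \<le> K4 * nP p ph" using K1_pos const_pos P0 by (simp add: K4_def)
      ultimately show "K1 * nG p \<le> K4 * (nG p + nP p ph)" "nG p \<le> K4 * (nG p + nP p ph)" by (simp_all add: distrib_left)
    qed
    show ?thesis
    proof (rule that[OF v zero_Uhat0 A])
      show "nD v (\<lambda>_ _. 0) \<le> K4 * (nG p + nP p ph)" using D K(1) by simp
      show "W v \<le> K4 * (nG p + nP p ph)" using W K(2) by simp
      show "nG p - sqrt Co * sqrt (nP p ph) * sqrt (nG p) \<le> - ip_elem \<T> v (\<lambda>T. grad (p T))"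
        unfolding I using const_pos P0 G0 by simp
    qed
  next
    case False
    then have a1: "\<alpha> = - 1" using \<alpha> by auto
    have ph0: "\<forall>F\<in>mesh_faces \<T>. F \<subseteq> frontier \<Omega> \<longrightarrow> (\<forall>x\<in>F. ph F x = 0)" using p(2) by (auto simp: Phat0_def boundary_faces_def)
    have phk: "\<forall>F\<in>mesh_faces \<T>. \<exists>q. pdeg k q \<and> (\<forall>x\<in>F. ph F x = q x)" using poly_faceD[OF ph] by blast
    let ?RHS = "\<Sum>T\<in>\<T>. \<Sum>F | F facet_of T. inverse (encl_diam F) * face_integral F (\<lambda>x. (p T x - ph F x)\<^sup>2)"
    let ?e = "\<lambda>pc. \<Sum>T\<in>\<T>. integral T (\<lambda>x. (norm (grad (\<lambda>y. p T y - pc T y) x))\<^sup>2)"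
    have pk': "\<forall>T\<in>\<T>. pdeg k (p T)" using pk by simp
    obtain pc where PC: "(\<forall>T\<in>\<T>. pdeg k (pc T)) \<and>
        (\<forall>T\<in>\<T>. \<forall>T'\<in>\<T>. \<forall>F. F facet_of T \<longrightarrow> F facet_of T' \<longrightarrow> (\<forall>x\<in>F. pc T x = pc T' x)) \<and>
        (\<forall>T\<in>\<T>. \<forall>F. F facet_of T \<longrightarrow> F \<subseteq> frontier \<Omega> \<longrightarrow> (\<forall>x\<in>F. pc T x = 0)) \<and> ?e pc \<le> Co * ?RHS"
      by (rule exE[OF conforming_approx[OF pk' phk ph0]])
    have pc1: "pdeg k (pc T)" if "T \<in> \<T>" for T using conjunct1[OF PC] that by (rule bspec)
    have pc2: "pc T x = pc T' x" if "T \<in> \<T>" "T' \<in> \<T>" "F facet_of T" "F facet_of T'" "x \<in> F" for T T' F x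
      by (rule conjunct1[OF conjunct2[OF PC], THEN bspec, OF that(1), THEN bspec, OF that(2), THEN spec, THEN mp, OF that(3), THEN mp, OF that(4), THEN bspec, OF that(5)])
    have pc3: "pc T x = 0" if "T \<in> \<T>" "F facet_of T" "F \<subseteq> frontier \<Omega>" "x \<in> F" for T F x
      by (rule conjunct1[OF conjunct2[OF conjunct2[OF PC]], THEN bspec, OF that(1), THEN spec, THEN mp, OF that(2), THEN mp, OF that(3), THEN bspec, OF that(4)])
    note pc4 = conjunct2[OF conjunct2[OF conjunct2[OF PC]]]
    have RHS: "?RHS = nP p ph"
    proof -
      have "nP p ph = (\<Sum>T\<in>\<T>. \<Sum>F | F facet_of T. encl_diam F powr \<alpha> * face_integral F (\<lambda>x. (p T x - ph F x) * (p T x - ph F x)))"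
        unfolding nP_alt ip_bdry_scaled[OF cont_bdry_scalar[OF p(1) ph], of "\<lambda>F. encl_diam F powr (\<alpha> / 2)"] using encl_diam_facet_pos
        by (intro sum.cong refl) (simp only: powr_half_square mem_Collect_eq inner_real_def)
      also have "\<dots> = ?RHS" unfolding a1
      proof (intro sum.cong refl)
        fix T F assume "T \<in> \<T>" "F \<in> {F. F facet_of T}"
        then have "0 < encl_diam F" using encl_diam_facet_pos by blast
        then show "encl_diam F powr (- 1) * face_integral F (\<lambda>x. (p T x - ph F x) * (p T x - ph F x)) = inverse (encl_diam F) * face_integral F (\<lambda>x. (p T x - ph F x)\<^sup>2)"
          by (simp add: powr_minus power2_eq_square)
      qed
      finally show ?thesis by simp
    qed
    have e: "?e pc \<le> Co * nP p ph" using pc4 RHS by simp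
    have G: "nG p = (\<Sum>T\<in>\<T>. integral T (\<lambda>x. grad (p T) x \<bullet> grad (p T) x))"
      unfolding nG_alt unfolding a1 using encl_diam_element_pos by (intro sum.cong refl) (simp add: less_imp_neq[symmetric])
    define v where "v = (\<lambda>T x. if T \<in> \<T> then (- 1) *\<^sub>R grad (pc T) x else 0)"
    have vT: "v T = (\<lambda>x. (- 1) *\<^sub>R grad (pc T) x)" if "T \<in> \<T>" for T using that by (simp add: v_def)
    have pck: "vdeg k (grad (pc T))" if "T \<in> \<T>" for T using vdeg_mono[OF vdeg_grad[OF pc1[OF that]]] by simp
    have vk: "vdeg k (v T)" if "T \<in> \<T>" for T unfolding vT[OF that] by (rule vdeg_scaleR[OF pck[OF that]])
    have v: "v \<in> vpoly_elem k \<T>" by (rule vpoly_elemI[OF vk]) (simp_all add: v_def)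
    have A: "nA v = 0" by (rule nA0) (simp only: vT curl_scaled[OF pc1])
    \<comment> \<open>the tangential part of the trace, taken from the first element of the face\<close>
    define w where "w = (\<lambda>F x. - (grad (pc (elem1 \<T> F)) x - (grad (pc (elem1 \<T> F)) x \<bullet> face_normal \<T> F) *\<^sub>R face_normal \<T> F))"
    define vh where "vh = (\<lambda>F x. if F \<in> mesh_faces \<T> \<and> x \<in> F then w F x else 0)"
    have wk: "pdeg k (\<lambda>x. w F x $ i)" if F: "F \<in> mesh_faces \<T>" for F i
    proof -
      have gk: "vdeg k (grad (pc (elem1 \<T> F)))" by (rule pck[OF normal_field_on_face(1)[OF F]])
      have "pdeg k (\<lambda>x. (- 1) * (grad (pc (elem1 \<T> F)) x $ i - face_normal \<T> F $ i * (face_normal \<T> F \<bullet> grad (pc (elem1 \<T> F)) x)))"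
        using gk by (intro pdeg_cmult pdeg_diff pdeg_inner) (auto simp: vdeg_def)
      then show ?thesis by (simp add: w_def inner_commute mult.commute)
    qed
    have vh_face: "vh \<in> vpoly_face k \<T>"
      unfolding vpoly_face_def poly_face_def poly_fun_iff_pdeg
    proof (intro CollectI allI conjI ballI impI)
      show "\<exists>q. pdeg k q \<and> (\<lambda>x. vh F x $ i) = (\<lambda>x. if x \<in> F then q x else 0)" if "F \<in> mesh_faces \<T>" for F i
        using wk[OF that, of i] that by (intro exI[of _ "\<lambda>x. w F x $ i"]) (auto simp: vh_def)
      show "(\<lambda>x. vh F x $ i) = (\<lambda>_. 0)" if "F \<notin> mesh_faces \<T>" for F i using that by (simp add: vh_def)
    qed
    have cross_w: "cross3 n (w F x) = - cross3 n (grad (pc (elem1 \<T> F)) x)" if "n = face_normal \<T> F \<or> n = - face_normal \<T> F" for n F x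
      using that by (auto simp: w_def Cross3.right_diff_distrib cross_mult_right)
    have vh: "vh \<in> Uhat0 k \<Omega> \<T>"
    proof -
      have "vh F x \<bullet> face_normal \<T> F = 0" if F: "F \<in> mesh_faces \<T>" "x \<in> F" for F x
        using normal_field_on_face(3)[OF F(1)] F by (simp add: vh_def w_def inner_diff_left dot_square_norm)
      moreover have "cross3 (face_normal \<T> F) (vh F x) = 0" if F: "F \<in> boundary_faces \<Omega> \<T>" "x \<in> F" for F x
      proof -
        have F': "F \<in> mesh_faces \<T>" "F \<subseteq> frontier \<Omega>" using F(1) by (auto simp: boundary_faces_def)
        note N = normal_field_on_face[OF F'(1)]
        have "cross3 (outward_normal (elem1 \<T> F) F) (grad (pc (elem1 \<T> F)) x) = 0"
          by (rule tangential_gradient_zero[OF N(1,2) pc1[OF N(1)] pc3[OF N(1,2) F'(2)] F(2)])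
        then show ?thesis using F F' cross_w[of "face_normal \<T> F" F x] by (simp add: vh_def face_normal_def)
      qed
      ultimately show ?thesis using vh_face by (auto simp: Uhat0_def Uhat_def)
    qed
    have tang: "cross3 (outward_normal T F) (v T x - vh F x) = 0" if T: "T \<in> \<T>" "F facet_of T" and x: "x \<in> F" for T F x
    proof -
      have mf: "F \<in> mesh_faces \<T>" by (rule mesh_faceI[OF T])
      note N = normal_field_on_face[OF mf]
      let ?T1 = "elem1 \<T> F" and ?n = "outward_normal T F"
      have n: "?n = face_normal \<T> F \<or> ?n = - face_normal \<T> F"
        using opposite_normal[OF N(1,2) T] by (cases "T = ?T1") (auto simp: face_normal_def)
      have "cross3 ?n (grad (\<lambda>y. pc T y - pc ?T1 y) x) = 0"
        by (rule tangential_gradient_zero[OF T pdeg_diff[OF pc1[OF T(1)] pc1[OF N(1)]] _ x]) (simp add: pc2[OF T(1) N(1) T(2) N(2)])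
      then have "cross3 ?n (grad (pc T) x) - cross3 ?n (grad (pc ?T1) x) = 0"
        unfolding grad_norm_triangle(2)[OF T(1) pc1[OF T(1)] pc1[OF N(1)]] by (simp add: Cross3.right_diff_distrib)
      then show ?thesis using x mf cross_w[OF n, of x] by (simp add: vh_def vT[OF T(1)] Cross3.right_diff_distrib)
    qed
    have D: "nD v vh = 0"
      unfolding nD_def su_h_def ip_bdry_def
    proof (intro sum.neutral ballI)
      fix T F assume T: "T \<in> \<T>" "F \<in> {F. F facet_of T}"
      have "face_integral F (\<lambda>x. (inverse (encl_diam F) *\<^sub>R cross3 (outward_normal T F) (v T x - vh F x)) \<bullet> cross3 (outward_normal T F) (v T x - vh F x)) = face_integral F (\<lambda>_. 0)"
        by (rule face_integral_cong[OF facet_is_triangle[OF T(1)]]) (use T tang in auto)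
      then show "face_integral F (\<lambda>x. (inverse (encl_diam F) *\<^sub>R cross3 (outward_normal T F) (v T x - vh F x)) \<bullet> cross3 (outward_normal T F) (v T x - vh F x)) = 0"
        by (simp add: face_integral_zero)
    qed
    have W: "W v \<le> 2 * nG p + 2 * (Co * nP p ph)"
    proof -
      have "W v = (\<Sum>T\<in>\<T>. integral T (\<lambda>x. grad (pc T) x \<bullet> grad (pc T) x))"
        unfolding W_def unfolding a1 using encl_diam_element_pos by (intro sum.cong refl) (simp add: vT less_imp_neq[symmetric])
      also have "\<dots> \<le> (\<Sum>T\<in>\<T>. 2 * integral T (\<lambda>x. grad (p T) x \<bullet> grad (p T) x) + 2 * integral T (\<lambda>x. (norm (grad (\<lambda>y. p T y - pc T y) x))\<^sup>2))"
        by (intro sum_mono grad_norm_triangle(1) pk pc1)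
      also have "\<dots> = 2 * nG p + 2 * ?e pc" unfolding G by (simp only: sum.distrib sum_distrib_left)
      finally show ?thesis using e by simp
    qed
    have K4': "2 * nG p + 2 * (Co * nP p ph) \<le> K4 * (nG p + nP p ph)"
    proof -
      have "2 \<le> K4" "2 * Co \<le> K4" using K1_pos const_pos by (simp_all add: K4_def)
      from mult_right_mono[OF this(1) G0] mult_right_mono[OF this(2) P0] have "2 * nG p \<le> K4 * nG p" "2 * Co * nP p ph \<le> K4 * nP p ph" .
      then show ?thesis by (simp add: distrib_left)
    qed
    have I: "nG p - sqrt Co * sqrt (nP p ph) * sqrt (nG p) \<le> - ip_elem \<T> v (\<lambda>T. grad (p T))"
    proof -
      let ?d = "\<lambda>T. grad (\<lambda>y. p T y - pc T y)"
      have dk: "vdeg k (?d T)" if "T \<in> \<T>" for T using vdeg_mono[OF vdeg_grad[OF pdeg_diff[OF pk pc1[OF that]]]] by simp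
      have "ip_elem \<T> ?d (\<lambda>T. grad (p T)) = nG p + ip_elem \<T> v (\<lambda>T. grad (p T))"
        unfolding ip_elem_def G sum.distrib[symmetric]
      proof (rule sum.cong[OF refl])
        fix T assume T: "T \<in> \<T>"
        have "(\<lambda>x. ?d T x \<bullet> grad (p T) x) = (\<lambda>x. grad (p T) x \<bullet> grad (p T) x + v T x \<bullet> grad (p T) x)"
          unfolding grad_norm_triangle(2)[OF T pk pc1[OF T]] vT[OF T] by (simp add: inner_diff_left)
        then show "integral T (\<lambda>x. ?d T x \<bullet> grad (p T) x) = integral T (\<lambda>x. grad (p T) x \<bullet> grad (p T) x) + integral T (\<lambda>x. v T x \<bullet> grad (p T) x)"
          using posfun_add[OF posfun_element[OF T], of "\<lambda>x. grad (p T) x \<bullet> grad (p T) x" "\<lambda>x. v T x \<bullet> grad (p T) x"]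
            continuous_on_inner[OF vdeg_continuous[OF gk] vdeg_continuous[OF gk]] continuous_on_inner[OF vdeg_continuous[OF vk[OF T]] vdeg_continuous[OF gk]] by simp
      qed
      moreover have "\<bar>ip_elem \<T> ?d (\<lambda>T. grad (p T))\<bar> \<le> sqrt (?e pc) * sqrt (nG p)"
        using ip_elem_le[OF cont_elem_vdeg[OF dk] cont_elem_vdeg[OF gk]] unfolding G ip_elem_def by (simp add: dot_square_norm)
      moreover have "sqrt (?e pc) * sqrt (nG p) \<le> sqrt (Co * nP p ph) * sqrt (nG p)"
        using e G0 by (intro mult_right_mono real_sqrt_le_mono) auto
      ultimately show ?thesis by (simp add: real_sqrt_mult)
    qed
    show ?thesis
    proof (rule that[OF v vh A _ _ I])
      have "0 \<le> K4 * (nG p + nP p ph)" using K1_pos const_pos G0 P0 by (simp add: K4_def)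
      then show "nD v vh \<le> K4 * (nG p + nP p ph)" using D by simp
      show "W v \<le> K4 * (nG p + nP p ph)" using W K4' by simp
    qed
  qed
qed

lemma vdeg_differentiable: "vdeg j w \<Longrightarrow> (\<lambda>y. w y $ i) differentiable (at x)"
  by (rule pdeg_differentiable[of j]) (simp add: vdeg_def)

lemma curl_uminus: "vdeg j w \<Longrightarrow> curl (\<lambda>x. - w x) x = - curl w x"
  using pderivative_cmult[of "\<lambda>y. w y $ i" x _ "- 1" for i] vdeg_differentiable[of j w]
  by (simp add: curl_def vec_eq_iff forall_3)

lemma divergence_uminus: "vdeg j w \<Longrightarrow> divergence (\<lambda>x. - w x) x = - divergence w x"
  using pderivative_cmult[of "\<lambda>y. w y $ i" x _ "- 1" for i] vdeg_differentiable[of j w]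
  by (simp add: divergence_def sum_negf)

lemma uminus_vpoly_elem: "u \<in> vpoly_elem j \<T> \<Longrightarrow> (\<lambda>T x. - u T x) \<in> vpoly_elem j \<T>"
  using vdeg_scaleR[OF vpoly_elemD, of u j _ "- 1"] vpoly_elem_outside by (auto intro!: vpoly_elemI)

lemma uminus_Uhat0:
  assumes "uh \<in> Uhat0 k \<Omega> \<T>"
  shows "(\<lambda>F x. - uh F x) \<in> Uhat0 k \<Omega> \<T>"
proof -
  have "(\<lambda>F x. - q F x) \<in> poly_face k \<T>" if "q \<in> poly_face k \<T>" for q
    unfolding poly_face_def
  proof (intro CollectI conjI ballI allI impI)
    fix F assume "F \<in> mesh_faces \<T>"
    with that obtain p where "pdeg k p" "q F = (\<lambda>x. if x \<in> F then p x else 0)"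
      by (auto simp: poly_face_def poly_fun_iff_pdeg)
    then show "\<exists>p. poly_fun k p \<and> (\<lambda>x. - q F x) = (\<lambda>x. if x \<in> F then p x else 0)"
      using pdeg_cmult[of k p "- 1"] by (intro exI[of _ "\<lambda>x. - p x"]) (auto simp: poly_fun_iff_pdeg)
  qed (use that in \<open>simp add: poly_face_def\<close>)
  then have "(\<lambda>F x. - uh F x) \<in> vpoly_face k \<T>" using assms by (simp add: Uhat0_def Uhat_def vpoly_face_def)
  then show ?thesis using assms by (simp add: Uhat0_def Uhat_def cross_minus_right)
qed

text \<open>Reversing the sign of the vector unknown turns its stabilisation term positive and lets the off-diagonal terms
cancel.\<close>

lemma diagonal_test_function:
  assumes "(r, u, uh, p, ph) \<in> Sigma0 m k \<Omega> \<T>"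
  defines "\<tau> \<equiv> (r, \<lambda>T x. - u T x, \<lambda>F x. - uh F x, p, ph)"
  shows "\<tau> \<in> Sigma0 m k \<Omega> \<T>" "norm_Sigma \<alpha> \<Omega> \<T> \<tau> = norm_Sigma \<alpha> \<Omega> \<T> (r, u, uh, p, ph)"
    "B_h \<alpha> \<T> (r, u, uh, p, ph) \<tau> = ip_elem \<T> r r + nD u uh + nP p ph"
proof -
  have mem: "r \<in> vpoly_elem m \<T>" "u \<in> vpoly_elem k \<T>" "uh \<in> Uhat0 k \<Omega> \<T>" "p \<in> poly_elem k \<T>" "ph \<in> Phat0 k \<Omega> \<T>"
    using assms by (auto simp: Sigma0_def)
  show "\<tau> \<in> Sigma0 m k \<Omega> \<T>" unfolding \<tau>_def using mem uminus_vpoly_elem uminus_Uhat0 by (auto simp: Sigma0_def)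
  note neg = curl_uminus[OF vpoly_elemD[OF mem(2)]] divergence_uminus[OF vpoly_elemD[OF mem(2)]]
  have x: "cross3 n (- a - - b) = - cross3 n (a - b)" "cross3 n (b - a) = - cross3 n (a - b)" for n a b :: "real^3" by (simp_all add: cross3_simps)
  have su: "su_h \<T> u uh (\<lambda>T x. - u T x) (\<lambda>F x. - uh F x) = - nD u uh"
    unfolding nD_def su_h_def x(1) ip_bdry_commute[of _ _ "\<lambda>T F x. - _ T F x"] by (simp add: ip_bdry_def face_integral_neg sum_negf)
  have nA: "nA (\<lambda>T x. - u T x) = nA u" by (simp add: nA_def normsq_elem_def ip_elem_def neg)
  have nD: "nD (\<lambda>T x. - u T x) (\<lambda>F x. - uh F x) = nD u uh" by (simp add: nD_def su_h_def ip_bdry_def x(1) del: minus_diff_eq diff_minus_eq_add)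
  have nE: "nE (\<lambda>T x. - u T x) = nE u" by (simp add: nE_def normsq_elem_def ip_elem_def neg)
  have nJ: "nJ (\<lambda>T x. - u T x) = nJ u"
  proof -
    have "jump \<Omega> \<T> (\<lambda>T y. face_normal \<T> F \<bullet> - u T y) F x = - jump \<Omega> \<T> (\<lambda>T y. face_normal \<T> F \<bullet> u T y) F x" for F x
      by (simp add: jump_def)
    then show ?thesis by (simp add: nJ_def normsq_int_faces_def)
  qed
  show "norm_Sigma \<alpha> \<Omega> \<T> \<tau> = norm_Sigma \<alpha> \<Omega> \<T> (r, u, uh, p, ph)"
    unfolding \<tau>_def norm_Sigma_eq nA nD nE nJ ..
  have b: "b_h \<T> (\<lambda>T x. - u T x) (\<lambda>F x. - uh F x) r = - b_h \<T> u uh r"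
    unfolding b_h_def cross_minus_right ip_elem_uminus ip_bdry_uminus by simp
  have c: "c_h \<T> p ph (\<lambda>T x. - u T x) = - c_h \<T> p ph u"
    unfolding c_h_def neg inner_minus_right ip_elem_uminus ip_bdry_uminus by simp
  show "B_h \<alpha> \<T> (r, u, uh, p, ph) \<tau> = ip_elem \<T> r r + nD u uh + nP p ph"
    unfolding \<tau>_def B_h.simps su b c nP_def by simp
qed

lemma jump_zero: "jump \<Omega> \<T> (\<lambda>T y. 0) F x = 0"
  by (simp add: jump_def)

lemma norms_of_zero: "nA (\<lambda>_ _. 0) = 0" "nD (\<lambda>_ _. 0) (\<lambda>_ _. 0) = 0" "nE (\<lambda>_ _. 0) = 0" "nJ (\<lambda>_ _. 0) = 0"
    "nG (\<lambda>_ _. 0) = 0" "nP (\<lambda>_ _. 0) (\<lambda>_ _. 0) = 0"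
  using jump_zero by (simp_all add: nA_def nD_def nE_def nJ_def nG_def nP_def su_h_def sp_h_def normsq_elem_def normsq_int_faces_def
      curl_zero divergence_zero grad_zero ip_elem_zero ip_bdry_zero face_integral_zero)

lemma forms_of_zero: "b_h \<T> (\<lambda>_ _. 0) (\<lambda>_ _. 0) s = 0" "b_h \<T> u uh (\<lambda>_ _. 0) = 0"
    "c_h \<T> (\<lambda>_ _. 0) (\<lambda>_ _. 0) u = 0" "c_h \<T> q qh (\<lambda>_ _. 0) = 0"
    "su_h \<T> u uh (\<lambda>_ _. 0) (\<lambda>_ _. 0) = 0" "sp_h \<alpha> \<T> q qh (\<lambda>_ _. 0) (\<lambda>_ _. 0) = 0"
  by (simp_all add: b_h_def c_h_def su_h_def sp_h_def curl_zero divergence_zero ip_elem_zero ip_bdry_zero)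

lemma zero_members: "(\<lambda>_ _. 0) \<in> vpoly_elem j \<T>" "(\<lambda>_ _. 0) \<in> poly_elem j \<T>" "(\<lambda>_ _. 0) \<in> Phat0 k \<Omega> \<T>"
  by (auto simp: Phat0_def vpoly_elem_def poly_elem_def poly_face_def poly_fun_iff_pdeg intro!: exI[of _ "\<lambda>_. 0"] pdeg_const)

lemma ip_elem_vdeg_bound:
  assumes "\<And>T. T \<in> \<T> \<Longrightarrow> vdeg i (u T)" "\<And>T. T \<in> \<T> \<Longrightarrow> vdeg j (v T)"
  shows "\<bar>ip_elem \<T> u v\<bar> \<le> sqrt (ip_elem \<T> u u) * sqrt (ip_elem \<T> v v)"
  using assms by (intro ip_elem_le cont_elem_vdeg)

subsection \<open>The inf-sup condition\<close>

definition K5 :: real where "K5 = K4 + (Cd + 2 * K1) * K4"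
text \<open>Large enough for all the coefficients in the hypotheses of \<open>quadratic_bound\<close>.\<close>

definition Kc :: real where "Kc = 1 + sqrt K1 + sqrt K3 + sqrt Co + sqrt (K1 * K4) + (sqrt K1 + 1) * sqrt K5"

lemma constants_pos: "0 < K3" "0 < K4" "0 < K5"
  using const_pos K1_pos by (simp_all add: K3_def K4_def K5_def add_pos_pos)

lemma constants_le: "1 \<le> Kc" "sqrt K1 \<le> Kc" "sqrt K3 \<le> Kc" "sqrt Co + sqrt (K1 * K4) \<le> Kc" "(sqrt K1 + 1) * sqrt K5 \<le> Kc"
proof -
  have "0 \<le> sqrt K1" "0 \<le> sqrt K3" "0 \<le> sqrt Co" "0 \<le> sqrt (K1 * K4)" "0 \<le> (sqrt K1 + 1) * sqrt K5"
    using const_pos K1_pos constants_pos by simp_all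
  then show "1 \<le> Kc" "sqrt K1 \<le> Kc" "sqrt K3 \<le> Kc" "sqrt Co + sqrt (K1 * K4) \<le> Kc" "(sqrt K1 + 1) * sqrt K5 \<le> Kc"
    unfolding Kc_def by linarith+
qed

lemma divide_quadratic:
  fixes x b :: real
  assumes "x * x \<le> b * x" "0 \<le> b" "0 \<le> x"
  shows "x \<le> b"
  using assms by (cases "x = 0") auto

text \<open>The four hypotheses of \<open>quadratic_bound\<close> come from four test functions. In the last two cases the test function is
bounded by the part of the norm that it recovers, up to a multiple of the part \<open>P\<close> for the last one.\<close>

lemma stability:
  assumes \<sigma>: "(r, u, uh, p, ph) \<in> Sigma0 m k \<Omega> \<T>" and M: "0 \<le> M"
    and bound: "\<And>\<tau>. \<tau> \<in> Sigma0 m k \<Omega> \<T> \<Longrightarrow> 0 < norm_Sigma \<alpha> \<Omega> \<T> \<tau> \<Longrightarrow> B_h \<alpha> \<T> (r, u, uh, p, ph) \<tau> \<le> M * norm_Sigma \<alpha> \<Omega> \<T> \<tau>"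
  shows "norm_Sigma \<alpha> \<Omega> \<T> (r, u, uh, p, ph) \<le> 120 * (Kc + 1)\<^sup>2 * M"
proof -
  have mem: "r \<in> vpoly_elem m \<T>" "u \<in> vpoly_elem k \<T>" "uh \<in> Uhat0 k \<Omega> \<T>" "p \<in> poly_elem k \<T>" "ph \<in> Phat0 k \<Omega> \<T>"
    using \<sigma> by (auto simp: Sigma0_def)
  have uh: "uh \<in> vpoly_face k \<T>" and ph: "ph \<in> poly_face k \<T>" using mem by (auto simp: Uhat0_def Uhat_def Phat0_def)
  have r0: "0 \<le> ip_elem \<T> r r" by (rule ip_elem_nonneg[OF cont_elem_vdeg[OF vpoly_elemD[OF mem(1)]]])
  note nn = r0 nonneg(1)[OF mem(2)] nonneg(2)[OF mem(2) uh] nonneg(3,4)[OF mem(2)] nonneg(5)[OF mem(4)] nonneg(6)[OF mem(4) ph]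
  define R where "R = sqrt (ip_elem \<T> r r)"
  define A where "A = sqrt (nA u)"
  define D where "D = sqrt (nD u uh)"
  define E where "E = sqrt (nE u + nJ u)"
  define G where "G = sqrt (nG p)"
  define P where "P = sqrt (nP p ph)"
  define S where "S = norm_Sigma \<alpha> \<Omega> \<T> (r, u, uh, p, ph)"
  have pos: "0 \<le> R" "0 \<le> A" "0 \<le> D" "0 \<le> E" "0 \<le> G" "0 \<le> P"
    unfolding R_def A_def D_def E_def G_def P_def using nn by simp_all
  have sq: "ip_elem \<T> r r = R\<^sup>2" "nA u = A\<^sup>2" "nD u uh = D\<^sup>2" "nE u + nJ u = E\<^sup>2" "nG p = G\<^sup>2" "nP p ph = P\<^sup>2"
    unfolding R_def A_def D_def E_def G_def P_def using nn by simp_all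
  have S: "S\<^sup>2 = R\<^sup>2 + A\<^sup>2 + D\<^sup>2 + E\<^sup>2 + G\<^sup>2 + P\<^sup>2" and S0: "0 \<le> S"
  proof -
    have "S = sqrt (R\<^sup>2 + A\<^sup>2 + D\<^sup>2 + E\<^sup>2 + G\<^sup>2 + P\<^sup>2)"
      unfolding S_def norm_Sigma_eq sq[symmetric] by (simp add: add.assoc)
    then show "S\<^sup>2 = R\<^sup>2 + A\<^sup>2 + D\<^sup>2 + E\<^sup>2 + G\<^sup>2 + P\<^sup>2" "0 \<le> S" by simp_all
  qed
  have h1: "R\<^sup>2 + D\<^sup>2 + P\<^sup>2 \<le> M * S"
  proof (cases "S = 0")
    case True
    have "R\<^sup>2 + D\<^sup>2 + P\<^sup>2 \<le> S\<^sup>2" unfolding S by simp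
    then show ?thesis using True by simp
  next
    case False
    note d = diagonal_test_function[OF \<sigma>]
    show ?thesis using bound[OF d(1)] False S0 unfolding d(2,3) S_def[symmetric] sq by simp
  qed
  have h2: "A \<le> M + R + Kc * D"
  proof -
    define s where "s = (\<lambda>T x. - curl (u T) x)"
    have cu: "vdeg (k - 1) (curl (u T))" for T by (rule vdeg_curl[OF vpoly_elemD[OF mem(2)]])
    have cm: "vdeg m (curl (u T))" for T using vdeg_mono[OF cu] m by auto
    have s: "s \<in> vpoly_elem m \<T>"
    proof (rule vpoly_elemI)
      show "vdeg m (s T)" for T using vdeg_scaleR[OF cm, of "- 1"] by (simp add: s_def)
      show "s T = (\<lambda>_. 0)" if "T \<notin> \<T>" for T using vpoly_elem_outside[OF mem(2) that] by (simp add: s_def curl_zero)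
    qed
    have ss: "ip_elem \<T> s s = A\<^sup>2" unfolding sq(2)[symmetric] nA_def normsq_elem_def by (simp add: s_def ip_elem_def)
    let ?\<tau> = "(s, \<lambda>_ _. 0, \<lambda>_ _. 0, \<lambda>_ _. 0, \<lambda>_ _. 0) :: state"
    have \<tau>: "?\<tau> \<in> Sigma0 m k \<Omega> \<T>" using s zero_members zero_Uhat0 by (simp add: Sigma0_def)
    have N: "norm_Sigma \<alpha> \<Omega> \<T> ?\<tau> = A" unfolding norm_Sigma_eq norms_of_zero ss using pos by simp
    have cs: "ip_elem \<T> (\<lambda>T. curl (u T)) s = - A\<^sup>2"
      unfolding sq(2)[symmetric] nA_def normsq_elem_def by (simp add: s_def ip_elem_def sum_negf)
    have "\<bar>ip_elem \<T> r s\<bar> \<le> R * A"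
      using ip_elem_vdeg_bound[of m r m s, OF vpoly_elemD[OF mem(1)] vpoly_elemD[OF s]] unfolding ss sq(1) using pos by simp
    moreover have "\<bar>ip_bdry \<T> (\<lambda>T F x. cross3 (outward_normal T F) (u T x - uh F x)) (\<lambda>T F x. s T x)\<bar> \<le> sqrt K1 * D * A"
      using tangential_bound[OF mem(2) uh s] unfolding ss sq(3) using pos by simp
    moreover have "B_h \<alpha> \<T> (r, u, uh, p, ph) ?\<tau> = ip_elem \<T> r s + A\<^sup>2
       + ip_bdry \<T> (\<lambda>T F x. cross3 (outward_normal T F) (u T x - uh F x)) (\<lambda>T F x. s T x)"
      unfolding B_h.simps forms_of_zero b_h_by_parts[OF mem(2) uh s] cs by simp
    moreover have "B_h \<alpha> \<T> (r, u, uh, p, ph) ?\<tau> \<le> M * A" if "A > 0"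
      using bound[OF \<tau>] that unfolding N by simp
    ultimately have "A * A \<le> (M + R + sqrt K1 * D) * A" if "A > 0" using that by (simp add: power2_eq_square distrib_right)
    then have "A \<le> M + R + sqrt K1 * D" using pos M K1_pos by (cases "A = 0") auto
    moreover have "sqrt K1 * D \<le> Kc * D" by (intro mult_right_mono constants_le pos)
    ultimately show ?thesis by simp
  qed
  have h3: "E \<le> Kc * (M + P)"
  proof -
    obtain q qh where q: "q \<in> poly_elem k \<T>" "qh \<in> Phat0 k \<Omega> \<T>" "c_h \<T> q qh u = nE u + nJ u" "nG q + nP q qh \<le> K3 * (nE u + nJ u)"
      by (rule scalar_test_function[OF mem(2)])
    have qh: "qh \<in> poly_face k \<T>" using q(2) by (simp add: Phat0_def)
    note n = nonneg(5)[OF q(1)] nonneg(6)[OF q(1) qh]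
    define N where "N = sqrt (nG q + nP q qh)"
    let ?\<tau> = "(\<lambda>_ _. 0, \<lambda>_ _. 0, \<lambda>_ _. 0, q, qh) :: state"
    have \<tau>: "?\<tau> \<in> Sigma0 m k \<Omega> \<T>" using q zero_members zero_Uhat0 by (simp add: Sigma0_def)
    have N: "norm_Sigma \<alpha> \<Omega> \<T> ?\<tau> = N" unfolding norm_Sigma_eq norms_of_zero N_def by (simp add: ip_elem_zero)
    have N0: "0 \<le> N" using n by (simp add: N_def)
    have NE: "N \<le> sqrt K3 * E"
      using real_sqrt_le_mono[OF q(4)] unfolding N_def[symmetric] sq real_sqrt_mult using pos by simp
    have "\<bar>sp_h \<alpha> \<T> p ph q qh\<bar> \<le> P * sqrt (nP q qh)" using sp_bound[OF mem(4) ph q(1) qh] by (simp add: P_def)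
    also have "\<dots> \<le> P * N" unfolding N_def using n pos by (intro mult_left_mono) simp_all
    finally have sp: "\<bar>sp_h \<alpha> \<T> p ph q qh\<bar> \<le> P * N" .
    have B: "B_h \<alpha> \<T> (r, u, uh, p, ph) ?\<tau> = E\<^sup>2 + sp_h \<alpha> \<T> p ph q qh"
      unfolding B_h.simps forms_of_zero q(3) sq by (simp add: ip_elem_zero)
    have "E\<^sup>2 \<le> (M + P) * N"
    proof (cases "N = 0")
      case True
      then have "nG q = 0" "nP q qh = 0" using n by (auto simp: N_def)
      then have "E\<^sup>2 = 0" using c_h_zero_P[OF mem(2) q(1) qh] q(3) sq(4) by simp
      then show ?thesis using True by simp
    next
      case False
      then show ?thesis using bound[OF \<tau>] N0 sp unfolding N B by (simp add: distrib_right)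
    qed
    also have "\<dots> \<le> (M + P) * (sqrt K3 * E)" using NE M pos by (intro mult_left_mono) auto
    finally have EE: "E * E \<le> (sqrt K3 * (M + P)) * E" by (simp add: power2_eq_square ac_simps)
    have "0 \<le> sqrt K3 * (M + P)" using M pos(6) constants_pos(1) by simp
    from divide_quadratic[OF EE this pos(4)] have "E \<le> sqrt K3 * (M + P)" .
    also have "\<dots> \<le> Kc * (M + P)" using M pos by (intro mult_right_mono constants_le) auto
    finally show ?thesis .
  qed
  have h4: "G\<^sup>2 \<le> Kc * (P * G + P\<^sup>2 + (R + D + M) * (G + P))"
  proof -
    obtain v vh where v: "v \<in> vpoly_elem k \<T>" "vh \<in> Uhat0 k \<Omega> \<T>" "nA v = 0"
      "nD v vh \<le> K4 * (nG p + nP p ph)" "W v \<le> K4 * (nG p + nP p ph)"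
      "- ip_elem \<T> v (\<lambda>T. grad (p T)) \<ge> nG p - sqrt Co * sqrt (nP p ph) * sqrt (nG p)"
      by (rule vector_test_function[OF mem(4,5)])
    have vh: "vh \<in> vpoly_face k \<T>" using v(2) by (simp add: Uhat0_def Uhat_def)
    note n = nonneg(2)[OF v(1) vh] nonneg(3,4)[OF v(1)]
    define N where "N = sqrt (nD v vh + nE v + nJ v)"
    let ?\<tau> = "(\<lambda>_ _. 0, v, vh, \<lambda>_ _. 0, \<lambda>_ _. 0) :: state"
    have \<tau>: "?\<tau> \<in> Sigma0 m k \<Omega> \<T>" using v zero_members by (simp add: Sigma0_def)
    have N: "norm_Sigma \<alpha> \<Omega> \<T> ?\<tau> = N" unfolding norm_Sigma_eq norms_of_zero N_def v(3) by (simp add: ip_elem_zero)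
    have N0: "0 \<le> N" using n by (simp add: N_def)
    have GP: "sqrt (G\<^sup>2 + P\<^sup>2) \<le> G + P" using pos by (intro real_le_lsqrt) (auto simp: power2_sum)
    have NG: "N \<le> sqrt K5 * (G + P)"
    proof -
      have "(Cd + 2 * K1) * W v \<le> (Cd + 2 * K1) * (K4 * (nG p + nP p ph))"
        using v(5) const_pos K1_pos by (intro mult_left_mono) auto
      then have "nD v vh + nE v + nJ v \<le> K5 * (nG p + nP p ph)"
        using nJ_le_W[OF v(1)] v(4) by (simp add: K5_def distrib_right)
      from real_sqrt_le_mono[OF this] have "N \<le> sqrt K5 * sqrt (G\<^sup>2 + P\<^sup>2)" unfolding N_def sq real_sqrt_mult .
      also have "\<dots> \<le> sqrt K5 * (G + P)" using GP constants_pos by (intro mult_left_mono) auto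
      finally show ?thesis .
    qed
    have DN: "sqrt (nD v vh) \<le> N" unfolding N_def using n by simp
    have su: "\<bar>su_h \<T> u uh v vh\<bar> \<le> D * N"
      by (rule order.trans[OF su_bound[OF mem(2) uh v(1) vh, folded D_def] mult_left_mono[OF DN pos(3)]])
    have bt: "\<bar>b_h \<T> v vh r\<bar> \<le> sqrt K1 * N * R"
    proof -
      have "\<bar>ip_elem \<T> (\<lambda>T. curl (v T)) r\<bar> \<le> sqrt (nA v) * R"
        using ip_elem_vdeg_bound[of "k - 1" "\<lambda>T. curl (v T)" m r, OF vdeg_curl[OF vpoly_elemD[OF v(1)]] vpoly_elemD[OF mem(1)]] unfolding nA_def normsq_elem_def R_def .
      then have "b_h \<T> v vh r = ip_bdry \<T> (\<lambda>T F x. cross3 (outward_normal T F) (v T x - vh F x)) (\<lambda>T F x. r T x)"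
        unfolding b_h_by_parts[OF v(1) vh mem(1)] v(3) by simp
      moreover have "sqrt K1 * sqrt (nD v vh) * R \<le> sqrt K1 * N * R" using DN K1_pos pos by (intro mult_right_mono mult_left_mono) auto
      ultimately show ?thesis using tangential_bound[OF v(1) vh mem(1)] unfolding R_def by simp
    qed
    have c: "G\<^sup>2 - sqrt Co * P * G - sqrt (K1 * K4) * (G + P) * P \<le> c_h \<T> p ph v"
    proof -
      have "sqrt (K1 * W v) \<le> sqrt (K1 * (K4 * (G\<^sup>2 + P\<^sup>2)))"
        using v(5) K1_pos unfolding sq by (intro real_sqrt_le_mono mult_left_mono) auto
      also have "\<dots> = sqrt (K1 * K4) * sqrt (G\<^sup>2 + P\<^sup>2)" unfolding mult.assoc[symmetric] by (rule real_sqrt_mult)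
      also have "\<dots> \<le> sqrt (K1 * K4) * (G + P)" using GP K1_pos constants_pos by (intro mult_left_mono) auto
      finally have "sqrt (K1 * W v) * P \<le> sqrt (K1 * K4) * (G + P) * P" using pos by (intro mult_right_mono)
      then show ?thesis
        using normal_bound[OF v(1) mem(4) ph] v(6) unfolding c_h_by_parts[OF v(1) mem(4) ph] G_def[symmetric] P_def[symmetric] sq(5) real_sqrt_unique[OF refl pos(5)] by linarith
    qed
    have B: "B_h \<alpha> \<T> (r, u, uh, p, ph) ?\<tau> = b_h \<T> v vh r + c_h \<T> p ph v - su_h \<T> u uh v vh"
      unfolding B_h.simps forms_of_zero by (simp add: ip_elem_zero)
    have cN: "c_h \<T> p ph v \<le> (M + sqrt K1 * R + D) * N"
    proof (cases "N = 0")
      case True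
      then have "nE v = 0" "nJ v = 0" using n by (auto simp: N_def)
      then show ?thesis using c_h_zero_U[OF v(1) mem(4,5)] True by simp
    next
      case False
      then have "B_h \<alpha> \<T> (r, u, uh, p, ph) ?\<tau> \<le> M * N" using bound[OF \<tau>] N0 unfolding N by simp
      then show ?thesis using bt su unfolding B by (simp add: algebra_simps)
    qed
    have "(M + sqrt K1 * R + D) * N \<le> ((sqrt K1 + 1) * (R + D + M)) * (sqrt K5 * (G + P))"
    proof (rule mult_mono)
      have "0 \<le> sqrt K1 * D" "0 \<le> sqrt K1 * M" using K1_pos pos M by simp_all
      then show "M + sqrt K1 * R + D \<le> (sqrt K1 + 1) * (R + D + M)" using pos by (simp add: algebra_simps)
    qed (use NG N0 K1_pos pos M in auto)
    also have "\<dots> = ((sqrt K1 + 1) * sqrt K5) * ((R + D + M) * (G + P))" by (simp add: ac_simps)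
    also have "\<dots> \<le> Kc * ((R + D + M) * (G + P))" using pos M by (intro mult_right_mono constants_le) auto
    finally have 1: "(M + sqrt K1 * R + D) * N \<le> Kc * ((R + D + M) * (G + P))" .
    have "sqrt Co * P * G + sqrt (K1 * K4) * (G + P) * P \<le> (sqrt Co + sqrt (K1 * K4)) * (P * G + P\<^sup>2)"
    proof -
      have "0 \<le> sqrt Co * P\<^sup>2" using const_pos by simp
      then show ?thesis by (simp add: algebra_simps power2_eq_square)
    qed
    also have "\<dots> \<le> Kc * (P * G + P\<^sup>2)" using pos by (intro mult_right_mono constants_le) auto
    finally show ?thesis using c cN 1 by (simp add: distrib_left)
  qed
  show ?thesis
    using quadratic_bound[OF pos M constants_le(1) S0 S h1 h2 h3 h4] unfolding S_def .
qed

text \<open>If the supremum were smaller than the asserted multiple of the norm, a number \<open>M\<close> strictly between the two would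
contradict \<open>stability\<close>. The supremum is nonnegative, since the test space contains a nonzero element together with its
negative. The summand 1 makes the constant positive before any mesh is given.\<close>

lemma inf_sup:
  assumes \<sigma>: "\<sigma> \<in> Sigma0 m k \<Omega> \<T>" and ne: "\<T> \<noteq> {}"
  shows "ereal (1 / (120 * (Kc + 1)\<^sup>2 + 1) * norm_Sigma \<alpha> \<Omega> \<T> \<sigma>)
     \<le> (SUP \<tau>\<in>Sigma0 m k \<Omega> \<T> - {zero_state}. ereal (B_h \<alpha> \<T> \<sigma> \<tau> / norm_Sigma \<alpha> \<Omega> \<T> \<tau>))"
proof (rule ccontr)
  let ?X = "SUP \<tau>\<in>Sigma0 m k \<Omega> \<T> - {zero_state}. ereal (B_h \<alpha> \<T> \<sigma> \<tau> / norm_Sigma \<alpha> \<Omega> \<T> \<tau>)"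
  let ?K = "120 * (Kc + 1)\<^sup>2 + 1"
  assume "\<not> ?thesis"
  then have less: "?X < ereal (1 / ?K * norm_Sigma \<alpha> \<Omega> \<T> \<sigma>)" by (simp only: not_le)
  obtain r u uh p ph where \<sigma>_eq: "\<sigma> = (r, u, uh, p, ph)" by (metis prod_cases5)
  have upper: "ereal (B_h \<alpha> \<T> \<sigma> \<tau> / norm_Sigma \<alpha> \<Omega> \<T> \<tau>) \<le> ?X" if "\<tau> \<in> Sigma0 m k \<Omega> \<T>" "\<tau> \<noteq> zero_state" for \<tau>
    using that by (intro SUP_upper) simp
  have X0: "0 \<le> ?X"
  proof -
    define s :: "(real^3) field" where "s = (\<lambda>T x. if T \<in> \<T> then axis 1 1 else 0)"
    let ?\<tau> = "\<lambda>s. (s, \<lambda>_ _. 0, \<lambda>_ _. 0, \<lambda>_ _. 0, \<lambda>_ _. 0) :: state"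
    have s: "s \<in> vpoly_elem m \<T>"
      by (rule vpoly_elemI) (auto simp: s_def vdeg_def pdeg_const)
    have s': "(\<lambda>T x. - s T x) \<in> vpoly_elem m \<T>" by (rule uminus_vpoly_elem[OF s])
    have mem: "?\<tau> s \<in> Sigma0 m k \<Omega> \<T>" "?\<tau> (\<lambda>T x. - s T x) \<in> Sigma0 m k \<Omega> \<T>"
      using s s' zero_members zero_Uhat0 by (simp_all add: Sigma0_def)
    obtain T where T: "T \<in> \<T>" using ne by blast
    have "s T 0 \<noteq> 0" using T by (simp add: s_def axis_eq_0_iff)
    then have nz: "?\<tau> s \<noteq> zero_state" "?\<tau> (\<lambda>T x. - s T x) \<noteq> zero_state"
      by (auto simp: zero_state_def fun_eq_iff)
    have B: "B_h \<alpha> \<T> \<sigma> (?\<tau> (\<lambda>T x. - s T x)) = - B_h \<alpha> \<T> \<sigma> (?\<tau> s)"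
    proof -
      have cs: "curl (\<lambda>x. - s T x) x = - curl (s T) x" for T x by (rule curl_uminus[OF vpoly_elemD[OF s]])
      have i: "ip_elem \<T> w (\<lambda>T x. - z T x) = - ip_elem \<T> w z" for w z :: "(real^3) field" by (simp add: ip_elem_def sum_negf)
      have j: "ip_bdry \<T> w (\<lambda>T F x. - z T F x) = - ip_bdry \<T> w z" for w z :: "(real^3) set \<Rightarrow> (real^3) field"
        by (simp add: ip_bdry_def face_integral_neg sum_negf)
      show ?thesis unfolding \<sigma>_eq B_h.simps forms_of_zero b_h_def cs i j by (simp add: ip_elem_zero ip_bdry_zero)
    qed
    have N: "norm_Sigma \<alpha> \<Omega> \<T> (?\<tau> (\<lambda>T x. - s T x)) = norm_Sigma \<alpha> \<Omega> \<T> (?\<tau> s)"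
      unfolding norm_Sigma_eq by (simp add: ip_elem_def)
    let ?y = "B_h \<alpha> \<T> \<sigma> (?\<tau> s) / norm_Sigma \<alpha> \<Omega> \<T> (?\<tau> s)"
    have "ereal ?y \<le> ?X" "ereal (- ?y) \<le> ?X" using upper[OF mem(1) nz(1)] upper[OF mem(2) nz(2)] unfolding B N by simp_all
    moreover have "0 \<le> ereal y \<or> 0 \<le> ereal (- y)" for y by auto
    ultimately show ?thesis by (blast intro: order.trans)
  qed
  obtain M where M: "?X < ereal M" "ereal M < ereal (1 / ?K * norm_Sigma \<alpha> \<Omega> \<T> \<sigma>)"
    using ereal_dense2[OF less] by blast
  have M0: "0 \<le> M" using order.trans[OF X0 less_imp_le[OF M(1)]] by simp
  have z: "norm_Sigma \<alpha> \<Omega> \<T> zero_state = 0" unfolding zero_state_def norm_Sigma_eq norms_of_zero by (simp add: ip_elem_zero)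
  have "B_h \<alpha> \<T> \<sigma> \<tau> \<le> M * norm_Sigma \<alpha> \<Omega> \<T> \<tau>" if \<tau>: "\<tau> \<in> Sigma0 m k \<Omega> \<T>" "0 < norm_Sigma \<alpha> \<Omega> \<T> \<tau>" for \<tau>
  proof -
    have "\<tau> \<noteq> zero_state" using \<tau>(2) z by auto
    from order.strict_trans1[OF upper[OF \<tau>(1) this] M(1)] have "B_h \<alpha> \<T> \<sigma> \<tau> / norm_Sigma \<alpha> \<Omega> \<T> \<tau> < M" by simp
    then show ?thesis using \<tau>(2) by (simp add: divide_less_eq)
  qed
  from stability[OF \<sigma>[unfolded \<sigma>_eq] M0 this[unfolded \<sigma>_eq], folded \<sigma>_eq]
  have le: "norm_Sigma \<alpha> \<Omega> \<T> \<sigma> \<le> ?K * M" using M0 by (simp add: distrib_right)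
  have K: "0 < ?K" by (simp add: add_nonneg_pos)
  have "M < 1 / ?K * norm_Sigma \<alpha> \<Omega> \<T> \<sigma>" using M(2) by simp
  then have "?K * M < norm_Sigma \<alpha> \<Omega> \<T> \<sigma>" using K by (simp add: field_simps)
  then show False using le by simp
qed

end

lemma inscr_diam_nonneg:
  assumes "bounded S" "S \<noteq> {}"
  shows "0 \<le> inscr_diam S"
  unfolding inscr_diam_def
proof (rule cSup_upper)
  obtain a where "a \<in> S" using assms by blast
  then show "0 \<in> {2 * r | r a. 0 \<le> r \<and> cball a r \<subseteq> S}" by (auto intro!: exI[of _ 0] exI[of _ a])
  have "2 * r \<le> diameter S" if "0 \<le> r" "cball a r \<subseteq> S" for r and a :: "real^3"
    using diameter_subset[OF that(2) assms(1)] that(1) by (simp add: diameter_cball)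
  then show "bdd_above {2 * r | r a. 0 \<le> r \<and> cball a r \<subseteq> S}" by (intro bdd_aboveI[of _ "diameter S"]) blast
qed

theorem theorem4p1:
  fixes \<Omega> :: "(real^3) set" and k m :: nat and \<alpha> \<kappa> :: real
  assumes "lipschitz_polyhedron \<Omega>"
    and "simply_connected \<Omega>"
    and "connected (frontier \<Omega>)"
    and "k \<ge> 1"
    and "m \<in> {k - 1, k}"
    and "\<alpha> \<in> {- 1, 1}"
  shows "\<exists>C>0. \<forall>\<T>. conforming_triangulation \<Omega> \<T> \<and> shape_regular \<kappa> \<T> \<longrightarrow>
    (\<forall>\<sigma>\<in>Sigma0 m k \<Omega> \<T>.
       (SUP \<tau>\<in>Sigma0 m k \<Omega> \<T> - {zero_state}.
          ereal (B_h \<alpha> \<T> \<sigma> \<tau> / norm_Sigma \<alpha> \<Omega> \<T> \<tau>))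
       \<ge> ereal (C * norm_Sigma \<alpha> \<Omega> \<T> \<sigma>)) \<and>
    (\<forall>\<tau>\<in>Sigma0 m k \<Omega> \<T>.
       (SUP \<sigma>\<in>Sigma0 m k \<Omega> \<T> - {zero_state}.
          ereal (B_h \<alpha> \<T> \<sigma> \<tau> / norm_Sigma \<alpha> \<Omega> \<T> \<sigma>))
       \<ge> ereal (C * norm_Sigma \<alpha> \<Omega> \<T> \<tau>))"
proof (rule exE[OF vector_trace_inequality[of "max \<kappa> 1" k]], rule exE[OF gradient_inverse_inequality[of "max \<kappa> 1" k]],
    rule exE[OF divergence_inverse_inequality[of "max \<kappa> 1" k]], rule exE[OF conforming_approximation[of "max \<kappa> 1" k]])
  fix Ct Ci Cd Co :: real
  \<comment> \<open>the inequalities are available for a shape parameter of at least 1, to which \<open>\<kappa>\<close> is raised\<close>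
  let ?\<kappa> = "max \<kappa> 1"
  assume Ct: "Ct > 0 \<and> (\<forall>\<Omega> \<T> T F w. mesh \<Omega> \<T> ?\<kappa> \<longrightarrow> T \<in> \<T> \<longrightarrow> F facet_of T \<longrightarrow> vdeg k w \<longrightarrow>
     encl_diam T * face_integral F (\<lambda>x. w x \<bullet> w x) \<le> Ct * integral T (\<lambda>x. w x \<bullet> w x))"
  assume Ci: "Ci > 0 \<and> (\<forall>\<Omega> \<T> T q. mesh \<Omega> \<T> ?\<kappa> \<longrightarrow> T \<in> \<T> \<longrightarrow> pdeg k q \<longrightarrow>
     (encl_diam T)\<^sup>2 * integral T (\<lambda>x. grad q x \<bullet> grad q x) \<le> Ci * integral T (\<lambda>x. q x * q x))"
  assume Cd: "Cd > 0 \<and> (\<forall>\<Omega> \<T> T w. mesh \<Omega> \<T> ?\<kappa> \<longrightarrow> T \<in> \<T> \<longrightarrow> vdeg k w \<longrightarrow>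
     (encl_diam T)\<^sup>2 * integral T (\<lambda>x. divergence w x * divergence w x) \<le> Cd * integral T (\<lambda>x. w x \<bullet> w x))"
  assume Co: "Co > 0 \<and> (\<forall>\<Omega> \<T> p ph. mesh \<Omega> \<T> ?\<kappa> \<longrightarrow> 1 \<le> k \<longrightarrow> (\<forall>T\<in>\<T>. pdeg k (p T)) \<longrightarrow>
     (\<forall>F\<in>mesh_faces \<T>. \<exists>q. pdeg k q \<and> (\<forall>x\<in>F. ph F x = q x)) \<longrightarrow>
     (\<forall>F\<in>mesh_faces \<T>. F \<subseteq> frontier \<Omega> \<longrightarrow> (\<forall>x\<in>F. ph F x = 0)) \<longrightarrow>
     (\<exists>pc. (\<forall>T\<in>\<T>. pdeg k (pc T)) \<and>
        (\<forall>T\<in>\<T>. \<forall>T'\<in>\<T>. \<forall>F. F facet_of T \<longrightarrow> F facet_of T' \<longrightarrow> (\<forall>x\<in>F. pc T x = pc T' x)) \<and>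
        (\<forall>T\<in>\<T>. \<forall>F. F facet_of T \<longrightarrow> F \<subseteq> frontier \<Omega> \<longrightarrow> (\<forall>x\<in>F. pc T x = 0)) \<and>
        (\<Sum>T\<in>\<T>. integral T (\<lambda>x. (norm (grad (\<lambda>y. p T y - pc T y) x))\<^sup>2))
          \<le> Co * (\<Sum>T\<in>\<T>. \<Sum>F | F facet_of T. inverse (encl_diam F) * face_integral F (\<lambda>x. (p T x - ph F x)\<^sup>2))))"
  have est: "estimates \<Omega> \<T> ?\<kappa> k m \<alpha> Ct Ci Cd Co" and ne: "\<T> \<noteq> {}"
    if tri: "conforming_triangulation \<Omega> \<T>" and reg: "shape_regular \<kappa> \<T>" for \<T>
  proof -
    have \<Omega>: "open \<Omega>" "\<Omega> \<noteq> {}" using assms(1) by (auto simp: lipschitz_polyhedron_def)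
    have "shape_regular ?\<kappa> \<T>"
      unfolding shape_regular_def
    proof
      fix T assume T: "T \<in> \<T>"
      then have "3 simplex T" using tri by (auto simp: conforming_triangulation_def)
      then have "bounded T" "T \<noteq> {}" using aff_dim_simplex[of 3 T] compact_simplex[of 3 T] compact_imp_bounded by auto
      from mult_right_mono[OF max.cobounded1[of \<kappa> 1] inscr_diam_nonneg[OF this]]
      show "encl_diam T \<le> ?\<kappa> * inscr_diam T" using reg T by (auto simp: shape_regular_def)
    qed
    then have M: "mesh \<Omega> \<T> ?\<kappa>" using \<Omega> tri by (simp add: mesh_def)
    show "estimates \<Omega> \<T> ?\<kappa> k m \<alpha> Ct Ci Cd Co"
      unfolding estimates_def estimates_axioms_def
      by (intro conjI allI impI M assms(4-6) conjunct1[OF Ct] conjunct1[OF Ci] conjunct1[OF Cd] conjunct1[OF Co]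
          conjunct2[OF Ct, rule_format, OF M] conjunct2[OF Ci, rule_format, OF M] conjunct2[OF Cd, rule_format, OF M]
          conjunct2[OF Co, THEN spec, THEN spec, THEN spec, THEN spec, THEN mp, OF M, THEN mp, OF assms(4), THEN mp, THEN mp, THEN mp]) assumption+
    show "\<T> \<noteq> {}" using tri \<Omega>(2) closure_subset[of \<Omega>] by (auto simp: conforming_triangulation_def)
  qed
  define Kc where "Kc = estimates.Kc ?\<kappa> Ct Ci Cd Co"
  show ?thesis
  proof (intro exI[of _ "1 / (120 * (Kc + 1)\<^sup>2 + 1)"] conjI allI impI ballI)
    show "0 < 1 / (120 * (Kc + 1)\<^sup>2 + 1)" by (simp add: add_nonneg_pos)
    fix \<T> \<sigma> assume T: "conforming_triangulation \<Omega> \<T> \<and> shape_regular \<kappa> \<T>" and \<sigma>: "\<sigma> \<in> Sigma0 m k \<Omega> \<T>"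
    note I = estimates.inf_sup[OF est[OF conjunct1[OF T] conjunct2[OF T]] \<sigma> ne[OF conjunct1[OF T] conjunct2[OF T]], folded Kc_def]
    show "ereal (1 / (120 * (Kc + 1)\<^sup>2 + 1) * norm_Sigma \<alpha> \<Omega> \<T> \<sigma>) \<le>
       (SUP \<tau>\<in>Sigma0 m k \<Omega> \<T> - {zero_state}. ereal (B_h \<alpha> \<T> \<sigma> \<tau> / norm_Sigma \<alpha> \<Omega> \<T> \<tau>))"
      by (rule I)
    show "ereal (1 / (120 * (Kc + 1)\<^sup>2 + 1) * norm_Sigma \<alpha> \<Omega> \<T> \<sigma>) \<le>
       (SUP \<tau>\<in>Sigma0 m k \<Omega> \<T> - {zero_state}. ereal (B_h \<alpha> \<T> \<tau> \<sigma> / norm_Sigma \<alpha> \<Omega> \<T> \<tau>))"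
      unfolding B_h_commute[of _ _ _ \<sigma>] by (rule I)
  qed
qed

end
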